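(* Let $(M,\nabla)$ be an affine surface, let $T$ be a smooth tensor field of type $(1,1)$ on $M$, and let $\Phi$ be a smooth symmetric $2$-tensor on $M$. Let $\mathcal{N}:=(T^*M,g_{T,\nabla,\Phi})$ be the associated modified Riemannian extension, with Bach tensor $\mathfrak{B}$. Let $\mathcal{S}_T:=\{P\in M: T(P)=\lambda(P)\operatorname{Id}\text{ for some scalar }\lambda(P)\}$ and $\mathcal{O}_T:=M\setminus\mathcal{S}_T$. (1) If $M=\mathcal{S}_T$, then $\mathcal{N}$ is half conformally flat and hence Bach flat (i.e. $\mathfrak{B}=0$). (2) $\mathcal{O}_T$ is an open subset of $M$. If $P\in\mathcal{O}_T$ and if $\mathfrak{B}$ vanishes at every point of the fiber $T_P^*M$, then $T(P)^2=0$. (3) If $T$ is nilpotent on $M$ (i.e. $T^2=0$) and if $T(P)\neq0$, then there exist local coordinates $(x^1,x^2)$ on a neighborhood of $P$ in which $T=\partial_{x^1}\otimes dx^2$. In any such coordinate system, defined on an open set $U$, the following assertions are equivalent: (a) $(T^*U,g_{T,\nabla,\Phi})$ is Bach flat. (b) On $U$ one has $\Gamma_{11}{}^2=0$ and $(\Gamma_{11}{}^1)^2-\Gamma_{11}{}^1\Gamma_{12}{}^2+\partial_{x^1}(\Gamma_{11}{}^1-\Gamma_{12}{}^2)=0$, where $\Gamma_{ij}{}^k$ are the Christoffel symbols of $\nabla$.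
   Context: An affine surface $(M,\nabla)$ is a smooth $2$-dimensional manifold $M$ with a torsion-free connection $\nabla$ on $TM$; in local coordinates $(x^1,x^2)$, $\nabla_{\partial_{x^i}}\partial_{x^j}=\Gamma_{ij}{}^k\partial_{x^k}$ (repeated indices are summed). Given local coordinates $(x^1,x^2)$ on $M$, let $(y_1,y_2)$ be the dual fiber coordinates on $T^*M$, where a $1$-form is written $\omega=y_1dx^1+y_2dx^2$. Let $T=T^r{}_i\,\partial_{x^r}\otimes dx^i$ be a tensor field of type $(1,1)$ (an endomorphism of $TM$) and $\Phi=\Phi_{ij}dx^i\circ dx^j$ a symmetric $2$-tensor on $M$. The modified Riemannian extension is the neutral signature $(2,2)$ metric on $T^*M$ $$g_{T,\nabla,\Phi}=2\,dx^i\circ dy_i+\left\{\tfrac12 y_ry_s(T^r{}_iT^s{}_j+T^r{}_jT^s{}_i)-2y_k\Gamma_{ij}{}^k+\Phi_{ij}\right\}dx^i\circ dx^j,$$ where $\circ$ is the symmetric product (so $g(\partial_{x^i},\partial_{y_j})=\delta_{ij}$, $g(\partial_{y_i},\partial_{y_j})=0$, and $g(\partial_{x^i},\partial_{x^j})$ is the expression in braces); it is independent of the choice of local coordinates. For a pseudo-Riemannian manifold $(N,g)$ of dimension four with Levi-Civita connection ${}^g\nabla$, curvature operator $R(X,Y)={}^g\nabla_X{}^g\nabla_Y-{}^g\nabla_Y{}^g\nabla_X-{}^g\nabla_{[X,Y]}$, Weyl tensor $W$ and Ricci tensor $\rho$, the Bach tensor is $$\mathfrak{B}_{ij}={}^g\nabla^k\,{}^g\nabla^\ell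 W_{kij\ell}+\tfrac12\rho^{k\ell}W_{kij\ell};$$ $(N,g)$ is Bach flat if $\mathfrak{B}=0$. It is half conformally flat if the self-dual part or the anti-self-dual part of the Weyl tensor vanishes. *)

theory Defs
  imports "HOL-Analysis.Analysis"
begin

section \<open>Smooth maps between Euclidean spaces\<close>

text \<open>The differentiability classes are only used on open sets.\<close>

fun Ck_on :: "nat \<Rightarrow> ('a::euclidean_space \<Rightarrow> 'b::real_normed_vector) \<Rightarrow> 'a set \<Rightarrow> bool" where
  "Ck_on 0 f S \<longleftrightarrow> continuous_on S f"
| "Ck_on (Suc n) f S \<longleftrightarrow>
     f differentiable_on S \<and> (\<forall>v. Ck_on n (\<lambda>x. frechet_derivative f (at x) v) S)"

definition smooth_on :: "('a::euclidean_space \<Rightarrow> 'b::real_normed_vector) \<Rightarrow> 'a set \<Rightarrow> bool" where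
  "smooth_on f S \<longleftrightarrow> (\<forall>n. Ck_on n f S)"

definition pd :: "'n::finite \<Rightarrow> (real^'n \<Rightarrow> real) \<Rightarrow> real^'n \<Rightarrow> real" where
  "pd i f x = frechet_derivative f (at x) (axis i 1)"


section \<open>Smooth surfaces\<close>

text \<open>
  The surface \<open>M\<close> is the whole type \<open>'m\<close>, a second countable Hausdorff space. Its smooth structure
  is a maximal atlas \<open>A\<close> of charts \<open>(U, \<phi>)\<close>; the values of \<open>\<phi>\<close> outside \<open>U\<close> are irrelevant.
  The local coordinate systems of \<open>M\<close> are the members of \<open>A\<close>.
\<close>

type_synonym 'm chart = "'m set \<times> ('m \<Rightarrow> real^2)"

definition is_chart :: "'m::topological_space chart \<Rightarrow> bool" where
  "is_chart c \<longleftrightarrow> open (fst c) \<and> open (snd c ` fst c) \<and>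
     homeomorphism (fst c) (snd c ` fst c) (snd c) (inv_into (fst c) (snd c))"

definition chart_compatible :: "'m chart \<Rightarrow> 'm chart \<Rightarrow> bool" where
  "chart_compatible c c' \<longleftrightarrow>
     smooth_on (snd c' \<circ> inv_into (fst c) (snd c)) (snd c ` (fst c \<inter> fst c')) \<and>
     smooth_on (snd c \<circ> inv_into (fst c') (snd c')) (snd c' ` (fst c \<inter> fst c'))"

definition smooth_surface ::
    "'m::{t2_space, second_countable_topology} chart set \<Rightarrow> bool" where
  "smooth_surface A \<longleftrightarrow>
     (\<forall>c\<in>A. is_chart c) \<and>
     (\<Union>c\<in>A. fst c) = UNIV \<and>
     (\<forall>c\<in>A. \<forall>c'\<in>A. chart_compatible c c') \<and>
     (\<forall>c. is_chart c \<and> (\<forall>c'\<in>A. chart_compatible c c') \<longrightarrow> c \<in> A)"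

definition smooth_fun ::
    "'m::topological_space chart set \<Rightarrow> 'm set \<Rightarrow> ('m \<Rightarrow> real) \<Rightarrow> bool" where
  "smooth_fun A V f \<longleftrightarrow>
     open V \<and> (\<forall>c\<in>A. smooth_on (f \<circ> inv_into (fst c) (snd c)) (snd c ` (fst c \<inter> V)))"

definition smooth_near ::
    "'m::topological_space chart set \<Rightarrow> 'm \<Rightarrow> ('m \<Rightarrow> real) \<Rightarrow> bool" where
  "smooth_near A p f \<longleftrightarrow> (\<exists>V. p \<in> V \<and> smooth_fun A V f)"


section \<open>Tangent and cotangent spaces\<close>

text \<open>
  Tangent vectors at \<open>p\<close> are the derivations of the algebra of germs at \<open>p\<close> of smooth functions.
  They are total functions on \<open>'m \<Rightarrow> real\<close>; the value \<open>0\<close> off the functions that are smooth near \<open>p\<close>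
  makes the representation unique, so that equality of tangent vectors is equality in HOL.
\<close>

type_synonym 'm tvec = "('m \<Rightarrow> real) \<Rightarrow> real"

definition tangent_space :: "'m::topological_space chart set \<Rightarrow> 'm \<Rightarrow> 'm tvec set" where
  "tangent_space A p = {v.
     (\<forall>f. \<not> smooth_near A p f \<longrightarrow> v f = 0) \<and>
     (\<forall>f g W. smooth_near A p f \<and> open W \<and> p \<in> W \<and> (\<forall>q\<in>W. f q = g q) \<longrightarrow> v f = v g) \<and>
     (\<forall>f g a b. smooth_near A p f \<and> smooth_near A p g \<longrightarrow>
        v (\<lambda>q. a * f q + b * g q) = a * v f + b * v g) \<and>
     (\<forall>f g. smooth_near A p f \<and> smooth_near A p g \<longrightarrow>
        v (\<lambda>q. f q * g q) = f p * v g + g p * v f)}"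

text \<open>The coordinate vector field \<open>\<partial>\<^bsub>x\<^sup>i\<^esub>\<close> of a chart, at points of its domain.\<close>

definition coord_vec ::
    "'m::topological_space chart set \<Rightarrow> 'm chart \<Rightarrow> 2 \<Rightarrow> 'm \<Rightarrow> 'm tvec" where
  "coord_vec A c i p f =
     (if smooth_near A p f then pd i (f \<circ> inv_into (fst c) (snd c)) (snd c p) else 0)"

definition coord_fun :: "'m chart \<Rightarrow> 2 \<Rightarrow> 'm \<Rightarrow> real" where
  "coord_fun c k q = snd c q $ k"

text \<open>As for tangent vectors, covectors are \<open>0\<close> off the tangent space.\<close>

definition cotangent_space :: "'m::topological_space chart set \<Rightarrow> 'm \<Rightarrow> ('m tvec \<Rightarrow> real) set" where
  "cotangent_space A p = {\<omega>.
     (\<forall>v. v \<notin> tangent_space A p \<longrightarrow> \<omega> v = 0) \<and>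
     (\<forall>v\<in>tangent_space A p. \<forall>w\<in>tangent_space A p. \<forall>a b.
        \<omega> (\<lambda>f. a * v f + b * w f) = a * \<omega> v + b * \<omega> w)}"

definition cotangent_bundle ::
    "'m::topological_space chart set \<Rightarrow> 'm set \<Rightarrow> ('m \<times> ('m tvec \<Rightarrow> real)) set" where
  "cotangent_bundle A U = {(p, \<omega>). p \<in> U \<and> \<omega> \<in> cotangent_space A p}"


section \<open>Vector fields, connections and tensor fields\<close>

definition vector_field ::
    "'m::topological_space chart set \<Rightarrow> 'm set \<Rightarrow> ('m \<Rightarrow> 'm tvec) \<Rightarrow> bool" where
  "vector_field A U X \<longleftrightarrow>
     (\<forall>p\<in>U. X p \<in> tangent_space A p) \<and>
     (\<forall>V f. V \<subseteq> U \<and> smooth_fun A V f \<longrightarrow> smooth_fun A V (\<lambda>q. X q f))"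

text \<open>
  A connection acts on the vector fields over every open \<open>U \<subseteq> M\<close>, compatibly with restriction, so
  that it can be applied to the coordinate fields of a chart. (A connection given on global fields
  extends uniquely to such an operator, by locality.) The values of \<open>X\<close>, \<open>Y\<close> and \<open>nabla X Y\<close>
  outside the set \<open>U\<close> under consideration are irrelevant.
\<close>

definition affine_connection ::
    "'m::topological_space chart set \<Rightarrow>
     (('m \<Rightarrow> 'm tvec) \<Rightarrow> ('m \<Rightarrow> 'm tvec) \<Rightarrow> 'm \<Rightarrow> 'm tvec) \<Rightarrow> bool" where
  "affine_connection A nabla \<longleftrightarrow> (\<forall>U. open U \<longrightarrow>
     (\<forall>X Y. vector_field A U X \<and> vector_field A U Y \<longrightarrow> vector_field A U (nabla X Y)) \<and>
     (\<forall>X Y X' Y'. vector_field A U X \<and> vector_field A U Y \<and>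
        vector_field A U X' \<and> vector_field A U Y' \<and> (\<forall>p\<in>U. X p = X' p \<and> Y p = Y' p) \<longrightarrow>
        (\<forall>p\<in>U. nabla X Y p = nabla X' Y' p)) \<and>
     (\<forall>X X' Y. vector_field A U X \<and> vector_field A U X' \<and> vector_field A U Y \<longrightarrow>
        (\<forall>p\<in>U. nabla (\<lambda>q f. X q f + X' q f) Y p = (\<lambda>f. nabla X Y p f + nabla X' Y p f))) \<and>
     (\<forall>X Y Y'. vector_field A U X \<and> vector_field A U Y \<and> vector_field A U Y' \<longrightarrow>
        (\<forall>p\<in>U. nabla X (\<lambda>q f. Y q f + Y' q f) p = (\<lambda>f. nabla X Y p f + nabla X Y' p f))) \<and>
     (\<forall>h X Y. smooth_fun A U h \<and> vector_field A U X \<and> vector_field A U Y \<longrightarrow>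
        (\<forall>p\<in>U. nabla (\<lambda>q f. h q * X q f) Y p = (\<lambda>f. h p * nabla X Y p f))) \<and>
     (\<forall>h X Y. smooth_fun A U h \<and> vector_field A U X \<and> vector_field A U Y \<longrightarrow>
        (\<forall>p\<in>U. nabla X (\<lambda>q f. h q * Y q f) p = (\<lambda>f. h p * nabla X Y p f + X p h * Y p f))))"

definition torsion_free ::
    "'m::topological_space chart set \<Rightarrow>
     (('m \<Rightarrow> 'm tvec) \<Rightarrow> ('m \<Rightarrow> 'm tvec) \<Rightarrow> 'm \<Rightarrow> 'm tvec) \<Rightarrow> bool" where
  "torsion_free A nabla \<longleftrightarrow> (\<forall>U X Y f. smooth_fun A U f \<and>
     vector_field A U X \<and> vector_field A U Y \<longrightarrow>
     (\<forall>p\<in>U. nabla X Y p f - nabla Y X p f = X p (\<lambda>q. Y q f) - Y p (\<lambda>q. X q f)))"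

definition affine_surface ::
    "'m::{t2_space, second_countable_topology} chart set \<Rightarrow>
     (('m \<Rightarrow> 'm tvec) \<Rightarrow> ('m \<Rightarrow> 'm tvec) \<Rightarrow> 'm \<Rightarrow> 'm tvec) \<Rightarrow> bool" where
  "affine_surface A nabla \<longleftrightarrow> smooth_surface A \<and> affine_connection A nabla \<and> torsion_free A nabla"

definition smooth_endomorphism_field ::
    "'m::topological_space chart set \<Rightarrow> ('m \<Rightarrow> 'm tvec \<Rightarrow> 'm tvec) \<Rightarrow> bool" where
  "smooth_endomorphism_field A T \<longleftrightarrow>
     (\<forall>p. \<forall>v\<in>tangent_space A p. T p v \<in> tangent_space A p) \<and>
     (\<forall>p. \<forall>v\<in>tangent_space A p. \<forall>w\<in>tangent_space A p. \<forall>a b.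
        T p (\<lambda>f. a * v f + b * w f) = (\<lambda>f. a * T p v f + b * T p w f)) \<and>
     (\<forall>U X. open U \<and> vector_field A U X \<longrightarrow> vector_field A U (\<lambda>p. T p (X p)))"

definition smooth_symmetric_2tensor ::
    "'m::topological_space chart set \<Rightarrow> ('m \<Rightarrow> 'm tvec \<Rightarrow> 'm tvec \<Rightarrow> real) \<Rightarrow> bool" where
  "smooth_symmetric_2tensor A Phi \<longleftrightarrow>
     (\<forall>p. \<forall>v\<in>tangent_space A p. \<forall>w\<in>tangent_space A p. Phi p v w = Phi p w v) \<and>
     (\<forall>p. \<forall>u\<in>tangent_space A p. \<forall>v\<in>tangent_space A p. \<forall>w\<in>tangent_space A p. \<forall>a b.
        Phi p (\<lambda>f. a * u f + b * v f) w = a * Phi p u w + b * Phi p v w) \<and>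
     (\<forall>U X Y. open U \<and> vector_field A U X \<and> vector_field A U Y \<longrightarrow>
        smooth_fun A U (\<lambda>p. Phi p (X p) (Y p)))"

definition scalar_locus ::
    "'m::topological_space chart set \<Rightarrow> ('m \<Rightarrow> 'm tvec \<Rightarrow> 'm tvec) \<Rightarrow> 'm set" where
  "scalar_locus A T = {p. \<exists>l::real. \<forall>v\<in>tangent_space A p. T p v = (\<lambda>f. l * v f)}"

definition square_zero_at ::
    "'m::topological_space chart set \<Rightarrow> ('m \<Rightarrow> 'm tvec \<Rightarrow> 'm tvec) \<Rightarrow> 'm \<Rightarrow> bool" where
  "square_zero_at A T p \<longleftrightarrow> (\<forall>v\<in>tangent_space A p. T p (T p v) = (\<lambda>f. 0))"

definition zero_at ::
    "'m::topological_space chart set \<Rightarrow> ('m \<Rightarrow> 'm tvec \<Rightarrow> 'm tvec) \<Rightarrow> 'm \<Rightarrow> bool" where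
  "zero_at A T p \<longleftrightarrow> (\<forall>v\<in>tangent_space A p. T p v = (\<lambda>f. 0))"

text \<open>\<open>T = \<partial>\<^bsub>x\<^sup>1\<^esub> \<otimes> dx\<^sup>2\<close> on the domain of the chart.\<close>

definition nilpotent_normal_form ::
    "'m::topological_space chart set \<Rightarrow> ('m \<Rightarrow> 'm tvec \<Rightarrow> 'm tvec) \<Rightarrow> 'm chart \<Rightarrow> bool" where
  "nilpotent_normal_form A T c \<longleftrightarrow> (\<forall>p\<in>fst c. \<forall>v\<in>tangent_space A p.
     T p v = (\<lambda>f. v (coord_fun c 2) * coord_vec A c 1 p f))"

text \<open>
  Components in a chart, as functions of the coordinates \<open>x\<close>:
  \<open>\<Gamma>\<^bsub>ij\<^esub>\<^sup>k\<close>, \<open>T\<^sup>r\<^sub>i\<close> and \<open>\<Phi>\<^bsub>ij\<^esub>\<close> (in this order of indices).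
\<close>

definition conn_comp ::
    "'m::topological_space chart set \<Rightarrow>
     (('m \<Rightarrow> 'm tvec) \<Rightarrow> ('m \<Rightarrow> 'm tvec) \<Rightarrow> 'm \<Rightarrow> 'm tvec) \<Rightarrow>
     'm chart \<Rightarrow> 2 \<Rightarrow> 2 \<Rightarrow> 2 \<Rightarrow> real^2 \<Rightarrow> real" where
  "conn_comp A nabla c i j k x =
     nabla (coord_vec A c i) (coord_vec A c j) (inv_into (fst c) (snd c) x) (coord_fun c k)"

definition endo_comp ::
    "'m::topological_space chart set \<Rightarrow> ('m \<Rightarrow> 'm tvec \<Rightarrow> 'm tvec) \<Rightarrow>
     'm chart \<Rightarrow> 2 \<Rightarrow> 2 \<Rightarrow> real^2 \<Rightarrow> real" where
  "endo_comp A T c r i x =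
     (let p = inv_into (fst c) (snd c) x in T p (coord_vec A c i p) (coord_fun c r))"

definition sym_comp ::
    "'m::topological_space chart set \<Rightarrow> ('m \<Rightarrow> 'm tvec \<Rightarrow> 'm tvec \<Rightarrow> real) \<Rightarrow>
     'm chart \<Rightarrow> 2 \<Rightarrow> 2 \<Rightarrow> real^2 \<Rightarrow> real" where
  "sym_comp A Phi c i j x =
     (let p = inv_into (fst c) (snd c) x in Phi p (coord_vec A c i p) (coord_vec A c j p))"


section \<open>Pseudo-Riemannian geometry in local coordinates\<close>

text \<open>
  A metric on an open subset of \<open>real^'n\<close> is given by its Gram matrix \<open>g z\<close> in the coordinate frame.
  Sign conventions: \<open>R\<^bsub>ijkl\<^esub> = g(R(\<partial>\<^sub>i, \<partial>\<^sub>j) \<partial>\<^sub>k, \<partial>\<^sub>l)\<close>, and \<open>\<rho>\<^bsub>jk\<^esub>\<close> is the trace of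
  \<open>X \<mapsto> R(X, \<partial>\<^sub>j) \<partial>\<^sub>k\<close>, which is positive for round spheres.
\<close>

type_synonym 'n metric = "real^'n \<Rightarrow> real^'n^'n"

abbreviation inv_metric :: "'n::finite metric \<Rightarrow> 'n \<Rightarrow> 'n \<Rightarrow> real^'n \<Rightarrow> real" where
  "inv_metric g i j z \<equiv> matrix_inv (g z) $ i $ j"

text \<open>\<open>levi_civita g i j k\<close> is the Christoffel symbol with lower indices \<open>i\<close>, \<open>j\<close> and upper index \<open>k\<close>.\<close>

definition levi_civita :: "'n::finite metric \<Rightarrow> 'n \<Rightarrow> 'n \<Rightarrow> 'n \<Rightarrow> real^'n \<Rightarrow> real" where
  "levi_civita g i j k z = (1/2) * (\<Sum>l\<in>UNIV. inv_metric g k l z *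
     (pd i (\<lambda>w. g w $ j $ l) z + pd j (\<lambda>w. g w $ i $ l) z - pd l (\<lambda>w. g w $ i $ j) z))"

definition riemann :: "'n::finite metric \<Rightarrow> 'n \<Rightarrow> 'n \<Rightarrow> 'n \<Rightarrow> 'n \<Rightarrow> real^'n \<Rightarrow> real" where
  "riemann g i j k l z = (\<Sum>m\<in>UNIV. g z $ l $ m *
     (pd i (levi_civita g j k m) z - pd j (levi_civita g i k m) z +
      (\<Sum>n\<in>UNIV. levi_civita g j k n z * levi_civita g i n m z -
                 levi_civita g i k n z * levi_civita g j n m z)))"

definition ricci :: "'n::finite metric \<Rightarrow> 'n \<Rightarrow> 'n \<Rightarrow> real^'n \<Rightarrow> real" where
  "ricci g j k z = (\<Sum>i\<in>UNIV. \<Sum>l\<in>UNIV. inv_metric g i l z * riemann g i j k l z)"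

definition scalar_curvature :: "'n::finite metric \<Rightarrow> real^'n \<Rightarrow> real" where
  "scalar_curvature g z = (\<Sum>j\<in>UNIV. \<Sum>k\<in>UNIV. inv_metric g j k z * ricci g j k z)"

definition weyl :: "'n::finite metric \<Rightarrow> 'n \<Rightarrow> 'n \<Rightarrow> 'n \<Rightarrow> 'n \<Rightarrow> real^'n \<Rightarrow> real" where
  "weyl g i j k l z = riemann g i j k l z
     - (ricci g j k z * g z $ i $ l + g z $ j $ k * ricci g i l z
        - ricci g i k z * g z $ j $ l - g z $ i $ k * ricci g j l z) / (real CARD('n) - 2)
     + scalar_curvature g z * (g z $ j $ k * g z $ i $ l - g z $ i $ k * g z $ j $ l)
        / ((real CARD('n) - 1) * (real CARD('n) - 2))"

text \<open>
  A covariant tensor is given by its components, indexed by the list of its indices. The covariant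
  derivative adds its index in front: \<open>\<nabla>\<^sub>m S\<^bsub>ab\<dots>\<^esub>\<close> is the component with index list
  \<open>[m, a, b, \<dots>]\<close>.
\<close>

definition cov_deriv ::
    "'n::finite metric \<Rightarrow> ('n list \<Rightarrow> real^'n \<Rightarrow> real) \<Rightarrow> 'n list \<Rightarrow> real^'n \<Rightarrow> real" where
  "cov_deriv g S idx z = (let m = hd idx; as = tl idx in
     pd m (S as) z - (\<Sum>a<length as. \<Sum>n\<in>UNIV. levi_civita g m (as ! a) n z * S (as[a := n]) z))"

definition weyl_tensor :: "'n::finite metric \<Rightarrow> 'n list \<Rightarrow> real^'n \<Rightarrow> real" where
  "weyl_tensor g idx = weyl g (idx ! 0) (idx ! 1) (idx ! 2) (idx ! 3)"

definition bach :: "'n::finite metric \<Rightarrow> 'n \<Rightarrow> 'n \<Rightarrow> real^'n \<Rightarrow> real" where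
  "bach g i j z =
     (\<Sum>k\<in>UNIV. \<Sum>l\<in>UNIV. \<Sum>a\<in>UNIV. \<Sum>b\<in>UNIV. inv_metric g k a z * inv_metric g l b z *
        cov_deriv g (cov_deriv g (weyl_tensor g)) [a, b, k, i, j, l] z)
     + (1/2) * (\<Sum>k\<in>UNIV. \<Sum>l\<in>UNIV. \<Sum>a\<in>UNIV. \<Sum>b\<in>UNIV.
        inv_metric g k a z * inv_metric g l b z * ricci g a b z * weyl g k i j l z)"


section \<open>Modified Riemannian extensions\<close>

text \<open>
  The index type of the coordinates of \<open>T\<^sup>*M\<close> is \<open>2 + 2\<close>: \<open>Inl i\<close> stands for the base coordinate
  \<open>x\<^sup>i\<close> and \<open>Inr i\<close> for the dual fibre coordinate \<open>y\<^sub>i\<close>.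
\<close>

definition base_part :: "real^(2 + 2) \<Rightarrow> real^2" where
  "base_part z = (\<chi> i. z $ Inl i)"

definition cotangent_coords ::
    "'m::topological_space chart set \<Rightarrow> 'm chart \<Rightarrow> 'm \<times> ('m tvec \<Rightarrow> real) \<Rightarrow> real^(2 + 2)" where
  "cotangent_coords A c \<xi> = (\<chi> a. case a of
     Inl i \<Rightarrow> snd c (fst \<xi>) $ i
   | Inr i \<Rightarrow> snd \<xi> (coord_vec A c i (fst \<xi>)))"

definition mre_metric ::
    "'m::topological_space chart set \<Rightarrow> ('m \<Rightarrow> 'm tvec \<Rightarrow> 'm tvec) \<Rightarrow>
     (('m \<Rightarrow> 'm tvec) \<Rightarrow> ('m \<Rightarrow> 'm tvec) \<Rightarrow> 'm \<Rightarrow> 'm tvec) \<Rightarrow>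
     ('m \<Rightarrow> 'm tvec \<Rightarrow> 'm tvec \<Rightarrow> real) \<Rightarrow> 'm chart \<Rightarrow> (2 + 2) metric" where
  "mre_metric A T nabla Phi c z = (let x = base_part z in \<chi> a b. case a of
     Inl i \<Rightarrow> (case b of
       Inl j \<Rightarrow>
         (1/2) * (\<Sum>r\<in>UNIV. \<Sum>s\<in>UNIV. z $ Inr r * z $ Inr s *
           (endo_comp A T c r i x * endo_comp A T c s j x +
            endo_comp A T c r j x * endo_comp A T c s i x))
         - 2 * (\<Sum>k\<in>UNIV. z $ Inr k * conn_comp A nabla c i j k x)
         + sym_comp A Phi c i j x
     | Inr j \<Rightarrow> (if i = j then 1 else 0))
   | Inr i \<Rightarrow> (case b of
       Inl j \<Rightarrow> (if i = j then 1 else 0)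
     | Inr j \<Rightarrow> 0))"

text \<open>
  Components of the volume form of a metric on a domain of \<open>real^(2 + 2)\<close>, for the orientation
  \<open>dx\<^sup>1 \<and> dx\<^sup>2 \<and> dy\<^sub>1 \<and> dy\<^sub>2\<close>. All induced charts of \<open>T\<^sup>*M\<close> determine the same orientation, since
  the coordinate changes between them have Jacobian determinant \<open>1\<close>. The determinant below is the
  sign of \<open>(i, j, k, l)\<close> as a permutation of \<open>(x\<^sup>1, x\<^sup>2, y\<^sub>1, y\<^sub>2)\<close>, or \<open>0\<close>.
\<close>

definition volume_form ::
    "(2 + 2) metric \<Rightarrow> 2 + 2 \<Rightarrow> 2 + 2 \<Rightarrow> 2 + 2 \<Rightarrow> 2 + 2 \<Rightarrow> real^(2 + 2) \<Rightarrow> real" where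
  "volume_form g i j k l z = sqrt \<bar>det (g z)\<bar> *
     det ((\<chi> a. axis (case a of
            Inl m \<Rightarrow> (if m = 1 then i else j)
          | Inr m \<Rightarrow> (if m = 1 then k else l)) 1) :: real^(2 + 2)^(2 + 2))"

text \<open>
  The part \<open>(W + s \<star>W)/2\<close> of the Weyl tensor, with the Hodge star acting on the first pair of
  indices: the self-dual part for \<open>s = 1\<close> and the anti-self-dual part for \<open>s = -1\<close>. In neutral
  signature \<open>\<star>\<close> is an involution on 2-forms, and it commutes with the Weyl curvature operator.
\<close>

definition weyl_half ::
    "real \<Rightarrow> (2 + 2) metric \<Rightarrow> 2 + 2 \<Rightarrow> 2 + 2 \<Rightarrow> 2 + 2 \<Rightarrow> 2 + 2 \<Rightarrow> real^(2 + 2) \<Rightarrow> real" where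
  "weyl_half s g i j k l z = (1/2) * (weyl g i j k l z +
     s * ((1/2) * (\<Sum>a\<in>UNIV. \<Sum>b\<in>UNIV. \<Sum>d\<in>UNIV. \<Sum>e\<in>UNIV.
       volume_form g i j a b z * inv_metric g a d z * inv_metric g b e z * weyl g d e k l z)))"

text \<open>
  Vanishing of the Bach tensor of the modified Riemannian extension on a set \<open>S\<close> of points of
  \<open>T\<^sup>*M\<close> lying over the domain of the chart \<open>c\<close>, expressed in the coordinates \<open>(x, y)\<close> induced by
  \<open>c\<close>. As for every tensor, this does not depend on the chart.
\<close>

definition bach_zero_on ::
    "'m::topological_space chart set \<Rightarrow> ('m \<Rightarrow> 'm tvec \<Rightarrow> 'm tvec) \<Rightarrow>
     (('m \<Rightarrow> 'm tvec) \<Rightarrow> ('m \<Rightarrow> 'm tvec) \<Rightarrow> 'm \<Rightarrow> 'm tvec) \<Rightarrow>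
     ('m \<Rightarrow> 'm tvec \<Rightarrow> 'm tvec \<Rightarrow> real) \<Rightarrow> 'm chart \<Rightarrow>
     ('m \<times> ('m tvec \<Rightarrow> real)) set \<Rightarrow> bool" where
  "bach_zero_on A T nabla Phi c S \<longleftrightarrow>
     (\<forall>\<xi>\<in>S. \<forall>i j. bach (mre_metric A T nabla Phi c) i j (cotangent_coords A c \<xi>) = 0)"

text \<open>
  In the next two definitions \<open>C \<subseteq> A\<close> is an atlas of an open subset \<open>U\<close> of \<open>M\<close>; the induced charts
  then form an atlas of \<open>T\<^sup>*U\<close>. The choice \<open>C = A\<close> gives all of \<open>T\<^sup>*M\<close>.
\<close>

definition mre_bach_flat ::
    "'m::topological_space chart set \<Rightarrow> ('m \<Rightarrow> 'm tvec \<Rightarrow> 'm tvec) \<Rightarrow>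
     (('m \<Rightarrow> 'm tvec) \<Rightarrow> ('m \<Rightarrow> 'm tvec) \<Rightarrow> 'm \<Rightarrow> 'm tvec) \<Rightarrow>
     ('m \<Rightarrow> 'm tvec \<Rightarrow> 'm tvec \<Rightarrow> real) \<Rightarrow> 'm chart set \<Rightarrow> bool" where
  "mre_bach_flat A T nabla Phi C \<longleftrightarrow>
     (\<forall>c\<in>C. bach_zero_on A T nabla Phi c (cotangent_bundle A (fst c)))"

definition mre_half_conformally_flat ::
    "'m::topological_space chart set \<Rightarrow> ('m \<Rightarrow> 'm tvec \<Rightarrow> 'm tvec) \<Rightarrow>
     (('m \<Rightarrow> 'm tvec) \<Rightarrow> ('m \<Rightarrow> 'm tvec) \<Rightarrow> 'm \<Rightarrow> 'm tvec) \<Rightarrow>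
     ('m \<Rightarrow> 'm tvec \<Rightarrow> 'm tvec \<Rightarrow> real) \<Rightarrow> 'm chart set \<Rightarrow> bool" where
  "mre_half_conformally_flat A T nabla Phi C \<longleftrightarrow> (\<exists>s\<in>{1, - 1}.
     \<forall>c\<in>C. \<forall>\<xi>\<in>cotangent_bundle A (fst c). \<forall>i j k l.
       weyl_half s (mre_metric A T nabla Phi c) i j k l (cotangent_coords A c \<xi>) = 0)"

end

(*
  In induced coordinates the metric is a Walker metric 2 dx^i dy_i + h_ij dx^i dx^j with h_ij quadratic
  in y, and its Christoffel symbols, Weyl tensor and Bach tensor are explicit polynomials in the jets
  of h. The second Bach derivative is reduced to one derivative of the divergence of the Weyl tensor.
  All components of the Bach tensor along the fibres vanish, the mixed ones are quadratic in the
  y-Hessians of h, and the coefficients of y^2 in the horizontal ones are algebraic in T. If T is not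
  scalar, the mixed components force trace zero or a double eigenvalue, and the coefficients of y^2
  then force T^2 = 0.

  For nilpotent T with T(P) nonzero, the kernel of T is a line field. Its integral curves, graphs of
  solutions of a scalar differential equation, provide the coordinate x^2 as their parameter; then
  T = u (x) dx^2 with u tangent to the curves, and x^1 is obtained by integrating along them.
*)
theory Submission
  imports Defs
begin

section \<open>Smooth maps\<close>

text \<open>The obstacle is the size of the Bach tensor, a fourth order expression in the metric. In
  induced coordinates only the block h depends on the point, the inverse metric is linear in h, and
  y-derivatives of h of order three vanish. Differentiation is therefore a shift of indices, and a
  single computation with an indeterminate h serves scalar, general and nilpotent T alike. In the
  horizontal components each x-derivative lowers the degree in y by one. Hence the coefficients of
  y^2 involve neither derivatives of T nor the connection nor the tensor \<open>Phi\<close>, which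
  is why they are algebraic in T. The mixed components are, up to constants, trace(T) * disc(T)
  times the entries of the trace-free part of T; this is the source of the dichotomy between trace
  zero and a double eigenvalue. For trace zero the coefficients of y^2 contain the square of the
  determinant, and for a double eigenvalue l they contain l^4.\<close>

lemma frechet_derivative_cong:
  assumes "open S" "x \<in> S" "\<And>y. y \<in> S \<Longrightarrow> f y = g y"
  shows "frechet_derivative f (at x) = frechet_derivative g (at x)"
proof -
  have "(f has_derivative D) (at x) \<longleftrightarrow> (g has_derivative D) (at x)" for D
    by (metis assms has_derivative_transform_within_open)
  then show ?thesis by (simp add: frechet_derivative_def)
qed

lemma Ck_on_cong:
  assumes "open S" "\<And>y. y \<in> S \<Longrightarrow> f y = g y"
  shows "Ck_on n f S \<longleftrightarrow> Ck_on n g S"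
  using assms(2)
proof (induction n arbitrary: f g)
  case 0
  then show ?case by (simp cong: continuous_on_cong)
next
  case (Suc n)
  have d: "f differentiable_on S \<longleftrightarrow> g differentiable_on S"
    using Suc.prems unfolding differentiable_on_def
    by (metis differentiable_transform_within zero_less_one)
  have "Ck_on n (\<lambda>x. frechet_derivative f (at x) v) S \<longleftrightarrow>
        Ck_on n (\<lambda>x. frechet_derivative g (at x) v) S" for v
  proof (rule Suc.IH)
    fix y assume "y \<in> S"
    then show "frechet_derivative f (at y) v = frechet_derivative g (at y) v"
      using frechet_derivative_cong[OF assms(1) \<open>y \<in> S\<close> Suc.prems] by simp
  qed
  with d show ?case by simp
qed

text \<open>Replaces the chosen \<open>frechet_derivative\<close> by any explicit formula for the
  derivative; the closure rules below are inductions on the order that use this rule.\<close>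

lemma Ck_on_SucI:
  assumes "open S" "\<And>x. x \<in> S \<Longrightarrow> (f has_derivative f' x) (at x)"
    and "\<And>v. Ck_on n (\<lambda>x. f' x v) S"
  shows "Ck_on (Suc n) f S"
proof -
  have "f differentiable_on S"
    using assms(1,2) by (meson differentiable_def differentiable_on_def has_derivative_at_withinI)
  moreover have "Ck_on n (\<lambda>x. frechet_derivative f (at x) v) S" for v
  proof -
    have "frechet_derivative f (at y) v = f' y v" if "y \<in> S" for y
      using assms(2)[OF that] frechet_derivative_at by metis
    then have "Ck_on n (\<lambda>x. frechet_derivative f (at x) v) S \<longleftrightarrow> Ck_on n (\<lambda>x. f' x v) S"
      by (rule Ck_on_cong[OF assms(1)])
    then show ?thesis using assms(3) by blast
  qed
  ultimately show ?thesis by simp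
qed

lemma Ck_on_Suc_has_derivative:
  assumes "open S" "Ck_on (Suc n) f S" "x \<in> S"
  shows "(f has_derivative frechet_derivative f (at x)) (at x)"
  using assms by (metis Ck_on.simps(2) at_within_open differentiable_on_def frechet_derivative_works)

lemma Ck_on_continuous: "Ck_on n f S \<Longrightarrow> continuous_on S f"
  by (cases n) (auto simp: differentiable_imp_continuous_on)

lemma Ck_on_le: "Ck_on n f S \<Longrightarrow> m \<le> n \<Longrightarrow> Ck_on m f S"
proof (induction m arbitrary: n f)
  case 0
  then show ?case using Ck_on_continuous by auto
next
  case (Suc m)
  then obtain k where "n = Suc k" by (metis Suc_le_D)
  with Suc show ?case by auto
qed

lemma Ck_on_Suc_le: "Ck_on (Suc n) f S \<Longrightarrow> Ck_on n f S"
  by (rule Ck_on_le[of "Suc n"]) auto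

lemma Ck_on_subset:
  assumes "Ck_on n f S" "T \<subseteq> S" shows "Ck_on n f T"
  using assms(1)
  by (induction n arbitrary: f)
     (use assms(2) in \<open>auto intro: continuous_on_subset differentiable_on_subset\<close>)

text \<open>Needed for the flow of a differential equation, whose derivative in the initial value is
  first controlled only on a smaller rectangle around each point.\<close>

lemma Ck_on_local:
  assumes "open S" "\<And>x. x \<in> S \<Longrightarrow> \<exists>T. open T \<and> x \<in> T \<and> T \<subseteq> S \<and> Ck_on n f T"
  shows "Ck_on n f S"
  using assms(2)
proof (induction n arbitrary: f)
  case 0
  then show ?case
    by (simp add: assms(1) continuous_on_eq_continuous_at) (metis continuous_on_eq_continuous_at)
next
  case (Suc n)
  have "f differentiable (at x)" if "x \<in> S" for x
  proof -
    from Suc.prems[OF that] obtain T where "open T" "x \<in> T" "f differentiable_on T" by auto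
    then show ?thesis by (metis at_within_open differentiable_on_def)
  qed
  then have "f differentiable_on S"
    by (simp add: differentiable_at_withinI differentiable_on_def)
  moreover have "Ck_on n (\<lambda>x. frechet_derivative f (at x) v) S" for v
  proof (rule Suc.IH)
    fix x assume "x \<in> S"
    from Suc.prems[OF this] obtain T where "open T" "x \<in> T" "T \<subseteq> S" "Ck_on (Suc n) f T" by auto
    then show "\<exists>T. open T \<and> x \<in> T \<and> T \<subseteq> S \<and> Ck_on n (\<lambda>x. frechet_derivative f (at x) v) T"
      by auto
  qed
  ultimately show ?case by simp
qed

section \<open>Closure properties of the differentiability classes\<close>

lemma Ck_on_const: "Ck_on n (\<lambda>x. c) S"
  by (induction n arbitrary: c) (auto simp: frechet_derivative_const)

lemma Ck_on_bounded_linear: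
  assumes "bounded_linear f" shows "Ck_on n f S"
proof (cases n)
  case 0
  then show ?thesis using assms by (simp add: linear_continuous_on)
next
  case (Suc m)
  have "frechet_derivative f (at x) = f" for x
    using bounded_linear_imp_has_derivative[OF assms] frechet_derivative_at by metis
  then show ?thesis unfolding Suc
    using Ck_on_const bounded_linear_imp_differentiable_on[OF assms] by auto
qed

lemma Ck_on_linear_compose:
  assumes "bounded_linear L" "open S" "Ck_on n f S"
  shows "Ck_on n (\<lambda>x. L (f x)) S"
  using assms(3)
proof (induction n arbitrary: f)
  case 0
  then show ?case using assms(1) by (simp add: bounded_linear.continuous_on)
next
  case (Suc n)
  show ?case
  proof (rule Ck_on_SucI[OF assms(2)])
    fix x assume "x \<in> S"
    then show "((\<lambda>x. L (f x)) has_derivative (\<lambda>v. L (frechet_derivative f (at x) v))) (at x)"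
      using Ck_on_Suc_has_derivative[OF assms(2) Suc.prems] assms(1) bounded_linear.has_derivative by blast
  next
    fix v show "Ck_on n (\<lambda>x. L (frechet_derivative f (at x) v)) S"
      using Suc by auto
  qed
qed

lemma Ck_on_add:
  assumes "open S" "Ck_on n f S" "Ck_on n g S"
  shows "Ck_on n (\<lambda>x. f x + g x) S"
  using assms(2,3)
proof (induction n arbitrary: f g)
  case 0
  then show ?case by (simp add: continuous_on_add)
next
  case (Suc n)
  show ?case
  proof (rule Ck_on_SucI[OF assms(1)])
    fix x assume "x \<in> S"
    then show "((\<lambda>x. f x + g x) has_derivative
       (\<lambda>v. frechet_derivative f (at x) v + frechet_derivative g (at x) v)) (at x)"
      using Ck_on_Suc_has_derivative[OF assms(1)] Suc.prems has_derivative_add by blast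
  next
    fix v show "Ck_on n (\<lambda>x. frechet_derivative f (at x) v + frechet_derivative g (at x) v) S"
      using Suc by auto
  qed
qed

lemma Ck_on_scaleR:
  assumes "open S" "Ck_on n f S" "Ck_on n g S"
  shows "Ck_on n (\<lambda>x. f x *\<^sub>R g x) S"
  using assms(2,3)
proof (induction n arbitrary: f g)
  case 0
  then show ?case by (simp add: continuous_on_scaleR)
next
  case (Suc n)
  show ?case
  proof (rule Ck_on_SucI[OF assms(1)])
    fix x assume x: "x \<in> S"
    show "((\<lambda>x. f x *\<^sub>R g x) has_derivative
       (\<lambda>v. f x *\<^sub>R frechet_derivative g (at x) v + frechet_derivative f (at x) v *\<^sub>R g x)) (at x)"
      using has_derivative_scaleR[OF Ck_on_Suc_has_derivative[OF assms(1) Suc.prems(1) x]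
          Ck_on_Suc_has_derivative[OF assms(1) Suc.prems(2) x]] .
  next
    fix v
    show "Ck_on n (\<lambda>x. f x *\<^sub>R frechet_derivative g (at x) v + frechet_derivative f (at x) v *\<^sub>R g x) S"
      by (rule Ck_on_add[OF assms(1)]; rule Suc.IH)
         (use Suc.prems in \<open>auto intro: Ck_on_Suc_le\<close>)
  qed
qed

lemma Ck_on_mult:
  fixes f g :: "_ \<Rightarrow> real"
  assumes "open S" "Ck_on n f S" "Ck_on n g S"
  shows "Ck_on n (\<lambda>x. f x * g x) S"
  using Ck_on_scaleR[OF assms] by simp

lemma Ck_on_minus:
  assumes "open S" "Ck_on n f S" shows "Ck_on n (\<lambda>x. - f x) S"
  using Ck_on_scaleR[OF assms(1) Ck_on_const[where c = "-1"] assms(2)] by simp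

lemma Ck_on_diff:
  assumes "open S" "Ck_on n f S" "Ck_on n g S" shows "Ck_on n (\<lambda>x. f x - g x) S"
  using Ck_on_add[OF assms(1,2) Ck_on_minus[OF assms(1,3)]] by simp

lemma Ck_on_sum:
  assumes "open S" "\<And>i. i \<in> I \<Longrightarrow> Ck_on n (f i) S"
  shows "Ck_on n (\<lambda>x. \<Sum>i\<in>I. f i x) S"
  using assms(2)
  by (induction I rule: infinite_finite_induct) (auto simp: Ck_on_const Ck_on_add[OF assms(1)])

text \<open>The induction leaves g arbitrary, because the chain rule replaces g by its directional
  derivatives, which are again composed with the same f.\<close>

lemma Ck_on_compose:
  fixes f :: "'a::euclidean_space \<Rightarrow> 'b::euclidean_space" and g :: "'b \<Rightarrow> 'c::real_normed_vector"
  assumes S: "open S" and T: "open T" and "f ` S \<subseteq> T" "Ck_on n f S" "Ck_on n g T"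
  shows "Ck_on n (\<lambda>x. g (f x)) S"
  using assms(3-)
proof (induction n arbitrary: g)
  case 0
  then show ?case by (auto intro: continuous_on_compose2)
next
  case (Suc n)
  let ?f' = "\<lambda>x. frechet_derivative f (at x)" and ?g' = "\<lambda>x. frechet_derivative g (at x)"
  have g': "(g has_derivative ?g' (f x)) (at (f x))" if "x \<in> S" for x
    using Ck_on_Suc_has_derivative[OF T Suc.prems(3)] Suc.prems(1) that by auto
  show ?case
  proof (rule Ck_on_SucI[OF S])
    fix x assume x: "x \<in> S"
    have D: "((\<lambda>x. g (f x)) has_derivative (\<lambda>v. ?g' (f x) (?f' x v))) (at x)"
      using diff_chain_at[OF Ck_on_Suc_has_derivative[OF S Suc.prems(2) x] g'[OF x]]
      by (simp add: o_def)
    \<comment> \<open>Expanding the direction in a basis turns the chain rule into a sum of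
      products, each with one factor depending only on f and one of the form covered by the
      induction hypothesis.\<close>
    have rep: "?g' (f x) w = (\<Sum>b\<in>Basis. (w \<bullet> b) *\<^sub>R ?g' (f x) b)" for w
    proof -
      have "linear (?g' (f x))" using g'[OF x] has_derivative_linear by blast
      then have "?g' (f x) (\<Sum>b\<in>Basis. (w \<bullet> b) *\<^sub>R b) = (\<Sum>b\<in>Basis. (w \<bullet> b) *\<^sub>R ?g' (f x) b)"
        by (simp add: linear_sum linear_scale)
      then show ?thesis by (simp add: euclidean_representation)
    qed
    from D show "((\<lambda>x. g (f x)) has_derivative
       (\<lambda>v. \<Sum>b\<in>Basis. (?f' x v \<bullet> b) *\<^sub>R ?g' (f x) b)) (at x)"
      by (simp only: rep[symmetric])
  next
    fix v
    show "Ck_on n (\<lambda>x. \<Sum>b\<in>Basis. (?f' x v \<bullet> b) *\<^sub>R ?g' (f x) b) S"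
    proof (intro Ck_on_sum Ck_on_scaleR S)
      fix b :: 'b assume "b \<in> Basis"
      show "Ck_on n (\<lambda>x. ?f' x v \<bullet> b) S"
        by (rule Ck_on_linear_compose[OF bounded_linear_inner_left S]) (use Suc.prems in auto)
      show "Ck_on n (\<lambda>x. ?g' (f x) b) S"
        using Suc.IH[of "\<lambda>y. ?g' y b"] Suc.prems(1,3) Ck_on_Suc_le[OF Suc.prems(2)] by simp
    qed
  qed
qed

lemma Ck_on_vec_iff:
  fixes f :: "'a::euclidean_space \<Rightarrow> real^'n"
  assumes "open S"
  shows "Ck_on n f S \<longleftrightarrow> (\<forall>i. Ck_on n (\<lambda>x. f x $ i) S)"
proof
  assume "Ck_on n f S"
  then show "\<forall>i. Ck_on n (\<lambda>x. f x $ i) S"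
    by (intro allI Ck_on_linear_compose[OF bounded_linear_vec_nth assms])
next
  assume *: "\<forall>i. Ck_on n (\<lambda>x. f x $ i) S"
  have "Ck_on n (\<lambda>x. \<Sum>i\<in>UNIV. (f x $ i) *\<^sub>R axis i (1::real)) S"
    by (intro Ck_on_sum Ck_on_scaleR Ck_on_const assms) (use * in auto)
  moreover have "(\<Sum>i\<in>UNIV. (f x $ i) *\<^sub>R axis i (1::real)) = f x" for x
    using basis_expansion[of "f x"] by (simp add: scalar_mult_eq_scaleR)
  ultimately show "Ck_on n f S" by simp
qed

lemma Ck_on_exp: "Ck_on n (exp :: real \<Rightarrow> real) UNIV"
proof (induction n)
  case 0 then show ?case by (simp add: continuous_on_exp)
next
  case (Suc n)
  show ?case
  proof (rule Ck_on_SucI)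
    show "((exp :: real \<Rightarrow> real) has_derivative (\<lambda>v. v * exp x)) (at x)" for x
      by (auto intro!: derivative_eq_intros)
    show "Ck_on n (\<lambda>x. v * exp x :: real) UNIV" for v :: real
      by (intro Ck_on_mult Ck_on_const Suc) auto
  qed auto
qed

lemma Ck_on_inverse: "Ck_on n (inverse :: real \<Rightarrow> real) (- {0})"
proof (induction n)
  case 0 then show ?case by (auto intro!: continuous_intros)
next
  case (Suc n)
  show ?case
  proof (rule Ck_on_SucI)
    show "((inverse :: real \<Rightarrow> real) has_derivative (\<lambda>v. - v * (inverse x * inverse x))) (at x)"
      if "x \<in> - {0}" for x
      using that by (auto intro!: derivative_eq_intros)
    show "Ck_on n (\<lambda>x. - v * (inverse x * inverse x) :: real) (- {0})" for v :: real
      by (intro Ck_on_mult Ck_on_const Suc) auto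
  qed auto
qed

lemma Ck_on_divide:
  fixes f g :: "'a::euclidean_space \<Rightarrow> real"
  assumes "open S" "Ck_on n f S" "Ck_on n g S" "\<And>x. x \<in> S \<Longrightarrow> g x \<noteq> 0"
  shows "Ck_on n (\<lambda>x. f x / g x) S"
proof -
  have "Ck_on n (\<lambda>x. f x * inverse (g x)) S"
    by (intro Ck_on_mult assms(1,2) Ck_on_compose[OF assms(1) _ _ assms(3) Ck_on_inverse]) (use assms(4)
        in auto)
  then show ?thesis by (simp add: divide_inverse)
qed

text \<open>Mixed partials commute: both equal the limit of the same second difference quotient.\<close>

lemma second_difference_mvt:
  fixes f :: "'a::euclidean_space \<Rightarrow> real"
  assumes S: "open S" and C: "Ck_on 2 f S" and h: "h > 0"
    and sub: "\<And>s t. 0 \<le> s \<Longrightarrow> s \<le> h \<Longrightarrow> 0 \<le> t \<Longrightarrow> t \<le> h \<Longrightarrow> x + s *\<^sub>R u + t *\<^sub>R v \<in> S"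
  shows "\<exists>s t. 0 < s \<and> s < h \<and> 0 < t \<and> t < h \<and>
    f (x + h *\<^sub>R u + h *\<^sub>R v) - f (x + h *\<^sub>R u) - f (x + h *\<^sub>R v) + f x =
      h * h * frechet_derivative (\<lambda>y. frechet_derivative f (at y) u) (at (x + s *\<^sub>R u + t *\<^sub>R v)) v"
proof -
  let ?f' = "\<lambda>x. frechet_derivative f (at x)"
  let ?g = "\<lambda>y. ?f' y u"
  let ?g' = "\<lambda>x. frechet_derivative ?g (at x)"
  have C': "Ck_on (Suc 1) f S" using C by (simp add: numeral_2_eq_2)
  have f': "(f has_derivative ?f' y) (at y)" if "y \<in> S" for y
    using Ck_on_Suc_has_derivative[OF S C' that] .
  have C1: "Ck_on (Suc 0) ?g S" using C' by simp
  have g': "(?g has_derivative ?g' y) (at y)" if "y \<in> S" for y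
    using Ck_on_Suc_has_derivative[OF S C1 that] .
  \<comment> \<open>The increment in direction v as a function of the step in direction u. The mean
    value theorem applied to it produces s, and applied afterwards to \<open>?q\<close> it produces
    t.\<close>
  let ?p = "\<lambda>s. f (x + s *\<^sub>R u + h *\<^sub>R v) - f (x + s *\<^sub>R u)"
  have p': "(?p has_derivative (\<lambda>r. r * (?g (x + s *\<^sub>R u + h *\<^sub>R v) - ?g (x + s *\<^sub>R u)))) (at s)"
    if "0 \<le> s" "s \<le> h" for s
  proof -
    have 1: "((\<lambda>s. f (x + s *\<^sub>R u + h *\<^sub>R v)) has_derivative (\<lambda>r. ?f' (x + s *\<^sub>R u + h *\<^sub>R v) (r *\<^sub>R
        u))) (at s)"
      by (rule has_derivative_compose[of "\<lambda>s. x + s *\<^sub>R u + h *\<^sub>R v" _ _ _ f]) (use f' sub[of s h] that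
          h in \<open>auto intro!: derivative_eq_intros\<close>)
    have 2: "((\<lambda>s. f (x + s *\<^sub>R u)) has_derivative (\<lambda>r. ?f' (x + s *\<^sub>R u) (r *\<^sub>R u))) (at s)"
      by (rule has_derivative_compose[of "\<lambda>s. x + s *\<^sub>R u" _ _ _ f]) (use f' sub[of s 0] that h in \<open>auto
          intro!: derivative_eq_intros\<close>)
    have l: "linear (?f' (x + s *\<^sub>R u + h *\<^sub>R v))" "linear (?f' (x + s *\<^sub>R u))"
      using f' sub[of s 0] sub[of s h] that h by (auto intro: has_derivative_linear)
    show ?thesis using has_derivative_diff[OF 1 2] l by (simp add: linear_scale algebra_simps)
  qed
  have "\<exists>s. 0 < s \<and> s < h \<and> ?p h - ?p 0 = (h - 0) * (?g (x + s *\<^sub>R u + h *\<^sub>R v) - ?g (x + s *\<^sub>R u))"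
  proof -
    have "continuous_on {0..h} ?p"
      by (rule has_derivative_continuous_on) (use p' in \<open>auto intro: has_derivative_at_withinI\<close>)
    from mvt[OF h this, of "\<lambda>s r. r * (?g (x + s *\<^sub>R u + h *\<^sub>R v) - ?g (x + s *\<^sub>R u))"] p' obtain s
        where "s \<in> {0<..<h}" "?p h - ?p 0 = (h - 0) * (?g (x + s *\<^sub>R u + h *\<^sub>R v) - ?g (x + s *\<^sub>R u))"
      by auto
    then show ?thesis by auto
  qed
  then obtain s where s: "0 < s" "s < h"
    and ps: "?p h - ?p 0 = h * (?g (x + s *\<^sub>R u + h *\<^sub>R v) - ?g (x + s *\<^sub>R u))" by auto
  let ?q = "\<lambda>t. ?g (x + s *\<^sub>R u + t *\<^sub>R v)"
  have q': "(?q has_derivative (\<lambda>r. r * ?g' (x + s *\<^sub>R u + t *\<^sub>R v) v)) (at t)"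
    if "0 \<le> t" "t \<le> h" for t
  proof -
    have in': "x + s *\<^sub>R u + t *\<^sub>R v \<in> S" using sub s that by simp
    have 1: "(?q has_derivative (\<lambda>r. ?g' (x + s *\<^sub>R u + t *\<^sub>R v) (r *\<^sub>R v))) (at t)"
      by (rule has_derivative_compose[of "\<lambda>t. x + s *\<^sub>R u + t *\<^sub>R v" _ _ _ ?g]) (use g'[OF in'] in \<open>auto
          intro!: derivative_eq_intros\<close>)
    have "linear (?g' (x + s *\<^sub>R u + t *\<^sub>R v))"
      using g'[OF in'] by (auto intro: has_derivative_linear)
    then show ?thesis using 1 by (simp add: linear_scale)
  qed
  have "continuous_on {0..h} ?q"
    by (rule has_derivative_continuous_on) (use q' in \<open>auto intro: has_derivative_at_withinI\<close>)
  from mvt[OF h this, of "\<lambda>t r. r * ?g' (x + s *\<^sub>R u + t *\<^sub>R v) v"] q' obtain t where "t \<in> {0<..<h}" "?q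
      h - ?q 0 = (h - 0) * ?g' (x + s *\<^sub>R u + t *\<^sub>R v) v"
    by auto
  then show ?thesis using s ps by (intro exI[of _ s] exI[of _ t]) (auto simp: algebra_simps)
qed

lemma frechet_derivative_commute:
  fixes f :: "'a::euclidean_space \<Rightarrow> real"
  assumes S: "open S" and C: "Ck_on 2 f S" and x: "x \<in> S"
  shows "frechet_derivative (\<lambda>y. frechet_derivative f (at y) u) (at x) v =
         frechet_derivative (\<lambda>y. frechet_derivative f (at y) v) (at x) u"
proof -
  define G where "G = (\<lambda>u v y. frechet_derivative (\<lambda>y. frechet_derivative f (at y) u) (at y) v)"
  have cont: "isCont (G u v) x" for u v
  proof -
    have "Ck_on (Suc (Suc 0)) f S" using C by (simp add: numeral_2_eq_2)
    then have "continuous_on S (G u v)" by (simp add: G_def)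
    then show ?thesis using S x continuous_on_eq_continuous_at by blast
  qed
  have ex: "\<exists>e>0. \<forall>s t. \<bar>s\<bar> < e \<longrightarrow> \<bar>t\<bar> < e \<longrightarrow> x + s *\<^sub>R u + t *\<^sub>R v \<in> S \<and>
      dist (G a b (x + s *\<^sub>R u + t *\<^sub>R v)) (G a b x) < \<epsilon>"
    if "\<epsilon> > 0" for \<epsilon> a b u v
  proof -
    from cont[of a b] that obtain d where d: "d > 0" "\<And>y. dist y x < d \<Longrightarrow> dist (G a b y) (G a b x) < \<epsilon>"
      unfolding continuous_at_eps_delta by blast
    from S x obtain r where r: "r > 0" "ball x r \<subseteq> S" using open_contains_ball by blast
    \<comment> \<open>The summand 1 keeps the denominator positive when both directions are
      zero.\<close>
    let ?m = "min d r" and ?N = "norm u + norm v + 1"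
    have N: "?N > 0" by (simp add: add_nonneg_pos)
    have "dist (x + s *\<^sub>R u + t *\<^sub>R v) x < ?m" if "\<bar>s\<bar> < ?m / ?N" "\<bar>t\<bar> < ?m / ?N" for s t
    proof -
      have "dist (x + s *\<^sub>R u + t *\<^sub>R v) x = norm (s *\<^sub>R u + t *\<^sub>R v)"
        by (simp add: dist_norm algebra_simps)
      also have "\<dots> \<le> \<bar>s\<bar> * norm u + \<bar>t\<bar> * norm v" by (metis norm_triangle_ineq norm_scaleR)
      also have "\<dots> \<le> ?m / ?N * norm u + ?m / ?N * norm v"
        using that by (intro add_mono mult_right_mono) auto
      also have "\<dots> = ?m / ?N * (norm u + norm v)" by (simp add: distrib_left)
      also have "\<dots> < ?m / ?N * ?N"
        using d(1) r(1) N by (intro mult_strict_left_mono) auto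
      also have "\<dots> = ?m" using N by simp
      finally show ?thesis .
    qed
    then have *: "x + s *\<^sub>R u + t *\<^sub>R v \<in> S \<and> dist (G a b (x + s *\<^sub>R u + t *\<^sub>R v)) (G a b x) < \<epsilon>"
      if "\<bar>s\<bar> < ?m / ?N" "\<bar>t\<bar> < ?m / ?N" for s t
      using that d(2) r(2) by (metis dist_commute mem_ball min_less_iff_conj subsetD)
    moreover have "?m / ?N > 0" using d(1) r(1) N by simp
    ultimately show ?thesis by blast
  qed
  have "\<bar>G u v x - G v u x\<bar> \<le> \<epsilon>" if "\<epsilon> > 0" for \<epsilon>
  proof -
    from ex[of "\<epsilon>/2" u v u v] that obtain e1 where e1: "e1 > 0"
      "\<And>s t. \<bar>s\<bar> < e1 \<Longrightarrow> \<bar>t\<bar> < e1 \<Longrightarrow> x + s *\<^sub>R u + t *\<^sub>R v \<in> S \<and> dist (G u v (x + s *\<^sub>R u + t *\<^sub>R v)) (G u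
          v x) < \<epsilon>/2"
      using \<open>\<epsilon> > 0\<close> by fastforce
    from ex[of "\<epsilon>/2" u v v u] that obtain e2 where e2: "e2 > 0"
      "\<And>s t. \<bar>s\<bar> < e2 \<Longrightarrow> \<bar>t\<bar> < e2 \<Longrightarrow> x + s *\<^sub>R u + t *\<^sub>R v \<in> S \<and> dist (G v u (x + s *\<^sub>R u + t *\<^sub>R v)) (G v
          u x) < \<epsilon>/2"
      using \<open>\<epsilon> > 0\<close> by fastforce
    define h where "h = min e1 e2 / 2"
    have h: "h > 0" "h < e1" "h < e2" using e1 e2 by (auto simp: h_def min_def)
    have sub1: "x + s *\<^sub>R u + t *\<^sub>R v \<in> S" if "0 \<le> s" "s \<le> h" "0 \<le> t" "t \<le> h" for s t
      using e1(2)[of s t] that h by auto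
    have sub2: "x + s *\<^sub>R v + t *\<^sub>R u \<in> S" if "0 \<le> s" "s \<le> h" "0 \<le> t" "t \<le> h" for s t
      using sub1[of t s] that by (simp add: algebra_simps)
    from second_difference_mvt[OF S C h(1) sub1] obtain s t where
      1: "0 < s" "s < h" "0 < t" "t < h"
      "f (x + h *\<^sub>R u + h *\<^sub>R v) - f (x + h *\<^sub>R u) - f (x + h *\<^sub>R v) + f x = h * h * G u v (x + s *\<^sub>R u
          + t *\<^sub>R v)"
      unfolding G_def by auto
    from second_difference_mvt[OF S C h(1) sub2] obtain s' t' where
      2: "0 < s'" "s' < h" "0 < t'" "t' < h"
      "f (x + h *\<^sub>R v + h *\<^sub>R u) - f (x + h *\<^sub>R v) - f (x + h *\<^sub>R u) + f x = h * h * G v u (x + s' *\<^sub>R v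
          + t' *\<^sub>R u)"
      unfolding G_def by auto
    \<comment> \<open>The second difference is symmetric in u and v, so the two mean value
      expressions have the same value.\<close>
    have "h * h * G u v (x + s *\<^sub>R u + t *\<^sub>R v) = h * h * G v u (x + t' *\<^sub>R u + s' *\<^sub>R v)"
      using 1(5) 2(5) by (simp add: algebra_simps)
    then have "G u v (x + s *\<^sub>R u + t *\<^sub>R v) = G v u (x + t' *\<^sub>R u + s' *\<^sub>R v)"
      using h(1) by simp
    moreover have "dist (G u v (x + s *\<^sub>R u + t *\<^sub>R v)) (G u v x) < \<epsilon>/2" using e1(2)[of s t] 1 h by auto
    moreover have "dist (G v u (x + t' *\<^sub>R u + s' *\<^sub>R v)) (G v u x) < \<epsilon>/2" using e2(2)[of t' s'] 2 h by auto
    ultimately show ?thesis unfolding dist_real_def by linarith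
  qed
  then have "\<bar>G u v x - G v u x\<bar> \<le> 0"
    using field_le_epsilon[of "\<bar>G u v x - G v u x\<bar>" 0] by simp
  then show ?thesis by (simp add: G_def)
qed

text \<open>Differentiation under the integral sign replaces F by a partial derivative of F, so the
  induction leaves F arbitrary. The open W around the closed interval makes F differentiable at the
  end points as well.\<close>

lemma Ck_on_parametric_integral:
  fixes F :: "'a::euclidean_space \<times> real \<Rightarrow> real"
  assumes U: "open U" and W: "open W" "{0..1} \<subseteq> W" and F: "Ck_on n F (U \<times> W)"
  shows "Ck_on n (\<lambda>x. integral {0..1} (\<lambda>t. F (x, t))) U"
  using F
proof (induction n arbitrary: F)
  case 0
  then have "continuous_on (U \<times> cbox 0 1) (\<lambda>(x, t). F (x, t))"
    using W(2) by (auto intro: continuous_on_subset)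
  then show ?case
    using integral_continuous_on_param[of U 0 1 "\<lambda>x t. F (x, t)"] by simp
next
  case (Suc n)
  have UW: "open (U \<times> W)" using U W(1) by (rule open_Times)
  let ?F' = "\<lambda>p. frechet_derivative F (at p)"
  have F': "(F has_derivative ?F' p) (at p)" if "p \<in> U \<times> W" for p
    using Ck_on_Suc_has_derivative[OF UW Suc.prems that] .
  \<comment> \<open>The Leibniz rule asks for the x-derivative as a continuous map into the bounded
    linear functions; continuity is then checked on basis vectors.\<close>
  define fx where "fx = (\<lambda>x t. Blinfun (\<lambda>v. ?F' (x, t) (v, 0)))"
  have fx: "blinfun_apply (fx x t) = (\<lambda>v. ?F' (x, t) (v, 0))" if "x \<in> U" "t \<in> {0..1}" for x t
  proof -
    have "bounded_linear (?F' (x, t))"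
      by (rule has_derivative_bounded_linear[OF F']) (use that W(2) in auto)
    moreover have "bounded_linear (\<lambda>v::'a. (v, 0::real))"
      by (intro bounded_linear_Pair bounded_linear_ident bounded_linear_zero)
    ultimately have "bounded_linear (\<lambda>v. ?F' (x, t) (v, 0))"
      using bounded_linear_compose by blast
    then show ?thesis unfolding fx_def by (rule bounded_linear_Blinfun_apply)
  qed
  have cont_fx: "continuous_on (U \<times> cbox 0 1) (\<lambda>(x, t). fx x t)"
  proof (rule continuous_on_blinfun_componentwise)
    fix i :: 'a
    have "Ck_on n (\<lambda>p. ?F' p (i, 0)) (U \<times> W)" using Suc.prems by simp
    then have "continuous_on (U \<times> cbox 0 1) (\<lambda>p. ?F' p (i, 0))"
      by (rule continuous_on_subset[OF Ck_on_continuous]) (use W(2) in auto)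
    then show "continuous_on (U \<times> cbox 0 1) (\<lambda>p. blinfun_apply (case p of (x, t) \<Rightarrow> fx x t) i)"
      by (rule continuous_on_eq) (auto simp: fx)
  qed
  show ?case
  proof (rule Ck_on_SucI[OF U])
    fix x assume x: "x \<in> U"
    then obtain r where r: "r > 0" "ball x r \<subseteq> U" using U open_contains_ball by blast
    have int_fx: "fx x integrable_on cbox 0 1"
    proof (rule integrable_continuous)
      have "continuous_on (cbox 0 1) ((\<lambda>(x, t). fx x t) \<circ> (\<lambda>t. (x, t)))"
        by (rule continuous_on_compose) (use x in \<open>auto intro!: continuous_intros
            continuous_on_subset[OF cont_fx]\<close>)
      then show "continuous_on (cbox 0 1) (fx x)" by (simp add: o_def)
    qed
    have "((\<lambda>y. integral (cbox 0 1) (\<lambda>t. F (y, t))) has_derivative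
        blinfun_apply (integral (cbox 0 1) (fx x))) (at x within ball x r)"
    proof (rule leibniz_rule)
      fix y t assume y: "y \<in> ball x r" and t: "t \<in> cbox 0 (1::real)"
      have "(y, t) \<in> U \<times> W" using y t r W(2) by auto
      moreover have "((\<lambda>y. (y, t)) has_derivative (\<lambda>v. (v, 0))) (at y)"
        by (auto intro!: derivative_eq_intros)
      ultimately have "((\<lambda>y. F (y, t)) has_derivative (\<lambda>v. ?F' (y, t) (v, 0))) (at y)"
        using has_derivative_compose[where f = "\<lambda>y. (y, t)" and g = F and x = y and s = UNIV] F' by blast
      then show "((\<lambda>y. F (y, t)) has_derivative blinfun_apply (fx y t)) (at y within ball x r)"
        using fx[of y t] y t r by (simp add: has_derivative_at_withinI subset_iff)
    next
      fix y assume "y \<in> ball x r"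
      then have "continuous_on (cbox 0 1) (F \<circ> (\<lambda>t. (y, t)))"
        using r(2) W(2)
        by (intro continuous_on_compose continuous_on_subset[OF Ck_on_continuous[OF Suc.prems]])
           (auto intro!: continuous_intros)
      then show "(\<lambda>t. F (y, t)) integrable_on cbox 0 1"
        by (intro integrable_continuous) (simp add: o_def)
    next
      show "continuous_on (ball x r \<times> cbox 0 1) (\<lambda>(x, t). fx x t)"
        using cont_fx r by (rule_tac continuous_on_subset) auto
    qed (use r in auto)
    moreover have "blinfun_apply (integral (cbox 0 1) (fx x)) = (\<lambda>v. integral {0..1} (\<lambda>t. ?F' (x, t) (v,
        0)))"
    proof
      fix v
      have "blinfun_apply (integral (cbox 0 1) (fx x)) v = integral (cbox 0 1) (\<lambda>t. blinfun_apply (fx x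
          t) v)"
        by (rule blinfun_apply_integral[OF int_fx])
      also have "\<dots> = integral (cbox 0 1) (\<lambda>t. ?F' (x, t) (v, 0))"
        by (rule integral_cong) (simp add: fx x)
      finally show "blinfun_apply (integral (cbox 0 1) (fx x)) v = integral {0..1} (\<lambda>t. ?F' (x, t) (v, 0))"
        by simp
    qed
    ultimately show "((\<lambda>y. integral {0..1} (\<lambda>t. F (y, t))) has_derivative
        (\<lambda>v. integral {0..1} (\<lambda>t. ?F' (x, t) (v, 0)))) (at x)"
      using r(1) by (simp add: at_within_open[of x "ball x r"])
  next
    fix v show "Ck_on n (\<lambda>x. integral {0..1} (\<lambda>t. ?F' (x, t) (v, 0))) U"
      by (rule Suc.IH) (use Suc.prems in simp)
  qed
qed

section \<open>Smooth functions and their partial derivatives\<close>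

lemma smooth_on_Ck: "smooth_on f S \<Longrightarrow> Ck_on n f S"
  by (simp add: smooth_on_def)

lemma smooth_onI: "(\<And>n. Ck_on n f S) \<Longrightarrow> smooth_on f S"
  by (simp add: smooth_on_def)

lemma smooth_on_cong:
  assumes "open S" "\<And>y. y \<in> S \<Longrightarrow> f y = g y"
  shows "smooth_on f S \<longleftrightarrow> smooth_on g S"
  unfolding smooth_on_def using Ck_on_cong[OF assms] by auto

lemma smooth_on_subset: "smooth_on f S \<Longrightarrow> T \<subseteq> S \<Longrightarrow> smooth_on f T"
  by (auto simp: smooth_on_def intro: Ck_on_subset)

lemma smooth_on_continuous: "smooth_on f S \<Longrightarrow> continuous_on S f"
  by (rule Ck_on_continuous[OF smooth_on_Ck])

lemma smooth_on_const [simp]: "smooth_on (\<lambda>x. c) S"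
  by (simp add: smooth_on_def Ck_on_const)

lemma smooth_on_bounded_linear: "bounded_linear f \<Longrightarrow> smooth_on f S"
  by (simp add: smooth_on_def Ck_on_bounded_linear)

lemma smooth_on_linear_compose:
  "bounded_linear L \<Longrightarrow> open S \<Longrightarrow> smooth_on f S \<Longrightarrow> smooth_on (\<lambda>x. L (f x)) S"
  by (simp add: smooth_on_def Ck_on_linear_compose)

lemma smooth_on_add:
  "open S \<Longrightarrow> smooth_on f S \<Longrightarrow> smooth_on g S \<Longrightarrow> smooth_on (\<lambda>x. f x + g x) S"
  by (simp add: smooth_on_def Ck_on_add)

lemma smooth_on_diff:
  "open S \<Longrightarrow> smooth_on f S \<Longrightarrow> smooth_on g S \<Longrightarrow> smooth_on (\<lambda>x. f x - g x) S"
  by (simp add: smooth_on_def Ck_on_diff)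

lemma smooth_on_mult:
  fixes f g :: "_ \<Rightarrow> real"
  shows "open S \<Longrightarrow> smooth_on f S \<Longrightarrow> smooth_on g S \<Longrightarrow> smooth_on (\<lambda>x. f x * g x) S"
  by (simp add: smooth_on_def Ck_on_mult)

lemma smooth_on_divide:
  fixes f g :: "'a::euclidean_space \<Rightarrow> real"
  shows "open S \<Longrightarrow> smooth_on f S \<Longrightarrow> smooth_on g S \<Longrightarrow> (\<And>x. x \<in> S \<Longrightarrow> g x \<noteq> 0) \<Longrightarrow>
    smooth_on (\<lambda>x. f x / g x) S"
  by (simp add: smooth_on_def Ck_on_divide)

lemma smooth_on_compose:
  fixes f :: "'a::euclidean_space \<Rightarrow> 'b::euclidean_space"
  assumes "open S" "open T" "f ` S \<subseteq> T" "smooth_on f S" "smooth_on g T"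
  shows "smooth_on (\<lambda>x. g (f x)) S"
  by (rule smooth_onI) (rule Ck_on_compose[OF assms(1-3) smooth_on_Ck[OF assms(4)] smooth_on_Ck[OF
      assms(5)]])

lemma smooth_on_vec_iff:
  fixes f :: "'a::euclidean_space \<Rightarrow> real^'n"
  shows "open S \<Longrightarrow> smooth_on f S \<longleftrightarrow> (\<forall>i. smooth_on (\<lambda>x. f x $ i) S)"
  unfolding smooth_on_def by (auto simp: Ck_on_vec_iff)

lemma smooth_on_frechet:
  "smooth_on f S \<Longrightarrow> smooth_on (\<lambda>x. frechet_derivative f (at x) v) S"
  using smooth_on_Ck[of f S "Suc n" for n] by (intro smooth_onI) simp

lemma smooth_on_has_derivative:
  "open S \<Longrightarrow> smooth_on f S \<Longrightarrow> x \<in> S \<Longrightarrow> (f has_derivative frechet_derivative f (at x)) (at x)"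
  by (rule Ck_on_Suc_has_derivative[OF _ smooth_on_Ck])

lemma smooth_on_pd: "smooth_on f S \<Longrightarrow> smooth_on (pd i f) S"
  unfolding pd_def[abs_def] by (rule smooth_on_frechet)

lemma pd_has_derivative: "(f has_derivative f') (at x) \<Longrightarrow> pd i f x = f' (axis i 1)"
  unfolding pd_def by (simp add: frechet_derivative_at[symmetric])

lemma pd_cong:
  assumes "open S" "x \<in> S" "\<And>y. y \<in> S \<Longrightarrow> f y = g y"
  shows "pd i f x = pd i g x"
  unfolding pd_def using frechet_derivative_cong[OF assms] by simp

lemma pd_commute:
  assumes "open S" "smooth_on f S" "x \<in> S"
  shows "pd i (pd j f) x = pd j (pd i f) x"
  unfolding pd_def[abs_def] by (rule frechet_derivative_commute[OF assms(1) _ assms(3)]) (rule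
      smooth_on_Ck[OF assms(2)])

lemma has_derivative_pd:
  assumes "(f has_derivative f') (at x)"
  shows "(f has_derivative (\<lambda>v. \<Sum>i\<in>UNIV. v $ i * pd i f x)) (at x)"
proof -
  have "f' v = (\<Sum>i\<in>UNIV. v $ i * pd i f x)" for v
  proof -
    have "linear f'" using assms has_derivative_linear by blast
    then have "f' (\<Sum>i\<in>UNIV. v $ i *s axis i 1) = (\<Sum>i\<in>UNIV. v $ i *\<^sub>R f' (axis i 1))"
      by (simp add: linear_sum linear_scale scalar_mult_eq_scaleR)
    then show ?thesis by (simp add: basis_expansion pd_has_derivative[OF assms])
  qed
  then have "f' = (\<lambda>v. \<Sum>i\<in>UNIV. v $ i * pd i f x)" by (rule ext)
  with assms show ?thesis by simp
qed

lemma smooth_on_has_derivative_pd: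
  assumes "open S" "smooth_on f S" "x \<in> S"
  shows "(f has_derivative (\<lambda>v. \<Sum>i\<in>UNIV. v $ i * pd i f x)) (at x)"
  using has_derivative_pd[OF smooth_on_has_derivative[OF assms]] .

lemma smooth_on_parametric_integral:
  fixes F :: "'a::euclidean_space \<times> real \<Rightarrow> real"
  assumes "open U" "open W" "{0..1} \<subseteq> W" "smooth_on F (U \<times> W)"
  shows "smooth_on (\<lambda>x. integral {0..1} (\<lambda>t. F (x, t))) U"
  by (rule smooth_onI) (rule Ck_on_parametric_integral[OF assms(1-3) smooth_on_Ck[OF assms(4)]])

section \<open>Scalar differential equations and local diffeomorphisms\<close>

lemma has_derivative_vec_lambda:
  fixes f :: "'n::finite \<Rightarrow> 'a::real_normed_vector \<Rightarrow> real"
  assumes "\<And>k. (f k has_derivative f' k) F"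
  shows "((\<lambda>x. \<chi> k. f k x) has_derivative (\<lambda>v. \<chi> k. f' k v)) F"
proof -
  have vec: "(\<chi> k. w k) = (\<Sum>k\<in>UNIV. w k *\<^sub>R axis k (1::real))" for w :: "'n \<Rightarrow> real"
    using basis_expansion[of "\<chi> k. w k"] by (simp add: scalar_mult_eq_scaleR)
  show ?thesis unfolding vec
    by (intro has_derivative_sum has_derivative_scaleR_left assms)
qed

section \<open>Inverse functions in the plane\<close>

definition jac2 :: "(real^2 \<Rightarrow> real^2) \<Rightarrow> real^2 \<Rightarrow> real" where
  "jac2 \<Theta> x = pd 1 (\<lambda>x. \<Theta> x $ 1) x * pd 2 (\<lambda>x. \<Theta> x $ 2) x - pd 2 (\<lambda>x. \<Theta> x $ 1) x * pd 1 (\<lambda>x. \<Theta> x $ 2) x"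

text \<open>Injectivity is assumed, so invariance of domain already yields an open image and a
  continuous inverse; only the differentiability of the inverse has to be established.\<close>

lemma smooth_inverse_2d:
  fixes \<Theta> :: "real^2 \<Rightarrow> real^2"
  assumes S: "open S" and \<Theta>: "smooth_on \<Theta> S" and inj: "inj_on \<Theta> S"
    and jac: "\<And>x. x \<in> S \<Longrightarrow> jac2 \<Theta> x \<noteq> 0"
  shows "open (\<Theta> ` S)" "homeomorphism S (\<Theta> ` S) \<Theta> (inv_into S \<Theta>)"
    "smooth_on (inv_into S \<Theta>) (\<Theta> ` S)"
proof -
  let ?G = "inv_into S \<Theta>"
  have cont: "continuous_on S \<Theta>" by (rule smooth_on_continuous[OF \<Theta>])
  show im: "open (\<Theta> ` S)" by (rule invariance_of_domain[OF cont S inj])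
  obtain g where g: "homeomorphism S (\<Theta> ` S) \<Theta> g"
    using invariance_of_domain_homeomorphism[OF S cont _ inj] by auto
  have G: "?G (\<Theta> x) = x" if "x \<in> S" for x using inj that by (rule inv_into_f_f)
  have Gin: "?G y \<in> S" "\<Theta> (?G y) = y" if "y \<in> \<Theta> ` S" for y
    using that by (auto simp: inv_into_into f_inv_into_f)
  have "?G y = g y" if "y \<in> \<Theta> ` S" for y using that g G by (auto simp: homeomorphism_def)
  then show hom: "homeomorphism S (\<Theta> ` S) \<Theta> ?G"
    using g by (auto simp: homeomorphism_def cong: continuous_on_cong)
  define D where "D = (\<lambda>k i. pd i (\<lambda>x. \<Theta> x $ k))"
  have \<Theta>k: "smooth_on (\<lambda>x. \<Theta> x $ k) S" for k using \<Theta> smooth_on_vec_iff[OF S] by blast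
  have D: "smooth_on (D k i) S" for k i unfolding D_def by (rule smooth_on_pd[OF \<Theta>k])
  have J: "jac2 \<Theta> = (\<lambda>x. D 1 1 x * D 2 2 x - D 1 2 x * D 2 1 x)"
    by (auto simp: jac2_def D_def)
  have sJ: "smooth_on (jac2 \<Theta>) S" unfolding J by (intro smooth_on_diff smooth_on_mult S D)
  \<comment> \<open>Cramer's rule for the inverse of the Jacobian matrix.\<close>
  define G' :: "real^2 \<Rightarrow> real^2 \<Rightarrow> real^2" where "G' = (\<lambda>x w. \<chi> i. if i = 1 then (w $ 1 * D 2 2 x - w $ 2
      * D 1 2 x) / jac2 \<Theta> x
      else (w $ 2 * D 1 1 x - w $ 1 * D 2 1 x) / jac2 \<Theta> x)"
  have dG: "(?G has_derivative G' (?G y)) (at y)" if y: "y \<in> \<Theta> ` S" for y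
  proof -
    let ?x = "?G y"
    have x: "?x \<in> S" and xy: "\<Theta> ?x = y" using Gin[OF y] by auto
    have "((\<lambda>x. \<chi> k. \<Theta> x $ k) has_derivative (\<lambda>v. \<chi> k. \<Sum>i\<in>UNIV. v $ i * D k i ?x)) (at ?x)"
      unfolding D_def
      by (intro has_derivative_vec_lambda smooth_on_has_derivative_pd[OF S \<Theta>k x])
    then have d: "(\<Theta> has_derivative (\<lambda>v. \<chi> k. \<Sum>i\<in>UNIV. v $ i * D k i ?x)) (at ?x)" by simp
    have "(\<lambda>v. \<chi> k. \<Sum>i\<in>UNIV. v $ i * D k i ?x) \<circ> G' ?x = id"
    proof
      fix w :: "real^2"
      have nz: "D 1 1 ?x * D 2 2 ?x - D 1 2 ?x * D 2 1 ?x \<noteq> 0" using jac[OF x] by (simp add: J)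
      have "(w $ 1 * D 2 2 ?x - w $ 2 * D 1 2 ?x) / jac2 \<Theta> ?x * D 1 1 ?x + (w $ 2 * D 1 1 ?x - w $ 1 * D
          2 1 ?x) / jac2 \<Theta> ?x * D 1 2 ?x = w $ 1"
        "(w $ 1 * D 2 2 ?x - w $ 2 * D 1 2 ?x) / jac2 \<Theta> ?x * D 2 1 ?x + (w $ 2 * D 1 1 ?x - w $ 1 * D 2
            1 ?x) / jac2 \<Theta> ?x * D 2 2 ?x = w $ 2"
        unfolding J times_divide_eq_left add_divide_distrib[symmetric] nonzero_divide_eq_eq[OF nz]
        by (simp_all add: algebra_simps)
      then show "((\<lambda>v. \<chi> k. \<Sum>i\<in>UNIV. v $ i * D k i ?x) \<circ> G' ?x) w = id w"
        by (simp add: vec_eq_iff forall_2 sum_2 G'_def)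
    qed
    from has_derivative_inverse_strong[OF S x cont G d this] show ?thesis by (simp add: xy)
  qed
  \<comment> \<open>Bootstrapping: the derivative of the inverse is a smooth function composed with
    the inverse itself, so each order of differentiability gives the next.\<close>
  have "Ck_on n ?G (\<Theta> ` S)" for n
  proof (induction n)
    case 0
    then show ?case using hom by (simp add: homeomorphism_def)
  next
    case (Suc n)
    have c: "Ck_on n (\<lambda>y. f (?G y)) (\<Theta> ` S)" if "smooth_on f S" for f :: "real^2 \<Rightarrow> real"
      by (rule Ck_on_compose[OF im S _ Suc smooth_on_Ck[OF that]]) (use Gin in auto)
    show ?case
    proof (rule Ck_on_SucI[OF im])
      show "(?G has_derivative G' (?G y)) (at y)" if "y \<in> \<Theta> ` S" for y using dG[OF that] .
      fix v :: "real^2"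
      have "Ck_on n (\<lambda>y. (v $ 1 * D 2 2 (?G y) - v $ 2 * D 1 2 (?G y)) / jac2 \<Theta> (?G y)) (\<Theta> ` S)"
        "Ck_on n (\<lambda>y. (v $ 2 * D 1 1 (?G y) - v $ 1 * D 2 1 (?G y)) / jac2 \<Theta> (?G y)) (\<Theta> ` S)"
        by (intro Ck_on_divide Ck_on_diff Ck_on_mult Ck_on_const im c D sJ jac Gin; assumption)+
      then show "Ck_on n (\<lambda>y. G' (?G y) v) (\<Theta> ` S)"
        by (simp add: Ck_on_vec_iff[OF im] forall_2 G'_def)
    qed
  qed
  then show "smooth_on ?G (\<Theta> ` S)" by (rule smooth_onI)
qed

text \<open>The primitive of h vanishing at t0, written over the fixed interval from 0 to 1. In this
  form it makes sense on both sides of t0, and smoothness in further parameters follows from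
  \<open>Ck_on_parametric_integral\<close>.\<close>

lemma mean_integral_has_derivative:
  fixes h :: "real \<Rightarrow> real"
  assumes h: "continuous_on {t0 - \<delta><..<t0 + \<delta>} h" and t: "\<bar>t - t0\<bar> < \<delta>"
  shows "((\<lambda>t. (t - t0) * integral {0..1} (\<lambda>\<theta>. h (t0 + \<theta> * (t - t0)))) has_real_derivative h t) (at t)"
proof -
  \<comment> \<open>A closed interval inside the open one, since the antiderivative is available for
    continuous functions on closed intervals.\<close>
  obtain r where r: "\<bar>t - t0\<bar> < r" "r < \<delta>" using t dense by blast
  then have "continuous_on {t0 - r..t0 + r} h" using h by (auto elim!: continuous_on_subset)
  from antiderivative_continuous[OF this] obtain g where
    g: "\<And>x. x \<in> {t0 - r..t0 + r} \<Longrightarrow> (g has_vector_derivative h x) (at x within {t0 - r..t0 + r})" by blast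
  have eq: "(s - t0) * integral {0..1} (\<lambda>\<theta>. h (t0 + \<theta> * (s - t0))) = g s - g t0" if s: "\<bar>s - t0\<bar> \<le> r" for s
  proof -
    have "((\<lambda>\<theta>. g (t0 + \<theta> * (s - t0))) has_vector_derivative (s - t0) * h (t0 + \<theta> * (s - t0))) (at \<theta>
        within {0..1})"
      if th: "\<theta> \<in> {0..1}" for \<theta>
    proof -
      have in': "t0 + \<theta>' * (s - t0) \<in> {t0 - r..t0 + r}" if "\<theta>' \<in> {0..1}" for \<theta>'
      proof -
        have "\<bar>\<theta>' * (s - t0)\<bar> \<le> 1 * r" unfolding abs_mult using that s by (intro mult_mono) auto
        then show ?thesis by auto
      qed
      have "((\<lambda>\<theta>. t0 + \<theta> * (s - t0)) has_vector_derivative (s - t0)) (at \<theta> within {0..1})"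
        by (auto intro!: derivative_eq_intros simp:
            has_real_derivative_iff_has_vector_derivative[symmetric])
      moreover have "(g has_vector_derivative h (t0 + \<theta> * (s - t0))) (at (t0 + \<theta> * (s - t0)) within (\<lambda>\<theta>.
          t0 + \<theta> * (s - t0)) ` {0..1})"
        by (rule has_vector_derivative_within_subset[OF g[OF in'[OF th]]]) (use in' in auto)
      ultimately show ?thesis
        using vector_diff_chain_within[of "\<lambda>\<theta>. t0 + \<theta> * (s - t0)" "s - t0" \<theta> "{0..1}" g] by (simp add:
            o_def)
    qed
    then have "((\<lambda>\<theta>. (s - t0) * h (t0 + \<theta> * (s - t0))) has_integral g (t0 + 1 * (s - t0)) - g (t0 + 0 *
        (s - t0))) {0..1}"
      by (intro fundamental_theorem_of_calculus) auto
    from integral_unique[OF this] show ?thesis by simp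
  qed
  have "(g has_real_derivative h t) (at t within {t0 - r..t0 + r})"
    unfolding has_real_derivative_iff_has_vector_derivative by (rule g) (use r in \<open>simp; linarith\<close>)
  then have "(g has_real_derivative h t) (at t within {t0 - r<..<t0 + r})"
    by (rule DERIV_subset) auto
  then have "(g has_real_derivative h t) (at t)"
    using r by (subst (asm) at_within_open) auto
  then have "((\<lambda>s. g s - g t0) has_real_derivative h t) (at t)"
    by (auto intro!: derivative_eq_intros)
  then show ?thesis
  proof (rule has_field_derivative_transform_within_open)
    show "open {t0 - r<..<t0 + r}" "t \<in> {t0 - r<..<t0 + r}" using r by auto
    show "g s - g t0 = (s - t0) * integral {0..1} (\<lambda>\<theta>. h (t0 + \<theta> * (s - t0)))" if "s \<in> {t0 - r<..<t0 +
        r}" for s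
      using eq[of s] that by auto
  qed
qed

text \<open>For r >= 0 the nearest point projection onto the interval of radius r around c.
  Composition with it extends a function from a rectangle to the whole plane, preserving bounds and
  Lipschitz constants and changing nothing on the rectangle.\<close>

definition clip :: "real \<Rightarrow> real \<Rightarrow> real \<Rightarrow> real" where
  "clip c r x = max (c - r) (min (c + r) x)"

lemma clip_range: "r \<ge> 0 \<Longrightarrow> \<bar>clip c r x - c\<bar> \<le> r"
  by (auto simp: clip_def max_def min_def)

lemma clip_id: "\<bar>x - c\<bar> \<le> r \<Longrightarrow> clip c r x = x"
  by (auto simp: clip_def max_def min_def)

lemma clip_lipschitz: "\<bar>clip c r x - clip c r y\<bar> \<le> \<bar>x - y\<bar>"
  by (auto simp: clip_def max_def min_def)

lemma continuous_on_clip [continuous_intros]: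
  "continuous_on S f \<Longrightarrow> continuous_on S (\<lambda>x. clip c r (f x))"
  unfolding clip_def by (intro continuous_intros)

text \<open>Picard's fixed point argument, carried out for functions of time and initial value
  together. The fixed point is thus jointly continuous in both variables from the outset.\<close>

lemma lipschitz_ode_solution:
  fixes F :: "real \<times> real \<Rightarrow> real"
  assumes F: "continuous_on UNIV F" and M: "\<And>p. \<bar>F p\<bar> \<le> M"
    and L: "\<And>t y y'. \<bar>F (t, y) - F (t, y')\<bar> \<le> L * \<bar>y - y'\<bar>" and \<delta>: "\<delta> > 0" "\<delta> * L \<le> 1 / 2" and L0: "L \<ge> 0"
  obtains U where "continuous_on UNIV U"
    "\<And>t s. \<bar>t - t0\<bar> \<le> \<delta> \<Longrightarrow> \<bar>s - y0\<bar> \<le> r \<Longrightarrow>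
       U (t, s) = s + (t - t0) * integral {0..1} (\<lambda>\<theta>. F (t0 + \<theta> * (t - t0), U (t0 + \<theta> * (t - t0), s)))"
proof -
  \<comment> \<open>The time displacement is clipped, so that the operator below acts on functions
    on the whole plane.\<close>
  define \<tau> where "\<tau> = (\<lambda>t. clip t0 \<delta> t - t0)"
  have \<tau>: "\<bar>\<tau> t\<bar> \<le> \<delta>" for t using clip_range[of \<delta> t0 t] \<delta>(1) by (simp add: \<tau>_def)
  have \<tau>c: "continuous_on S (\<lambda>x. \<tau> (f x))" if "continuous_on S f" for S and f :: "(real \<times> real) \<times> real \<Rightarrow>
      real"
    unfolding \<tau>_def by (intro continuous_intros that)
  have \<tau>c': "continuous_on S (\<lambda>x. \<tau> (f x))" if "continuous_on S f" for S and f :: "real \<times> real \<Rightarrow> real"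
    unfolding \<tau>_def by (intro continuous_intros that)
  \<comment> \<open>Clipping the initial value makes \<open>P u\<close> bounded. The radius is
    \<open>\<bar>r\<bar>\<close> because r carries no sign condition.\<close>
  define P where "P = (\<lambda>u p. clip y0 \<bar>r\<bar> (snd p) + \<tau> (fst p) *
     integral {0..1} (\<lambda>\<theta>. F (t0 + \<theta> * \<tau> (fst p), u (t0 + \<theta> * \<tau> (fst p), snd p))))"
  have cu: "continuous_on UNIV (\<lambda>(p, \<theta>). F (t0 + \<theta> * \<tau> (fst p), u (t0 + \<theta> * \<tau> (fst p), snd p)))"
    if u: "continuous_on UNIV u" for u :: "real \<times> real \<Rightarrow> real"
    unfolding split_beta
    by (intro continuous_on_compose2[OF F] continuous_intros \<tau>c continuous_on_compose2[OF u]) auto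
  have cu': "continuous_on {0..1} (\<lambda>\<theta>. F (t0 + \<theta> * \<tau> (fst p), u (t0 + \<theta> * \<tau> (fst p), snd p)))"
    if u: "continuous_on UNIV u" for u :: "real \<times> real \<Rightarrow> real" and p
    by (rule continuous_on_compose2[OF cu[OF u], of _ "\<lambda>\<theta>. (p, \<theta>)", simplified]) (intro continuous_intros)
  have Pc: "P u \<in> bcontfun" if u: "continuous_on UNIV u" for u
  proof (rule bcontfun_normI)
    have "continuous_on UNIV (\<lambda>p. integral (cbox 0 1) (\<lambda>\<theta>. F (t0 + \<theta> * \<tau> (fst p), u (t0 + \<theta> * \<tau> (fst p),
        snd p))))"
      by (rule integral_continuous_on_param) (use cu[OF u] in \<open>auto elim: continuous_on_subset\<close>)
    then show "continuous_on UNIV (P u)"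
      unfolding P_def by (intro continuous_intros \<tau>c') simp_all
    fix p
    have "\<bar>integral {0..1} (\<lambda>\<theta>. F (t0 + \<theta> * \<tau> (fst p), u (t0 + \<theta> * \<tau> (fst p), snd p)))\<bar> \<le> M"
      using integral_bound[OF _ cu'[OF u, of p], of M] M by simp
    then have "\<bar>\<tau> (fst p) * integral {0..1} (\<lambda>\<theta>. F (t0 + \<theta> * \<tau> (fst p), u (t0 + \<theta> * \<tau> (fst p), snd p)))\<bar>
        \<le> \<delta> * M"
      unfolding abs_mult using \<tau> \<delta>(1) by (intro mult_mono) auto
    then show "norm (P u p) \<le> \<bar>y0\<bar> + \<bar>r\<bar> + \<delta> * M"
      using clip_range[of "\<bar>r\<bar>" y0 "snd p"] by (simp add: P_def)
  qed
  define Q where "Q = (\<lambda>u. Bcontfun (P (apply_bcontfun u)))"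
  have Q: "apply_bcontfun (Q u) = P (apply_bcontfun u)" for u
    unfolding Q_def by (rule Bcontfun_inverse[OF Pc]) auto
  \<comment> \<open>The contraction factor is \<delta> * L, at most 1/2.\<close>
  have "dist (Q u) (Q v) \<le> 1 / 2 * dist u v" for u v
  proof (rule dist_bound)
    fix p :: "real \<times> real"
    let ?I = "\<lambda>u \<theta>. F (t0 + \<theta> * \<tau> (fst p), apply_bcontfun u (t0 + \<theta> * \<tau> (fst p), snd p))"
    have c: "continuous_on {0..1} (?I u)" "continuous_on {0..1} (?I v)"
      by (rule cu'; simp)+
    have "\<bar>?I u \<theta> - ?I v \<theta>\<bar> \<le> L * dist u v" for \<theta>
    proof -
      have "\<bar>?I u \<theta> - ?I v \<theta>\<bar> \<le> L * \<bar>apply_bcontfun u (t0 + \<theta> * \<tau> (fst p), snd p) - apply_bcontfun v (t0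
          + \<theta> * \<tau> (fst p), snd p)\<bar>"
        by (rule L)
      also have "\<dots> \<le> L * dist u v"
        using dist_bounded[of u _ v] L0 by (intro mult_left_mono) (auto simp: dist_real_def)
      finally show ?thesis .
    qed
    then have "\<bar>integral {0..1} (\<lambda>\<theta>. ?I u \<theta> - ?I v \<theta>)\<bar> \<le> L * dist u v"
      using integral_bound[OF _ continuous_on_diff[OF c], of "L * dist u v"] by simp
    moreover have "integral {0..1} (\<lambda>\<theta>. ?I u \<theta> - ?I v \<theta>) = integral {0..1} (?I u) - integral {0..1} (?I v)"
      by (intro integral_diff integrable_continuous_real c)
    ultimately have "\<bar>\<tau> (fst p) * (integral {0..1} (?I u) - integral {0..1} (?I v))\<bar> \<le> \<delta> * (L * dist u v)"
      unfolding abs_mult using \<tau> \<delta>(1) by (intro mult_mono) auto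
    also have "\<dots> \<le> 1 / 2 * dist u v"
      using \<delta>(2) by (simp only: mult.assoc[symmetric]) (intro mult_right_mono; simp)
    finally show "dist (apply_bcontfun (Q u) p) (apply_bcontfun (Q v) p) \<le> 1 / 2 * dist u v"
      by (simp add: Q P_def dist_real_def algebra_simps)
  qed
  then obtain u where u: "Q u = u"
    using banach_fix_type[of "1/2" Q] by auto
  show ?thesis
  proof (rule that[of "apply_bcontfun u"])
    show "continuous_on UNIV (apply_bcontfun u)" by simp
    fix t s assume "\<bar>t - t0\<bar> \<le> \<delta>" "\<bar>s - y0\<bar> \<le> r"
    moreover have "apply_bcontfun u (t, s) = P (apply_bcontfun u) (t, s)" using Q[of u] u by simp
    ultimately show "apply_bcontfun u (t, s) = s + (t - t0) * integral {0..1} (\<lambda>\<theta>. F (t0 + \<theta> * (t - t0),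
        apply_bcontfun u (t0 + \<theta> * (t - t0), s)))"
      by (simp add: P_def \<tau>_def clip_id)
  qed
qed

section \<open>Smooth dependence of the solution on time and initial value\<close>

lemma Ck_on_Pair:
  assumes "open S" "Ck_on n f S" "Ck_on n g S"
  shows "Ck_on n (\<lambda>x. (f x, g x)) S"
proof -
  have "Ck_on n (\<lambda>x. (f x, 0) + (0, g x)) S"
    by (intro Ck_on_add Ck_on_linear_compose[of "\<lambda>y. (y, 0)"] Ck_on_linear_compose[of "\<lambda>y. (0, y)"] assms
        bounded_linear_Pair bounded_linear_ident bounded_linear_zero)
  then show ?thesis by simp
qed

text
  \<open>Difference quotients of solutions solve a linear equation, so they are exponentials of an integral; this gives the first derivative in the initial value, and higher ones by induction.\<close>

lemma smooth_scalar_flow: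
  fixes F :: "real \<times> real \<Rightarrow> real"
  assumes S: "open S" and F: "smooth_on F S" and p0: "(t0, y0) \<in> S"
  obtains \<delta> r U E where "\<delta> > 0" "r > 0" "smooth_on U ({t0 - \<delta><..<t0 + \<delta>} \<times> {y0 - r<..<y0 + r})"
    "\<And>t s. \<bar>t - t0\<bar> < \<delta> \<Longrightarrow> \<bar>s - y0\<bar> < r \<Longrightarrow> (t, U (t, s)) \<in> S"
    "\<And>t s. \<bar>t - t0\<bar> < \<delta> \<Longrightarrow> \<bar>s - y0\<bar> < r \<Longrightarrow>
       (U has_derivative (\<lambda>v. fst v * F (t, U (t, s)) + snd v * E (t, s))) (at (t, s))"
    "\<And>p. E p > (0::real)" "\<And>s. \<bar>s - y0\<bar> < r \<Longrightarrow> U (t0, s) = s"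
proof -
  obtain e where e: "e > 0" "ball (t0, y0) e \<subseteq> S" using S p0 open_contains_ball by blast
  \<comment> \<open>The rectangle \<open>K\<close> has half-widths a and 2 * a, and a + 2 * a < e
    keeps it inside the ball.\<close>
  define a where "a = e / 4"
  define K where "K = {t0 - a..t0 + a} \<times> {y0 - 2 * a..y0 + 2 * a}"
  have a: "a > 0" using e by (simp add: a_def)
  have KS: "K \<subseteq> S"
  proof
    fix p assume "p \<in> K"
    then obtain t y where p: "p = (t, y)" "\<bar>t - t0\<bar> \<le> a" "\<bar>y - y0\<bar> \<le> 2 * a"
      by (cases p) (auto simp: K_def abs_le_iff)
    have "dist (t0, y0) p \<le> \<bar>t - t0\<bar> + \<bar>y - y0\<bar>"
      using norm_Pair_le[of "t0 - t" "y0 - y"] by (simp add: p dist_norm abs_minus_commute)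
    also have "\<dots> < e" using p a by (simp add: a_def)
    finally show "p \<in> S" using e(2) by auto
  qed
  have K: "compact K" unfolding K_def by (intro compact_Times compact_Icc)
  define F2 where "F2 = (\<lambda>p. frechet_derivative F (at p) (0, 1))"
  have sF2: "smooth_on F2 S" unfolding F2_def by (rule smooth_on_frechet[OF F])
  have cF: "continuous_on K F" "continuous_on K F2"
    using smooth_on_continuous[OF F] smooth_on_continuous[OF sF2] KS by (auto intro: continuous_on_subset)
  obtain M where M: "\<And>p. p \<in> K \<Longrightarrow> \<bar>F p\<bar> \<le> M" "M \<ge> 0"
    using compact_imp_bounded[OF compact_continuous_image[OF cF(1) K]]
    by (auto simp: bounded_iff) (metis abs_ge_zero order.trans a K_def)
  obtain L where L: "\<And>p. p \<in> K \<Longrightarrow> \<bar>F2 p\<bar> \<le> L" "L \<ge> 0"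
    using compact_imp_bounded[OF compact_continuous_image[OF cF(2) K]]
    by (auto simp: bounded_iff) (metis abs_ge_zero order.trans a K_def)
  have F2: "((\<lambda>y. F (t, y)) has_real_derivative F2 (t, y)) (at y within X)" if "(t, y) \<in> S" for t y X
  proof -
    have D: "(F has_derivative frechet_derivative F (at (t, y))) (at (t, y))"
      by (rule smooth_on_has_derivative[OF S F that])
    have "((\<lambda>y. (t, y)) has_derivative (\<lambda>h. (0, h))) (at y within X)" by (auto intro!: derivative_eq_intros)
    from has_derivative_compose[OF this D]
    have "((\<lambda>y. F (t, y)) has_derivative (\<lambda>h. frechet_derivative F (at (t, y)) (0, h))) (at y within X)" .
    moreover have "frechet_derivative F (at (t, y)) (0, h) = F2 (t, y) * h" for h
      using linear_scale[OF has_derivative_linear[OF D], of h "(0, 1)"] by (simp add: F2_def)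
    ultimately show ?thesis by (simp add: has_field_derivative_def)
  qed
  \<comment> \<open>Projection onto \<open>K\<close>. The equation with right-hand side F(cl p) is
    globally Lipschitz and bounded, and it agrees with the original one as long as the solution
    stays in \<open>K\<close>.\<close>
  define cl where "cl = (\<lambda>p :: real \<times> real. (clip t0 a (fst p), clip y0 (2 * a) (snd p)))"
  have clK: "cl p \<in> K" for p
    using clip_range[of a t0 "fst p"] clip_range[of "2 * a" y0 "snd p"] a by (auto simp: cl_def K_def
        abs_le_iff)
  have cl_id: "cl (t, y) = (t, y)" if "\<bar>t - t0\<bar> \<le> a" "\<bar>y - y0\<bar> \<le> 2 * a" for t y
    using that by (simp add: cl_def clip_id)
  have inK: "(t, y) \<in> K" if "\<bar>t - t0\<bar> \<le> a" "\<bar>y - y0\<bar> \<le> 2 * a" for t y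
    using clK[of "(t, y)"] cl_id[OF that] by simp
  have ccl: "continuous_on X (\<lambda>x. cl (f x))" if "continuous_on X f" for X and f ::
      "'c::topological_space \<Rightarrow> real \<times> real"
    unfolding cl_def by (intro continuous_intros that)
  have cFt: "continuous_on X (\<lambda>x. F (cl (f x)))" "continuous_on X (\<lambda>x. F2 (cl (f x)))"
    if "continuous_on X f" for X and f :: "'c::topological_space \<Rightarrow> real \<times> real"
    by (rule continuous_on_compose2[OF cF(1) ccl[OF that]] continuous_on_compose2[OF cF(2) ccl[OF that]];
        simp add: image_subset_iff clK)+
  \<comment> \<open>The three bounds keep the time inside \<open>K\<close>, limit the displacement
    of a solution to a (so that starting within a of y0 it stays within 2 * a), and make the
    contraction factor at most 1/2. The summands 1 avoid division by zero.\<close>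
  define \<delta> where "\<delta> = min a (min (a / (M + 1)) (1 / (2 * (L + 1))))"
  have \<delta>: "\<delta> > 0" "\<delta> \<le> a" "\<delta> * M \<le> a" "\<delta> * L \<le> 1 / 2"
  proof -
    show "\<delta> > 0" "\<delta> \<le> a" using a M(2) L(2) by (auto simp: \<delta>_def)
    have "\<delta> * M \<le> a / (M + 1) * (M + 1)" using \<open>\<delta> > 0\<close> M(2) a by (intro mult_mono) (auto simp: \<delta>_def)
    then show "\<delta> * M \<le> a" using M(2) by simp
    have "\<delta> * L \<le> 1 / (2 * (L + 1)) * (L + 1)" using \<open>\<delta> > 0\<close> L(2) by (intro mult_mono) (auto simp: \<delta>_def)
    also have "\<dots> = 1 / 2" using L(2) by (simp add: field_simps)
    finally show "\<delta> * L \<le> 1 / 2" .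
  qed
  have lip: "\<bar>F (cl (t, y)) - F (cl (t, y'))\<bar> \<le> L * \<bar>y - y'\<bar>" for t y y'
  proof -
    let ?J = "{y0 - 2 * a..y0 + 2 * a}"
    have "norm (F (clip t0 a t, clip y0 (2 * a) y) - F (clip t0 a t, clip y0 (2 * a) y')) \<le>
        L * norm (clip y0 (2 * a) y - clip y0 (2 * a) y')"
    proof (rule field_differentiable_bound[of ?J "\<lambda>y. F (clip t0 a t, y)" "\<lambda>y. F2 (clip t0 a t, y)"])
      fix z assume "z \<in> ?J"
      then have zK: "(clip t0 a t, z) \<in> K" using clK[of "(t, z)"] by (auto simp: K_def cl_def)
      show "((\<lambda>y. F (clip t0 a t, y)) has_real_derivative F2 (clip t0 a t, z)) (at z within ?J)"
        by (rule F2) (use zK KS in auto)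
      show "norm (F2 (clip t0 a t, z)) \<le> L" using L(1)[OF zK] by simp
    qed (use clK[of "(t, y)"] clK[of "(t, y')"] in \<open>auto simp: K_def cl_def\<close>)
    also have "\<dots> \<le> L * \<bar>y - y'\<bar>" using clip_lipschitz[of y0 "2 * a" y y'] L(2) by (simp add: mult_left_mono)
    finally show ?thesis by (simp add: cl_def)
  qed
  obtain U where cU: "continuous_on UNIV U" and U: "\<And>t s. \<bar>t - t0\<bar> \<le> \<delta> \<Longrightarrow> \<bar>s - y0\<bar> \<le> a \<Longrightarrow>
       U (t, s) = s + (t - t0) * integral {0..1} (\<lambda>\<theta>. F (cl (t0 + \<theta> * (t - t0), U (t0 + \<theta> * (t - t0), s))))"
    using lipschitz_ode_solution[of "\<lambda>p. F (cl p)" M L \<delta> t0 y0 a, OF cFt(1)[OF continuous_on_id] M(1)[OF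
        clK] lip \<delta>(1,4) L(2)]
    by blast
  have cU': "continuous_on X (\<lambda>x. U (f x))" if "continuous_on X f" for X and f :: "'c::topological_space
      \<Rightarrow> real \<times> real"
    by (rule continuous_on_compose2[OF cU that]) auto
  have U0: "U (t0, s) = s" if "\<bar>s - y0\<bar> \<le> a" for s using U[of t0 s] that \<delta>(1) by simp
  have UJ: "\<bar>U (t, s) - y0\<bar> \<le> 2 * a" if "\<bar>t - t0\<bar> \<le> \<delta>" "\<bar>s - y0\<bar> \<le> a" for t s
  proof -
    have "\<bar>integral {0..1} (\<lambda>\<theta>. F (cl (t0 + \<theta> * (t - t0), U (t0 + \<theta> * (t - t0), s))))\<bar> \<le> M"
      using integral_bound[of 0 1 "\<lambda>\<theta>. F (cl (t0 + \<theta> * (t - t0), U (t0 + \<theta> * (t - t0), s)))" M]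
        M(1)[OF clK] by (simp add: cFt cU' continuous_intros)
    then have "\<bar>U (t, s) - s\<bar> \<le> \<delta> * M"
      unfolding U[OF that] using that(1) \<delta>(1) by (simp add: abs_mult mult_mono)
    then show ?thesis using \<delta>(3) that(2) by linarith
  qed
  have Ucl: "cl (t, U (t, s)) = (t, U (t, s))" "(t, U (t, s)) \<in> S" if "\<bar>t - t0\<bar> \<le> \<delta>" "\<bar>s - y0\<bar> \<le> a" for t s
    using cl_id[OF _ UJ[OF that]] inK[OF _ UJ[OF that]] KS that(1) \<delta>(2) by auto
  have Ut: "((\<lambda>t. U (t, s)) has_real_derivative F (t, U (t, s))) (at t)" if t: "\<bar>t - t0\<bar> < \<delta>" and s: "\<bar>s
      - y0\<bar> \<le> a" for t s
  proof -
    have "((\<lambda>t. (t - t0) * integral {0..1} (\<lambda>\<theta>. F (cl (t0 + \<theta> * (t - t0), U (t0 + \<theta> * (t - t0), s)))))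
        has_real_derivative F (cl (t, U (t, s)))) (at t)"
      by (rule mean_integral_has_derivative[OF _ t]) (intro cFt cU' continuous_intros)
    from DERIV_add[OF DERIV_const[of s] this]
    have "((\<lambda>t. s + (t - t0) * integral {0..1} (\<lambda>\<theta>. F (cl (t0 + \<theta> * (t - t0), U (t0 + \<theta> * (t - t0), s)))))
        has_real_derivative F (t, U (t, s))) (at t)"
      using Ucl(1)[of t s] t s by simp
    then show ?thesis
      by (rule has_field_derivative_transform_within_open[of _ _ _ "{t0 - \<delta><..<t0 + \<delta>}"])
         (use t in \<open>auto simp: abs_less_iff intro!: U[symmetric] s\<close>)
  qed
  \<comment> \<open>The mean of the y-derivative of F over a segment; it turns a difference F(t,x) -
    F(t,y) into (x - y) * H(t,x,y), also when x = y.\<close>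
  define H where "H = (\<lambda>t x y. integral {0..1} (\<lambda>\<theta>. F2 (cl (t, y + \<theta> * (x - y)))))"
  have cH: "continuous_on X (\<lambda>z. H (f z) (g z) (h z))"
    if "continuous_on X f" "continuous_on X g" "continuous_on X h" for X and f g h :: "real \<Rightarrow> real"
  proof -
    have "continuous_on UNIV (\<lambda>q :: real \<times> real \<times> real. integral (cbox 0 1) (\<lambda>\<theta>. F2 (cl (fst q, snd (snd
        q) + \<theta> * (fst (snd q) - snd (snd q))))))"
      by (rule integral_continuous_on_param) (unfold split_beta, intro cFt continuous_intros)
    then have "continuous_on UNIV (\<lambda>q. H (fst q) (fst (snd q)) (snd (snd q)))"
      by (simp add: H_def)
    from continuous_on_compose2[OF this, of X "\<lambda>z. (f z, g z, h z)"] that show ?thesis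
      by (simp add: continuous_on_Pair)
  qed
  have cH2: "continuous_on X (\<lambda>z. H (f z) (g z) (h z))"
    if "continuous_on X f" "continuous_on X g" "continuous_on X h" for X and f g h :: "real \<times> real \<Rightarrow> real"
  proof -
    have "continuous_on UNIV (\<lambda>q :: real \<times> real \<times> real. integral (cbox 0 1) (\<lambda>\<theta>. F2 (cl (fst q, snd (snd
        q) + \<theta> * (fst (snd q) - snd (snd q))))))"
      by (rule integral_continuous_on_param) (unfold split_beta, intro cFt continuous_intros)
    then have "continuous_on UNIV (\<lambda>q. H (fst q) (fst (snd q)) (snd (snd q)))"
      by (simp add: H_def)
    from continuous_on_compose2[OF this, of X "\<lambda>z. (f z, g z, h z)"] that show ?thesis
      by (simp add: continuous_on_Pair)
  qed
  have H: "F (t, x) - F (t, y) = (x - y) * H t x y" if t: "\<bar>t - t0\<bar> \<le> a" and x: "\<bar>x - y0\<bar> \<le> 2 * a" and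
      y: "\<bar>y - y0\<bar> \<le> 2 * a" for t x y
  proof -
    have seg: "\<bar>y + \<theta> * (x - y) - y0\<bar> \<le> 2 * a" if "\<theta> \<in> {0..1}" for \<theta>
    proof -
      have "y + \<theta> * (x - y) - y0 = (1 - \<theta>) * (y - y0) + \<theta> * (x - y0)" by (simp add: algebra_simps)
      also have "\<bar>\<dots>\<bar> \<le> (1 - \<theta>) * \<bar>y - y0\<bar> + \<theta> * \<bar>x - y0\<bar>"
        using that by (intro order.trans[OF abs_triangle_ineq]) (simp add: abs_mult)
      also have "\<dots> \<le> (1 - \<theta>) * (2 * a) + \<theta> * (2 * a)"
        using that x y by (intro add_mono mult_left_mono) auto
      finally show ?thesis by (simp add: algebra_simps)
    qed
    have "((\<lambda>\<theta>. F (t, y + \<theta> * (x - y))) has_vector_derivative (x - y) * F2 (cl (t, y + \<theta> * (x - y))))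
        (at \<theta> within {0..1})"
      if th: "\<theta> \<in> {0..1}" for \<theta>
    proof -
      have "((\<lambda>y. F (t, y)) has_real_derivative F2 (t, y + \<theta> * (x - y))) (at (y + \<theta> * (x - y)))"
        by (rule F2) (use inK[OF t seg[OF th]] KS in auto)
      moreover have "((\<lambda>\<theta>. y + \<theta> * (x - y)) has_real_derivative (x - y)) (at \<theta> within {0..1})"
        by (auto intro!: derivative_eq_intros)
      ultimately have "((\<lambda>\<theta>. F (t, y + \<theta> * (x - y))) has_real_derivative F2 (t, y + \<theta> * (x - y)) * (x -
          y)) (at \<theta> within {0..1})"
        by (rule DERIV_chain2)
      then show ?thesis
        unfolding has_real_derivative_iff_has_vector_derivative[symmetric] cl_id[OF t seg[OF th]] by
            (simp add: mult.commute)
    qed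
    then have "((\<lambda>\<theta>. (x - y) * F2 (cl (t, y + \<theta> * (x - y)))) has_integral F (t, y + 1 * (x - y)) - F (t,
        y + 0 * (x - y))) {0..1}"
      by (intro fundamental_theorem_of_calculus) auto
    from integral_unique[OF this] show ?thesis by (simp add: H_def)
  qed
  \<comment> \<open>The difference of two solutions solves w' = H * w, whose solution with initial
    value s' - s is explicit. \<open>Q\<close> is therefore the difference quotient in the initial
    value, and it is defined for s' = s too.\<close>
  define Q where "Q = (\<lambda>t s s'. exp ((t - t0) * integral {0..1} (\<lambda>\<theta>. H (t0 + \<theta> * (t - t0)) (U (t0 + \<theta> *
      (t - t0), s')) (U (t0 + \<theta> * (t - t0), s)))))"
  have Q: "U (t, s') - U (t, s) = (s' - s) * Q t s s'" if t: "\<bar>t - t0\<bar> < \<delta>" and s: "\<bar>s - y0\<bar> \<le> a" "\<bar>s' -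
      y0\<bar> \<le> a" for t s s'
  proof -
    define N where "N = (\<lambda>t. (t - t0) * integral {0..1} (\<lambda>\<theta>. H (t0 + \<theta> * (t - t0)) (U (t0 + \<theta> * (t -
        t0), s')) (U (t0 + \<theta> * (t - t0), s))))"
    let ?I = "{t0 - \<delta><..<t0 + \<delta>}"
    \<comment> \<open>Integrating factor: the product is constant in t, and its value at t0 is s' -
      s.\<close>
    have "((\<lambda>t. (U (t, s') - U (t, s)) * exp (- N t)) has_real_derivative 0) (at t within ?I)" if "t \<in>
        ?I" for t
    proof -
      have t: "\<bar>t - t0\<bar> < \<delta>" using that by (auto simp: abs_less_iff)
      have N': "(N has_real_derivative H t (U (t, s')) (U (t, s))) (at t)"
        unfolding N_def by (rule mean_integral_has_derivative[OF _ t]) (intro cH cU' continuous_intros)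
      have "F (t, U (t, s')) - F (t, U (t, s)) = (U (t, s') - U (t, s)) * H t (U (t, s')) (U (t, s))"
        by (rule H) (use UJ t s \<delta>(2) in auto)
      then have "exp (- N t) * (F (t, U (t, s')) - F (t, U (t, s))) = exp (- N t) * ((U (t, s') - U (t,
          s)) * H t (U (t, s')) (U (t, s)))"
        by (rule arg_cong)
      then have "((\<lambda>t. (U (t, s') - U (t, s)) * exp (- N t)) has_real_derivative 0) (at t)"
        by (auto intro!: derivative_eq_intros Ut[OF t] N' s simp: algebra_simps)
      then show ?thesis by (rule has_field_derivative_at_within)
    qed
    then have "\<exists>c. \<forall>x\<in>?I. (U (x, s') - U (x, s)) * exp (- N x) = c"
      by (intro has_field_derivative_zero_constant convex_real_interval)
    then obtain c where c: "\<And>x. x \<in> ?I \<Longrightarrow> (U (x, s') - U (x, s)) * exp (- N x) = c" by blast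
    have "(U (t, s') - U (t, s)) * exp (- N t) = s' - s"
      using c[of t] c[of t0] t \<delta>(1) U0 s by (auto simp: abs_less_iff N_def)
    then have "(U (t, s') - U (t, s)) * (exp (- N t) * exp (N t)) = (s' - s) * exp (N t)"
      by (simp add: mult.assoc[symmetric])
    then show ?thesis by (simp add: Q_def N_def exp_minus)
  qed
  \<comment> \<open>The value of \<open>Q\<close> at s' = s, where \<open>H\<close> reduces to the
    y-derivative of F. Being an exponential, it is positive.\<close>
  define E where "E = (\<lambda>p. exp ((fst p - t0) * integral {0..1} (\<lambda>\<theta>. F2 (cl (t0 + \<theta> * (fst p - t0), U (t0
      + \<theta> * (fst p - t0), snd p))))))"
  have cE: "continuous_on UNIV E"
  proof -
    have "continuous_on UNIV (\<lambda>p :: real \<times> real. integral (cbox 0 1) (\<lambda>\<theta>. F2 (cl (t0 + \<theta> * (fst p - t0),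
        U (t0 + \<theta> * (fst p - t0), snd p)))))"
      by (rule integral_continuous_on_param) (unfold split_beta, intro cFt cU' continuous_intros)
    then show ?thesis unfolding E_def by (intro continuous_intros) simp_all
  qed
  have Us: "((\<lambda>s. U (t, s)) has_real_derivative E (t, s)) (at s)" if t: "\<bar>t - t0\<bar> < \<delta>" and s: "\<bar>s - y0\<bar>
      < a" for t s
  proof -
    have "continuous_on UNIV (\<lambda>s'. integral (cbox 0 1) (\<lambda>\<theta>. H (t0 + \<theta> * (t - t0)) (U (t0 + \<theta> * (t - t0),
        s')) (U (t0 + \<theta> * (t - t0), s))))"
      by (rule integral_continuous_on_param) (unfold split_beta, intro cH2 cU' continuous_intros)
    then have "continuous_on UNIV (Q t s)" unfolding Q_def by (intro continuous_intros) simp_all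
    \<comment> \<open>Caratheodory's criterion: U(t,s') - U(t,s) = (s' - s) * Q with
      \<open>Q\<close> continuous at s gives the derivative.\<close>
    then have "isCont (Q t s) s" by (simp add: continuous_on_eq_continuous_at)
    moreover have "Q t s s = E (t, s)" by (simp add: Q_def E_def H_def)
    ultimately have "((\<lambda>s'. U (t, s) + (s' - s) * Q t s s') has_real_derivative E (t, s)) (at s)"
      unfolding CARAT_DERIV by (intro exI[of _ "Q t s"]) simp
    then show ?thesis
    proof (rule has_field_derivative_transform_within_open)
      show "open {y0 - a<..<y0 + a}" "s \<in> {y0 - a<..<y0 + a}" using s by (auto simp: abs_less_iff)
      fix s' assume "s' \<in> {y0 - a<..<y0 + a}"
      then have "\<bar>s' - y0\<bar> \<le> a" by (auto simp: abs_le_iff)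
      with Q[OF t _ this, of s] s show "U (t, s) + (s' - s) * Q t s s' = U (t, s')" by simp
    qed
  qed
  let ?I = "{t0 - \<delta><..<t0 + \<delta>}" and ?J = "{y0 - a<..<y0 + a}"
  have B: "open (?I \<times> ?J)" by (intro open_Times) auto
  have DU: "(U has_derivative (\<lambda>v. fst v * F (t, U (t, s)) + snd v * E (t, s))) (at (t, s))"
    if t: "\<bar>t - t0\<bar> < \<delta>" and s: "\<bar>s - y0\<bar> < a" for t s
  proof -
    have ts: "t \<in> ?I" "s \<in> ?J" using t s by (auto simp: abs_less_iff)
    have "((\<lambda>(t, s). U (t, s)) has_derivative (\<lambda>(x, y). x * F (t, U (t, s)) + blinfun_apply
        (blinfun_scaleR_left (E (t, s))) y)) (at (t, s) within ?I \<times> ?J)"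
    \<comment> \<open>Continuity of one partial derivative, here that in the initial value, suffices
      for total differentiability.\<close>
    proof (rule has_derivative_partialsI)
      show "((\<lambda>t. U (t, s)) has_derivative (\<lambda>x. x * F (t, U (t, s)))) (at t within ?I)"
        using Ut[OF t, of s] s by (simp add: has_field_derivative_def mult.commute[of _ "F _"]
            has_derivative_at_withinI)
      show "((\<lambda>y. U (x, y)) has_derivative blinfun_apply (blinfun_scaleR_left (E (x, y)))) (at y within ?J)"
        if "x \<in> ?I" "y \<in> ?J" for x y
      proof -
        have "((\<lambda>y. U (x, y)) has_derivative (*) (E (x, y))) (at y)"
          using Us[of x y] that by (auto simp: has_field_derivative_def abs_less_iff)
        moreover have "blinfun_apply (blinfun_scaleR_left (E (x, y))) = (*) (E (x, y))"
          by (auto simp: fun_eq_iff mult.commute)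
        ultimately show ?thesis by (simp add: has_derivative_at_withinI)
      qed
      have "continuous_on UNIV (\<lambda>p. blinfun_scaleR_left (E p))"
        by (rule bounded_linear.continuous_on[OF bounded_linear_blinfun_scaleR_left cE])
      then have "continuous_on UNIV (\<lambda>(x, y). blinfun_scaleR_left (E (x, y)))" by (simp add: split_beta)
      then show "continuous (at (t, s) within ?I \<times> ?J) (\<lambda>(x, y). blinfun_scaleR_left (E (x, y)))"
        using continuous_on_eq_continuous_at[OF open_UNIV] continuous_at_imp_continuous_at_within by blast
    qed (use ts in auto)
    then show ?thesis
      using at_within_open[OF _ B, of "(t, s)"] ts by (simp add: case_prod_unfold)
  qed
  have "Ck_on n U (?I \<times> ?J)" for n
  proof (induction n)
    case 0
    then show ?case using cU by (auto intro: continuous_on_subset)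
  next
    case (Suc n)
    have CF: "Ck_on n (\<lambda>p. F (fst p, U p)) (?I \<times> ?J)"
    proof (rule Ck_on_compose[OF B S _ Ck_on_Pair[OF B] smooth_on_Ck[OF F]])
      show "(\<lambda>p. (fst p, U p)) ` (?I \<times> ?J) \<subseteq> S" using Ucl(2) by (auto simp: abs_le_iff)
    qed (auto intro: Suc Ck_on_bounded_linear bounded_linear_fst)
    have CE: "Ck_on n E (?I \<times> ?J)"
    \<comment> \<open>The integral defining \<open>E\<close> must extend over an open set of
      \<theta> containing the interval from 0 to 1. The points t0 + \<theta> * (t - t0) then leave
      the time interval unless t is kept away from its ends, so the argument is local.\<close>
    proof (rule Ck_on_local[OF B])
      fix p assume p: "p \<in> ?I \<times> ?J"
      then have "\<bar>fst p - t0\<bar> < \<delta>" by (auto simp: abs_less_iff)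
      then obtain \<rho> where \<rho>: "\<bar>fst p - t0\<bar> < \<rho>" "\<rho> < \<delta>" using dense by blast
      then have \<rho>0: "\<rho> > 0" by linarith
      define N where "N = {t0 - \<rho><..<t0 + \<rho>} \<times> ?J"
      \<comment> \<open>For |t - t0| < \<rho> and |\<theta>| < \<delta> / \<rho> the scaled time
        stays within \<delta> of t0; since \<delta> / \<rho> > 1 this set contains 0 and 1.\<close>
      define W where "W = {- (\<delta> / \<rho> - 1)<..<\<delta> / \<rho>}"
      have N: "open N" "p \<in> N" "N \<subseteq> ?I \<times> ?J" using p \<rho> by (auto simp: N_def intro!: open_Times)
      have "\<delta> / \<rho> > 1" using \<rho> \<rho>0 by simp
      then have W: "open W" "{0..1} \<subseteq> W" by (auto simp: W_def)
      have NW: "open (N \<times> W)" using N W by (intro open_Times)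
      have sh: "(t0 + \<theta> * (fst q - t0), snd q) \<in> ?I \<times> ?J" if "q \<in> N" "\<theta> \<in> W" for q \<theta>
      proof -
        have "\<bar>\<theta>\<bar> \<le> \<delta> / \<rho>" using that(2) by (auto simp: W_def)
        moreover have "\<bar>fst q - t0\<bar> < \<rho>" using that(1) by (auto simp: N_def abs_less_iff)
        ultimately have "\<bar>\<theta> * (fst q - t0)\<bar> < \<delta> / \<rho> * \<rho>"
          unfolding abs_mult using \<delta>(1) \<rho>0
          by (intro le_less_trans[OF mult_right_mono mult_strict_left_mono]) auto
        then show ?thesis using that(1) \<rho>0 by (auto simp: N_def abs_less_iff)
      qed
      have C1: "Ck_on n (\<lambda>x :: (real \<times> real) \<times> real. t0 + snd x * (fst (fst x) - t0)) (N \<times> W)"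
        by (intro Ck_on_add Ck_on_mult Ck_on_diff Ck_on_const NW Ck_on_bounded_linear bounded_linear_snd
            bounded_linear_compose[OF bounded_linear_fst bounded_linear_fst])
      have C2: "Ck_on n (\<lambda>x :: (real \<times> real) \<times> real. (t0 + snd x * (fst (fst x) - t0), snd (fst x))) (N
          \<times> W)"
        by (intro Ck_on_Pair C1 NW Ck_on_bounded_linear bounded_linear_compose[OF bounded_linear_snd
            bounded_linear_fst])
      have C3: "Ck_on n (\<lambda>x :: (real \<times> real) \<times> real. U (t0 + snd x * (fst (fst x) - t0), snd (fst x)))
          (N \<times> W)"
        by (rule Ck_on_compose[OF NW B _ C2 Suc]) (use sh in auto)
      have "Ck_on n (\<lambda>x. F2 (t0 + snd x * (fst (fst x) - t0), U (t0 + snd x * (fst (fst x) - t0), snd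
          (fst x)))) (N \<times> W)"
      proof (rule Ck_on_compose[OF NW S _ Ck_on_Pair[OF NW C1 C3] smooth_on_Ck[OF sF2]])
        show "(\<lambda>x. (t0 + snd x * (fst (fst x) - t0), U (t0 + snd x * (fst (fst x) - t0), snd (fst x))))
            ` (N \<times> W) \<subseteq> S"
        proof safe
          fix t s \<theta> assume "(t, s) \<in> N" "\<theta> \<in> W"
          from sh[OF this] show "(t0 + snd ((t, s), \<theta>) * (fst (fst ((t, s), \<theta>)) - t0), U (t0 + snd ((t,
              s), \<theta>) * (fst (fst ((t, s), \<theta>)) - t0), snd (fst ((t, s), \<theta>)))) \<in> S"
            by (intro Ucl(2)) (auto simp: abs_le_iff)
        qed
      qed
      from Ck_on_parametric_integral[OF N(1) W this]
      have C4: "Ck_on n (\<lambda>q. integral {0..1} (\<lambda>\<theta>. F2 (t0 + \<theta> * (fst q - t0), U (t0 + \<theta> * (fst q - t0),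
          snd q)))) N"
        by simp
      have C5: "Ck_on n (\<lambda>q :: real \<times> real. fst q - t0) N"
        by (intro Ck_on_diff Ck_on_const N(1) Ck_on_bounded_linear bounded_linear_fst)
      have "Ck_on n (\<lambda>q. exp ((fst q - t0) * integral {0..1} (\<lambda>\<theta>. F2 (t0 + \<theta> * (fst q - t0), U (t0 + \<theta> *
          (fst q - t0), snd q))))) N"
        by (rule Ck_on_compose[OF N(1) open_UNIV _ Ck_on_mult[OF N(1) C5 C4] Ck_on_exp]) simp
      moreover have "exp ((fst q - t0) * integral {0..1} (\<lambda>\<theta>. F2 (t0 + \<theta> * (fst q - t0), U (t0 + \<theta> *
          (fst q - t0), snd q)))) = E q"
        if "q \<in> N" for q
      proof -
        have "cl (t0 + \<theta> * (fst q - t0), U (t0 + \<theta> * (fst q - t0), snd q)) = (t0 + \<theta> * (fst q - t0), U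
            (t0 + \<theta> * (fst q - t0), snd q))"
          if "\<theta> \<in> {0..1}" for \<theta>
          by (rule Ucl(1)) (use sh[OF \<open>q \<in> N\<close>, of \<theta>] that W(2) in \<open>auto simp: abs_le_iff\<close>)
        then have "integral {0..1} (\<lambda>\<theta>. F2 (cl (t0 + \<theta> * (fst q - t0), U (t0 + \<theta> * (fst q - t0), snd q)))) =
            integral {0..1} (\<lambda>\<theta>. F2 (t0 + \<theta> * (fst q - t0), U (t0 + \<theta> * (fst q - t0), snd q)))"
          by (intro integral_cong) simp
        then show ?thesis by (simp only: E_def)
      qed
      ultimately have "Ck_on n E N" by (rule Ck_on_cong[OF N(1), THEN iffD1, rotated])
      then show "\<exists>T. open T \<and> p \<in> T \<and> T \<subseteq> ?I \<times> ?J \<and> Ck_on n E T" using N by blast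
    qed
    show ?case
    proof (rule Ck_on_SucI[OF B])
      fix p assume "p \<in> ?I \<times> ?J"
      then show "(U has_derivative (\<lambda>v. fst v * F (fst p, U p) + snd v * E p)) (at p)"
        by (cases p) (use DU[of "fst p" "snd p"] in \<open>simp add: abs_less_iff\<close>)
    next
      fix v :: "real \<times> real"
      show "Ck_on n (\<lambda>p. fst v * F (fst p, U p) + snd v * E p) (?I \<times> ?J)"
        by (intro Ck_on_add Ck_on_mult Ck_on_const CF CE B)
    qed
  qed
  then have "smooth_on U (?I \<times> ?J)" by (rule smooth_onI)
  moreover have "(t, U (t, s)) \<in> S" if "\<bar>t - t0\<bar> < \<delta>" "\<bar>s - y0\<bar> < a" for t s
    using Ucl(2)[of t s] that by simp
  moreover have "E p > 0" for p by (simp add: E_def)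
  moreover have "U (t0, s) = s" if "\<bar>s - y0\<bar> < a" for s using U0[of s] that by simp
  ultimately show ?thesis using that[OF \<delta>(1) a, of U E] DU by presburger
qed

section \<open>Normal form of a nilpotent field of endomorphisms of the plane\<close>

definition vec2 :: "real \<Rightarrow> real \<Rightarrow> real^2" where
  "vec2 a b = (\<chi> i. if i = 1 then a else b)"

lemma vec2_nth [simp]: "vec2 a b $ 1 = a" "vec2 a b $ 2 = b"
  by (simp_all add: vec2_def)

lemma vec2_eta [simp]: "vec2 (x $ 1) (x $ 2) = x"
  by (simp add: vec_eq_iff forall_2)

lemma bounded_linear_vec2: "bounded_linear (\<lambda>p. vec2 (fst p) (snd p))"
  by (rule linear_conv_bounded_linear[THEN iffD1], rule linearI) (simp_all add: vec_eq_iff forall_2)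

lemma bounded_linear_unvec2: "bounded_linear (\<lambda>x::real^2. (x $ 1, x $ 2))"
  by (intro bounded_linear_Pair bounded_linear_vec_nth)

lemma smooth_on_vec2:
  assumes "open S" "smooth_on f S" "smooth_on g S"
  shows "smooth_on (\<lambda>x. vec2 (f x) (g x)) S"
  by (simp add: smooth_on_vec_iff[OF assms(1)] forall_2 assms)

lemma pd_chain_2d:
  fixes \<Theta> :: "real^2 \<Rightarrow> real^2" and f :: "real^2 \<Rightarrow> real"
  assumes S: "open S" and \<Theta>: "smooth_on \<Theta> S" and z: "z \<in> S"
    and R: "open R" and f: "smooth_on f R" and zR: "\<Theta> z \<in> R"
  shows "pd j (\<lambda>x. f (\<Theta> x)) z = pd 1 f (\<Theta> z) * pd j (\<lambda>x. \<Theta> x $ 1) z + pd 2 f (\<Theta> z) * pd j (\<lambda>x. \<Theta> x $ 2) z"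
proof -
  have k: "smooth_on (\<lambda>x. \<Theta> x $ k) S" for k using \<Theta> smooth_on_vec_iff[OF S] by blast
  have "((\<lambda>x. \<chi> k. \<Theta> x $ k) has_derivative (\<lambda>v. \<chi> k. \<Sum>i\<in>UNIV. v $ i * pd i (\<lambda>x. \<Theta> x $ k) z)) (at z)"
    by (intro has_derivative_vec_lambda smooth_on_has_derivative_pd[OF S k z])
  then have d: "(\<Theta> has_derivative (\<lambda>v. \<chi> k. \<Sum>i\<in>UNIV. v $ i * pd i (\<lambda>x. \<Theta> x $ k) z)) (at z)" by simp
  have "((\<lambda>x. f (\<Theta> x)) has_derivative (\<lambda>v. \<Sum>i\<in>UNIV. (\<chi> k. \<Sum>i\<in>UNIV. v $ i * pd i (\<lambda>x. \<Theta> x $ k) z) $ i *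
      pd i f (\<Theta> z))) (at z)"
    by (rule has_derivative_compose[OF d smooth_on_has_derivative_pd[OF R f zR]])
  from pd_has_derivative[OF this, of j] show ?thesis
    using exhaust_2[of j] by (auto simp: sum_2 axis_def mult.commute)
qed

text \<open>The conclusion says that t is the tensor product of a vector a with the differential of
  the second component of \<Psi>, and that a is the first coordinate vector of \<Psi>; this is the
  normal form. The hypotheses \<open>tr\<close> and \<open>det\<close> express vanishing trace and
  determinant.\<close>

lemma nilpotent_coordinates_graph:
  fixes t :: "2 \<Rightarrow> 2 \<Rightarrow> real^2 \<Rightarrow> real"
  assumes V: "open V" and x0: "x0 \<in> V" and t: "\<And>r i. smooth_on (t r i) V"
    and tr: "\<And>x. x \<in> V \<Longrightarrow> t 2 2 x = - t 1 1 x"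
    and det: "\<And>x. x \<in> V \<Longrightarrow> t 1 2 x * t 2 1 x = - (t 1 1 x * t 1 1 x)"
    and nz: "t 1 2 x0 \<noteq> 0"
  obtains V' and \<Psi> :: "real^2 \<Rightarrow> real^2" where "open V'" "x0 \<in> V'" "V' \<subseteq> V" "smooth_on \<Psi> V'" "inj_on \<Psi>
      V'" "open (\<Psi> ` V')"
    "smooth_on (inv_into V' \<Psi>) (\<Psi> ` V')"
    "\<And>x. x \<in> V' \<Longrightarrow> \<exists>a :: real^2. (\<forall>r i. t r i x = a $ r * pd i (\<lambda>x. \<Psi> x $ 2) x) \<and>
       a $ 1 * pd 1 (\<lambda>x. \<Psi> x $ 1) x + a $ 2 * pd 2 (\<lambda>x. \<Psi> x $ 1) x = 1 \<and>
       a $ 1 * pd 1 (\<lambda>x. \<Psi> x $ 2) x + a $ 2 * pd 2 (\<lambda>x. \<Psi> x $ 2) x = 0"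
proof -
  let ?t0 = "x0 $ 1" and ?y0 = "x0 $ 2"
  define V0 where "V0 = V \<inter> t 1 2 -` (- {0})"
  have V0: "open V0" "V0 \<subseteq> V" "x0 \<in> V0" "\<And>x. x \<in> V0 \<Longrightarrow> t 1 2 x \<noteq> 0"
    using continuous_on_open_vimage[OF V, THEN iffD1, OF smooth_on_continuous[OF t], rule_format, of "-
        {0}" 1 2] x0 nz
    by (auto simp: V0_def Int_commute)
  have t0: "smooth_on (t r i) V0" for r i by (rule smooth_on_subset[OF t V0(2)])
  define S where "S = (\<lambda>p. vec2 (fst p) (snd p)) -` V0"
  \<comment> \<open>The slope of the kernel line, spanned by (t 1 2, - t 1 1); its integral curves
    are graphs over the first coordinate because t 1 2 does not vanish.\<close>
  define f where "f = (\<lambda>x. - t 1 1 x / t 1 2 x)"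
  have sf: "smooth_on f V0"
    unfolding f_def using smooth_on_divide[OF V0(1) smooth_on_diff[OF V0(1) smooth_on_const t0] t0
        V0(4), of 0 1 1] by simp
  have S: "open S"
    unfolding S_def by (rule open_vimage[OF V0(1)]) (rule linear_continuous_on[OF bounded_linear_vec2])
  have F: "smooth_on (\<lambda>p. f (vec2 (fst p) (snd p))) S"
    by (rule smooth_on_compose[OF S V0(1) _ smooth_on_bounded_linear[OF bounded_linear_vec2] sf]) (auto
        simp: S_def)
  have p0: "(?t0, ?y0) \<in> S" using V0(3) by (simp add: S_def)
  obtain \<delta> r U E where \<delta>: "\<delta> > 0" "r > 0" and sU: "smooth_on U ({?t0 - \<delta><..<?t0 + \<delta>} \<times> {?y0 - r<..<?y0 +
      r})"
    and US: "\<And>t s. \<bar>t - ?t0\<bar> < \<delta> \<Longrightarrow> \<bar>s - ?y0\<bar> < r \<Longrightarrow> (t, U (t, s)) \<in> S"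
    and DU: "\<And>t s. \<bar>t - ?t0\<bar> < \<delta> \<Longrightarrow> \<bar>s - ?y0\<bar> < r \<Longrightarrow>
       (U has_derivative (\<lambda>v. fst v * f (vec2 (fst (t, U (t, s))) (snd (t, U (t, s)))) + snd v * E (t,
           s))) (at (t, s))"
    and E: "\<And>p. E p > (0::real)" and U0: "\<And>s. \<bar>s - ?y0\<bar> < r \<Longrightarrow> U (?t0, s) = s"
    by (rule smooth_scalar_flow[OF S F p0]) (rule that; assumption)
  define B where "B = {x :: real^2. \<bar>x $ 1 - ?t0\<bar> < \<delta> \<and> \<bar>x $ 2 - ?y0\<bar> < r}"
  \<comment> \<open>Half the time range, so that multiplying the time displacement by any factor
    between -1 and 2 stays inside \<open>B\<close>.\<close>
  define B' where "B' = {x :: real^2. \<bar>x $ 1 - ?t0\<bar> < \<delta> / 2 \<and> \<bar>x $ 2 - ?y0\<bar> < r}"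
  have B: "open B" "open B'" "B' \<subseteq> B" "x0 \<in> B'"
    using \<delta> by (auto simp: B_def B'_def intro!: open_Collect_conj open_Collect_less continuous_intros)
  \<comment> \<open>Straightens the integral curves: the second argument labels the curve by its
    height at the time of x0, and the first is the position along it.\<close>
  define \<Theta> where "\<Theta> = (\<lambda>x :: real^2. vec2 (x $ 1) (U (x $ 1, x $ 2)))"
  have \<Theta>k: "(\<lambda>x. \<Theta> x $ 1) = (\<lambda>x. x $ 1)" "(\<lambda>x. \<Theta> x $ 2) = (\<lambda>x. U (x $ 1, x $ 2))"
    by (simp_all add: \<Theta>_def)
  have s\<Theta>2: "smooth_on (\<lambda>x::real^2. U (x $ 1, x $ 2)) B"
    by (rule smooth_on_compose[OF B(1) _ _ smooth_on_bounded_linear[OF bounded_linear_unvec2] sU])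
       (auto simp: B_def abs_less_iff intro!: open_Times)
  have s\<Theta>: "smooth_on \<Theta> B"
    unfolding \<Theta>_def by (intro smooth_on_vec2 B(1) s\<Theta>2 smooth_on_bounded_linear bounded_linear_vec_nth)
  have \<Theta>V: "\<Theta> x \<in> V0" if "x \<in> B" for x
    using US[of "x $ 1" "x $ 2"] that by (simp add: B_def \<Theta>_def S_def)
  have d\<Theta>2: "((\<lambda>x::real^2. U (x $ 1, x $ 2)) has_derivative (\<lambda>v. v $ 1 * f (\<Theta> x) + v $ 2 * E (x $ 1, x $
      2))) (at x)" if "x \<in> B" for x
  proof -
    have "((\<lambda>x::real^2. (x $ 1, x $ 2)) has_derivative (\<lambda>v. (v $ 1, v $ 2))) (at x)"
      by (rule bounded_linear_imp_has_derivative[OF bounded_linear_unvec2])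
    from has_derivative_compose[OF this DU[of "x $ 1" "x $ 2"]] that show ?thesis
      by (simp add: B_def \<Theta>_def)
  qed
  have pd\<Theta>: "pd 1 (\<lambda>x. \<Theta> x $ 1) x = 1" "pd 2 (\<lambda>x. \<Theta> x $ 1) x = 0"
    "pd 1 (\<lambda>x. \<Theta> x $ 2) x = f (\<Theta> x)" "pd 2 (\<lambda>x. \<Theta> x $ 2) x = E (x $ 1, x $ 2)" if "x \<in> B" for x
    unfolding \<Theta>k
    using pd_has_derivative[OF d\<Theta>2[OF that]]
      pd_has_derivative[OF bounded_linear_imp_has_derivative[OF bounded_linear_vec_nth[of "1::2"]], of _ x]
    by (simp_all add: axis_def)
  have inj\<Theta>: "inj_on \<Theta> B"
  proof (rule inj_onI)
    fix x y assume x: "x \<in> B" and y: "y \<in> B" and eq: "\<Theta> x = \<Theta> y"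
    then have 1: "x $ 1 = y $ 1" and 2: "U (x $ 1, x $ 2) = U (x $ 1, y $ 2)"
      by (auto simp: \<Theta>_def vec_eq_iff forall_2)
    have D: "((\<lambda>s. U (x $ 1, s)) has_real_derivative E (x $ 1, s)) (at s)" if "\<bar>s - ?y0\<bar> < r" for s
    proof -
      have "((\<lambda>s. (x $ 1, s)) has_derivative (\<lambda>h. (0, h))) (at s)" by (auto intro!: derivative_eq_intros)
      from has_derivative_compose[OF this DU[of "x $ 1" s]] x that show ?thesis
        by (simp add: B_def has_field_derivative_def mult_commute_abs)
    qed
    have neq: "U (x $ 1, a) \<noteq> U (x $ 1, b)" if "a < b" "\<bar>a - ?y0\<bar> < r" "\<bar>b - ?y0\<bar> < r" for a b
    proof -
      have "\<exists>z>a. z < b \<and> U (x $ 1, b) - U (x $ 1, a) = (b - a) * E (x $ 1, z)"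
        by (rule MVT2[OF that(1)]) (rule D, use that in linarith)
      then obtain z where "U (x $ 1, b) - U (x $ 1, a) = (b - a) * E (x $ 1, z)" by blast
      then show ?thesis using E[of "(x $ 1, z)"] that(1) by auto
    qed
    have "x $ 2 = y $ 2"
      using neq[of "x $ 2" "y $ 2"] neq[of "y $ 2" "x $ 2"] 2 x y
      by (cases "x $ 2" "y $ 2" rule: linorder_cases) (auto simp: B_def)
    with 1 show "x = y" by (simp add: vec_eq_iff forall_2)
  qed
  \<comment> \<open>The image under \<Theta> of the first coordinate vector is (1, f). The vector a
    with t = a tensor d(label) is t 1 2 * E times it, because the label has x2-derivative 1 / E. So
    \<kappa> is the rate at which the new first coordinate must grow along the curve for a to have
    derivative 1.\<close>
  define \<kappa> where "\<kappa> = (\<lambda>x :: real^2. 1 / (t 1 2 (\<Theta> x) * E (x $ 1, x $ 2)))"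
  have \<kappa>0: "\<kappa> x \<noteq> 0" if "x \<in> B" for x
    using V0(4)[OF \<Theta>V[OF that]] E[of "(x $ 1, x $ 2)"] by (simp add: \<kappa>_def)
  have sE: "smooth_on (\<lambda>x::real^2. E (x $ 1, x $ 2)) B"
    by (rule smooth_on_cong[OF B(1), THEN iffD1, OF _ smooth_on_pd[of "\<lambda>x. \<Theta> x $ 2" B 2]])
       (use pd\<Theta>(4) s\<Theta>2 in \<open>auto simp: \<Theta>k\<close>)
  have s\<kappa>: "smooth_on \<kappa> B"
    unfolding \<kappa>_def
  proof (intro smooth_on_divide smooth_on_mult B(1) smooth_on_const sE)
    show "smooth_on (\<lambda>x. t 1 2 (\<Theta> x)) B"
      by (rule smooth_on_compose[OF B(1) V0(1) _ s\<Theta> t0]) (use \<Theta>V in auto)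
    show "t 1 2 (\<Theta> x) * E (x $ 1, x $ 2) \<noteq> 0" if "x \<in> B" for x
      using V0(4)[OF \<Theta>V[OF that]] E[of "(x $ 1, x $ 2)"] by simp
  qed
  \<comment> \<open>The primitive of \<kappa> along each curve, starting from the initial
    time.\<close>
  define g where "g = (\<lambda>x :: real^2. (x $ 1 - ?t0) * integral {0..1} (\<lambda>\<theta>. \<kappa> (vec2 (?t0 + \<theta> * (x $ 1 -
      ?t0)) (x $ 2))))"
  have sg: "smooth_on g B'"
  proof -
    let ?W = "{-1<..<2 :: real}"
    have o: "open (B' \<times> ?W)" using B(2) by (intro open_Times) auto
    have "smooth_on (\<lambda>p :: (real^2) \<times> real. \<kappa> (vec2 (?t0 + snd p * (fst p $ 1 - ?t0)) (fst p $ 2))) (B'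
        \<times> ?W)"
    proof (rule smooth_on_compose[OF o B(1) _ _ s\<kappa>])
      show "(\<lambda>p :: (real^2) \<times> real. vec2 (?t0 + snd p * (fst p $ 1 - ?t0)) (fst p $ 2)) ` (B' \<times> ?W) \<subseteq> B"
      proof safe
        fix x :: "real^2" and \<theta> assume x: "x \<in> B'" and th: "\<theta> \<in> ?W"
        have "\<bar>\<theta> * (x $ 1 - ?t0)\<bar> \<le> 2 * \<bar>x $ 1 - ?t0\<bar>"
          unfolding abs_mult using th by (intro mult_right_mono) auto
        also have "\<dots> < \<delta>" using x by (simp add: B'_def)
        finally show "vec2 (?t0 + snd (x, \<theta>) * (fst (x, \<theta>) $ 1 - ?t0)) (fst (x, \<theta>) $ 2) \<in> B"
          using x by (simp add: B'_def B_def)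
      qed
      show "smooth_on (\<lambda>p :: (real^2) \<times> real. vec2 (?t0 + snd p * (fst p $ 1 - ?t0)) (fst p $ 2)) (B' \<times> ?W)"
        by (intro smooth_on_vec2 smooth_on_add smooth_on_mult smooth_on_diff smooth_on_const o
            smooth_on_bounded_linear
            bounded_linear_snd bounded_linear_compose[OF bounded_linear_vec_nth bounded_linear_fst])
    qed
    from smooth_on_parametric_integral[OF B(2) _ _ this]
    have si: "smooth_on (\<lambda>x. integral {0..1} (\<lambda>\<theta>. \<kappa> (vec2 (?t0 + \<theta> * (x $ 1 - ?t0)) (x $ 2)))) B'"
      by (simp add: subset_iff)
    have "smooth_on (\<lambda>x::real^2. x $ 1 - ?t0) B'"
      by (intro smooth_on_diff smooth_on_const B(2) smooth_on_bounded_linear bounded_linear_vec_nth)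
    from smooth_on_mult[OF B(2) this si] show ?thesis unfolding g_def .
  qed
  have dg: "((\<lambda>t. g (vec2 t s)) has_real_derivative \<kappa> (vec2 t s)) (at t)" if "\<bar>t - ?t0\<bar> < \<delta>" "\<bar>s - ?y0\<bar>
      < r" for t s
  proof -
    have "continuous_on {?t0 - \<delta><..<?t0 + \<delta>} (\<lambda>t. \<kappa> (vec2 t s))"
    proof (rule continuous_on_compose2[OF smooth_on_continuous[OF s\<kappa>]])
      show "continuous_on {?t0 - \<delta><..<?t0 + \<delta>} (\<lambda>t. vec2 t s)"
        unfolding vec2_def
      proof (rule continuous_on_vec_lambda)
        show "continuous_on {?t0 - \<delta><..<?t0 + \<delta>} (\<lambda>t. if i = 1 then t else s)" for i :: 2
          by (cases "i = 1") auto
      qed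
    qed (use that in \<open>auto simp: B_def abs_less_iff\<close>)
    from mean_integral_has_derivative[OF this that(1)] show ?thesis by (simp add: g_def)
  qed
  have pdg: "pd 1 g x = \<kappa> x" if "x \<in> B'" for x
  proof -
    have x: "\<bar>x $ 1 - ?t0\<bar> < \<delta>" "\<bar>x $ 2 - ?y0\<bar> < r" using that B(3) by (auto simp: B_def)
    have "((\<lambda>t. vec2 t (x $ 2)) has_derivative (\<lambda>h. vec2 h 0)) (at (x $ 1))"
    proof -
      have "((\<lambda>t. (t, x $ 2)) has_derivative (\<lambda>h. (h, 0))) (at (x $ 1))" by (auto intro!:
          derivative_eq_intros)
      from bounded_linear.has_derivative[OF bounded_linear_vec2 this] show ?thesis by simp
    qed
    moreover have "(g has_derivative (\<lambda>v. \<Sum>i\<in>UNIV. v $ i * pd i g x)) (at (vec2 (x $ 1) (x $ 2)))"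
      using smooth_on_has_derivative_pd[OF B(2) sg that] by simp
    ultimately have "((\<lambda>t. g (vec2 t (x $ 2))) has_derivative (\<lambda>h. \<Sum>i\<in>UNIV. vec2 h 0 $ i * pd i g x))
        (at (x $ 1))"
      by (rule has_derivative_compose)
    then have "((\<lambda>t. g (vec2 t (x $ 2))) has_real_derivative pd 1 g x) (at (x $ 1))"
      by (simp add: sum_2 has_field_derivative_def mult_commute_abs)
    from DERIV_unique[OF this dg[OF x]] show ?thesis by simp
  qed
  \<comment> \<open>Replaces the position along the curve by \<open>g\<close>; the Jacobian
    determinant is \<kappa>. The coordinates sought are \<Xi> after the inverse of \<Theta>.\<close>
  define \<Xi> where "\<Xi> = (\<lambda>x :: real^2. vec2 (g x) (x $ 2))"
  have \<Xi>k: "(\<lambda>x. \<Xi> x $ 1) = g" "(\<lambda>x. \<Xi> x $ 2) = (\<lambda>x. x $ 2)"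
    by (simp_all add: \<Xi>_def)
  have s\<Xi>: "smooth_on \<Xi> B'"
    unfolding \<Xi>_def by (intro smooth_on_vec2 B(2) sg smooth_on_bounded_linear bounded_linear_vec_nth)
  have pd\<Xi>: "pd 1 (\<lambda>x. \<Xi> x $ 2) x = 0" "pd 2 (\<lambda>x. \<Xi> x $ 2) x = 1" for x
    unfolding \<Xi>k
    using pd_has_derivative[OF bounded_linear_imp_has_derivative[OF bounded_linear_vec_nth[of "2::2"]],
        of _ x]
    by (simp_all add: axis_def)
  have inj\<Xi>: "inj_on \<Xi> B'"
  proof (rule inj_onI)
    fix x y assume x: "x \<in> B'" and y: "y \<in> B'" and eq: "\<Xi> x = \<Xi> y"
    then have 2: "x $ 2 = y $ 2" and "g x = g y"
      by (auto simp: \<Xi>_def vec_eq_iff[of "vec2 _ _"] forall_2)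
    then have 1: "g (vec2 (x $ 1) (x $ 2)) = g (vec2 (y $ 1) (x $ 2))"
      using vec2_eta[of x] vec2_eta[of y] by (simp only: 2)
    have neq: "g (vec2 a (x $ 2)) \<noteq> g (vec2 b (x $ 2))" if "a < b" "\<bar>a - ?t0\<bar> < \<delta> / 2" "\<bar>b - ?t0\<bar> < \<delta> /
        2" for a b
    proof -
      have in': "\<bar>z - ?t0\<bar> < \<delta>" if "a \<le> z" "z \<le> b" for z using that \<open>\<bar>a - ?t0\<bar> < \<delta> / 2\<close> \<open>\<bar>b - ?t0\<bar> < \<delta> /
          2\<close> by linarith
      have x2: "\<bar>x $ 2 - ?y0\<bar> < r" using x by (simp add: B'_def)
      have "\<exists>z>a. z < b \<and> g (vec2 b (x $ 2)) - g (vec2 a (x $ 2)) = (b - a) * \<kappa> (vec2 z (x $ 2))"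
        by (rule MVT2[OF that(1)]) (rule dg, use in' x2 in auto)
      then obtain z where z: "a < z" "z < b" "g (vec2 b (x $ 2)) - g (vec2 a (x $ 2)) = (b - a) * \<kappa>
          (vec2 z (x $ 2))" by blast
      have "\<kappa> (vec2 z (x $ 2)) \<noteq> 0" by (rule \<kappa>0) (use in'[of z] z x2 in \<open>simp add: B_def\<close>)
      then show ?thesis using z by auto
    qed
    have "x $ 1 = y $ 1"
      using neq[of "x $ 1" "y $ 1"] neq[of "y $ 1" "x $ 1"] 1 x y
      by (cases "x $ 1" "y $ 1" rule: linorder_cases) (auto simp: B'_def)
    with 2 show "x = y" by (simp add: vec_eq_iff forall_2)
  qed
  have inj\<Theta>': "inj_on \<Theta> B'" by (rule inj_on_subset[OF inj\<Theta> B(3)])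
  have s\<Theta>': "smooth_on \<Theta> B'" by (rule smooth_on_subset[OF s\<Theta> B(3)])
  have j\<Theta>: "jac2 \<Theta> x \<noteq> 0" if "x \<in> B'" for x
    using pd\<Theta>[of x] that B(3) E[of "(x $ 1, x $ 2)"] by (auto simp: jac2_def)
  have j\<Xi>: "jac2 \<Xi> x \<noteq> 0" if "x \<in> B'" for x
    using pd\<Xi>[of x] pdg[OF that] \<kappa>0[of x] that B(3) by (auto simp: jac2_def \<Xi>k)
  \<comment> \<open>Both maps are inverted on the common domain \<open>B'\<close>, where
    \<open>g\<close> is known to be smooth.\<close>
  note I\<Theta> = smooth_inverse_2d[OF B(2) s\<Theta>' inj\<Theta>' j\<Theta>] and I\<Xi> = smooth_inverse_2d[OF B(2) s\<Xi> inj\<Xi> j\<Xi>]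
  define V' where "V' = \<Theta> ` B'"
  define \<Psi> where "\<Psi> = (\<lambda>x. \<Xi> (inv_into B' \<Theta> x))"
  have G: "inv_into B' \<Theta> (\<Theta> z) = z" if "z \<in> B'" for z using inj\<Theta>' that by (rule inv_into_f_f)
  have V': "open V'" "V' \<subseteq> V0"
    using I\<Theta>(1) \<Theta>V B(3) by (auto simp: V'_def)
  have \<Psi>\<Theta>: "\<Psi> (\<Theta> z) = \<Xi> z" if "z \<in> B'" for z using G[OF that] by (simp add: \<Psi>_def)
  have "x0 \<in> V'"
  proof -
    have "\<Theta> x0 = x0" using U0[of ?y0] \<delta> by (simp add: \<Theta>_def)
    then show ?thesis using B(4) unfolding V'_def by (metis imageI)
  qed
  moreover have s\<Psi>: "smooth_on \<Psi> V'"
    unfolding \<Psi>_def V'_def by (rule smooth_on_compose[OF I\<Theta>(1) B(2) _ I\<Theta>(3) s\<Xi>]) (auto simp: G)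
  moreover have inj\<Psi>: "inj_on \<Psi> V'"
    unfolding V'_def using inj\<Xi> by (auto simp: inj_on_def \<Psi>\<Theta>)
  moreover have im\<Psi>: "\<Psi> ` V' = \<Xi> ` B'"
    unfolding V'_def by (force simp: \<Psi>\<Theta>)
  moreover have "smooth_on (inv_into V' \<Psi>) (\<Psi> ` V')"
  proof -
    have eq: "inv_into V' \<Psi> w = \<Theta> (inv_into B' \<Xi> w)" if w: "w \<in> \<Xi> ` B'" for w
    proof -
      from w obtain z where z: "z \<in> B'" "w = \<Xi> z" by blast
      have "inv_into V' \<Psi> (\<Psi> (\<Theta> z)) = \<Theta> z" by (rule inv_into_f_f[OF inj\<Psi>]) (use z in \<open>auto simp: V'_def\<close>)
      moreover have "inv_into B' \<Xi> (\<Xi> z) = z" using inj\<Xi> z(1) by (rule inv_into_f_f)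
      ultimately show ?thesis by (simp add: z \<Psi>\<Theta>)
    qed
    have "smooth_on (\<lambda>w. \<Theta> (inv_into B' \<Xi> w)) (\<Xi> ` B')"
      by (rule smooth_on_compose[OF I\<Xi>(1) B(2) _ I\<Xi>(3) s\<Theta>']) (auto simp: inv_into_into)
    moreover have "smooth_on (inv_into V' \<Psi>) (\<Xi> ` B') \<longleftrightarrow> smooth_on (\<lambda>w. \<Theta> (inv_into B' \<Xi> w)) (\<Xi> ` B')"
      by (rule smooth_on_cong[OF I\<Xi>(1)]) (simp_all add: eq)
    ultimately show ?thesis unfolding im\<Psi> by blast
  qed
  moreover have "\<exists>a :: real^2. (\<forall>r i. t r i x = a $ r * pd i (\<lambda>x. \<Psi> x $ 2) x) \<and>
       a $ 1 * pd 1 (\<lambda>x. \<Psi> x $ 1) x + a $ 2 * pd 2 (\<lambda>x. \<Psi> x $ 1) x = 1 \<and>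
       a $ 1 * pd 1 (\<lambda>x. \<Psi> x $ 2) x + a $ 2 * pd 2 (\<lambda>x. \<Psi> x $ 2) x = 0" if x: "x \<in> V'" for x
  proof -
    from x obtain z where z: "z \<in> B'" "x = \<Theta> z" by (auto simp: V'_def)
    have zB: "z \<in> B" using z B(3) by auto
    have xV: "x \<in> V" "t 1 2 x \<noteq> 0" using x V' V0 by auto
    let ?p = "\<lambda>k i. pd i (\<lambda>x. \<Psi> x $ k) x" and ?E = "E (z $ 1, z $ 2)" and ?q = "t 1 2 x"
    have chain: "pd j (\<lambda>x. \<Xi> x $ k) z = ?p k 1 * pd j (\<lambda>x. \<Theta> x $ 1) z + ?p k 2 * pd j (\<lambda>x. \<Theta> x $ 2) z"
        for j k
    proof -
      have sk: "smooth_on (\<lambda>x. \<Psi> x $ k) V'" using s\<Psi> smooth_on_vec_iff[OF V'(1)] by blast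
      have "pd j (\<lambda>x. \<Xi> x $ k) z = pd j (\<lambda>x. \<Psi> (\<Theta> x) $ k) z"
        by (rule pd_cong[OF B(2) z(1)]) (simp add: \<Psi>\<Theta>)
      also have "\<dots> = ?p k 1 * pd j (\<lambda>x. \<Theta> x $ 1) z + ?p k 2 * pd j (\<lambda>x. \<Theta> x $ 2) z"
        unfolding z(2) by (rule pd_chain_2d[OF B(2) s\<Theta>' z(1) V'(1) sk]) (use z in \<open>simp add: V'_def\<close>)
      finally show ?thesis .
    qed
    have E0: "?E > 0" by (rule E)
    \<comment> \<open>Three of the four entries of the chain rule for \<Xi> = \<Psi> after \<Theta>;
      they determine what is needed of the derivatives of \<Psi>.\<close>
    have e1: "\<kappa> z = ?p 1 1 + ?p 1 2 * f x" using chain[of 1 1] pdg[OF z(1)] pd\<Theta>[OF zB] z(2) by (simp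
        add: \<Xi>k)
    have e2: "0 = ?p 2 1 + ?p 2 2 * f x" using chain[of 1 2] pd\<Theta>[OF zB] pd\<Xi>[of z] z(2) by simp
    have e3: "1 = ?p 2 2 * ?E" using chain[of 2 2] pd\<Theta>[OF zB] pd\<Xi>[of z] z(2) by simp
    have \<kappa>z: "\<kappa> z * (?q * ?E) = 1" using xV(2) E0 z(2) by (simp add: \<kappa>_def)
    have fq: "f x * ?q = - t 1 1 x" using xV(2) by (simp add: f_def)
    have "?q * (t 2 1 x) = ?q * (t 1 1 x * f x)" using det[OF xV(1)] fq by algebra
    then have t21: "t 2 1 x = t 1 1 x * f x" using xV(2) by simp
    \<comment> \<open>The vector (1, f) scaled by t 1 2 * E, since f * t 1 2 = - t 1 1.\<close>
    define a where "a = vec2 (?q * ?E) (- t 1 1 x * ?E)"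
    have p22: "?E * ?p 2 2 = 1" and p21: "?p 2 1 = - (?p 2 2 * f x)" using e2 e3 by (simp_all add:
        mult.commute)
    have Ep21: "?E * ?p 2 1 = - f x"
    proof -
      have "?E * ?p 2 1 = - ((?E * ?p 2 2) * f x)" by (simp add: p21)
      then show ?thesis by (simp add: p22)
    qed
    have "\<forall>r i. t r i x = a $ r * ?p 2 i"
      unfolding forall_2 a_def vec2_nth
      using p22 Ep21 fq t21 tr[OF xV(1)] by (simp add: mult.assoc mult.commute[of _ "f x"])
    moreover have "a $ 1 * ?p 1 1 + a $ 2 * ?p 1 2 = 1"
    proof -
      have "a $ 1 * ?p 1 1 + a $ 2 * ?p 1 2 = (?q * ?E) * ?p 1 1 + (f x * ?q) * ?E * ?p 1 2"
        by (simp add: a_def fq)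
      also have "\<dots> = \<kappa> z * (?q * ?E)" by (simp add: e1 algebra_simps)
      finally show ?thesis using \<kappa>z by simp
    qed
    moreover have "a $ 1 * ?p 2 1 + a $ 2 * ?p 2 2 = 0"
    proof -
      have "a $ 1 * ?p 2 1 + a $ 2 * ?p 2 2 = ?q * (?E * ?p 2 1) - t 1 1 x * (?E * ?p 2 2)"
        by (simp add: a_def algebra_simps)
      also have "\<dots> = - (f x * ?q) - t 1 1 x" by (simp only: Ep21 p22, simp?)
      also have "\<dots> = 0" by (simp only: fq, simp?)
      finally show ?thesis .
    qed
    ultimately show ?thesis by blast
  qed
  moreover have "V' \<subseteq> V" "open (\<Psi> ` V')" using V' V0(2) I\<Xi>(1) im\<Psi> by auto
  ultimately show ?thesis
    by (intro that[of V' \<Psi>] V'(1)) assumption+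
qed

text \<open>The image of \<open>t\<close> is the line spanned by \<open>(t\<^sup>1\<^sub>2, - t\<^sup>1\<^sub>1)\<close> or by \<open>(t\<^sup>1\<^sub>1, t\<^sup>2\<^sub>1)\<close>; interchanging
  the coordinates reduces the second case to the first, where integral curves are graphs over \<open>x\<^sup>1\<close>.\<close>

lemma nilpotent_coordinates:
  fixes t :: "2 \<Rightarrow> 2 \<Rightarrow> real^2 \<Rightarrow> real"
  assumes V: "open V" and x0: "x0 \<in> V" and t: "\<And>r i. smooth_on (t r i) V"
    and tr: "\<And>x. x \<in> V \<Longrightarrow> t 2 2 x = - t 1 1 x"
    and det: "\<And>x. x \<in> V \<Longrightarrow> t 1 2 x * t 2 1 x = - (t 1 1 x * t 1 1 x)"
    and nz: "t 1 2 x0 \<noteq> 0 \<or> t 2 1 x0 \<noteq> 0"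
  obtains V' and \<Psi> :: "real^2 \<Rightarrow> real^2" where "open V'" "x0 \<in> V'" "V' \<subseteq> V" "smooth_on \<Psi> V'" "inj_on \<Psi>
      V'" "open (\<Psi> ` V')"
    "smooth_on (inv_into V' \<Psi>) (\<Psi> ` V')"
    "\<And>x. x \<in> V' \<Longrightarrow> \<exists>a :: real^2. (\<forall>r i. t r i x = a $ r * pd i (\<lambda>x. \<Psi> x $ 2) x) \<and>
       a $ 1 * pd 1 (\<lambda>x. \<Psi> x $ 1) x + a $ 2 * pd 2 (\<lambda>x. \<Psi> x $ 1) x = 1 \<and>
       a $ 1 * pd 1 (\<lambda>x. \<Psi> x $ 2) x + a $ 2 * pd 2 (\<lambda>x. \<Psi> x $ 2) x = 0"
proof (cases "t 1 2 x0 = 0")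
  case False
  show ?thesis
    by (rule nilpotent_coordinates_graph[OF V x0 t tr det False]) (assumption | rule that; assumption)+
next
  case True
  define sw where "sw = (\<lambda>x :: real^2. vec2 (x $ 2) (x $ 1))"
  define \<pi> where "\<pi> = (\<lambda>i :: 2. if i = 1 then 2 else 1 :: 2)"
  have sw2: "sw (sw x) = x" for x by (simp add: sw_def vec_eq_iff forall_2)
  have swn [simp]: "sw x $ 1 = x $ 2" "sw x $ 2 = x $ 1" for x by (simp_all add: sw_def)
  have bsw: "bounded_linear sw"
    by (rule linear_conv_bounded_linear[THEN iffD1], rule linearI) (simp_all add: vec_eq_iff forall_2)
  have osw: "open (sw ` S)" if "open S" for S
  proof -
    have "sw ` S = sw -` S" using sw2 by (auto simp: image_iff) metis
    then show ?thesis using open_vimage[OF that linear_continuous_on[OF bsw]] by simp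
  qed
  have ssw: "smooth_on sw S" for S by (rule smooth_on_bounded_linear[OF bsw])
  have sw_mem: "sw x \<in> sw ` S \<longleftrightarrow> x \<in> S" for x S by (metis image_iff sw2)
  define t' where "t' = (\<lambda>r i x. t (\<pi> r) (\<pi> i) (sw x))"
  have st': "smooth_on (t' r i) (sw ` V)" for r i
    unfolding t'_def by (rule smooth_on_compose[OF osw[OF V] V _ ssw t]) (auto simp: sw2)
  have tr': "t' 2 2 x = - t' 1 1 x" if "x \<in> sw ` V" for x
    using that tr by (auto simp: t'_def \<pi>_def sw2)
  have det': "t' 1 2 x * t' 2 1 x = - (t' 1 1 x * t' 1 1 x)" if "x \<in> sw ` V" for x
    using that det tr by (auto simp: t'_def \<pi>_def sw2 mult.commute)
  have nz': "t' 1 2 (sw x0) \<noteq> 0" using True nz by (simp add: t'_def \<pi>_def sw2)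
  have x0': "sw x0 \<in> sw ` V" using x0 by simp
  obtain V' and \<Psi> :: "real^2 \<Rightarrow> real^2" where V': "open V'" "sw x0 \<in> V'" "V' \<subseteq> sw ` V" and s\<Psi>: "smooth_on
      \<Psi> V'" and inj: "inj_on \<Psi> V'"
    and o: "open (\<Psi> ` V')" and si: "smooth_on (inv_into V' \<Psi>) (\<Psi> ` V')"
    and ex: "\<And>x. x \<in> V' \<Longrightarrow> \<exists>a :: real^2. (\<forall>r i. t' r i x = a $ r * pd i (\<lambda>x. \<Psi> x $ 2) x) \<and>
       a $ 1 * pd 1 (\<lambda>x. \<Psi> x $ 1) x + a $ 2 * pd 2 (\<lambda>x. \<Psi> x $ 1) x = 1 \<and>
       a $ 1 * pd 1 (\<lambda>x. \<Psi> x $ 2) x + a $ 2 * pd 2 (\<lambda>x. \<Psi> x $ 2) x = 0"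
    by (rule nilpotent_coordinates_graph[OF osw[OF V] x0' st' tr' det' nz']) (assumption | rule that;
        assumption)+
  let ?V = "sw ` V'" and ?\<Psi> = "\<lambda>x. \<Psi> (sw x)"
  have oV: "open ?V" by (rule osw[OF V'(1)])
  have inj': "inj_on ?\<Psi> ?V" using inj by (auto simp: inj_on_def sw2)
  have im: "?\<Psi> ` ?V = \<Psi> ` V'" by (force simp: sw2)
  have inv: "inv_into ?V ?\<Psi> w = sw (inv_into V' \<Psi> w)" if "w \<in> \<Psi> ` V'" for w
  proof -
    from that obtain z where z: "z \<in> V'" "w = \<Psi> z" by blast
    have "inv_into ?V ?\<Psi> (?\<Psi> (sw z)) = sw z" by (rule inv_into_f_f[OF inj']) (use z in auto)
    then show ?thesis using inv_into_f_f[OF inj z(1)] by (simp add: z sw2)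
  qed
  have "smooth_on (\<lambda>w. sw (inv_into V' \<Psi> w)) (\<Psi> ` V')"
    by (rule smooth_on_linear_compose[OF bsw o si])
  moreover have "smooth_on (inv_into ?V ?\<Psi>) (\<Psi> ` V') \<longleftrightarrow> smooth_on (\<lambda>w. sw (inv_into V' \<Psi> w)) (\<Psi> ` V')"
    by (rule smooth_on_cong[OF o]) (rule inv)
  ultimately have si': "smooth_on (inv_into ?V ?\<Psi>) (?\<Psi> ` ?V)" unfolding im by blast
  have s\<Psi>': "smooth_on ?\<Psi> ?V"
    by (rule smooth_on_compose[OF oV V'(1) _ ssw s\<Psi>]) (auto simp: sw2)
  have pdsw: "pd i (\<lambda>x. sw x $ k) x = (if k = \<pi> i then 1 else 0)" for i k x
  proof -
    have "((\<lambda>x. sw x $ k) has_derivative (\<lambda>v. sw v $ k)) (at x)"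
      by (rule bounded_linear_imp_has_derivative[OF bounded_linear_compose[OF bounded_linear_vec_nth bsw]])
    from pd_has_derivative[OF this, of i] show ?thesis
      using exhaust_2[of i] exhaust_2[of k] by (auto simp: \<pi>_def axis_def)
  qed
  have pd': "pd i (\<lambda>x. ?\<Psi> x $ k) x = pd (\<pi> i) (\<lambda>x. \<Psi> x $ k) (sw x)" if "x \<in> ?V" for x i k
  proof -
    have "smooth_on (\<lambda>x. \<Psi> x $ k) V'" using s\<Psi> smooth_on_vec_iff[OF V'(1)] by blast
    from pd_chain_2d[OF oV ssw that V'(1) this, of i, unfolded pdsw] that
    show ?thesis using exhaust_2[of i] by (auto simp: pdsw \<pi>_def sw2)
  qed
  show ?thesis
  proof (rule that[of ?V ?\<Psi>])
    show "open ?V" "smooth_on ?\<Psi> ?V" "inj_on ?\<Psi> ?V" "open (?\<Psi> ` ?V)" "smooth_on (inv_into ?V ?\<Psi>) (?\<Psi> ` ?V)"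
      using oV s\<Psi>' inj' si' o im by auto
    show "x0 \<in> ?V" using V'(2) by (metis image_eqI sw2)
    show "?V \<subseteq> V" using V'(3) by (auto simp: sw2)
    fix x assume x: "x \<in> ?V"
    then have "sw x \<in> V'" by (auto simp: sw2)
    from ex[OF this] obtain a :: "real^2" where a: "\<And>r i. t' r i (sw x) = a $ r * pd i (\<lambda>x. \<Psi> x $ 2) (sw x)"
       "a $ 1 * pd 1 (\<lambda>x. \<Psi> x $ 1) (sw x) + a $ 2 * pd 2 (\<lambda>x. \<Psi> x $ 1) (sw x) = 1"
       "a $ 1 * pd 1 (\<lambda>x. \<Psi> x $ 2) (sw x) + a $ 2 * pd 2 (\<lambda>x. \<Psi> x $ 2) (sw x) = 0" by blast
    have "t r i x = sw a $ r * pd i (\<lambda>x. ?\<Psi> x $ 2) x" for r i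
      using a(1)[of "\<pi> r" "\<pi> i"] exhaust_2[of r] exhaust_2[of i] by (auto simp: pd'[OF x] t'_def \<pi>_def sw2)
    then show "\<exists>a :: real^2. (\<forall>r i. t r i x = a $ r * pd i (\<lambda>x. ?\<Psi> x $ 2) x) \<and>
       a $ 1 * pd 1 (\<lambda>x. ?\<Psi> x $ 1) x + a $ 2 * pd 2 (\<lambda>x. ?\<Psi> x $ 1) x = 1 \<and>
       a $ 1 * pd 1 (\<lambda>x. ?\<Psi> x $ 2) x + a $ 2 * pd 2 (\<lambda>x. ?\<Psi> x $ 2) x = 0"
      using a(2,3) by (intro exI[of _ "sw a"]) (simp add: pd'[OF x] \<pi>_def add.commute)
  qed
qed

section \<open>Curvature of Walker metrics quadratic in the fibre coordinates\<close>

definition X1 :: "2 + 2" where "X1 = Inl 1"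
definition X2 :: "2 + 2" where "X2 = Inl 2"
definition Y1 :: "2 + 2" where "Y1 = Inr 1"
definition Y2 :: "2 + 2" where "Y2 = Inr 2"

lemmas idx_defs = X1_def X2_def Y1_def Y2_def

lemma UNIV_idx: "(UNIV :: (2 + 2) set) = {X1, X2, Y1, Y2}"
  by (auto simp: UNIV_2 UNIV_sum idx_defs)

lemma idx_distinct [simp]:
  "X1 \<noteq> X2" "X1 \<noteq> Y1" "X1 \<noteq> Y2" "X2 \<noteq> X1" "X2 \<noteq> Y1" "X2 \<noteq> Y2"
  "Y1 \<noteq> X1" "Y1 \<noteq> X2" "Y1 \<noteq> Y2" "Y2 \<noteq> X1" "Y2 \<noteq> X2" "Y2 \<noteq> Y1"
  by (simp_all add: idx_defs)

lemma sum_idx: "sum f (UNIV :: (2 + 2) set) = f X1 + f X2 + f Y1 + f Y2"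
  by (simp add: UNIV_idx add.assoc)

lemma exhaust_idx: "i = X1 \<or> i = X2 \<or> i = Y1 \<or> i = Y2" for i :: "2 + 2"
  using UNIV_idx by blast

lemma forall_idx: "(\<forall>i :: 2 + 2. P i) \<longleftrightarrow> P X1 \<and> P X2 \<and> P Y1 \<and> P Y2"
  by (metis exhaust_idx)

lemma cov_deriv_4:
  "cov_deriv g S [b, k, i, j, l] z = pd b (S [k, i, j, l]) z -
     (\<Sum>n\<in>UNIV. levi_civita g b k n z * S [n, i, j, l] z + levi_civita g b i n z * S [k, n, j, l] z +
       levi_civita g b j n z * S [k, i, n, l] z + levi_civita g b l n z * S [k, i, j, n] z)"
  by (simp add: cov_deriv_def sum.distrib)

lemma cov_deriv_5:
  "cov_deriv g S [a, b, k, i, j, l] z = pd a (S [b, k, i, j, l]) z -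
     (\<Sum>n\<in>UNIV. levi_civita g a b n z * S [n, k, i, j, l] z + levi_civita g a k n z * S [b, n, i, j, l] z +
       levi_civita g a i n z * S [b, k, n, j, l] z + levi_civita g a j n z * S [b, k, i, n, l] z +
       levi_civita g a l n z * S [b, k, i, j, n] z)"
  by (simp add: cov_deriv_def sum.distrib)

lemma det_idx:
  fixes A :: "real^(2 + 2)^(2 + 2)"
  shows "det A =
    A $ X1 $ X1 * A $ X2 $ X2 * A $ Y1 $ Y1 * A $ Y2 $ Y2 - A $ X1 $ X1 * A $ X2 $ X2 * A $ Y1 $ Y2 * A
        $ Y2 $ Y1 - A $ X1 $ X1 * A $ X2 $ Y1 * A $ Y1 $ X2 * A $ Y2 $ Y2 + A $ X1 $ X1 * A $ X2 $ Y1 * A $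
        Y1 $ Y2 * A $ Y2 $ X2 + A $ X1 $ X1 * A $ X2 $ Y2 * A $ Y1 $ X2 * A $ Y2 $ Y1 - A $ X1 $ X1 * A $ X2
        $ Y2 * A $ Y1 $ Y1 * A $ Y2 $ X2 - A $ X1 $ X2 * A $ X2 $ X1 * A $ Y1 $ Y1 * A $ Y2 $ Y2 + A $ X1 $
        X2 * A $ X2 $ X1 * A $ Y1 $ Y2 * A $ Y2 $ Y1 + A $ X1 $ X2 * A $ X2 $ Y1 * A $ Y1 $ X1 * A $ Y2 $ Y2
        - A $ X1 $ X2 * A $ X2 $ Y1 * A $ Y1 $ Y2 * A $ Y2 $ X1 - A $ X1 $ X2 * A $ X2 $ Y2 * A $ Y1 $ X1 *
        A $ Y2 $ Y1 + A $ X1 $ X2 * A $ X2 $ Y2 * A $ Y1 $ Y1 * A $ Y2 $ X1 + A $ X1 $ Y1 * A $ X2 $ X1 * A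
        $ Y1 $ X2 * A $ Y2 $ Y2 - A $ X1 $ Y1 * A $ X2 $ X1 * A $ Y1 $ Y2 * A $ Y2 $ X2 - A $ X1 $ Y1 * A $
        X2 $ X2 * A $ Y1 $ X1 * A $ Y2 $ Y2 + A $ X1 $ Y1 * A $ X2 $ X2 * A $ Y1 $ Y2 * A $ Y2 $ X1 + A $ X1
        $ Y1 * A $ X2 $ Y2 * A $ Y1 $ X1 * A $ Y2 $ X2 - A $ X1 $ Y1 * A $ X2 $ Y2 * A $ Y1 $ X2 * A $ Y2 $
        X1 - A $ X1 $ Y2 * A $ X2 $ X1 * A $ Y1 $ X2 * A $ Y2 $ Y1 + A $ X1 $ Y2 * A $ X2 $ X1 * A $ Y1 $ Y1
        * A $ Y2 $ X2 + A $ X1 $ Y2 * A $ X2 $ X2 * A $ Y1 $ X1 * A $ Y2 $ Y1 - A $ X1 $ Y2 * A $ X2 $ X2 *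
        A $ Y1 $ Y1 * A $ Y2 $ X1 - A $ X1 $ Y2 * A $ X2 $ Y1 * A $ Y1 $ X1 * A $ Y2 $ X2 + A $ X1 $ Y2 * A
        $ X2 $ Y1 * A $ Y1 $ X2 * A $ Y2 $ X1"
proof -
  have f4: "finite {X2, Y1, Y2}" "X1 \<notin> {X2, Y1, Y2}" by auto
  have f3: "finite {Y1, Y2}" "X2 \<notin> {Y1, Y2}" by auto
  have f2: "finite {Y2}" "Y1 \<notin> {Y2}" by auto
  show ?thesis
    unfolding det_def UNIV_idx
    unfolding sum_over_permutations_insert[OF f4]
    unfolding sum_over_permutations_insert[OF f3]
    unfolding sum_over_permutations_insert[OF f2]
    unfolding permutes_sing
    by (simp add: sign_swap_id permutation_swap_id permutation_compose sign_compose sign_id transpose_def)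
qed

lemma volume_form_idx:
  "volume_form g i j k l z = sqrt \<bar>det (g z)\<bar> * det ((\<chi> a. axis (if a = X1 then i else if a = X2 then j
      else if a = Y1 then k else l) 1) :: real^(2 + 2)^(2 + 2))"
proof -
  have "(case a of Inl m \<Rightarrow> if m = 1 then i else j | Inr m \<Rightarrow> if m = 1 then k else l) =
      (if a = X1 then i else if a = X2 then j else if a = Y1 then k else l)" for a :: "2 + 2"
    using exhaust_idx[of a] by (auto simp: idx_defs)
  then show ?thesis unfolding volume_form_def by simp
qed

lemma axis_idx: "axis i (1::real) $ j = (if i = j then 1 else 0)" for i j :: "2 + 2"
  by (auto simp: axis_def)

definition weyl_div :: "'n::finite metric \<Rightarrow> 'n \<Rightarrow> 'n \<Rightarrow> 'n \<Rightarrow> real^'n \<Rightarrow> real" where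
  "weyl_div g k i j z = (\<Sum>l\<in>UNIV. \<Sum>b\<in>UNIV. inv_metric g l b z *
     cov_deriv g (weyl_tensor g) [b, k, i, j, l] z)"

text \<open>\<open>matrix_inv\<close> is defined by choice, so it can be evaluated once a two-sided
  inverse has been exhibited.\<close>

lemma matrix_inv_unique:
  fixes A :: "'a::semiring_1^'n^'n"
  assumes "A ** B = mat 1" "B ** A = mat 1"
  shows "matrix_inv A = B"
proof -
  have "A ** matrix_inv A = mat 1 \<and> matrix_inv A ** A = mat 1"
    unfolding matrix_inv_def by (rule someI[of _ B]) (use assms in simp)
  then have "matrix_inv A = matrix_inv A ** (A ** B)" using assms by simp
  also have "\<dots> = B" using \<open>A ** matrix_inv A = mat 1 \<and> _\<close> by (simp add: matrix_mul_assoc)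
  finally show ?thesis .
qed

text \<open>The jets of the block \<open>h\<^bsub>ij\<^esub>\<close> of a Walker metric \<open>2 dx\<^sup>i dy\<^sub>i + h\<^bsub>ij\<^esub> dx\<^sup>i dx\<^sup>j\<close> that is quadratic
  in \<open>y\<close>: \<open>h c a b p q\<close> is the partial derivative of order \<open>a\<close> in \<open>x\<^sup>1\<close>, \<open>b\<close> in \<open>x\<^sup>2\<close>, \<open>p\<close> in \<open>y\<^sub>1\<close>, \<open>q\<close>
  in \<open>y\<^sub>2\<close> of \<open>h\<^sub>1\<^sub>1\<close>, \<open>h\<^sub>2\<^sub>2\<close>, \<open>h\<^sub>1\<^sub>2\<close> for \<open>c = 0, 1, 2\<close>.\<close>

locale walker_jets =
  fixes Z :: "(real^(2 + 2)) set"
    and h :: "nat \<Rightarrow> nat \<Rightarrow> nat \<Rightarrow> nat \<Rightarrow> nat \<Rightarrow> real^(2 + 2) \<Rightarrow> real"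
    and g :: "(2 + 2) metric"
  assumes open_Z: "open Z"
    and h_has_derivative: "z \<in> Z \<Longrightarrow> (h c a b p q has_derivative
       (\<lambda>v. v $ X1 * h c (a + 1) b p q z + v $ X2 * h c a (b + 1) p q z +
            v $ Y1 * h c a b (p + 1) q z + v $ Y2 * h c a b p (q + 1) z)) (at z)"
    and h_cubic: "p + q \<ge> 3 \<Longrightarrow> h c a b p q z = 0"
    and g_components:
    "\<forall>z\<in>Z. g z $ X1 $ X1 = h 0 0 0 0 0 z"
    "\<forall>z\<in>Z. g z $ X1 $ X2 = h 2 0 0 0 0 z"
    "\<forall>z\<in>Z. g z $ X1 $ Y1 = 1"
    "\<forall>z\<in>Z. g z $ X1 $ Y2 = 0"
    "\<forall>z\<in>Z. g z $ X2 $ X1 = h 2 0 0 0 0 z"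
    "\<forall>z\<in>Z. g z $ X2 $ X2 = h 1 0 0 0 0 z"
    "\<forall>z\<in>Z. g z $ X2 $ Y1 = 0"
    "\<forall>z\<in>Z. g z $ X2 $ Y2 = 1"
    "\<forall>z\<in>Z. g z $ Y1 $ X1 = 1"
    "\<forall>z\<in>Z. g z $ Y1 $ X2 = 0"
    "\<forall>z\<in>Z. g z $ Y1 $ Y1 = 0"
    "\<forall>z\<in>Z. g z $ Y1 $ Y2 = 0"
    "\<forall>z\<in>Z. g z $ Y2 $ X1 = 0"
    "\<forall>z\<in>Z. g z $ Y2 $ X2 = 1"
    "\<forall>z\<in>Z. g z $ Y2 $ Y1 = 0"
    "\<forall>z\<in>Z. g z $ Y2 $ Y2 = 0"
begin

section \<open>Differential calculus of polynomials in the jets\<close>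

declare One_nat_def [simp del]

text \<open>The differential algebra generated by the jets. Membership discharges the
  differentiability conditions of the sum and product rules in the component computations. Rule
  \<open>agree\<close> is sound because only derivatives at points of the open set \<open>Z\<close>
  matter.\<close>

inductive jet_poly :: "(real^(2 + 2) \<Rightarrow> real) \<Rightarrow> bool" where
  const: "jet_poly (\<lambda>z. c)"
| jet: "jet_poly (h c a b p q)"
| add: "jet_poly f \<Longrightarrow> jet_poly f' \<Longrightarrow> jet_poly (\<lambda>z. f z + f' z)"
| mult: "jet_poly f \<Longrightarrow> jet_poly f' \<Longrightarrow> jet_poly (\<lambda>z. f z * f' z)"
| agree: "jet_poly f \<Longrightarrow> \<forall>z\<in>Z. f' z = f z \<Longrightarrow> jet_poly f'"

lemma jet_poly_differentiable:
  "jet_poly f \<Longrightarrow> z \<in> Z \<Longrightarrow> f differentiable (at z)"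
proof (induction rule: jet_poly.induct)
  case (jet c a b p q)
  then show ?case using h_has_derivative differentiable_def by blast
next
  case (agree f f')
  then obtain D where "(f has_derivative D) (at z)" by (auto simp: differentiable_def)
  then have "(f' has_derivative D) (at z)"
    by (rule has_derivative_transform_within_open[OF _ open_Z]) (use agree in auto)
  then show ?case by (auto simp: differentiable_def)
qed auto

lemma jet_poly_has_derivative:
  "jet_poly f \<Longrightarrow> z \<in> Z \<Longrightarrow> (f has_derivative frechet_derivative f (at z)) (at z)"
  using jet_poly_differentiable by (simp add: frechet_derivative_works[symmetric])

text \<open>Turns a component formula valid on all of \<open>Z\<close> into a formula for its
  partial derivatives; the families \<open>pd_g\<close>, \<open>pd_levi_civita\<close> and
  \<open>pd_weyl\<close> arise in this way.\<close>

lemma pd_eqI: "\<forall>w\<in>Z. f w = F w \<Longrightarrow> z \<in> Z \<Longrightarrow> pd i f z = pd i F z"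
  by (rule pd_cong[OF open_Z]) auto

lemma pd_const: "pd i (\<lambda>z. c) z = 0"
  by (simp add: pd_def)

lemma pd_add:
  "jet_poly f \<Longrightarrow> jet_poly f' \<Longrightarrow> z \<in> Z \<Longrightarrow> pd i (\<lambda>z. f z + f' z) z = pd i f z + pd i f' z"
  using pd_has_derivative[OF has_derivative_add[OF jet_poly_has_derivative jet_poly_has_derivative]]
  by (simp add: pd_def)

lemma pd_mult:
  "jet_poly f \<Longrightarrow> jet_poly f' \<Longrightarrow> z \<in> Z \<Longrightarrow> pd i (\<lambda>z. f z * f' z) z = pd i f z * f' z + f z * pd i f' z"
  using pd_has_derivative[OF has_derivative_mult[OF jet_poly_has_derivative jet_poly_has_derivative]]
  by (simp add: pd_def)

lemma jet_poly_minus: "jet_poly f \<Longrightarrow> jet_poly (\<lambda>z. - f z)"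
  using jet_poly.mult[OF jet_poly.const[of "-1"]] by simp

lemma jet_poly_diff: "jet_poly f \<Longrightarrow> jet_poly f' \<Longrightarrow> jet_poly (\<lambda>z. f z - f' z)"
  using jet_poly.add[OF _ jet_poly_minus] by simp

lemma jet_poly_sum: "(\<And>i. i \<in> I \<Longrightarrow> jet_poly (f i)) \<Longrightarrow> jet_poly (\<lambda>z. \<Sum>i\<in>I. f i z)"
  by (induction I rule: infinite_finite_induct) (auto intro: jet_poly.add jet_poly.const)

lemma jet_poly_divide: "jet_poly f \<Longrightarrow> jet_poly (\<lambda>z. f z / c)"
  using jet_poly.mult[OF _ jet_poly.const[of "1 / c"]] by simp

lemma pd_minus: "jet_poly f \<Longrightarrow> z \<in> Z \<Longrightarrow> pd i (\<lambda>z. - f z) z = - pd i f z"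
  using pd_mult[OF jet_poly.const[of "-1"]] by (simp add: pd_const)

lemma pd_diff:
  "jet_poly f \<Longrightarrow> jet_poly f' \<Longrightarrow> z \<in> Z \<Longrightarrow> pd i (\<lambda>z. f z - f' z) z = pd i f z - pd i f' z"
  using pd_add[OF _ jet_poly_minus] by (simp add: pd_minus)

lemma pd_divide: "jet_poly f \<Longrightarrow> z \<in> Z \<Longrightarrow> pd i (\<lambda>z. f z / c) z = pd i f z / c"
  using pd_mult[OF _ jet_poly.const[of "1 / c"]] by (simp add: pd_const)

lemma pd_jet:
  assumes "z \<in> Z"
  shows "pd X1 (h c a b p q) z = h c (a + 1) b p q z" "pd X2 (h c a b p q) z = h c a (b + 1) p q z"
    "pd Y1 (h c a b p q) z = h c a b (p + 1) q z" "pd Y2 (h c a b p q) z = h c a b p (q + 1) z"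
  by (simp_all add: pd_has_derivative[OF h_has_derivative[OF assms]] axis_idx)

lemma jet_poly_pd: "jet_poly f \<Longrightarrow> jet_poly (pd i f)"
proof (induction rule: jet_poly.induct)
  case (const c)
  then show ?case using jet_poly.const[of 0] by (simp add: pd_const[abs_def])
next
  case (jet c a b p q)
  consider "i = X1" | "i = X2" | "i = Y1" | "i = Y2" using exhaust_idx by blast
  then show ?case
    by cases (auto intro!: jet_poly.agree[OF jet_poly.jet] simp: pd_jet)
next
  case (add f f')
  then show ?case by (auto intro!: jet_poly.agree[OF jet_poly.add[OF add.IH]] simp: pd_add)
next
  case (mult f f')
  then show ?case
    by (auto intro!: jet_poly.agree[OF jet_poly.add[OF jet_poly.mult[OF mult.IH(1) mult.hyps(2)]
          jet_poly.mult[OF mult.hyps(1) mult.IH(2)]]] simp: pd_mult)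
next
  case (agree f f')
  then show ?case by (auto intro!: jet_poly.agree[OF agree.IH] simp: pd_eqI)
qed

lemmas jet_poly_rules = jet_poly.const jet_poly.jet jet_poly.add jet_poly.mult jet_poly_minus
    jet_poly_diff jet_poly_divide
lemmas pd_rules = pd_const pd_add pd_mult pd_minus pd_diff pd_divide pd_jet jet_poly_rules

lemma h_cubic_simps [simp]:
  "h c a b 3 0 z = 0" "h c a b 2 1 z = 0" "h c a b 1 2 z = 0" "h c a b 0 3 z = 0"
  by (simp_all add: h_cubic)

text \<open>In blocks, the inverse of (h, 1; 1, 0) is (0, 1; 1, -h).\<close>

lemma matrix_inv_metric:
  assumes z: "z \<in> Z"
  shows "matrix_inv (g z) = (\<chi> i j.
      if i \<in> {Y1, Y2} \<and> j \<in> {Y1, Y2} then - g z $ (if i = Y1 then X1 else X2) $ (if j = Y1 then X1 else X2)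
      else if i \<in> {X1, X2} \<and> j \<in> {X1, X2} then 0 else g z $ i $ j)" (is "_ = ?B")
proof -
  have "g z ** ?B = mat 1" "?B ** g z = mat 1"
    using z by (simp_all add: vec_eq_iff forall_idx matrix_matrix_mult_def sum_idx mat_def g_components)
  then show ?thesis by (simp add: matrix_inv_unique)
qed

lemma inv_metric_components:
    "\<forall>z\<in>Z. inv_metric g X1 X1 z = 0"
    "\<forall>z\<in>Z. inv_metric g X1 X2 z = 0"
    "\<forall>z\<in>Z. inv_metric g X1 Y1 z = 1"
    "\<forall>z\<in>Z. inv_metric g X1 Y2 z = 0"
    "\<forall>z\<in>Z. inv_metric g X2 X1 z = 0"
    "\<forall>z\<in>Z. inv_metric g X2 X2 z = 0"
    "\<forall>z\<in>Z. inv_metric g X2 Y1 z = 0"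
    "\<forall>z\<in>Z. inv_metric g X2 Y2 z = 1"
    "\<forall>z\<in>Z. inv_metric g Y1 X1 z = 1"
    "\<forall>z\<in>Z. inv_metric g Y1 X2 z = 0"
    "\<forall>z\<in>Z. inv_metric g Y1 Y1 z = - h 0 0 0 0 0 z"
    "\<forall>z\<in>Z. inv_metric g Y1 Y2 z = - h 2 0 0 0 0 z"
    "\<forall>z\<in>Z. inv_metric g Y2 X1 z = 0"
    "\<forall>z\<in>Z. inv_metric g Y2 X2 z = 1"
    "\<forall>z\<in>Z. inv_metric g Y2 Y1 z = - h 2 0 0 0 0 z"
    "\<forall>z\<in>Z. inv_metric g Y2 Y2 z = - h 1 0 0 0 0 z"
  by (simp_all add: matrix_inv_metric g_components)

section \<open>Levi-Civita connection and curvature\<close>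

lemmas pd_g = g_components[THEN pd_eqI]
lemmas g_at = g_components[THEN bspec]
lemmas inv_at = inv_metric_components[THEN bspec]

lemma levi_civita_components:
    "\<forall>z\<in>Z. levi_civita g X1 X1 X1 z = - 1/2 * h 0 0 0 1 0 z"
    "\<forall>z\<in>Z. levi_civita g X1 X1 X2 z = - 1/2 * h 0 0 0 0 1 z"
    "\<forall>z\<in>Z. levi_civita g X1 X1 Y1 z = 1/2 * h 0 0 0 0 0 z * h 0 0 0 1 0 z + 1/2 * h 0 0 0 0 1 z * h 2 0
        0 0 0 z + 1/2 * h 0 1 0 0 0 z"
    "\<forall>z\<in>Z. levi_civita g X1 X1 Y2 z = 1/2 * h 0 0 0 0 1 z * h 1 0 0 0 0 z + 1/2 * h 0 0 0 1 0 z * h 2 0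
        0 0 0 z - 1/2 * h 0 0 1 0 0 z + h 2 1 0 0 0 z"
    "\<forall>z\<in>Z. levi_civita g X1 X2 X1 z = - 1/2 * h 2 0 0 1 0 z"
    "\<forall>z\<in>Z. levi_civita g X1 X2 X2 z = - 1/2 * h 2 0 0 0 1 z"
    "\<forall>z\<in>Z. levi_civita g X1 X2 Y1 z = 1/2 * h 0 0 0 0 0 z * h 2 0 0 1 0 z + 1/2 * h 0 0 1 0 0 z + 1/2 *
        h 2 0 0 0 0 z * h 2 0 0 0 1 z"
    "\<forall>z\<in>Z. levi_civita g X1 X2 Y2 z = 1/2 * h 1 0 0 0 0 z * h 2 0 0 0 1 z + 1/2 * h 1 1 0 0 0 z + 1/2 *
        h 2 0 0 0 0 z * h 2 0 0 1 0 z"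
    "\<forall>z\<in>Z. levi_civita g X1 Y1 X1 z = 0"
    "\<forall>z\<in>Z. levi_civita g X1 Y1 X2 z = 0"
    "\<forall>z\<in>Z. levi_civita g X1 Y1 Y1 z = 1/2 * h 0 0 0 1 0 z"
    "\<forall>z\<in>Z. levi_civita g X1 Y1 Y2 z = 1/2 * h 2 0 0 1 0 z"
    "\<forall>z\<in>Z. levi_civita g X1 Y2 X1 z = 0"
    "\<forall>z\<in>Z. levi_civita g X1 Y2 X2 z = 0"
    "\<forall>z\<in>Z. levi_civita g X1 Y2 Y1 z = 1/2 * h 0 0 0 0 1 z"
    "\<forall>z\<in>Z. levi_civita g X1 Y2 Y2 z = 1/2 * h 2 0 0 0 1 z"
    "\<forall>z\<in>Z. levi_civita g X2 X1 X1 z = - 1/2 * h 2 0 0 1 0 z"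
    "\<forall>z\<in>Z. levi_civita g X2 X1 X2 z = - 1/2 * h 2 0 0 0 1 z"
    "\<forall>z\<in>Z. levi_civita g X2 X1 Y1 z = 1/2 * h 0 0 0 0 0 z * h 2 0 0 1 0 z + 1/2 * h 0 0 1 0 0 z + 1/2 *
        h 2 0 0 0 0 z * h 2 0 0 0 1 z"
    "\<forall>z\<in>Z. levi_civita g X2 X1 Y2 z = 1/2 * h 1 0 0 0 0 z * h 2 0 0 0 1 z + 1/2 * h 1 1 0 0 0 z + 1/2 *
        h 2 0 0 0 0 z * h 2 0 0 1 0 z"
    "\<forall>z\<in>Z. levi_civita g X2 X2 X1 z = - 1/2 * h 1 0 0 1 0 z"
    "\<forall>z\<in>Z. levi_civita g X2 X2 X2 z = - 1/2 * h 1 0 0 0 1 z"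
    "\<forall>z\<in>Z. levi_civita g X2 X2 Y1 z = 1/2 * h 0 0 0 0 0 z * h 1 0 0 1 0 z + 1/2 * h 1 0 0 0 1 z * h 2 0
        0 0 0 z - 1/2 * h 1 1 0 0 0 z + h 2 0 1 0 0 z"
    "\<forall>z\<in>Z. levi_civita g X2 X2 Y2 z = 1/2 * h 1 0 0 0 0 z * h 1 0 0 0 1 z + 1/2 * h 1 0 0 1 0 z * h 2 0
        0 0 0 z + 1/2 * h 1 0 1 0 0 z"
    "\<forall>z\<in>Z. levi_civita g X2 Y1 X1 z = 0"
    "\<forall>z\<in>Z. levi_civita g X2 Y1 X2 z = 0"
    "\<forall>z\<in>Z. levi_civita g X2 Y1 Y1 z = 1/2 * h 2 0 0 1 0 z"
    "\<forall>z\<in>Z. levi_civita g X2 Y1 Y2 z = 1/2 * h 1 0 0 1 0 z"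
    "\<forall>z\<in>Z. levi_civita g X2 Y2 X1 z = 0"
    "\<forall>z\<in>Z. levi_civita g X2 Y2 X2 z = 0"
    "\<forall>z\<in>Z. levi_civita g X2 Y2 Y1 z = 1/2 * h 2 0 0 0 1 z"
    "\<forall>z\<in>Z. levi_civita g X2 Y2 Y2 z = 1/2 * h 1 0 0 0 1 z"
    "\<forall>z\<in>Z. levi_civita g Y1 X1 X1 z = 0"
    "\<forall>z\<in>Z. levi_civita g Y1 X1 X2 z = 0"
    "\<forall>z\<in>Z. levi_civita g Y1 X1 Y1 z = 1/2 * h 0 0 0 1 0 z"
    "\<forall>z\<in>Z. levi_civita g Y1 X1 Y2 z = 1/2 * h 2 0 0 1 0 z"
    "\<forall>z\<in>Z. levi_civita g Y1 X2 X1 z = 0"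
    "\<forall>z\<in>Z. levi_civita g Y1 X2 X2 z = 0"
    "\<forall>z\<in>Z. levi_civita g Y1 X2 Y1 z = 1/2 * h 2 0 0 1 0 z"
    "\<forall>z\<in>Z. levi_civita g Y1 X2 Y2 z = 1/2 * h 1 0 0 1 0 z"
    "\<forall>z\<in>Z. levi_civita g Y1 Y1 X1 z = 0"
    "\<forall>z\<in>Z. levi_civita g Y1 Y1 X2 z = 0"
    "\<forall>z\<in>Z. levi_civita g Y1 Y1 Y1 z = 0"
    "\<forall>z\<in>Z. levi_civita g Y1 Y1 Y2 z = 0"
    "\<forall>z\<in>Z. levi_civita g Y1 Y2 X1 z = 0"
    "\<forall>z\<in>Z. levi_civita g Y1 Y2 X2 z = 0"
    "\<forall>z\<in>Z. levi_civita g Y1 Y2 Y1 z = 0"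
    "\<forall>z\<in>Z. levi_civita g Y1 Y2 Y2 z = 0"
    "\<forall>z\<in>Z. levi_civita g Y2 X1 X1 z = 0"
    "\<forall>z\<in>Z. levi_civita g Y2 X1 X2 z = 0"
    "\<forall>z\<in>Z. levi_civita g Y2 X1 Y1 z = 1/2 * h 0 0 0 0 1 z"
    "\<forall>z\<in>Z. levi_civita g Y2 X1 Y2 z = 1/2 * h 2 0 0 0 1 z"
    "\<forall>z\<in>Z. levi_civita g Y2 X2 X1 z = 0"
    "\<forall>z\<in>Z. levi_civita g Y2 X2 X2 z = 0"
    "\<forall>z\<in>Z. levi_civita g Y2 X2 Y1 z = 1/2 * h 2 0 0 0 1 z"
    "\<forall>z\<in>Z. levi_civita g Y2 X2 Y2 z = 1/2 * h 1 0 0 0 1 z"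
    "\<forall>z\<in>Z. levi_civita g Y2 Y1 X1 z = 0"
    "\<forall>z\<in>Z. levi_civita g Y2 Y1 X2 z = 0"
    "\<forall>z\<in>Z. levi_civita g Y2 Y1 Y1 z = 0"
    "\<forall>z\<in>Z. levi_civita g Y2 Y1 Y2 z = 0"
    "\<forall>z\<in>Z. levi_civita g Y2 Y2 X1 z = 0"
    "\<forall>z\<in>Z. levi_civita g Y2 Y2 X2 z = 0"
    "\<forall>z\<in>Z. levi_civita g Y2 Y2 Y1 z = 0"
    "\<forall>z\<in>Z. levi_civita g Y2 Y2 Y2 z = 0"
  by (simp_all add: levi_civita_def sum_idx inv_at pd_g pd_rules)

lemmas pd_levi_civita = levi_civita_components[THEN pd_eqI]
lemmas levi_civita_at = levi_civita_components[THEN bspec]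

text \<open>The metric and its inverse consist mostly of zeros and ones. Removing these first leaves
  short polynomial identities for \<open>algebra\<close>.\<close>

lemma ring_units:
  fixes a :: real
  shows "0 * a = 0" "a * 0 = 0" "1 * a = a" "a * 1 = a" "0 + a = a" "a + 0 = a" "a - 0 = a" "0 - a = - a"
    "- (0::real) = 0" "0 / a = 0"
  by simp_all

lemma jet_index: "(0::nat) + 1 = 1" "(1::nat) + 1 = 2" "(2::nat) + 1 = 3" "(3::nat) + 1 = 4"
  by simp_all

lemma riemann_antisym: "riemann g j i k l z = - riemann g i j k l z"
  unfolding riemann_def sum_negf[symmetric] by (rule sum.cong) (auto simp: sum_subtractf algebra_simps)

lemma riemann_components:
    "\<forall>z\<in>Z. riemann g X1 X2 X1 X2 z = - 1/4 * h 0 0 0 0 0 z * h 0 0 0 1 0 z * h 1 0 0 1 0 z + 1/4 * h 0 0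
        0 0 0 z * h 2 0 0 1 0 z * h 2 0 0 1 0 z - 1/4 * h 0 0 0 0 1 z * h 1 0 0 0 0 z * h 1 0 0 0 1 z - 1/4
        * h 0 0 0 0 1 z * h 1 0 0 1 0 z * h 2 0 0 0 0 z - 1/4 * h 0 0 0 0 1 z * h 1 0 1 0 0 z - 1/4 * h 0 0
        0 1 0 z * h 1 0 0 0 1 z * h 2 0 0 0 0 z + 1/4 * h 0 0 0 1 0 z * h 1 1 0 0 0 z - 1/2 * h 0 0 0 1 0 z
        * h 2 0 1 0 0 z + 1/4 * h 0 0 1 0 0 z * h 1 0 0 0 1 z + 1/2 * h 0 0 1 0 0 z * h 2 0 0 1 0 z + 1/2 *
        h 0 0 2 0 0 z - 1/4 * h 0 1 0 0 0 z * h 1 0 0 1 0 z + 1/4 * h 1 0 0 0 0 z * h 2 0 0 0 1 z * h 2 0 0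
        0 1 z - 1/2 * h 1 0 0 0 1 z * h 2 1 0 0 0 z + 1/2 * h 1 1 0 0 0 z * h 2 0 0 0 1 z + 1/2 * h 1 2 0 0
        0 z + 1/2 * h 2 0 0 0 0 z * h 2 0 0 0 1 z * h 2 0 0 1 0 z - h 2 1 1 0 0 z"
    "\<forall>z\<in>Z. riemann g X1 X2 X1 Y1 z = - 1/4 * h 0 0 0 0 1 z * h 1 0 0 1 0 z + 1/2 * h 0 0 1 1 0 z + 1/4 *
        h 2 0 0 0 1 z * h 2 0 0 1 0 z - 1/2 * h 2 1 0 1 0 z"
    "\<forall>z\<in>Z. riemann g X1 X2 X1 Y2 z = - 1/4 * h 0 0 0 0 1 z * h 1 0 0 0 1 z + 1/4 * h 0 0 0 0 1 z * h 2 0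
        0 1 0 z - 1/4 * h 0 0 0 1 0 z * h 2 0 0 0 1 z + 1/2 * h 0 0 1 0 1 z + 1/4 * h 2 0 0 0 1 z * h 2 0 0
        0 1 z - 1/2 * h 2 1 0 0 1 z"
    "\<forall>z\<in>Z. riemann g X1 X2 X2 Y1 z = 1/4 * h 0 0 0 1 0 z * h 1 0 0 1 0 z + 1/4 * h 1 0 0 0 1 z * h 2 0 0
        1 0 z - 1/4 * h 1 0 0 1 0 z * h 2 0 0 0 1 z - 1/2 * h 1 1 0 1 0 z - 1/4 * h 2 0 0 1 0 z * h 2 0 0 1
        0 z + 1/2 * h 2 0 1 1 0 z"
    "\<forall>z\<in>Z. riemann g X1 X2 X2 Y2 z = 1/4 * h 0 0 0 0 1 z * h 1 0 0 1 0 z - 1/2 * h 1 1 0 0 1 z - 1/4 * h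
        2 0 0 0 1 z * h 2 0 0 1 0 z + 1/2 * h 2 0 1 0 1 z"
    "\<forall>z\<in>Z. riemann g X1 X2 Y1 Y2 z = 0"
    "\<forall>z\<in>Z. riemann g X1 Y1 X1 X2 z = - 1/4 * h 0 0 0 0 1 z * h 1 0 0 1 0 z + 1/2 * h 0 0 1 1 0 z + 1/4 *
        h 2 0 0 0 1 z * h 2 0 0 1 0 z - 1/2 * h 2 1 0 1 0 z"
    "\<forall>z\<in>Z. riemann g X1 Y1 X1 Y1 z = 1/2 * h 0 0 0 2 0 z"
    "\<forall>z\<in>Z. riemann g X1 Y1 X1 Y2 z = 1/2 * h 0 0 0 1 1 z"
    "\<forall>z\<in>Z. riemann g X1 Y1 X2 Y1 z = 1/2 * h 2 0 0 2 0 z"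
    "\<forall>z\<in>Z. riemann g X1 Y1 X2 Y2 z = 1/2 * h 2 0 0 1 1 z"
    "\<forall>z\<in>Z. riemann g X1 Y1 Y1 Y2 z = 0"
    "\<forall>z\<in>Z. riemann g X1 Y2 X1 X2 z = - 1/4 * h 0 0 0 0 1 z * h 1 0 0 0 1 z + 1/4 * h 0 0 0 0 1 z * h 2 0
        0 1 0 z - 1/4 * h 0 0 0 1 0 z * h 2 0 0 0 1 z + 1/2 * h 0 0 1 0 1 z + 1/4 * h 2 0 0 0 1 z * h 2 0 0
        0 1 z - 1/2 * h 2 1 0 0 1 z"
    "\<forall>z\<in>Z. riemann g X1 Y2 X1 Y1 z = 1/2 * h 0 0 0 1 1 z"
    "\<forall>z\<in>Z. riemann g X1 Y2 X1 Y2 z = 1/2 * h 0 0 0 0 2 z"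
    "\<forall>z\<in>Z. riemann g X1 Y2 X2 Y1 z = 1/2 * h 2 0 0 1 1 z"
    "\<forall>z\<in>Z. riemann g X1 Y2 X2 Y2 z = 1/2 * h 2 0 0 0 2 z"
    "\<forall>z\<in>Z. riemann g X1 Y2 Y1 Y2 z = 0"
    "\<forall>z\<in>Z. riemann g X2 Y1 X1 X2 z = 1/4 * h 0 0 0 1 0 z * h 1 0 0 1 0 z + 1/4 * h 1 0 0 0 1 z * h 2 0 0
        1 0 z - 1/4 * h 1 0 0 1 0 z * h 2 0 0 0 1 z - 1/2 * h 1 1 0 1 0 z - 1/4 * h 2 0 0 1 0 z * h 2 0 0 1
        0 z + 1/2 * h 2 0 1 1 0 z"
    "\<forall>z\<in>Z. riemann g X2 Y1 X1 Y1 z = 1/2 * h 2 0 0 2 0 z"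
    "\<forall>z\<in>Z. riemann g X2 Y1 X1 Y2 z = 1/2 * h 2 0 0 1 1 z"
    "\<forall>z\<in>Z. riemann g X2 Y1 X2 Y1 z = 1/2 * h 1 0 0 2 0 z"
    "\<forall>z\<in>Z. riemann g X2 Y1 X2 Y2 z = 1/2 * h 1 0 0 1 1 z"
    "\<forall>z\<in>Z. riemann g X2 Y1 Y1 Y2 z = 0"
    "\<forall>z\<in>Z. riemann g X2 Y2 X1 X2 z = 1/4 * h 0 0 0 0 1 z * h 1 0 0 1 0 z - 1/2 * h 1 1 0 0 1 z - 1/4 * h
        2 0 0 0 1 z * h 2 0 0 1 0 z + 1/2 * h 2 0 1 0 1 z"
    "\<forall>z\<in>Z. riemann g X2 Y2 X1 Y1 z = 1/2 * h 2 0 0 1 1 z"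
    "\<forall>z\<in>Z. riemann g X2 Y2 X1 Y2 z = 1/2 * h 2 0 0 0 2 z"
    "\<forall>z\<in>Z. riemann g X2 Y2 X2 Y1 z = 1/2 * h 1 0 0 1 1 z"
    "\<forall>z\<in>Z. riemann g X2 Y2 X2 Y2 z = 1/2 * h 1 0 0 0 2 z"
    "\<forall>z\<in>Z. riemann g X2 Y2 Y1 Y2 z = 0"
    "\<forall>z\<in>Z. riemann g Y1 Y2 X1 X2 z = 0"
    "\<forall>z\<in>Z. riemann g Y1 Y2 X1 Y1 z = 0"
    "\<forall>z\<in>Z. riemann g Y1 Y2 X1 Y2 z = 0"
    "\<forall>z\<in>Z. riemann g Y1 Y2 X2 Y1 z = 0"
    "\<forall>z\<in>Z. riemann g Y1 Y2 X2 Y2 z = 0"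
    "\<forall>z\<in>Z. riemann g Y1 Y2 Y1 Y2 z = 0"
  by (intro ballI, simp only: riemann_def sum_idx levi_civita_at g_at pd_levi_civita pd_rules
      ring_units jet_index h_cubic_simps; algebra)+

text \<open>Unlike the antisymmetry in the first pair, this is not visible in the definition: it
  reflects that the connection preserves the metric. Here it is checked for each choice of
  indices.\<close>

lemma riemann_antisym':
  assumes "z \<in> Z"
  shows "riemann g i j l k z = - riemann g i j k l z"
proof -
  have "\<forall>i j k l. riemann g i j l k z + riemann g i j k l z = 0"
    unfolding forall_idx
    by (intro conjI; simp only: assms riemann_def sum_idx levi_civita_at g_at pd_levi_civita pd_rules
      ring_units jet_index h_cubic_simps; algebra)
  then show ?thesis by (simp add: eq_neg_iff_add_eq_0)
qed

lemma riemann_diag: "riemann g i i k l z = 0" "z \<in> Z \<Longrightarrow> riemann g i j k k z = 0"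
  using riemann_antisym[of i i k l z] riemann_antisym'[of z i j k k] by simp_all

text \<open>Each instance is oriented towards the index order X1, X2, Y1, Y2, so rewriting
  terminates and the component list needs only increasing pairs.\<close>

lemmas riemann_swap =

  riemann_antisym[of X2 X1]
  riemann_antisym[of Y1 X1]
  riemann_antisym[of Y2 X1]
  riemann_antisym[of Y1 X2]
  riemann_antisym[of Y2 X2]
  riemann_antisym[of Y2 Y1]
  riemann_antisym'[where l = X2 and k = X1]
  riemann_antisym'[where l = Y1 and k = X1]
  riemann_antisym'[where l = Y2 and k = X1]
  riemann_antisym'[where l = Y1 and k = X2]
  riemann_antisym'[where l = Y2 and k = X2]
  riemann_antisym'[where l = Y2 and k = Y1]

lemmas riemann_at = riemann_components[THEN bspec] riemann_diag riemann_swap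

lemma ricci_components:
    "\<forall>z\<in>Z. ricci g X1 X1 z = 1/2 * h 0 0 0 0 0 z * h 0 0 0 2 0 z + 1/2 * h 0 0 0 0 1 z * h 1 0 0 0 1 z -
        1/2 * h 0 0 0 0 1 z * h 2 0 0 1 0 z + 1/2 * h 0 0 0 0 2 z * h 1 0 0 0 0 z + 1/2 * h 0 0 0 1 0 z * h
        2 0 0 0 1 z + h 0 0 0 1 1 z * h 2 0 0 0 0 z - h 0 0 1 0 1 z - 1/2 * h 2 0 0 0 1 z * h 2 0 0 0 1 z +
        h 2 1 0 0 1 z"
    "\<forall>z\<in>Z. ricci g X1 X2 z = 1/2 * h 0 0 0 0 0 z * h 2 0 0 2 0 z - 1/2 * h 0 0 0 0 1 z * h 1 0 0 1 0 z +
        1/2 * h 0 0 1 1 0 z + 1/2 * h 1 0 0 0 0 z * h 2 0 0 0 2 z + 1/2 * h 1 1 0 0 1 z + h 2 0 0 0 0 z * h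
        2 0 0 1 1 z + 1/2 * h 2 0 0 0 1 z * h 2 0 0 1 0 z - 1/2 * h 2 0 1 0 1 z - 1/2 * h 2 1 0 1 0 z"
    "\<forall>z\<in>Z. ricci g X1 Y1 z = 1/2 * h 0 0 0 2 0 z + 1/2 * h 2 0 0 1 1 z"
    "\<forall>z\<in>Z. ricci g X1 Y2 z = 1/2 * h 0 0 0 1 1 z + 1/2 * h 2 0 0 0 2 z"
    "\<forall>z\<in>Z. ricci g X2 X1 z = 1/2 * h 0 0 0 0 0 z * h 2 0 0 2 0 z - 1/2 * h 0 0 0 0 1 z * h 1 0 0 1 0 z +
        1/2 * h 0 0 1 1 0 z + 1/2 * h 1 0 0 0 0 z * h 2 0 0 0 2 z + 1/2 * h 1 1 0 0 1 z + h 2 0 0 0 0 z * h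
        2 0 0 1 1 z + 1/2 * h 2 0 0 0 1 z * h 2 0 0 1 0 z - 1/2 * h 2 0 1 0 1 z - 1/2 * h 2 1 0 1 0 z"
    "\<forall>z\<in>Z. ricci g X2 X2 z = 1/2 * h 0 0 0 0 0 z * h 1 0 0 2 0 z + 1/2 * h 0 0 0 1 0 z * h 1 0 0 1 0 z +
        1/2 * h 1 0 0 0 0 z * h 1 0 0 0 2 z + 1/2 * h 1 0 0 0 1 z * h 2 0 0 1 0 z - 1/2 * h 1 0 0 1 0 z * h
        2 0 0 0 1 z + h 1 0 0 1 1 z * h 2 0 0 0 0 z - h 1 1 0 1 0 z - 1/2 * h 2 0 0 1 0 z * h 2 0 0 1 0 z +
        h 2 0 1 1 0 z"
    "\<forall>z\<in>Z. ricci g X2 Y1 z = 1/2 * h 1 0 0 1 1 z + 1/2 * h 2 0 0 2 0 z"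
    "\<forall>z\<in>Z. ricci g X2 Y2 z = 1/2 * h 1 0 0 0 2 z + 1/2 * h 2 0 0 1 1 z"
    "\<forall>z\<in>Z. ricci g Y1 X1 z = 1/2 * h 0 0 0 2 0 z + 1/2 * h 2 0 0 1 1 z"
    "\<forall>z\<in>Z. ricci g Y1 X2 z = 1/2 * h 1 0 0 1 1 z + 1/2 * h 2 0 0 2 0 z"
    "\<forall>z\<in>Z. ricci g Y1 Y1 z = 0"
    "\<forall>z\<in>Z. ricci g Y1 Y2 z = 0"
    "\<forall>z\<in>Z. ricci g Y2 X1 z = 1/2 * h 0 0 0 1 1 z + 1/2 * h 2 0 0 0 2 z"
    "\<forall>z\<in>Z. ricci g Y2 X2 z = 1/2 * h 1 0 0 0 2 z + 1/2 * h 2 0 0 1 1 z"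
    "\<forall>z\<in>Z. ricci g Y2 Y1 z = 0"
    "\<forall>z\<in>Z. ricci g Y2 Y2 z = 0"
  by (intro ballI, simp only: ricci_def sum_idx inv_at riemann_at ring_units; algebra)+

lemmas ricci_at = ricci_components[THEN bspec]

lemma scalar_curvature_eq:
    "\<forall>z\<in>Z. scalar_curvature g z = h 0 0 0 2 0 z + h 1 0 0 0 2 z + 2 * h 2 0 0 1 1 z"
  by (intro ballI, simp only: scalar_curvature_def sum_idx inv_at ricci_at ring_units; algebra)

section \<open>The Weyl tensor of a Walker metric\<close>

lemma weyl_antisym: "weyl g j i k l z = - weyl g i j k l z"
  unfolding weyl_def by (subst riemann_antisym) (simp add: field_simps)

lemma weyl_antisym': "z \<in> Z \<Longrightarrow> weyl g i j l k z = - weyl g i j k l z"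
  unfolding weyl_def by (subst riemann_antisym') (simp_all add: field_simps)

lemma weyl_diag: "weyl g i i k l z = 0" "z \<in> Z \<Longrightarrow> weyl g i j k k z = 0"
  using weyl_antisym[of i i k l z] weyl_antisym'[of z i j k k] by simp_all

text \<open>The definition with the numerical factors of dimension four, 1/(n - 2) = 1/2 and 1/((n -
  1)(n - 2)) = 1/6.\<close>

lemma weyl_eq:
  "weyl g i j k l z = riemann g i j k l z
     - 1/2 * (ricci g j k z * g z $ i $ l + g z $ j $ k * ricci g i l z
        - ricci g i k z * g z $ j $ l - g z $ i $ k * ricci g j l z)
     + 1/6 * (scalar_curvature g z * (g z $ j $ k * g z $ i $ l - g z $ i $ k * g z $ j $ l))"
  by (simp add: weyl_def)

lemma weyl_components:
    "\<forall>z\<in>Z. weyl g X1 X2 X1 X2 z = 1/4 * h 0 0 0 0 0 z * h 0 0 0 0 0 z * h 1 0 0 2 0 z + 1/12 * h 0 0 0 0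
        0 z * h 0 0 0 2 0 z * h 1 0 0 0 0 z + 1/12 * h 0 0 0 0 0 z * h 1 0 0 0 0 z * h 1 0 0 0 2 z - 1/3 * h
        0 0 0 0 0 z * h 1 0 0 0 0 z * h 2 0 0 1 1 z + 1/4 * h 0 0 0 0 0 z * h 1 0 0 0 1 z * h 2 0 0 1 0 z -
        1/4 * h 0 0 0 0 0 z * h 1 0 0 1 0 z * h 2 0 0 0 1 z + 1/2 * h 0 0 0 0 0 z * h 1 0 0 1 1 z * h 2 0 0
        0 0 z - 1/2 * h 0 0 0 0 0 z * h 1 1 0 1 0 z - 1/2 * h 0 0 0 0 0 z * h 2 0 0 0 0 z * h 2 0 0 2 0 z +
        1/2 * h 0 0 0 0 0 z * h 2 0 1 1 0 z - 1/4 * h 0 0 0 0 1 z * h 1 0 0 0 0 z * h 2 0 0 1 0 z + 1/4 * h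
        0 0 0 0 1 z * h 1 0 0 1 0 z * h 2 0 0 0 0 z - 1/4 * h 0 0 0 0 1 z * h 1 0 1 0 0 z + 1/4 * h 0 0 0 0
        2 z * h 1 0 0 0 0 z * h 1 0 0 0 0 z + 1/4 * h 0 0 0 1 0 z * h 1 0 0 0 0 z * h 2 0 0 0 1 z - 1/4 * h
        0 0 0 1 0 z * h 1 0 0 0 1 z * h 2 0 0 0 0 z + 1/4 * h 0 0 0 1 0 z * h 1 1 0 0 0 z - 1/2 * h 0 0 0 1
        0 z * h 2 0 1 0 0 z + 1/2 * h 0 0 0 1 1 z * h 1 0 0 0 0 z * h 2 0 0 0 0 z + 1/6 * h 0 0 0 2 0 z * h
        2 0 0 0 0 z * h 2 0 0 0 0 z + 1/4 * h 0 0 1 0 0 z * h 1 0 0 0 1 z + 1/2 * h 0 0 1 0 0 z * h 2 0 0 1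
        0 z - 1/2 * h 0 0 1 0 1 z * h 1 0 0 0 0 z - 1/2 * h 0 0 1 1 0 z * h 2 0 0 0 0 z + 1/2 * h 0 0 2 0 0
        z - 1/4 * h 0 1 0 0 0 z * h 1 0 0 1 0 z - 1/2 * h 1 0 0 0 0 z * h 2 0 0 0 0 z * h 2 0 0 0 2 z + 1/2
        * h 1 0 0 0 0 z * h 2 1 0 0 1 z - 1/2 * h 1 0 0 0 1 z * h 2 1 0 0 0 z + 1/6 * h 1 0 0 0 2 z * h 2 0
        0 0 0 z * h 2 0 0 0 0 z + 1/2 * h 1 1 0 0 0 z * h 2 0 0 0 1 z - 1/2 * h 1 1 0 0 1 z * h 2 0 0 0 0 z
        + 1/2 * h 1 2 0 0 0 z - 2/3 * h 2 0 0 0 0 z * h 2 0 0 0 0 z * h 2 0 0 1 1 z + 1/2 * h 2 0 0 0 0 z *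
        h 2 0 1 0 1 z + 1/2 * h 2 0 0 0 0 z * h 2 1 0 1 0 z - h 2 1 1 0 0 z"
    "\<forall>z\<in>Z. weyl g X1 X2 X1 Y1 z = 1/4 * h 0 0 0 0 0 z * h 1 0 0 1 1 z - 1/12 * h 0 0 0 2 0 z * h 2 0 0 0
        0 z + 1/4 * h 0 0 1 1 0 z - 1/4 * h 1 0 0 0 0 z * h 2 0 0 0 2 z + 1/6 * h 1 0 0 0 2 z * h 2 0 0 0 0
        z - 1/4 * h 1 1 0 0 1 z - 5/12 * h 2 0 0 0 0 z * h 2 0 0 1 1 z + 1/4 * h 2 0 1 0 1 z - 1/4 * h 2 1 0
        1 0 z"
    "\<forall>z\<in>Z. weyl g X1 X2 X1 Y2 z = 1/12 * h 0 0 0 0 0 z * h 0 0 0 2 0 z + 1/12 * h 0 0 0 0 0 z * h 1 0 0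
        0 2 z - 1/12 * h 0 0 0 0 0 z * h 2 0 0 1 1 z + 1/4 * h 0 0 0 0 2 z * h 1 0 0 0 0 z + 1/4 * h 0 0 0 1
        1 z * h 2 0 0 0 0 z - 1/4 * h 2 0 0 0 0 z * h 2 0 0 0 2 z"
    "\<forall>z\<in>Z. weyl g X1 X2 X2 Y1 z = - 1/4 * h 0 0 0 0 0 z * h 1 0 0 2 0 z - 1/12 * h 0 0 0 2 0 z * h 1 0 0
        0 0 z - 1/12 * h 1 0 0 0 0 z * h 1 0 0 0 2 z + 1/12 * h 1 0 0 0 0 z * h 2 0 0 1 1 z - 1/4 * h 1 0 0
        1 1 z * h 2 0 0 0 0 z + 1/4 * h 2 0 0 0 0 z * h 2 0 0 2 0 z"
    "\<forall>z\<in>Z. weyl g X1 X2 X2 Y2 z = 1/4 * h 0 0 0 0 0 z * h 2 0 0 2 0 z - 1/4 * h 0 0 0 1 1 z * h 1 0 0 0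
        0 z - 1/6 * h 0 0 0 2 0 z * h 2 0 0 0 0 z + 1/4 * h 0 0 1 1 0 z + 1/12 * h 1 0 0 0 2 z * h 2 0 0 0 0
        z - 1/4 * h 1 1 0 0 1 z + 5/12 * h 2 0 0 0 0 z * h 2 0 0 1 1 z + 1/4 * h 2 0 1 0 1 z - 1/4 * h 2 1 0
        1 0 z"
    "\<forall>z\<in>Z. weyl g X1 X2 Y1 Y2 z = 1/12 * h 0 0 0 2 0 z + 1/12 * h 1 0 0 0 2 z + 1/6 * h 2 0 0 1 1 z"
    "\<forall>z\<in>Z. weyl g X1 Y1 X1 X2 z = 1/4 * h 0 0 0 0 0 z * h 1 0 0 1 1 z - 1/12 * h 0 0 0 2 0 z * h 2 0 0 0
        0 z + 1/4 * h 0 0 1 1 0 z - 1/4 * h 1 0 0 0 0 z * h 2 0 0 0 2 z + 1/6 * h 1 0 0 0 2 z * h 2 0 0 0 0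
        z - 1/4 * h 1 1 0 0 1 z - 5/12 * h 2 0 0 0 0 z * h 2 0 0 1 1 z + 1/4 * h 2 0 1 0 1 z - 1/4 * h 2 1 0
        1 0 z"
    "\<forall>z\<in>Z. weyl g X1 Y1 X1 Y1 z = 1/6 * h 0 0 0 2 0 z + 1/6 * h 1 0 0 0 2 z - 1/6 * h 2 0 0 1 1 z"
    "\<forall>z\<in>Z. weyl g X1 Y1 X1 Y2 z = 1/4 * h 0 0 0 1 1 z - 1/4 * h 2 0 0 0 2 z"
    "\<forall>z\<in>Z. weyl g X1 Y1 X2 Y1 z = - 1/4 * h 1 0 0 1 1 z + 1/4 * h 2 0 0 2 0 z"
    "\<forall>z\<in>Z. weyl g X1 Y1 X2 Y2 z = 1/2 * h 2 0 0 1 1 z"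
    "\<forall>z\<in>Z. weyl g X1 Y1 Y1 Y2 z = 0"
    "\<forall>z\<in>Z. weyl g X1 Y2 X1 X2 z = 1/12 * h 0 0 0 0 0 z * h 0 0 0 2 0 z + 1/12 * h 0 0 0 0 0 z * h 1 0 0
        0 2 z - 1/12 * h 0 0 0 0 0 z * h 2 0 0 1 1 z + 1/4 * h 0 0 0 0 2 z * h 1 0 0 0 0 z + 1/4 * h 0 0 0 1
        1 z * h 2 0 0 0 0 z - 1/4 * h 2 0 0 0 0 z * h 2 0 0 0 2 z"
    "\<forall>z\<in>Z. weyl g X1 Y2 X1 Y1 z = 1/4 * h 0 0 0 1 1 z - 1/4 * h 2 0 0 0 2 z"
    "\<forall>z\<in>Z. weyl g X1 Y2 X1 Y2 z = 1/2 * h 0 0 0 0 2 z"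
    "\<forall>z\<in>Z. weyl g X1 Y2 X2 Y1 z = - 1/12 * h 0 0 0 2 0 z - 1/12 * h 1 0 0 0 2 z + 1/3 * h 2 0 0 1 1 z"
    "\<forall>z\<in>Z. weyl g X1 Y2 X2 Y2 z = - 1/4 * h 0 0 0 1 1 z + 1/4 * h 2 0 0 0 2 z"
    "\<forall>z\<in>Z. weyl g X1 Y2 Y1 Y2 z = 0"
    "\<forall>z\<in>Z. weyl g X2 Y1 X1 X2 z = - 1/4 * h 0 0 0 0 0 z * h 1 0 0 2 0 z - 1/12 * h 0 0 0 2 0 z * h 1 0 0
        0 0 z - 1/12 * h 1 0 0 0 0 z * h 1 0 0 0 2 z + 1/12 * h 1 0 0 0 0 z * h 2 0 0 1 1 z - 1/4 * h 1 0 0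
        1 1 z * h 2 0 0 0 0 z + 1/4 * h 2 0 0 0 0 z * h 2 0 0 2 0 z"
    "\<forall>z\<in>Z. weyl g X2 Y1 X1 Y1 z = - 1/4 * h 1 0 0 1 1 z + 1/4 * h 2 0 0 2 0 z"
    "\<forall>z\<in>Z. weyl g X2 Y1 X1 Y2 z = - 1/12 * h 0 0 0 2 0 z - 1/12 * h 1 0 0 0 2 z + 1/3 * h 2 0 0 1 1 z"
    "\<forall>z\<in>Z. weyl g X2 Y1 X2 Y1 z = 1/2 * h 1 0 0 2 0 z"
    "\<forall>z\<in>Z. weyl g X2 Y1 X2 Y2 z = 1/4 * h 1 0 0 1 1 z - 1/4 * h 2 0 0 2 0 z"
    "\<forall>z\<in>Z. weyl g X2 Y1 Y1 Y2 z = 0"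
    "\<forall>z\<in>Z. weyl g X2 Y2 X1 X2 z = 1/4 * h 0 0 0 0 0 z * h 2 0 0 2 0 z - 1/4 * h 0 0 0 1 1 z * h 1 0 0 0
        0 z - 1/6 * h 0 0 0 2 0 z * h 2 0 0 0 0 z + 1/4 * h 0 0 1 1 0 z + 1/12 * h 1 0 0 0 2 z * h 2 0 0 0 0
        z - 1/4 * h 1 1 0 0 1 z + 5/12 * h 2 0 0 0 0 z * h 2 0 0 1 1 z + 1/4 * h 2 0 1 0 1 z - 1/4 * h 2 1 0
        1 0 z"
    "\<forall>z\<in>Z. weyl g X2 Y2 X1 Y1 z = 1/2 * h 2 0 0 1 1 z"
    "\<forall>z\<in>Z. weyl g X2 Y2 X1 Y2 z = - 1/4 * h 0 0 0 1 1 z + 1/4 * h 2 0 0 0 2 z"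
    "\<forall>z\<in>Z. weyl g X2 Y2 X2 Y1 z = 1/4 * h 1 0 0 1 1 z - 1/4 * h 2 0 0 2 0 z"
    "\<forall>z\<in>Z. weyl g X2 Y2 X2 Y2 z = 1/6 * h 0 0 0 2 0 z + 1/6 * h 1 0 0 0 2 z - 1/6 * h 2 0 0 1 1 z"
    "\<forall>z\<in>Z. weyl g X2 Y2 Y1 Y2 z = 0"
    "\<forall>z\<in>Z. weyl g Y1 Y2 X1 X2 z = 1/12 * h 0 0 0 2 0 z + 1/12 * h 1 0 0 0 2 z + 1/6 * h 2 0 0 1 1 z"
    "\<forall>z\<in>Z. weyl g Y1 Y2 X1 Y1 z = 0"
    "\<forall>z\<in>Z. weyl g Y1 Y2 X1 Y2 z = 0"
    "\<forall>z\<in>Z. weyl g Y1 Y2 X2 Y1 z = 0"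
    "\<forall>z\<in>Z. weyl g Y1 Y2 X2 Y2 z = 0"
    "\<forall>z\<in>Z. weyl g Y1 Y2 Y1 Y2 z = 0"
  by (intro ballI, simp only: weyl_eq g_at riemann_at ricci_at scalar_curvature_eq[THEN bspec]
      ring_units; algebra)+

lemmas weyl_swap =

  weyl_antisym[where j = X2 and i = X1]
  weyl_antisym[where j = Y1 and i = X1]
  weyl_antisym[where j = Y2 and i = X1]
  weyl_antisym[where j = Y1 and i = X2]
  weyl_antisym[where j = Y2 and i = X2]
  weyl_antisym[where j = Y2 and i = Y1]
  weyl_antisym'[where l = X2 and k = X1]
  weyl_antisym'[where l = Y1 and k = X1]
  weyl_antisym'[where l = Y2 and k = X1]
  weyl_antisym'[where l = Y1 and k = X2]
  weyl_antisym'[where l = Y2 and k = X2]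
  weyl_antisym'[where l = Y2 and k = Y1]

lemmas weyl_at = weyl_components[THEN bspec] weyl_diag weyl_swap

lemma jet_polyI: "\<forall>z\<in>Z. f' z = f z \<Longrightarrow> jet_poly f \<Longrightarrow> jet_poly f'"
  by (rule jet_poly.agree)

lemma jet_poly_metric: "jet_poly (\<lambda>z. g z $ i $ j)" "jet_poly (inv_metric g i j)"
proof -
  have "\<forall>i j. jet_poly (\<lambda>z. g z $ i $ j)" "\<forall>i j. jet_poly (inv_metric g i j)"
    by (simp_all add: forall_idx jet_poly_rules
        g_components[THEN jet_polyI] inv_metric_components[THEN jet_polyI])
  then show "jet_poly (\<lambda>z. g z $ i $ j)" "jet_poly (inv_metric g i j)" by auto
qed

lemmas jet_poly_intros = jet_poly_rules jet_poly_sum jet_poly_metric jet_poly_pd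

lemma jet_poly_levi_civita: "jet_poly (levi_civita g i j k)"
  unfolding levi_civita_def[abs_def] by (intro jet_poly_intros)

lemma jet_poly_riemann: "jet_poly (riemann g i j k l)"
  unfolding riemann_def[abs_def] by (intro jet_poly_intros jet_poly_levi_civita)

lemma jet_poly_ricci: "jet_poly (ricci g i j)"
  unfolding ricci_def[abs_def] by (intro jet_poly_intros jet_poly_riemann)

lemma jet_poly_scalar_curvature: "jet_poly (scalar_curvature g)"
  unfolding scalar_curvature_def[abs_def] by (intro jet_poly_intros jet_poly_ricci)

lemma jet_poly_weyl: "jet_poly (weyl g i j k l)"
  unfolding weyl_def[abs_def]
  by (intro jet_poly_intros jet_poly_riemann jet_poly_ricci jet_poly_scalar_curvature)

lemma jet_poly_cov_deriv_weyl: "jet_poly (cov_deriv g (weyl_tensor g) [b, k, i, j, l])"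
  unfolding cov_deriv_4[abs_def] weyl_tensor_def
  by (simp add: numeral_2_eq_2 numeral_3_eq_3)
     (intro jet_poly_intros jet_poly_levi_civita jet_poly_weyl)

text \<open>The metric is parallel, so contraction commutes with the second covariant derivative.\<close>

lemma contracted_cov_deriv:
  assumes z: "z \<in> Z"
  shows "(\<Sum>l\<in>UNIV. \<Sum>b\<in>UNIV. inv_metric g l b z * cov_deriv g (cov_deriv g (weyl_tensor g)) [a, b, k, i,
      j, l] z) =
    pd a (weyl_div g k i j) z - (\<Sum>n\<in>UNIV. levi_civita g a k n z * weyl_div g n i j z +
      levi_civita g a i n z * weyl_div g k n j z + levi_civita g a j n z * weyl_div g k i n z)"
proof -
  define S where "S b k i j l = cov_deriv g (weyl_tensor g) [b, k, i, j, l]" for b k i j l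
  have [simp]: "jet_poly (S b k i j l)" for b k i j l
    unfolding S_def by (rule jet_poly_cov_deriv_weyl)
  have div: "\<forall>z\<in>Z. weyl_div g k i j z = S Y1 k i j X1 z + S X1 k i j Y1 z + S Y2 k i j X2 z + S X2 k i j
      Y2 z
      - h 0 0 0 0 0 z * S Y1 k i j Y1 z - h 1 0 0 0 0 z * S Y2 k i j Y2 z
      - h 2 0 0 0 0 z * (S Y1 k i j Y2 z + S Y2 k i j Y1 z)" for k i j
    by (simp add: weyl_div_def S_def[symmetric] sum_idx inv_at algebra_simps)
  have jp: "jet_poly (S b k i j l)" for b k i j l by simp
  have "\<forall>a. (\<Sum>l\<in>UNIV. \<Sum>b\<in>UNIV. inv_metric g l b z * cov_deriv g (cov_deriv g (weyl_tensor g)) [a, b, k,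
      i, j, l] z) =
    pd a (weyl_div g k i j) z - (\<Sum>n\<in>UNIV. levi_civita g a k n z * weyl_div g n i j z +
      levi_civita g a i n z * weyl_div g k n j z + levi_civita g a j n z * weyl_div g k i n z)"
    unfolding forall_idx
    \<comment> \<open>The derivatives of the coefficients h in \<open>div\<close> cancel the
      connection terms that belong to the two contracted indices b and l; the terms for k, i and j
      remain.\<close>
    by (intro conjI; simp only: z cov_deriv_5 S_def[symmetric] sum_idx inv_at levi_civita_at div[THEN bspec]
        pd_eqI[OF div] pd_rules jp jet_index ring_units; algebra)
  then show ?thesis by blast
qed

lemma bach_eq_div:
  assumes z: "z \<in> Z"
  shows "bach g i j z = (\<Sum>k\<in>UNIV. \<Sum>a\<in>UNIV. inv_metric g k a z * (pd a (weyl_div g k i j) z -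
      (\<Sum>n\<in>UNIV. levi_civita g a k n z * weyl_div g n i j z +
      levi_civita g a i n z * weyl_div g k n j z + levi_civita g a j n z * weyl_div g k i n z)))
     + 1/2 * (\<Sum>k\<in>UNIV. \<Sum>l\<in>UNIV. \<Sum>a\<in>UNIV. \<Sum>b\<in>UNIV.
        inv_metric g k a z * inv_metric g l b z * ricci g a b z * weyl g k i j l z)"
proof -
  have "(\<Sum>k\<in>UNIV. \<Sum>l\<in>UNIV. \<Sum>a\<in>UNIV. \<Sum>b\<in>UNIV. inv_metric g k a z * inv_metric g l b z *
        cov_deriv g (cov_deriv g (weyl_tensor g)) [a, b, k, i, j, l] z) =
    (\<Sum>k\<in>UNIV. \<Sum>a\<in>UNIV. inv_metric g k a z * (\<Sum>l\<in>UNIV. \<Sum>b\<in>UNIV. inv_metric g l b z *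
        cov_deriv g (cov_deriv g (weyl_tensor g)) [a, b, k, i, j, l] z))"
    unfolding sum_distrib_left
    by (rule sum.cong[OF refl], subst sum.swap) (simp add: mult.assoc)
  then show ?thesis unfolding bach_def contracted_cov_deriv[OF z] by simp
qed

section \<open>Divergence of the Weyl tensor\<close>

lemmas pd_weyl = weyl_components[THEN pd_eqI]

lemma pd_eq_minus: "\<forall>w\<in>Z. f w = - F w \<Longrightarrow> jet_poly F \<Longrightarrow> z \<in> Z \<Longrightarrow> pd b f z = - pd b F z"
  using pd_eqI[of f "\<lambda>w. - F w"] pd_minus[of F] by simp

lemma pd_weyl_antisym: "z \<in> Z \<Longrightarrow> pd b (weyl g j i k l) z = - pd b (weyl g i j k l) z"
  by (rule pd_eq_minus[OF _ jet_poly_weyl]) (intro ballI weyl_antisym)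

lemma pd_weyl_antisym': "z \<in> Z \<Longrightarrow> pd b (weyl g i j l k) z = - pd b (weyl g i j k l) z"
  by (rule pd_eq_minus[OF _ jet_poly_weyl]) (intro ballI weyl_antisym')

lemma pd_weyl_diag: "z \<in> Z \<Longrightarrow> pd b (weyl g i i k l) z = 0" "z \<in> Z \<Longrightarrow> pd b (weyl g i j k k) z = 0"
  using pd_weyl_antisym[of z b i i k l] pd_weyl_antisym'[of z b i j k k] by simp_all

lemmas pd_weyl_swap =

  pd_weyl_antisym[where j = X2 and i = X1]
  pd_weyl_antisym[where j = Y1 and i = X1]
  pd_weyl_antisym[where j = Y2 and i = X1]
  pd_weyl_antisym[where j = Y1 and i = X2]
  pd_weyl_antisym[where j = Y2 and i = X2]
  pd_weyl_antisym[where j = Y2 and i = Y1]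
  pd_weyl_antisym'[where l = X2 and k = X1]
  pd_weyl_antisym'[where l = Y1 and k = X1]
  pd_weyl_antisym'[where l = Y2 and k = X1]
  pd_weyl_antisym'[where l = Y1 and k = X2]
  pd_weyl_antisym'[where l = Y2 and k = X2]
  pd_weyl_antisym'[where l = Y2 and k = Y1]

lemmas pd_weyl_at = pd_weyl pd_weyl_diag pd_weyl_swap

lemma weyl_tensor_4: "weyl_tensor g [k, i, j, l] = weyl g k i j l"
  by (simp add: weyl_tensor_def numeral_2_eq_2 numeral_3_eq_3)

lemma weyl_div_components:
    "\<forall>z\<in>Z. weyl_div g X1 X2 X1 z = 1/8 * h 0 0 0 0 0 z * h 0 0 0 0 1 z * h 1 0 0 2 0 z - 1/8 * h 0 0 0 0
        0 z * h 0 0 0 1 0 z * h 1 0 0 1 1 z - 1/6 * h 0 0 0 0 0 z * h 0 0 1 2 0 z + 1/12 * h 0 0 0 0 0 z * h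
        1 0 1 0 2 z - 1/8 * h 0 0 0 0 0 z * h 2 0 0 0 1 z * h 2 0 0 2 0 z + 1/8 * h 0 0 0 0 0 z * h 2 0 0 1
        0 z * h 2 0 0 1 1 z + 1/6 * h 0 0 0 0 0 z * h 2 0 1 1 1 z + 1/4 * h 0 0 0 0 0 z * h 2 1 0 2 0 z -
        1/8 * h 0 0 0 0 1 z * h 1 0 0 0 0 z * h 2 0 0 1 1 z + 1/8 * h 0 0 0 0 1 z * h 1 0 0 1 1 z * h 2 0 0
        0 0 z - 1/4 * h 0 0 0 0 1 z * h 1 0 1 0 1 z - 1/2 * h 0 0 0 0 1 z * h 1 1 0 1 0 z - 1/8 * h 0 0 0 0
        1 z * h 2 0 0 0 0 z * h 2 0 0 2 0 z + 1/2 * h 0 0 0 0 1 z * h 2 0 1 1 0 z - 1/8 * h 0 0 0 0 2 z * h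
        1 0 0 0 0 z * h 2 0 0 1 0 z - 1/4 * h 0 0 0 0 2 z * h 1 0 1 0 0 z + 1/8 * h 0 0 0 1 0 z * h 0 0 1 1
        0 z + 1/8 * h 0 0 0 1 0 z * h 1 0 0 0 0 z * h 2 0 0 0 2 z - 1/8 * h 0 0 0 1 0 z * h 1 0 0 0 2 z * h
        2 0 0 0 0 z + 1/8 * h 0 0 0 1 0 z * h 1 1 0 0 1 z + 1/8 * h 0 0 0 1 0 z * h 2 0 0 0 0 z * h 2 0 0 1
        1 z - 3/8 * h 0 0 0 1 0 z * h 2 0 1 0 1 z - 1/8 * h 0 0 0 1 0 z * h 2 1 0 1 0 z + 1/8 * h 0 0 0 1 1
        z * h 1 0 0 0 0 z * h 2 0 0 0 1 z + 1/8 * h 0 0 0 1 1 z * h 1 1 0 0 0 z - 1/8 * h 0 0 0 1 1 z * h 2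
        0 0 0 0 z * h 2 0 0 1 0 z - 1/2 * h 0 0 0 1 1 z * h 2 0 1 0 0 z - 1/8 * h 0 0 0 2 0 z * h 0 0 1 0 0
        z + 1/8 * h 0 0 0 2 0 z * h 2 0 0 0 0 z * h 2 0 0 0 1 z + 1/8 * h 0 0 1 0 0 z * h 1 0 0 0 2 z + 1/4
        * h 0 0 1 0 0 z * h 2 0 0 1 1 z - 1/4 * h 0 0 1 0 1 z * h 1 0 0 0 1 z + 1/2 * h 0 0 1 0 1 z * h 2 0
        0 1 0 z - 1/4 * h 0 0 1 0 2 z * h 1 0 0 0 0 z - 3/8 * h 0 0 1 1 0 z * h 2 0 0 0 1 z - 1/2 * h 0 0 1
        1 1 z * h 2 0 0 0 0 z + 1/2 * h 0 0 2 0 1 z - 1/8 * h 0 1 0 0 0 z * h 1 0 0 1 1 z + 1/8 * h 0 1 0 0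
        0 z * h 2 0 0 2 0 z - 1/4 * h 0 1 0 0 1 z * h 1 0 0 1 0 z - 1/12 * h 0 1 0 2 0 z * h 2 0 0 0 0 z +
        1/4 * h 0 1 1 1 0 z + 1/4 * h 1 0 0 0 0 z * h 2 1 0 0 2 z - 1/4 * h 1 0 0 0 2 z * h 2 1 0 0 0 z +
        3/8 * h 1 1 0 0 0 z * h 2 0 0 0 2 z - 1/8 * h 1 1 0 0 1 z * h 2 0 0 0 1 z - 1/12 * h 1 1 0 0 2 z * h
        2 0 0 0 0 z + 1/4 * h 1 2 0 0 1 z - 1/8 * h 2 0 0 0 0 z * h 2 0 0 0 1 z * h 2 0 0 1 1 z + 1/8 * h 2
        0 0 0 0 z * h 2 0 0 0 2 z * h 2 0 0 1 0 z + 1/3 * h 2 0 0 0 0 z * h 2 1 0 1 1 z + 5/8 * h 2 0 0 0 1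
        z * h 2 0 1 0 1 z + 3/8 * h 2 0 0 0 1 z * h 2 1 0 1 0 z + 1/4 * h 2 0 0 1 1 z * h 2 1 0 0 0 z - 3/4
        * h 2 1 1 0 1 z - 1/4 * h 2 2 0 1 0 z"
    "\<forall>z\<in>Z. weyl_div g X1 X2 X2 z = - 1/8 * h 0 0 0 0 0 z * h 1 0 0 0 1 z * h 2 0 0 2 0 z + 1/8 * h 0 0 0
        0 0 z * h 1 0 0 1 0 z * h 2 0 0 1 1 z - 1/8 * h 0 0 0 0 0 z * h 1 0 0 1 1 z * h 2 0 0 1 0 z + 1/8 *
        h 0 0 0 0 0 z * h 1 0 0 2 0 z * h 2 0 0 0 1 z + 1/4 * h 0 0 0 0 0 z * h 1 1 0 2 0 z - 1/4 * h 0 0 0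
        0 0 z * h 2 0 1 2 0 z + 1/4 * h 0 0 0 0 1 z * h 1 0 1 1 0 z - 1/8 * h 0 0 0 0 2 z * h 1 0 0 0 0 z *
        h 1 0 0 1 0 z + 1/4 * h 0 0 0 1 0 z * h 1 1 0 1 0 z + 1/8 * h 0 0 0 1 1 z * h 1 0 0 0 0 z * h 1 0 0
        0 1 z - 1/8 * h 0 0 0 1 1 z * h 1 0 0 1 0 z * h 2 0 0 0 0 z + 1/8 * h 0 0 0 1 1 z * h 1 0 1 0 0 z +
        1/8 * h 0 0 0 2 0 z * h 1 0 0 0 1 z * h 2 0 0 0 0 z - 1/8 * h 0 0 0 2 0 z * h 1 1 0 0 0 z + 1/4 * h
        0 0 0 2 0 z * h 2 0 1 0 0 z - 1/8 * h 0 0 1 0 0 z * h 1 0 0 1 1 z - 3/8 * h 0 0 1 0 0 z * h 2 0 0 2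
        0 z + 1/2 * h 0 0 1 0 1 z * h 1 0 0 1 0 z - 1/8 * h 0 0 1 1 0 z * h 1 0 0 0 1 z + 1/8 * h 0 0 1 1 0
        z * h 2 0 0 1 0 z + 1/12 * h 0 0 1 2 0 z * h 2 0 0 0 0 z - 1/4 * h 0 0 2 1 0 z + 1/4 * h 0 1 0 0 0 z
        * h 1 0 0 2 0 z + 1/4 * h 0 1 0 1 0 z * h 1 0 0 1 0 z - 1/12 * h 0 1 0 2 0 z * h 1 0 0 0 0 z + 1/6 *
        h 1 0 0 0 0 z * h 1 1 0 0 2 z - 1/8 * h 1 0 0 0 0 z * h 2 0 0 0 1 z * h 2 0 0 1 1 z + 1/8 * h 1 0 0
        0 0 z * h 2 0 0 0 2 z * h 2 0 0 1 0 z - 1/4 * h 1 0 0 0 0 z * h 2 0 1 0 2 z - 1/6 * h 1 0 0 0 0 z *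
        h 2 1 0 1 1 z - 1/8 * h 1 0 0 0 1 z * h 1 1 0 0 1 z - 1/8 * h 1 0 0 0 1 z * h 2 0 0 0 0 z * h 2 0 0
        1 1 z + 1/8 * h 1 0 0 0 1 z * h 2 0 1 0 1 z + 3/8 * h 1 0 0 0 1 z * h 2 1 0 1 0 z + 1/8 * h 1 0 0 0
        2 z * h 1 1 0 0 0 z - 1/8 * h 1 0 0 0 2 z * h 2 0 0 0 0 z * h 2 0 0 1 0 z + 1/8 * h 1 0 0 1 0 z * h
        2 0 0 0 0 z * h 2 0 0 0 2 z - 1/2 * h 1 0 0 1 0 z * h 2 1 0 0 1 z + 1/8 * h 1 0 0 1 1 z * h 2 0 0 0
        0 z * h 2 0 0 0 1 z + 1/2 * h 1 0 0 1 1 z * h 2 1 0 0 0 z - 1/8 * h 1 0 1 0 0 z * h 2 0 0 0 2 z +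
        1/12 * h 1 0 1 0 2 z * h 2 0 0 0 0 z - 1/4 * h 1 1 0 0 0 z * h 2 0 0 1 1 z + 3/8 * h 1 1 0 0 1 z * h
        2 0 0 1 0 z - 1/2 * h 1 1 0 1 0 z * h 2 0 0 0 1 z + 1/2 * h 1 1 0 1 1 z * h 2 0 0 0 0 z - 1/4 * h 1
        1 1 0 1 z - 1/2 * h 1 2 0 1 0 z - 1/8 * h 2 0 0 0 0 z * h 2 0 0 0 1 z * h 2 0 0 2 0 z + 1/8 * h 2 0
        0 0 0 z * h 2 0 0 1 0 z * h 2 0 0 1 1 z - 1/3 * h 2 0 0 0 0 z * h 2 0 1 1 1 z - 3/8 * h 2 0 0 1 0 z
        * h 2 0 1 0 1 z - 5/8 * h 2 0 0 1 0 z * h 2 1 0 1 0 z - 1/4 * h 2 0 0 1 1 z * h 2 0 1 0 0 z + 1/4 *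
        h 2 0 2 0 1 z + 3/4 * h 2 1 1 1 0 z"
    "\<forall>z\<in>Z. weyl_div g X1 X2 Y1 z = - 1/8 * h 0 0 0 1 0 z * h 1 0 0 1 1 z - 1/8 * h 0 0 0 1 0 z * h 2 0 0
        2 0 z + 1/8 * h 0 0 0 1 1 z * h 1 0 0 1 0 z + 1/8 * h 0 0 0 2 0 z * h 2 0 0 1 0 z - 1/6 * h 0 0 1 2
        0 z - 1/8 * h 1 0 0 0 2 z * h 2 0 0 1 0 z + 1/8 * h 1 0 0 1 0 z * h 2 0 0 0 2 z + 1/12 * h 1 0 1 0 2
        z + 1/4 * h 1 1 0 1 1 z - 1/12 * h 2 0 1 1 1 z + 1/4 * h 2 1 0 2 0 z"
    "\<forall>z\<in>Z. weyl_div g X1 X2 Y2 z = - 1/8 * h 0 0 0 0 1 z * h 1 0 0 1 1 z - 1/8 * h 0 0 0 0 1 z * h 2 0 0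
        2 0 z + 1/8 * h 0 0 0 1 1 z * h 1 0 0 0 1 z + 1/8 * h 0 0 0 2 0 z * h 2 0 0 0 1 z - 1/4 * h 0 0 1 1
        1 z - 1/12 * h 0 1 0 2 0 z + 1/8 * h 1 0 0 0 1 z * h 2 0 0 0 2 z - 1/8 * h 1 0 0 0 2 z * h 2 0 0 0 1
        z + 1/6 * h 1 1 0 0 2 z - 1/4 * h 2 0 1 0 2 z + 1/12 * h 2 1 0 1 1 z"
    "\<forall>z\<in>Z. weyl_div g X1 Y1 X1 z = - 1/8 * h 0 0 0 0 1 z * h 1 0 0 1 1 z + 3/8 * h 0 0 0 0 1 z * h 2 0 0
        2 0 z - 1/4 * h 0 0 0 0 2 z * h 1 0 0 1 0 z - 1/4 * h 0 0 0 1 1 z * h 1 0 0 0 1 z - 1/8 * h 0 0 0 1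
        1 z * h 2 0 0 1 0 z - 1/4 * h 0 0 0 2 0 z * h 2 0 0 0 1 z + 1/2 * h 0 0 1 1 1 z + 1/6 * h 0 1 0 2 0
        z - 1/12 * h 1 1 0 0 2 z + 1/2 * h 2 0 0 0 1 z * h 2 0 0 1 1 z + 1/8 * h 2 0 0 0 2 z * h 2 0 0 1 0 z
        - 5/12 * h 2 1 0 1 1 z"
    "\<forall>z\<in>Z. weyl_div g X1 Y1 X2 z = 1/4 * h 0 0 0 0 1 z * h 1 0 0 2 0 z - 1/4 * h 0 0 0 1 0 z * h 2 0 0 2
        0 z + 3/8 * h 0 0 0 1 1 z * h 1 0 0 1 0 z + 1/4 * h 0 0 0 2 0 z * h 2 0 0 1 0 z - 1/4 * h 0 0 1 2 0
        z - 1/8 * h 1 0 0 1 0 z * h 2 0 0 0 2 z + 1/8 * h 1 0 0 1 1 z * h 2 0 0 0 1 z - 1/8 * h 2 0 0 0 1 z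
        * h 2 0 0 2 0 z - 1/2 * h 2 0 0 1 0 z * h 2 0 0 1 1 z + 1/4 * h 2 0 1 1 1 z + 1/2 * h 2 1 0 2 0 z"
    "\<forall>z\<in>Z. weyl_div g X1 Y1 Y1 z = 0"
    "\<forall>z\<in>Z. weyl_div g X1 Y1 Y2 z = 0"
    "\<forall>z\<in>Z. weyl_div g X1 Y2 X1 z = - 1/8 * h 0 0 0 0 1 z * h 0 0 0 2 0 z - 1/8 * h 0 0 0 0 1 z * h 1 0 0
        0 2 z + 1/2 * h 0 0 0 0 1 z * h 2 0 0 1 1 z - 1/2 * h 0 0 0 0 2 z * h 1 0 0 0 1 z + 1/4 * h 0 0 0 0
        2 z * h 2 0 0 1 0 z + 1/8 * h 0 0 0 1 0 z * h 0 0 0 1 1 z - 1/8 * h 0 0 0 1 0 z * h 2 0 0 0 2 z -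
        5/8 * h 0 0 0 1 1 z * h 2 0 0 0 1 z + 1/2 * h 0 0 1 0 2 z + 1/4 * h 0 1 0 1 1 z + 5/8 * h 2 0 0 0 1
        z * h 2 0 0 0 2 z - 1/4 * h 2 1 0 0 2 z"
    "\<forall>z\<in>Z. weyl_div g X1 Y2 X2 z = 1/4 * h 0 0 0 0 1 z * h 1 0 0 1 1 z - 1/4 * h 0 0 0 0 1 z * h 2 0 0 2
        0 z + 1/4 * h 0 0 0 0 2 z * h 1 0 0 1 0 z + 1/8 * h 0 0 0 1 1 z * h 1 0 0 0 1 z + 1/8 * h 0 0 0 1 1
        z * h 2 0 0 1 0 z + 1/8 * h 0 0 0 2 0 z * h 2 0 0 0 1 z - 1/4 * h 0 0 1 1 1 z - 1/12 * h 0 1 0 2 0 z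
        - 1/8 * h 1 0 0 0 1 z * h 2 0 0 0 2 z + 1/8 * h 1 0 0 0 2 z * h 2 0 0 0 1 z - 1/12 * h 1 1 0 0 2 z -
        1/2 * h 2 0 0 0 1 z * h 2 0 0 1 1 z - 1/8 * h 2 0 0 0 2 z * h 2 0 0 1 0 z + 1/4 * h 2 0 1 0 2 z +
        1/3 * h 2 1 0 1 1 z"
    "\<forall>z\<in>Z. weyl_div g X1 Y2 Y1 z = 0"
    "\<forall>z\<in>Z. weyl_div g X1 Y2 Y2 z = 0"
    "\<forall>z\<in>Z. weyl_div g X2 Y1 X1 z = 1/4 * h 0 0 0 0 1 z * h 1 0 0 2 0 z + 1/8 * h 0 0 0 1 0 z * h 1 0 0 1
        1 z - 1/8 * h 0 0 0 1 0 z * h 2 0 0 2 0 z + 1/4 * h 0 0 0 1 1 z * h 1 0 0 1 0 z + 1/8 * h 0 0 0 2 0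
        z * h 2 0 0 1 0 z - 1/12 * h 0 0 1 2 0 z + 1/8 * h 1 0 0 0 2 z * h 2 0 0 1 0 z - 1/4 * h 1 0 0 1 0 z
        * h 2 0 0 0 2 z + 1/8 * h 1 0 0 1 1 z * h 2 0 0 0 1 z - 1/12 * h 1 0 1 0 2 z - 1/4 * h 1 1 0 1 1 z -
        1/8 * h 2 0 0 0 1 z * h 2 0 0 2 0 z - 1/2 * h 2 0 0 1 0 z * h 2 0 0 1 1 z + 1/3 * h 2 0 1 1 1 z +
        1/4 * h 2 1 0 2 0 z"
    "\<forall>z\<in>Z. weyl_div g X2 Y1 X2 z = - 1/2 * h 0 0 0 1 0 z * h 1 0 0 2 0 z - 1/8 * h 0 0 0 2 0 z * h 1 0 0
        1 0 z + 1/8 * h 1 0 0 0 1 z * h 1 0 0 1 1 z - 1/8 * h 1 0 0 0 1 z * h 2 0 0 2 0 z - 1/8 * h 1 0 0 0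
        2 z * h 1 0 0 1 0 z + 1/2 * h 1 0 0 1 0 z * h 2 0 0 1 1 z - 5/8 * h 1 0 0 1 1 z * h 2 0 0 1 0 z +
        1/4 * h 1 0 0 2 0 z * h 2 0 0 0 1 z + 1/4 * h 1 0 1 1 1 z + 1/2 * h 1 1 0 2 0 z + 5/8 * h 2 0 0 1 0
        z * h 2 0 0 2 0 z - 1/4 * h 2 0 1 2 0 z"
    "\<forall>z\<in>Z. weyl_div g X2 Y1 Y1 z = 0"
    "\<forall>z\<in>Z. weyl_div g X2 Y1 Y2 z = 0"
    "\<forall>z\<in>Z. weyl_div g X2 Y2 X1 z = 3/8 * h 0 0 0 0 1 z * h 1 0 0 1 1 z - 1/8 * h 0 0 0 0 1 z * h 2 0 0 2
        0 z + 1/4 * h 0 0 0 0 2 z * h 1 0 0 1 0 z + 1/8 * h 0 0 0 1 1 z * h 2 0 0 1 0 z - 1/4 * h 1 0 0 0 1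
        z * h 2 0 0 0 2 z + 1/4 * h 1 0 0 0 2 z * h 2 0 0 0 1 z - 1/4 * h 1 1 0 0 2 z - 1/2 * h 2 0 0 0 1 z
        * h 2 0 0 1 1 z - 1/8 * h 2 0 0 0 2 z * h 2 0 0 1 0 z + 1/2 * h 2 0 1 0 2 z + 1/4 * h 2 1 0 1 1 z"
    "\<forall>z\<in>Z. weyl_div g X2 Y2 X2 z = - 1/4 * h 0 0 0 0 1 z * h 1 0 0 2 0 z - 1/4 * h 0 0 0 1 0 z * h 1 0 0
        1 1 z - 1/8 * h 0 0 0 1 1 z * h 1 0 0 1 0 z - 1/12 * h 0 0 1 2 0 z - 1/4 * h 1 0 0 0 2 z * h 2 0 0 1
        0 z + 3/8 * h 1 0 0 1 0 z * h 2 0 0 0 2 z - 1/8 * h 1 0 0 1 1 z * h 2 0 0 0 1 z + 1/6 * h 1 0 1 0 2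
        z + 1/2 * h 1 1 0 1 1 z + 1/8 * h 2 0 0 0 1 z * h 2 0 0 2 0 z + 1/2 * h 2 0 0 1 0 z * h 2 0 0 1 1 z
        - 5/12 * h 2 0 1 1 1 z"
    "\<forall>z\<in>Z. weyl_div g X2 Y2 Y1 z = 0"
    "\<forall>z\<in>Z. weyl_div g X2 Y2 Y2 z = 0"
    "\<forall>z\<in>Z. weyl_div g Y1 Y2 X1 z = 0"
    "\<forall>z\<in>Z. weyl_div g Y1 Y2 X2 z = 0"
    "\<forall>z\<in>Z. weyl_div g Y1 Y2 Y1 z = 0"
    "\<forall>z\<in>Z. weyl_div g Y1 Y2 Y2 z = 0"
  by (intro ballI, simp only: weyl_div_def cov_deriv_4 weyl_tensor_4 sum_idx inv_at weyl_at pd_weyl_at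
      levi_civita_at pd_rules ring_units jet_index h_cubic_simps; algebra)+

lemma weyl_div_antisym:
  assumes "z \<in> Z"
  shows "weyl_div g i k j z = - weyl_div g k i j z"
proof -
  have "\<forall>k i j. weyl_div g i k j z + weyl_div g k i j z = 0"
    unfolding forall_idx
    by (intro conjI; simp only: assms weyl_div_def cov_deriv_4 weyl_tensor_4 sum_idx inv_at weyl_at
        pd_weyl_at
      levi_civita_at pd_rules ring_units jet_index h_cubic_simps; algebra)
  then show ?thesis by (simp add: eq_neg_iff_add_eq_0)
qed

lemma weyl_div_diag: "z \<in> Z \<Longrightarrow> weyl_div g i i j z = 0"
  using weyl_div_antisym[of z i i j] by simp

lemma jet_poly_weyl_div: "jet_poly (weyl_div g k i j)"
  unfolding weyl_div_def[abs_def] by (intro jet_poly_intros jet_poly_cov_deriv_weyl)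

lemma pd_weyl_div_antisym: "z \<in> Z \<Longrightarrow> pd b (weyl_div g i k j) z = - pd b (weyl_div g k i j) z"
  by (rule pd_eq_minus[OF _ jet_poly_weyl_div]) (intro ballI weyl_div_antisym)

lemma pd_weyl_div_diag: "z \<in> Z \<Longrightarrow> pd b (weyl_div g i i j) z = 0"
  using pd_weyl_div_antisym[of z b i i j] by simp

lemmas weyl_div_at = weyl_div_components[THEN bspec] weyl_div_diag

  weyl_div_antisym[where i = X2 and k = X1]
  weyl_div_antisym[where i = Y1 and k = X1]
  weyl_div_antisym[where i = Y2 and k = X1]
  weyl_div_antisym[where i = Y1 and k = X2]
  weyl_div_antisym[where i = Y2 and k = X2]
  weyl_div_antisym[where i = Y2 and k = Y1]

lemmas pd_weyl_div_at = weyl_div_components[THEN pd_eqI] pd_weyl_div_diag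

  pd_weyl_div_antisym[where i = X2 and k = X1]
  pd_weyl_div_antisym[where i = Y1 and k = X1]
  pd_weyl_div_antisym[where i = Y2 and k = X1]
  pd_weyl_div_antisym[where i = Y1 and k = X2]
  pd_weyl_div_antisym[where i = Y2 and k = X2]
  pd_weyl_div_antisym[where i = Y2 and k = Y1]

text \<open>A check on the horizontal components: every term with k factors carries 3 - k
  derivatives in x and k + 1 in y. As each factor is quadratic in y, its degree in y is at most k -
  1, so degree two occurs only without x-derivatives. The mixed components contain only second
  y-derivatives and are constant along the fibres.\<close>

lemma bach_components:
    "\<forall>z\<in>Z. bach g X1 X1 z = - 1/2 * h 0 0 0 0 0 z * h 0 0 0 0 2 z * h 1 0 0 2 0 z - 1/4 * h 0 0 0 0 0 z
        * h 0 0 0 1 1 z * h 1 0 0 1 1 z + 1/4 * h 0 0 0 0 0 z * h 0 0 0 1 1 z * h 2 0 0 2 0 z + 1/24 * h 0 0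
        0 0 0 z * h 0 0 0 2 0 z * h 0 0 0 2 0 z - 1/4 * h 0 0 0 0 0 z * h 0 0 0 2 0 z * h 2 0 0 1 1 z - 1/24
        * h 0 0 0 0 0 z * h 1 0 0 0 2 z * h 1 0 0 0 2 z + 1/12 * h 0 0 0 0 0 z * h 1 0 0 0 2 z * h 2 0 0 1 1
        z - 1/4 * h 0 0 0 0 0 z * h 1 0 0 1 1 z * h 2 0 0 0 2 z + 1/4 * h 0 0 0 0 0 z * h 2 0 0 0 2 z * h 2
        0 0 2 0 z + 1/3 * h 0 0 0 0 0 z * h 2 0 0 1 1 z * h 2 0 0 1 1 z - 1/2 * h 0 0 0 0 1 z * h 0 0 0 0 1
        z * h 1 0 0 2 0 z - 1/4 * h 0 0 0 0 1 z * h 0 0 0 1 1 z * h 1 0 0 1 0 z - 1/6 * h 0 0 0 0 1 z * h 0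
        0 0 2 0 z * h 1 0 0 0 1 z - 1/12 * h 0 0 0 0 1 z * h 0 0 0 2 0 z * h 2 0 0 1 0 z + 5/12 * h 0 0 0 0
        1 z * h 0 0 1 2 0 z - 1/6 * h 0 0 0 0 1 z * h 1 0 0 0 1 z * h 1 0 0 0 2 z + 2/3 * h 0 0 0 0 1 z * h
        1 0 0 0 1 z * h 2 0 0 1 1 z - 1/12 * h 0 0 0 0 1 z * h 1 0 0 0 2 z * h 2 0 0 1 0 z + 1/4 * h 0 0 0 0
        1 z * h 1 0 0 1 0 z * h 2 0 0 0 2 z - h 0 0 0 0 1 z * h 1 0 0 1 1 z * h 2 0 0 0 1 z + 5/12 * h 0 0 0
        0 1 z * h 1 0 1 0 2 z + h 0 0 0 0 1 z * h 1 1 0 1 1 z + h 0 0 0 0 1 z * h 2 0 0 0 1 z * h 2 0 0 2 0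
        z + 1/3 * h 0 0 0 0 1 z * h 2 0 0 1 0 z * h 2 0 0 1 1 z - 5/3 * h 0 0 0 0 1 z * h 2 0 1 1 1 z - h 0
        0 0 0 1 z * h 2 1 0 2 0 z - 1/6 * h 0 0 0 0 2 z * h 0 0 0 2 0 z * h 1 0 0 0 0 z - 2/3 * h 0 0 0 0 2
        z * h 1 0 0 0 0 z * h 1 0 0 0 2 z + 7/6 * h 0 0 0 0 2 z * h 1 0 0 0 0 z * h 2 0 0 1 1 z - 1/2 * h 0
        0 0 0 2 z * h 1 0 0 0 1 z * h 1 0 0 0 1 z + 1/2 * h 0 0 0 0 2 z * h 1 0 0 0 1 z * h 2 0 0 1 0 z -
        1/2 * h 0 0 0 0 2 z * h 1 0 0 1 0 z * h 2 0 0 0 1 z - h 0 0 0 0 2 z * h 1 0 0 1 1 z * h 2 0 0 0 0 z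
        + h 0 0 0 0 2 z * h 1 0 1 0 1 z + h 0 0 0 0 2 z * h 1 1 0 1 0 z + h 0 0 0 0 2 z * h 2 0 0 0 0 z * h
        2 0 0 2 0 z - h 0 0 0 0 2 z * h 2 0 1 1 0 z + 1/4 * h 0 0 0 1 0 z * h 0 0 0 1 1 z * h 1 0 0 0 1 z +
        1/12 * h 0 0 0 1 0 z * h 0 0 0 2 0 z * h 2 0 0 0 1 z - 1/2 * h 0 0 0 1 0 z * h 0 0 1 1 1 z - 1/12 *
        h 0 0 0 1 0 z * h 0 1 0 2 0 z - 1/4 * h 0 0 0 1 0 z * h 1 0 0 0 1 z * h 2 0 0 0 2 z + 1/12 * h 0 0 0
        1 0 z * h 1 0 0 0 2 z * h 2 0 0 0 1 z - 1/12 * h 0 0 0 1 0 z * h 1 1 0 0 2 z - 1/3 * h 0 0 0 1 0 z *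
        h 2 0 0 0 1 z * h 2 0 0 1 1 z + 1/2 * h 0 0 0 1 0 z * h 2 0 1 0 2 z + 1/3 * h 0 0 0 1 0 z * h 2 1 0
        1 1 z + 1/4 * h 0 0 0 1 1 z * h 0 0 0 1 1 z * h 1 0 0 0 0 z + 1/6 * h 0 0 0 1 1 z * h 0 0 0 2 0 z *
        h 2 0 0 0 0 z - 1/2 * h 0 0 0 1 1 z * h 0 0 1 1 0 z - h 0 0 0 1 1 z * h 1 0 0 0 0 z * h 2 0 0 0 2 z
        - h 0 0 0 1 1 z * h 1 0 0 0 1 z * h 2 0 0 0 1 z - 1/3 * h 0 0 0 1 1 z * h 1 0 0 0 2 z * h 2 0 0 0 0
        z - 1/6 * h 0 0 0 1 1 z * h 2 0 0 0 0 z * h 2 0 0 1 1 z + 3/2 * h 0 0 0 1 1 z * h 2 0 1 0 1 z + 1/2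
        * h 0 0 0 1 1 z * h 2 1 0 1 0 z + 1/3 * h 0 0 0 2 0 z * h 0 0 1 0 1 z - 1/2 * h 0 0 0 2 0 z * h 2 0
        0 0 0 z * h 2 0 0 0 2 z - 1/3 * h 0 0 0 2 0 z * h 2 0 0 0 1 z * h 2 0 0 0 1 z + 1/6 * h 0 0 0 2 0 z
        * h 2 1 0 0 1 z + 1/3 * h 0 0 1 0 1 z * h 1 0 0 0 2 z - 4/3 * h 0 0 1 0 1 z * h 2 0 0 1 1 z + 3/2 *
        h 0 0 1 0 2 z * h 1 0 0 0 1 z - h 0 0 1 0 2 z * h 2 0 0 1 0 z + 1/2 * h 0 0 1 1 0 z * h 2 0 0 0 2 z
        + 2 * h 0 0 1 1 1 z * h 2 0 0 0 1 z - h 0 0 2 0 2 z + 1/2 * h 0 1 0 0 1 z * h 1 0 0 1 1 z - 1/2 * h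
        0 1 0 0 1 z * h 2 0 0 2 0 z + 1/2 * h 0 1 0 0 2 z * h 1 0 0 1 0 z + 1/2 * h 0 1 0 1 1 z * h 1 0 0 0
        1 z + 1/2 * h 0 1 0 2 0 z * h 2 0 0 0 1 z - h 0 1 1 1 1 z - 1/6 * h 0 2 0 2 0 z + 3/4 * h 1 0 0 0 0
        z * h 2 0 0 0 2 z * h 2 0 0 0 2 z + h 1 0 0 0 1 z * h 2 0 0 0 1 z * h 2 0 0 0 2 z - 1/2 * h 1 0 0 0
        1 z * h 2 1 0 0 2 z - 1/3 * h 1 0 0 0 2 z * h 2 0 0 0 1 z * h 2 0 0 0 1 z + 1/6 * h 1 0 0 0 2 z * h
        2 1 0 0 1 z + 1/2 * h 1 1 0 0 2 z * h 2 0 0 0 1 z - 1/6 * h 1 2 0 0 2 z + 3/2 * h 2 0 0 0 0 z * h 2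
        0 0 0 2 z * h 2 0 0 1 1 z + 4/3 * h 2 0 0 0 1 z * h 2 0 0 0 1 z * h 2 0 0 1 1 z - 2 * h 2 0 0 0 1 z
        * h 2 0 1 0 2 z - 2 * h 2 0 0 0 1 z * h 2 1 0 1 1 z - 3/2 * h 2 0 0 0 2 z * h 2 0 1 0 1 z - 1/2 * h
        2 0 0 0 2 z * h 2 1 0 1 0 z - 2/3 * h 2 0 0 1 1 z * h 2 1 0 0 1 z + h 2 1 1 0 2 z + 2/3 * h 2 2 0 1
        1 z"
    "\<forall>z\<in>Z. bach g X1 X2 z = 3/4 * h 0 0 0 0 0 z * h 0 0 0 1 1 z * h 1 0 0 2 0 z + 1/12 * h 0 0 0 0 0 z *
        h 0 0 0 2 0 z * h 2 0 0 2 0 z + 1/12 * h 0 0 0 0 0 z * h 1 0 0 0 2 z * h 2 0 0 2 0 z + 1/4 * h 0 0 0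
        0 0 z * h 1 0 0 1 1 z * h 2 0 0 1 1 z - 1/4 * h 0 0 0 0 0 z * h 1 0 0 2 0 z * h 2 0 0 0 2 z - 7/12 *
        h 0 0 0 0 0 z * h 2 0 0 1 1 z * h 2 0 0 2 0 z + 1/2 * h 0 0 0 0 1 z * h 0 0 0 1 0 z * h 1 0 0 2 0 z
        + 1/6 * h 0 0 0 0 1 z * h 0 0 0 2 0 z * h 1 0 0 1 0 z + 1/6 * h 0 0 0 0 1 z * h 1 0 0 0 2 z * h 1 0
        0 1 0 z - 2/3 * h 0 0 0 0 1 z * h 1 0 0 1 0 z * h 2 0 0 1 1 z + 3/4 * h 0 0 0 0 1 z * h 1 0 0 1 1 z
        * h 2 0 0 1 0 z - 3/4 * h 0 0 0 0 1 z * h 1 0 1 1 1 z - h 0 0 0 0 1 z * h 1 1 0 2 0 z - 3/4 * h 0 0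
        0 0 1 z * h 2 0 0 1 0 z * h 2 0 0 2 0 z + 3/4 * h 0 0 0 0 1 z * h 2 0 1 2 0 z + 3/4 * h 0 0 0 0 2 z
        * h 1 0 0 0 0 z * h 1 0 0 1 1 z - 1/4 * h 0 0 0 0 2 z * h 1 0 0 0 0 z * h 2 0 0 2 0 z + 1/2 * h 0 0
        0 0 2 z * h 1 0 0 0 1 z * h 1 0 0 1 0 z + 1/2 * h 0 0 0 0 2 z * h 1 0 0 2 0 z * h 2 0 0 0 0 z - 1/2
        * h 0 0 0 0 2 z * h 1 0 1 1 0 z + 1/4 * h 0 0 0 1 0 z * h 1 0 0 1 1 z * h 2 0 0 0 1 z - 1/4 * h 0 0
        0 1 0 z * h 1 1 0 1 1 z - 1/4 * h 0 0 0 1 0 z * h 2 0 0 0 1 z * h 2 0 0 2 0 z + 1/4 * h 0 0 0 1 0 z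
        * h 2 1 0 2 0 z + 1/4 * h 0 0 0 1 1 z * h 1 0 0 0 0 z * h 2 0 0 1 1 z + 1/4 * h 0 0 0 1 1 z * h 1 0
        0 0 1 z * h 2 0 0 1 0 z + 3/4 * h 0 0 0 1 1 z * h 1 0 0 1 0 z * h 2 0 0 0 1 z + h 0 0 0 1 1 z * h 1
        0 0 1 1 z * h 2 0 0 0 0 z - 1/4 * h 0 0 0 1 1 z * h 1 0 1 0 1 z - 3/4 * h 0 0 0 1 1 z * h 1 1 0 1 0
        z - 1/2 * h 0 0 0 1 1 z * h 2 0 0 0 0 z * h 2 0 0 2 0 z - 1/24 * h 0 0 0 2 0 z * h 0 0 0 2 0 z * h 2
        0 0 0 0 z + 1/12 * h 0 0 0 2 0 z * h 0 0 1 1 0 z + 1/12 * h 0 0 0 2 0 z * h 1 0 0 0 0 z * h 2 0 0 0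
        2 z - 1/12 * h 0 0 0 2 0 z * h 1 0 0 0 2 z * h 2 0 0 0 0 z + 1/12 * h 0 0 0 2 0 z * h 1 1 0 0 1 z +
        1/2 * h 0 0 0 2 0 z * h 2 0 0 0 0 z * h 2 0 0 1 1 z + 1/3 * h 0 0 0 2 0 z * h 2 0 0 0 1 z * h 2 0 0
        1 0 z - 1/3 * h 0 0 0 2 0 z * h 2 0 1 0 1 z - 1/3 * h 0 0 0 2 0 z * h 2 1 0 1 0 z - 3/4 * h 0 0 1 0
        1 z * h 1 0 0 1 1 z + 3/4 * h 0 0 1 0 1 z * h 2 0 0 2 0 z - h 0 0 1 0 2 z * h 1 0 0 1 0 z + 1/12 * h
        0 0 1 1 0 z * h 1 0 0 0 2 z - 1/3 * h 0 0 1 1 0 z * h 2 0 0 1 1 z - 1/4 * h 0 0 1 1 1 z * h 1 0 0 0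
        1 z - 1/2 * h 0 0 1 1 1 z * h 2 0 0 1 0 z - 1/3 * h 0 0 1 2 0 z * h 2 0 0 0 1 z + 1/2 * h 0 0 2 1 1
        z - 1/2 * h 0 1 0 0 1 z * h 1 0 0 2 0 z - 1/4 * h 0 1 0 1 0 z * h 1 0 0 1 1 z + 1/4 * h 0 1 0 1 0 z
        * h 2 0 0 2 0 z - 3/4 * h 0 1 0 1 1 z * h 1 0 0 1 0 z - 1/3 * h 0 1 0 2 0 z * h 2 0 0 1 0 z + 1/3 *
        h 0 1 1 2 0 z + 1/12 * h 1 0 0 0 0 z * h 1 0 0 0 2 z * h 2 0 0 0 2 z - 7/12 * h 1 0 0 0 0 z * h 2 0
        0 0 2 z * h 2 0 0 1 1 z - 1/4 * h 1 0 0 0 1 z * h 2 0 0 0 2 z * h 2 0 0 1 0 z + 1/4 * h 1 0 0 0 1 z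
        * h 2 0 1 0 2 z - 1/24 * h 1 0 0 0 2 z * h 1 0 0 0 2 z * h 2 0 0 0 0 z + 1/12 * h 1 0 0 0 2 z * h 1
        1 0 0 1 z + 1/2 * h 1 0 0 0 2 z * h 2 0 0 0 0 z * h 2 0 0 1 1 z + 1/3 * h 1 0 0 0 2 z * h 2 0 0 0 1
        z * h 2 0 0 1 0 z - 1/3 * h 1 0 0 0 2 z * h 2 0 1 0 1 z - 1/3 * h 1 0 0 0 2 z * h 2 1 0 1 0 z - 3/4
        * h 1 0 0 1 0 z * h 2 0 0 0 1 z * h 2 0 0 0 2 z + 3/4 * h 1 0 0 1 0 z * h 2 1 0 0 2 z - 1/2 * h 1 0
        0 1 1 z * h 2 0 0 0 0 z * h 2 0 0 0 2 z + 1/4 * h 1 0 1 0 1 z * h 2 0 0 0 2 z - 1/3 * h 1 0 1 0 2 z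
        * h 2 0 0 0 1 z - 1/3 * h 1 1 0 0 1 z * h 2 0 0 1 1 z - 1/3 * h 1 1 0 0 2 z * h 2 0 0 1 0 z + 3/4 *
        h 1 1 0 1 0 z * h 2 0 0 0 2 z - 1/2 * h 1 1 0 1 1 z * h 2 0 0 0 1 z + 1/3 * h 1 1 1 0 2 z + 1/2 * h
        1 2 0 1 1 z - 4/3 * h 2 0 0 0 0 z * h 2 0 0 1 1 z * h 2 0 0 1 1 z - 4/3 * h 2 0 0 0 1 z * h 2 0 0 1
        0 z * h 2 0 0 1 1 z + 4/3 * h 2 0 0 0 1 z * h 2 0 1 1 1 z + 1/2 * h 2 0 0 0 1 z * h 2 1 0 2 0 z +
        1/2 * h 2 0 0 1 0 z * h 2 0 1 0 2 z + 4/3 * h 2 0 0 1 0 z * h 2 1 0 1 1 z + 4/3 * h 2 0 0 1 1 z * h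
        2 0 1 0 1 z + 4/3 * h 2 0 0 1 1 z * h 2 1 0 1 0 z - 1/2 * h 2 0 2 0 2 z - 4/3 * h 2 1 1 1 1 z - 1/2
        * h 2 2 0 2 0 z"
    "\<forall>z\<in>Z. bach g X1 Y1 z = 1/4 * h 0 0 0 1 1 z * h 2 0 0 2 0 z + 1/24 * h 0 0 0 2 0 z * h 0 0 0 2 0 z -
        1/6 * h 0 0 0 2 0 z * h 2 0 0 1 1 z - 1/24 * h 1 0 0 0 2 z * h 1 0 0 0 2 z + 1/6 * h 1 0 0 0 2 z * h
        2 0 0 1 1 z - 1/4 * h 1 0 0 1 1 z * h 2 0 0 0 2 z"
    "\<forall>z\<in>Z. bach g X1 Y2 z = 1/4 * h 0 0 0 0 2 z * h 1 0 0 1 1 z + 1/4 * h 0 0 0 0 2 z * h 2 0 0 2 0 z +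
        1/12 * h 0 0 0 1 1 z * h 0 0 0 2 0 z - 1/6 * h 0 0 0 1 1 z * h 1 0 0 0 2 z + 1/6 * h 0 0 0 1 1 z * h
        2 0 0 1 1 z - 1/6 * h 0 0 0 2 0 z * h 2 0 0 0 2 z + 1/12 * h 1 0 0 0 2 z * h 2 0 0 0 2 z + 1/6 * h 2
        0 0 0 2 z * h 2 0 0 1 1 z"
    "\<forall>z\<in>Z. bach g X2 X1 z = 3/4 * h 0 0 0 0 0 z * h 0 0 0 1 1 z * h 1 0 0 2 0 z + 1/12 * h 0 0 0 0 0 z *
        h 0 0 0 2 0 z * h 2 0 0 2 0 z + 1/12 * h 0 0 0 0 0 z * h 1 0 0 0 2 z * h 2 0 0 2 0 z + 1/4 * h 0 0 0
        0 0 z * h 1 0 0 1 1 z * h 2 0 0 1 1 z - 1/4 * h 0 0 0 0 0 z * h 1 0 0 2 0 z * h 2 0 0 0 2 z - 7/12 *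
        h 0 0 0 0 0 z * h 2 0 0 1 1 z * h 2 0 0 2 0 z + 1/2 * h 0 0 0 0 1 z * h 0 0 0 1 0 z * h 1 0 0 2 0 z
        + 1/6 * h 0 0 0 0 1 z * h 0 0 0 2 0 z * h 1 0 0 1 0 z + 1/6 * h 0 0 0 0 1 z * h 1 0 0 0 2 z * h 1 0
        0 1 0 z - 2/3 * h 0 0 0 0 1 z * h 1 0 0 1 0 z * h 2 0 0 1 1 z + 3/4 * h 0 0 0 0 1 z * h 1 0 0 1 1 z
        * h 2 0 0 1 0 z - 3/4 * h 0 0 0 0 1 z * h 1 0 1 1 1 z - h 0 0 0 0 1 z * h 1 1 0 2 0 z - 3/4 * h 0 0
        0 0 1 z * h 2 0 0 1 0 z * h 2 0 0 2 0 z + 3/4 * h 0 0 0 0 1 z * h 2 0 1 2 0 z + 3/4 * h 0 0 0 0 2 z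
        * h 1 0 0 0 0 z * h 1 0 0 1 1 z - 1/4 * h 0 0 0 0 2 z * h 1 0 0 0 0 z * h 2 0 0 2 0 z + 1/2 * h 0 0
        0 0 2 z * h 1 0 0 0 1 z * h 1 0 0 1 0 z + 1/2 * h 0 0 0 0 2 z * h 1 0 0 2 0 z * h 2 0 0 0 0 z - 1/2
        * h 0 0 0 0 2 z * h 1 0 1 1 0 z + 1/4 * h 0 0 0 1 0 z * h 1 0 0 1 1 z * h 2 0 0 0 1 z - 1/4 * h 0 0
        0 1 0 z * h 1 1 0 1 1 z - 1/4 * h 0 0 0 1 0 z * h 2 0 0 0 1 z * h 2 0 0 2 0 z + 1/4 * h 0 0 0 1 0 z
        * h 2 1 0 2 0 z + 1/4 * h 0 0 0 1 1 z * h 1 0 0 0 0 z * h 2 0 0 1 1 z + 1/4 * h 0 0 0 1 1 z * h 1 0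
        0 0 1 z * h 2 0 0 1 0 z + 3/4 * h 0 0 0 1 1 z * h 1 0 0 1 0 z * h 2 0 0 0 1 z + h 0 0 0 1 1 z * h 1
        0 0 1 1 z * h 2 0 0 0 0 z - 1/4 * h 0 0 0 1 1 z * h 1 0 1 0 1 z - 3/4 * h 0 0 0 1 1 z * h 1 1 0 1 0
        z - 1/2 * h 0 0 0 1 1 z * h 2 0 0 0 0 z * h 2 0 0 2 0 z - 1/24 * h 0 0 0 2 0 z * h 0 0 0 2 0 z * h 2
        0 0 0 0 z + 1/12 * h 0 0 0 2 0 z * h 0 0 1 1 0 z + 1/12 * h 0 0 0 2 0 z * h 1 0 0 0 0 z * h 2 0 0 0
        2 z - 1/12 * h 0 0 0 2 0 z * h 1 0 0 0 2 z * h 2 0 0 0 0 z + 1/12 * h 0 0 0 2 0 z * h 1 1 0 0 1 z +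
        1/2 * h 0 0 0 2 0 z * h 2 0 0 0 0 z * h 2 0 0 1 1 z + 1/3 * h 0 0 0 2 0 z * h 2 0 0 0 1 z * h 2 0 0
        1 0 z - 1/3 * h 0 0 0 2 0 z * h 2 0 1 0 1 z - 1/3 * h 0 0 0 2 0 z * h 2 1 0 1 0 z - 3/4 * h 0 0 1 0
        1 z * h 1 0 0 1 1 z + 3/4 * h 0 0 1 0 1 z * h 2 0 0 2 0 z - h 0 0 1 0 2 z * h 1 0 0 1 0 z + 1/12 * h
        0 0 1 1 0 z * h 1 0 0 0 2 z - 1/3 * h 0 0 1 1 0 z * h 2 0 0 1 1 z - 1/4 * h 0 0 1 1 1 z * h 1 0 0 0
        1 z - 1/2 * h 0 0 1 1 1 z * h 2 0 0 1 0 z - 1/3 * h 0 0 1 2 0 z * h 2 0 0 0 1 z + 1/2 * h 0 0 2 1 1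
        z - 1/2 * h 0 1 0 0 1 z * h 1 0 0 2 0 z - 1/4 * h 0 1 0 1 0 z * h 1 0 0 1 1 z + 1/4 * h 0 1 0 1 0 z
        * h 2 0 0 2 0 z - 3/4 * h 0 1 0 1 1 z * h 1 0 0 1 0 z - 1/3 * h 0 1 0 2 0 z * h 2 0 0 1 0 z + 1/3 *
        h 0 1 1 2 0 z + 1/12 * h 1 0 0 0 0 z * h 1 0 0 0 2 z * h 2 0 0 0 2 z - 7/12 * h 1 0 0 0 0 z * h 2 0
        0 0 2 z * h 2 0 0 1 1 z - 1/4 * h 1 0 0 0 1 z * h 2 0 0 0 2 z * h 2 0 0 1 0 z + 1/4 * h 1 0 0 0 1 z
        * h 2 0 1 0 2 z - 1/24 * h 1 0 0 0 2 z * h 1 0 0 0 2 z * h 2 0 0 0 0 z + 1/12 * h 1 0 0 0 2 z * h 1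
        1 0 0 1 z + 1/2 * h 1 0 0 0 2 z * h 2 0 0 0 0 z * h 2 0 0 1 1 z + 1/3 * h 1 0 0 0 2 z * h 2 0 0 0 1
        z * h 2 0 0 1 0 z - 1/3 * h 1 0 0 0 2 z * h 2 0 1 0 1 z - 1/3 * h 1 0 0 0 2 z * h 2 1 0 1 0 z - 3/4
        * h 1 0 0 1 0 z * h 2 0 0 0 1 z * h 2 0 0 0 2 z + 3/4 * h 1 0 0 1 0 z * h 2 1 0 0 2 z - 1/2 * h 1 0
        0 1 1 z * h 2 0 0 0 0 z * h 2 0 0 0 2 z + 1/4 * h 1 0 1 0 1 z * h 2 0 0 0 2 z - 1/3 * h 1 0 1 0 2 z
        * h 2 0 0 0 1 z - 1/3 * h 1 1 0 0 1 z * h 2 0 0 1 1 z - 1/3 * h 1 1 0 0 2 z * h 2 0 0 1 0 z + 3/4 *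
        h 1 1 0 1 0 z * h 2 0 0 0 2 z - 1/2 * h 1 1 0 1 1 z * h 2 0 0 0 1 z + 1/3 * h 1 1 1 0 2 z + 1/2 * h
        1 2 0 1 1 z - 4/3 * h 2 0 0 0 0 z * h 2 0 0 1 1 z * h 2 0 0 1 1 z - 4/3 * h 2 0 0 0 1 z * h 2 0 0 1
        0 z * h 2 0 0 1 1 z + 4/3 * h 2 0 0 0 1 z * h 2 0 1 1 1 z + 1/2 * h 2 0 0 0 1 z * h 2 1 0 2 0 z +
        1/2 * h 2 0 0 1 0 z * h 2 0 1 0 2 z + 4/3 * h 2 0 0 1 0 z * h 2 1 0 1 1 z + 4/3 * h 2 0 0 1 1 z * h
        2 0 1 0 1 z + 4/3 * h 2 0 0 1 1 z * h 2 1 0 1 0 z - 1/2 * h 2 0 2 0 2 z - 4/3 * h 2 1 1 1 1 z - 1/2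
        * h 2 2 0 2 0 z"
    "\<forall>z\<in>Z. bach g X2 X2 z = - 2/3 * h 0 0 0 0 0 z * h 0 0 0 2 0 z * h 1 0 0 2 0 z - 1/6 * h 0 0 0 0 0 z
        * h 1 0 0 0 2 z * h 1 0 0 2 0 z + 1/4 * h 0 0 0 0 0 z * h 1 0 0 1 1 z * h 1 0 0 1 1 z - h 0 0 0 0 0
        z * h 1 0 0 1 1 z * h 2 0 0 2 0 z + 7/6 * h 0 0 0 0 0 z * h 1 0 0 2 0 z * h 2 0 0 1 1 z + 3/4 * h 0
        0 0 0 0 z * h 2 0 0 2 0 z * h 2 0 0 2 0 z - 1/4 * h 0 0 0 0 1 z * h 1 0 0 1 0 z * h 1 0 0 1 1 z +
        1/4 * h 0 0 0 0 1 z * h 1 0 0 1 0 z * h 2 0 0 2 0 z - 1/2 * h 0 0 0 0 1 z * h 1 0 0 2 0 z * h 2 0 0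
        1 0 z + 1/2 * h 0 0 0 0 1 z * h 1 0 1 2 0 z - 1/2 * h 0 0 0 0 2 z * h 1 0 0 0 0 z * h 1 0 0 2 0 z -
        1/2 * h 0 0 0 0 2 z * h 1 0 0 1 0 z * h 1 0 0 1 0 z - 1/2 * h 0 0 0 1 0 z * h 0 0 0 1 0 z * h 1 0 0
        2 0 z - 1/6 * h 0 0 0 1 0 z * h 0 0 0 2 0 z * h 1 0 0 1 0 z + 1/4 * h 0 0 0 1 0 z * h 1 0 0 0 1 z *
        h 1 0 0 1 1 z - 1/4 * h 0 0 0 1 0 z * h 1 0 0 0 1 z * h 2 0 0 2 0 z - 1/6 * h 0 0 0 1 0 z * h 1 0 0
        0 2 z * h 1 0 0 1 0 z + 2/3 * h 0 0 0 1 0 z * h 1 0 0 1 0 z * h 2 0 0 1 1 z - h 0 0 0 1 0 z * h 1 0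
        0 1 1 z * h 2 0 0 1 0 z + 1/2 * h 0 0 0 1 0 z * h 1 0 0 2 0 z * h 2 0 0 0 1 z + 1/2 * h 0 0 0 1 0 z
        * h 1 0 1 1 1 z + 3/2 * h 0 0 0 1 0 z * h 1 1 0 2 0 z + h 0 0 0 1 0 z * h 2 0 0 1 0 z * h 2 0 0 2 0
        z - 1/2 * h 0 0 0 1 0 z * h 2 0 1 2 0 z - 1/4 * h 0 0 0 1 1 z * h 1 0 0 0 0 z * h 1 0 0 1 1 z - 1/4
        * h 0 0 0 1 1 z * h 1 0 0 0 0 z * h 2 0 0 2 0 z - h 0 0 0 1 1 z * h 1 0 0 1 0 z * h 2 0 0 1 0 z - h
        0 0 0 1 1 z * h 1 0 0 2 0 z * h 2 0 0 0 0 z + 1/2 * h 0 0 0 1 1 z * h 1 0 1 1 0 z - 1/24 * h 0 0 0 2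
        0 z * h 0 0 0 2 0 z * h 1 0 0 0 0 z + 1/12 * h 0 0 0 2 0 z * h 1 0 0 0 0 z * h 2 0 0 1 1 z + 1/12 *
        h 0 0 0 2 0 z * h 1 0 0 0 1 z * h 2 0 0 1 0 z - 1/12 * h 0 0 0 2 0 z * h 1 0 0 1 0 z * h 2 0 0 0 1 z
        - 1/3 * h 0 0 0 2 0 z * h 1 0 0 1 1 z * h 2 0 0 0 0 z + 1/3 * h 0 0 0 2 0 z * h 1 1 0 1 0 z - 1/3 *
        h 0 0 0 2 0 z * h 2 0 0 1 0 z * h 2 0 0 1 0 z + 1/6 * h 0 0 0 2 0 z * h 2 0 1 1 0 z + h 0 0 1 0 1 z
        * h 1 0 0 2 0 z + h 0 0 1 1 1 z * h 1 0 0 1 0 z - 1/12 * h 0 0 1 2 0 z * h 1 0 0 0 1 z + 1/2 * h 0 0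
        1 2 0 z * h 2 0 0 1 0 z - 1/6 * h 0 0 2 2 0 z + h 0 1 0 1 0 z * h 1 0 0 2 0 z + 5/12 * h 0 1 0 2 0 z
        * h 1 0 0 1 0 z + 1/24 * h 1 0 0 0 0 z * h 1 0 0 0 2 z * h 1 0 0 0 2 z - 1/4 * h 1 0 0 0 0 z * h 1 0
        0 0 2 z * h 2 0 0 1 1 z + 1/4 * h 1 0 0 0 0 z * h 1 0 0 1 1 z * h 2 0 0 0 2 z + 1/4 * h 1 0 0 0 0 z
        * h 2 0 0 0 2 z * h 2 0 0 2 0 z + 1/3 * h 1 0 0 0 0 z * h 2 0 0 1 1 z * h 2 0 0 1 1 z + 1/12 * h 1 0
        0 0 1 z * h 1 0 0 0 2 z * h 2 0 0 1 0 z - 1/12 * h 1 0 0 0 1 z * h 1 0 1 0 2 z - 1/2 * h 1 0 0 0 1 z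
        * h 1 1 0 1 1 z - 1/3 * h 1 0 0 0 1 z * h 2 0 0 1 0 z * h 2 0 0 1 1 z + 1/3 * h 1 0 0 0 1 z * h 2 0
        1 1 1 z + 1/2 * h 1 0 0 0 1 z * h 2 1 0 2 0 z - 1/12 * h 1 0 0 0 2 z * h 1 0 0 1 0 z * h 2 0 0 0 1 z
        + 1/6 * h 1 0 0 0 2 z * h 1 0 0 1 1 z * h 2 0 0 0 0 z + 1/3 * h 1 0 0 0 2 z * h 1 1 0 1 0 z - 1/2 *
        h 1 0 0 0 2 z * h 2 0 0 0 0 z * h 2 0 0 2 0 z - 1/3 * h 1 0 0 0 2 z * h 2 0 0 1 0 z * h 2 0 0 1 0 z
        + 1/6 * h 1 0 0 0 2 z * h 2 0 1 1 0 z + 5/12 * h 1 0 0 1 0 z * h 1 1 0 0 2 z + 1/3 * h 1 0 0 1 0 z *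
        h 2 0 0 0 1 z * h 2 0 0 1 1 z + h 1 0 0 1 0 z * h 2 0 0 0 2 z * h 2 0 0 1 0 z - h 1 0 0 1 0 z * h 2
        0 1 0 2 z - 5/3 * h 1 0 0 1 0 z * h 2 1 0 1 1 z - 1/2 * h 1 0 0 1 1 z * h 1 1 0 0 1 z - 1/6 * h 1 0
        0 1 1 z * h 2 0 0 0 0 z * h 2 0 0 1 1 z + 1/2 * h 1 0 0 1 1 z * h 2 0 1 0 1 z + 3/2 * h 1 0 0 1 1 z
        * h 2 1 0 1 0 z + h 1 0 0 2 0 z * h 2 0 0 0 0 z * h 2 0 0 0 2 z - h 1 0 0 2 0 z * h 2 1 0 0 1 z +
        1/2 * h 1 0 1 0 2 z * h 2 0 0 1 0 z - 1/2 * h 1 0 1 1 0 z * h 2 0 0 0 2 z - 1/6 * h 1 0 2 0 2 z +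
        1/2 * h 1 1 0 0 1 z * h 2 0 0 2 0 z - 4/3 * h 1 1 0 1 0 z * h 2 0 0 1 1 z + 2 * h 1 1 0 1 1 z * h 2
        0 0 1 0 z - h 1 1 0 2 0 z * h 2 0 0 0 1 z - h 1 1 1 1 1 z - h 1 2 0 2 0 z + 3/2 * h 2 0 0 0 0 z * h
        2 0 0 1 1 z * h 2 0 0 2 0 z + 4/3 * h 2 0 0 1 0 z * h 2 0 0 1 0 z * h 2 0 0 1 1 z - 2 * h 2 0 0 1 0
        z * h 2 0 1 1 1 z - 2 * h 2 0 0 1 0 z * h 2 1 0 2 0 z - 2/3 * h 2 0 0 1 1 z * h 2 0 1 1 0 z - 1/2 *
        h 2 0 0 2 0 z * h 2 0 1 0 1 z - 3/2 * h 2 0 0 2 0 z * h 2 1 0 1 0 z + 2/3 * h 2 0 2 1 1 z + h 2 1 1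
        2 0 z"
    "\<forall>z\<in>Z. bach g X2 Y1 z = 1/4 * h 0 0 0 1 1 z * h 1 0 0 2 0 z - 1/6 * h 0 0 0 2 0 z * h 1 0 0 1 1 z +
        1/12 * h 0 0 0 2 0 z * h 2 0 0 2 0 z + 1/12 * h 1 0 0 0 2 z * h 1 0 0 1 1 z - 1/6 * h 1 0 0 0 2 z *
        h 2 0 0 2 0 z + 1/6 * h 1 0 0 1 1 z * h 2 0 0 1 1 z + 1/4 * h 1 0 0 2 0 z * h 2 0 0 0 2 z + 1/6 * h
        2 0 0 1 1 z * h 2 0 0 2 0 z"
    "\<forall>z\<in>Z. bach g X2 Y2 z = - 1/4 * h 0 0 0 1 1 z * h 2 0 0 2 0 z - 1/24 * h 0 0 0 2 0 z * h 0 0 0 2 0 z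
        + 1/6 * h 0 0 0 2 0 z * h 2 0 0 1 1 z + 1/24 * h 1 0 0 0 2 z * h 1 0 0 0 2 z - 1/6 * h 1 0 0 0 2 z *
        h 2 0 0 1 1 z + 1/4 * h 1 0 0 1 1 z * h 2 0 0 0 2 z"
    "\<forall>z\<in>Z. bach g Y1 X1 z = 1/4 * h 0 0 0 1 1 z * h 2 0 0 2 0 z + 1/24 * h 0 0 0 2 0 z * h 0 0 0 2 0 z -
        1/6 * h 0 0 0 2 0 z * h 2 0 0 1 1 z - 1/24 * h 1 0 0 0 2 z * h 1 0 0 0 2 z + 1/6 * h 1 0 0 0 2 z * h
        2 0 0 1 1 z - 1/4 * h 1 0 0 1 1 z * h 2 0 0 0 2 z"
    "\<forall>z\<in>Z. bach g Y1 X2 z = 1/4 * h 0 0 0 1 1 z * h 1 0 0 2 0 z - 1/6 * h 0 0 0 2 0 z * h 1 0 0 1 1 z +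
        1/12 * h 0 0 0 2 0 z * h 2 0 0 2 0 z + 1/12 * h 1 0 0 0 2 z * h 1 0 0 1 1 z - 1/6 * h 1 0 0 0 2 z *
        h 2 0 0 2 0 z + 1/6 * h 1 0 0 1 1 z * h 2 0 0 1 1 z + 1/4 * h 1 0 0 2 0 z * h 2 0 0 0 2 z + 1/6 * h
        2 0 0 1 1 z * h 2 0 0 2 0 z"
    "\<forall>z\<in>Z. bach g Y1 Y1 z = 0"
    "\<forall>z\<in>Z. bach g Y1 Y2 z = 0"
    "\<forall>z\<in>Z. bach g Y2 X1 z = 1/4 * h 0 0 0 0 2 z * h 1 0 0 1 1 z + 1/4 * h 0 0 0 0 2 z * h 2 0 0 2 0 z +
        1/12 * h 0 0 0 1 1 z * h 0 0 0 2 0 z - 1/6 * h 0 0 0 1 1 z * h 1 0 0 0 2 z + 1/6 * h 0 0 0 1 1 z * h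
        2 0 0 1 1 z - 1/6 * h 0 0 0 2 0 z * h 2 0 0 0 2 z + 1/12 * h 1 0 0 0 2 z * h 2 0 0 0 2 z + 1/6 * h 2
        0 0 0 2 z * h 2 0 0 1 1 z"
    "\<forall>z\<in>Z. bach g Y2 X2 z = - 1/4 * h 0 0 0 1 1 z * h 2 0 0 2 0 z - 1/24 * h 0 0 0 2 0 z * h 0 0 0 2 0 z
        + 1/6 * h 0 0 0 2 0 z * h 2 0 0 1 1 z + 1/24 * h 1 0 0 0 2 z * h 1 0 0 0 2 z - 1/6 * h 1 0 0 0 2 z *
        h 2 0 0 1 1 z + 1/4 * h 1 0 0 1 1 z * h 2 0 0 0 2 z"
    "\<forall>z\<in>Z. bach g Y2 Y1 z = 0"
    "\<forall>z\<in>Z. bach g Y2 Y2 z = 0"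
  using [[simp_depth_limit = 1000]]
  by (intro ballI, simp only: bach_eq_div sum_idx inv_at weyl_at weyl_div_at pd_weyl_div_at ricci_at
      levi_civita_at pd_rules ring_units jet_index h_cubic_simps; algebra)+

section \<open>Volume form and Hodge dual of the Weyl tensor\<close>

lemma det_metric: "z \<in> Z \<Longrightarrow> det (g z) = 1"
  by (simp add: det_idx g_at)

text \<open>The determinant has two equal rows.\<close>

lemma volume_form_repeated:
  shows "volume_form g i i k l z = 0" "volume_form g i j i l z = 0" "volume_form g i j k i z = 0"
    "volume_form g i j j l z = 0" "volume_form g i j k j z = 0" "volume_form g i j k k z = 0"
  by (simp only: volume_form_idx det_idx vec_lambda_beta axis_idx idx_distinct simp_thms if_True
      if_False; algebra)+

lemma volume_form_metric:
  "z \<in> Z \<Longrightarrow> volume_form g i j k l z = det ((\<chi> a. axis (if a = X1 then i else if a = X2 then j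
      else if a = Y1 then k else l) 1) :: real^(2 + 2)^(2 + 2))"
  by (simp add: volume_form_idx det_metric)

lemma volume_form_components:
  assumes z: "z \<in> Z"
  shows
    "volume_form g X1 X2 Y1 Y2 z = 1"
    "volume_form g X1 X2 Y2 Y1 z = - 1"
    "volume_form g X1 Y1 X2 Y2 z = - 1"
    "volume_form g X1 Y1 Y2 X2 z = 1"
    "volume_form g X1 Y2 X2 Y1 z = 1"
    "volume_form g X1 Y2 Y1 X2 z = - 1"
    "volume_form g X2 X1 Y1 Y2 z = - 1"
    "volume_form g X2 X1 Y2 Y1 z = 1"
    "volume_form g X2 Y1 X1 Y2 z = 1"
    "volume_form g X2 Y1 Y2 X1 z = - 1"
    "volume_form g X2 Y2 X1 Y1 z = - 1"
    "volume_form g X2 Y2 Y1 X1 z = 1"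
    "volume_form g Y1 X1 X2 Y2 z = 1"
    "volume_form g Y1 X1 Y2 X2 z = - 1"
    "volume_form g Y1 X2 X1 Y2 z = - 1"
    "volume_form g Y1 X2 Y2 X1 z = 1"
    "volume_form g Y1 Y2 X1 X2 z = 1"
    "volume_form g Y1 Y2 X2 X1 z = - 1"
    "volume_form g Y2 X1 X2 Y1 z = - 1"
    "volume_form g Y2 X1 Y1 X2 z = 1"
    "volume_form g Y2 X2 X1 Y1 z = 1"
    "volume_form g Y2 X2 Y1 X1 z = - 1"
    "volume_form g Y2 Y1 X1 X2 z = - 1"
    "volume_form g Y2 Y1 X2 X1 z = 1"
  using z by (simp_all add: volume_form_metric det_idx axis_idx)

abbreviation weyl_dual :: "2 + 2 \<Rightarrow> 2 + 2 \<Rightarrow> 2 + 2 \<Rightarrow> 2 + 2 \<Rightarrow> real^(2 + 2) \<Rightarrow> real" where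
  "weyl_dual i j k l z \<equiv> (1/2) * (\<Sum>a\<in>UNIV. \<Sum>b\<in>UNIV. \<Sum>d\<in>UNIV. \<Sum>e\<in>UNIV.
     volume_form g i j a b z * inv_metric g a d z * inv_metric g b e z * weyl g d e k l z)"

text \<open>The star acts on the first pair only, so k and l stay arbitrary and sixteen formulas
  cover all components. The h terms come from raising indices.\<close>

lemma weyl_dual_components:
  assumes z: "z \<in> Z"
  shows
    "weyl_dual X1 X1 k l z = 0"
    "weyl_dual X1 X2 k l z = weyl g X1 X2 k l z - h 2 0 0 0 0 z * weyl g X1 Y1 k l z - h 1 0 0 0 0 z *
        weyl g X1 Y2 k l z + h 0 0 0 0 0 z * weyl g X2 Y1 k l z + h 2 0 0 0 0 z * weyl g X2 Y2 k l z + (h 0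
        0 0 0 0 z * h 1 0 0 0 0 z - h 2 0 0 0 0 z * h 2 0 0 0 0 z) * weyl g Y1 Y2 k l z"
    "weyl_dual X1 Y1 k l z = weyl g X2 Y2 k l z - h 2 0 0 0 0 z * weyl g Y1 Y2 k l z"
    "weyl_dual X1 Y2 k l z = - weyl g X1 Y2 k l z + h 0 0 0 0 0 z * weyl g Y1 Y2 k l z"
    "weyl_dual X2 X1 k l z = - weyl g X1 X2 k l z + h 2 0 0 0 0 z * weyl g X1 Y1 k l z + h 1 0 0 0 0 z *
        weyl g X1 Y2 k l z - h 0 0 0 0 0 z * weyl g X2 Y1 k l z - h 2 0 0 0 0 z * weyl g X2 Y2 k l z + (- h
        0 0 0 0 0 z * h 1 0 0 0 0 z + h 2 0 0 0 0 z * h 2 0 0 0 0 z) * weyl g Y1 Y2 k l z"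
    "weyl_dual X2 X2 k l z = 0"
    "weyl_dual X2 Y1 k l z = - weyl g X2 Y1 k l z - h 1 0 0 0 0 z * weyl g Y1 Y2 k l z"
    "weyl_dual X2 Y2 k l z = weyl g X1 Y1 k l z + h 2 0 0 0 0 z * weyl g Y1 Y2 k l z"
    "weyl_dual Y1 X1 k l z = - weyl g X2 Y2 k l z + h 2 0 0 0 0 z * weyl g Y1 Y2 k l z"
    "weyl_dual Y1 X2 k l z = weyl g X2 Y1 k l z + h 1 0 0 0 0 z * weyl g Y1 Y2 k l z"
    "weyl_dual Y1 Y1 k l z = 0"
    "weyl_dual Y1 Y2 k l z = weyl g Y1 Y2 k l z"
    "weyl_dual Y2 X1 k l z = weyl g X1 Y2 k l z - h 0 0 0 0 0 z * weyl g Y1 Y2 k l z"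
    "weyl_dual Y2 X2 k l z = - weyl g X1 Y1 k l z - h 2 0 0 0 0 z * weyl g Y1 Y2 k l z"
    "weyl_dual Y2 Y1 k l z = - weyl g Y1 Y2 k l z"
    "weyl_dual Y2 Y2 k l z = 0"
  by ((simp only: z sum_idx volume_form_components volume_form_repeated inv_at ring_units mult_minus1
      minus_minus weyl_diag
      weyl_antisym[of X2 X1] weyl_antisym[of Y1 X1] weyl_antisym[of Y1 X2] weyl_antisym[of Y2 X1]
      weyl_antisym[of Y2 X2] weyl_antisym[of Y2 Y1]; (algebra | simp))+)

text \<open>The quadratic part of the metric is \<open>f y\<^sub>i y\<^sub>j\<close> with \<open>f\<close> a function on the base.\<close>

context
  assumes scalar_quadratic:
    "\<And>a b z. z \<in> Z \<Longrightarrow> h 0 a b 1 1 z = 0" "\<And>a b z. z \<in> Z \<Longrightarrow> h 0 a b 0 2 z = 0"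
    "\<And>a b z. z \<in> Z \<Longrightarrow> h 0 a b 2 0 z = 2 * h 2 a b 1 1 z"
    "\<And>a b z. z \<in> Z \<Longrightarrow> h 1 a b 1 1 z = 0" "\<And>a b z. z \<in> Z \<Longrightarrow> h 1 a b 2 0 z = 0"
    "\<And>a b z. z \<in> Z \<Longrightarrow> h 1 a b 0 2 z = 2 * h 2 a b 1 1 z"
    "\<And>a b z. z \<in> Z \<Longrightarrow> h 2 a b 2 0 z = 0" "\<And>a b z. z \<in> Z \<Longrightarrow> h 2 a b 0 2 z = 0"
begin

text \<open>For the orientation fixed by \<open>volume_form\<close> it is the anti-self-dual half
  that vanishes: in this case star fixes the Weyl tensor.\<close>

lemma weyl_half_scalar:
  assumes z: "z \<in> Z"
  shows "weyl_half (- 1) g i j k l z = 0"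
proof -
  have "\<forall>i j k l. weyl_half (- 1) g i j k l z = 0"
    unfolding forall_idx weyl_half_def
    by (intro conjI; simp only: z weyl_dual_components; simp only: z weyl_at scalar_quadratic
        ring_units; algebra)
  then show ?thesis by blast
qed

text \<open>Instead of invoking the general implication from half conformal flatness to Bach
  flatness, the components of the Bach tensor are evaluated directly.\<close>

lemma bach_scalar:
  assumes z: "z \<in> Z"
  shows "bach g i j z = 0"
proof -
  have "\<forall>i j. bach g i j z = 0"
    unfolding forall_idx
    by (intro conjI; simp only: z bach_components[THEN bspec] scalar_quadratic ring_units; (algebra |
        simp add: field_simps))
  then show ?thesis by blast
qed

end

text \<open>The quadratic part of the metric is \<open>y\<^sub>1\<^sup>2 dx\<^sup>2 dx\<^sup>2\<close>.\<close>

lemma bach_nilpotent: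
  assumes z: "z \<in> Z"
    and nilp: "\<And>c a b. h c a b 1 1 z = 0" "\<And>c a b. h c a b 0 2 z = 0" "\<And>a b. h 0 a b 2 0 z = 0"
      "\<And>a b. h 2 a b 2 0 z = 0" "h 1 0 0 2 0 z = 2" "\<And>a b. h 1 (a + 1) b 2 0 z = 0"
      "\<And>a b. h 1 a (b + 1) 2 0 z = 0"
  shows "bach g X1 X1 z = - (h 0 0 0 0 1 z * h 0 0 0 0 1 z)"
    and "bach g X1 X2 z = h 0 0 0 0 1 z * h 0 0 0 1 0 z - h 0 1 0 0 1 z"
    and "bach g X2 X1 z = h 0 0 0 0 1 z * h 0 0 0 1 0 z - h 0 1 0 0 1 z"
    and "bach g X2 X2 z = - h 0 0 0 0 1 z * h 2 0 0 1 0 z - h 0 0 0 1 0 z * h 0 0 0 1 0 z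
      + h 0 0 0 1 0 z * h 2 0 0 0 1 z + 2 * h 0 0 1 0 1 z + 2 * h 0 1 0 1 0 z - 2 * h 2 1 0 0 1 z"
    and "bach g X1 Y1 z = 0" "bach g X1 Y2 z = 0" "bach g X2 Y1 z = 0" "bach g X2 Y2 z = 0"
    and "bach g Y1 i z = 0" "bach g Y2 i z = 0"
proof -
  \<comment> \<open>The last two hypotheses at the orders that occur in
    \<open>bach_components\<close>, with the orders evaluated to numerals.\<close>
  have nilp': "h 1 0 1 2 0 z = 0" "h 1 1 0 2 0 z = 0" "h 1 1 1 2 0 z = 0" "h 1 0 2 2 0 z = 0" "h 1 2 0 2
      0 z = 0"
    using nilp(6)[of 0 0] nilp(6)[of 0 1] nilp(6)[of 1 0] nilp(7)[of 0 0] nilp(7)[of 0 1] by simp_all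
  note rules = z bach_components[THEN bspec] nilp(1-5) nilp' ring_units
  show "bach g X1 X1 z = - (h 0 0 0 0 1 z * h 0 0 0 0 1 z)"
    and "bach g X1 X2 z = h 0 0 0 0 1 z * h 0 0 0 1 0 z - h 0 1 0 0 1 z"
    and "bach g X2 X1 z = h 0 0 0 0 1 z * h 0 0 0 1 0 z - h 0 1 0 0 1 z"
    and "bach g X2 X2 z = - h 0 0 0 0 1 z * h 2 0 0 1 0 z - h 0 0 0 1 0 z * h 0 0 0 1 0 z
      + h 0 0 0 1 0 z * h 2 0 0 0 1 z + 2 * h 0 0 1 0 1 z + 2 * h 0 1 0 1 0 z - 2 * h 2 1 0 0 1 z"
    and "bach g X1 Y1 z = 0" "bach g X1 Y2 z = 0" "bach g X2 Y1 z = 0" "bach g X2 Y2 z = 0"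
    by (simp only: rules; (algebra | simp add: field_simps))+
  have "\<forall>i. bach g Y1 i z = 0" "\<forall>i. bach g Y2 i z = 0"
    unfolding forall_idx by (intro conjI; simp only: rules; (algebra | simp add: field_simps))+
  then show "bach g Y1 i z = 0" "bach g Y2 i z = 0" by auto
qed

end

section \<open>Jets of functions quadratic in the fibre coordinates\<close>

lemma base_part_has_derivative:
  assumes "(f has_derivative f') (at (base_part z))"
  shows "((\<lambda>z. f (base_part z)) has_derivative (\<lambda>v. f' (base_part v))) (at z)"
proof -
  have "bounded_linear base_part"
    unfolding base_part_def
    by (rule linear_conv_bounded_linear[THEN iffD1], rule linearI) (simp_all add: vec_eq_iff)
  then have "(base_part has_derivative base_part) (at z)" by (rule bounded_linear_imp_has_derivative)
  from has_derivative_compose[where s = UNIV, OF this, of f f'] assms show ?thesis by simp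
qed

definition pdx :: "nat \<Rightarrow> nat \<Rightarrow> (real^2 \<Rightarrow> real) \<Rightarrow> real^2 \<Rightarrow> real" where
  "pdx a b f = (pd 1 ^^ a) ((pd 2 ^^ b) f)"

lemma smooth_on_pd_power: "smooth_on f V \<Longrightarrow> smooth_on ((pd i ^^ n) f) V"
  by (induction n) (auto intro: smooth_on_pd)

lemma smooth_on_pdx: "smooth_on f V \<Longrightarrow> smooth_on (pdx a b f) V"
  unfolding pdx_def by (intro smooth_on_pd_power)

lemma pd_1_pdx: "pd 1 (pdx a b f) = pdx (a + 1) b f"
  by (simp add: pdx_def)

text \<open>In \<open>pdx\<close> the derivatives in the second coordinate are innermost, so an
  outer one has to be moved past a derivatives in the first coordinate.\<close>

lemma pd_2_pdx:
  assumes "open V" "smooth_on f V" "x \<in> V"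
  shows "pd 2 (pdx a b f) x = pdx a (b + 1) f x"
proof -
  have comm: "pd 2 ((pd 1 ^^ a) g) x = (pd 1 ^^ a) (pd 2 g) x" if "smooth_on g V" "x \<in> V" for g x
    using that(2)
  proof (induction a arbitrary: x)
    case (Suc a)
    have "pd 2 ((pd 1 ^^ Suc a) g) x = pd 1 (pd 2 ((pd 1 ^^ a) g)) x"
      using pd_commute[OF assms(1) smooth_on_pd_power[OF that(1)] Suc.prems] by simp
    also have "\<dots> = pd 1 ((pd 1 ^^ a) (pd 2 g)) x"
      by (rule pd_cong[OF assms(1) Suc.prems]) (rule Suc.IH)
    finally show ?case by simp
  qed simp
  show ?thesis
    using comm[OF smooth_on_pd_power[OF assms(2), where i = 2 and n = b] assms(3)] by (simp add: pdx_def)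
qed

lemma pdx_has_derivative:
  assumes "open V" "smooth_on f V" "base_part z \<in> V"
  shows "((\<lambda>z. pdx a b f (base_part z)) has_derivative
    (\<lambda>v. v $ X1 * pdx (a + 1) b f (base_part z) + v $ X2 * pdx a (b + 1) f (base_part z))) (at z)"
proof -
  have "(pdx a b f has_derivative (\<lambda>v. v $ 1 * pdx (a + 1) b f (base_part z) +
      v $ 2 * pdx a (b + 1) f (base_part z))) (at (base_part z))"
    using smooth_on_has_derivative_pd[OF assms(1) smooth_on_pdx[OF assms(2)] assms(3), of a b]
    by (simp only: sum_2 pd_1_pdx pd_2_pdx[OF assms])
  from base_part_has_derivative[OF this] show ?thesis
    by (simp add: base_part_def idx_defs)
qed

text \<open>\<open>K c m n\<close> is the coefficient of \<open>y\<^sub>1\<^sup>m y\<^sub>2\<^sup>n\<close> in the entry \<open>c\<close> of the metric.\<close>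

definition quad_jet ::
    "(nat \<Rightarrow> nat \<Rightarrow> nat \<Rightarrow> real^2 \<Rightarrow> real) \<Rightarrow> nat \<Rightarrow> nat \<Rightarrow> nat \<Rightarrow> nat \<Rightarrow> nat \<Rightarrow> real^(2 + 2) \<Rightarrow> real" where
  "quad_jet K c a b p q z = (let D = (\<lambda>m n. pdx a b (K c m n) (base_part z)); y1 = z $ Y1; y2 = z $ Y2 in
     if (p, q) = (0, 0) then D 2 0 * y1 * y1 + D 1 1 * y1 * y2 + D 0 2 * y2 * y2 + D 1 0 * y1 + D 0 1 *
         y2 + D 0 0
     else if (p, q) = (1, 0) then 2 * D 2 0 * y1 + D 1 1 * y2 + D 1 0
     else if (p, q) = (0, 1) then D 1 1 * y1 + 2 * D 0 2 * y2 + D 0 1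
     else if (p, q) = (2, 0) then 2 * D 2 0
     else if (p, q) = (1, 1) then D 1 1
     else if (p, q) = (0, 2) then 2 * D 0 2
     else 0)"

lemma quad_jet_simps:
  "quad_jet K c a b 0 0 z = pdx a b (K c 2 0) (base_part z) * z $ Y1 * z $ Y1 +
     pdx a b (K c 1 1) (base_part z) * z $ Y1 * z $ Y2 + pdx a b (K c 0 2) (base_part z) * z $ Y2 * z $ Y2 +
     pdx a b (K c 1 0) (base_part z) * z $ Y1 + pdx a b (K c 0 1) (base_part z) * z $ Y2 + pdx a b (K c
         0 0) (base_part z)"
  "quad_jet K c a b 1 0 z = 2 * pdx a b (K c 2 0) (base_part z) * z $ Y1 +
     pdx a b (K c 1 1) (base_part z) * z $ Y2 + pdx a b (K c 1 0) (base_part z)"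
  "quad_jet K c a b 0 1 z = pdx a b (K c 1 1) (base_part z) * z $ Y1 +
     2 * pdx a b (K c 0 2) (base_part z) * z $ Y2 + pdx a b (K c 0 1) (base_part z)"
  "quad_jet K c a b 2 0 z = 2 * pdx a b (K c 2 0) (base_part z)"
  "quad_jet K c a b 1 1 z = pdx a b (K c 1 1) (base_part z)"
  "quad_jet K c a b 0 2 z = 2 * pdx a b (K c 0 2) (base_part z)"
  by (simp_all add: quad_jet_def Let_def)

lemma quad_jet_cubic: "p + q \<ge> 3 \<Longrightarrow> quad_jet K c a b p q z = 0"
  by (auto simp: quad_jet_def Let_def)

text \<open>The six orders with p + q <= 2 are differentiated explicitly; from total order three on
  both sides are zero.\<close>

lemma quad_jet_has_derivative:
  assumes V: "open V" and K: "\<And>c m n. smooth_on (K c m n) V" and z: "base_part z \<in> V"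
  shows "(quad_jet K c a b p q has_derivative
       (\<lambda>v. v $ X1 * quad_jet K c (a + 1) b p q z + v $ X2 * quad_jet K c a (b + 1) p q z +
            v $ Y1 * quad_jet K c a b (p + 1) q z + v $ Y2 * quad_jet K c a b p (q + 1) z)) (at z)"
proof -
  have num: "(1::nat) + 1 = 2" "(2::nat) + 1 = 3" "(0::nat) + 1 = 1" by simp_all
  note D = pdx_has_derivative[OF V K z, of a b]
  have Y: "((\<lambda>z. z $ i) has_derivative (\<lambda>v. v $ i)) (at z)" for i :: "2 + 2"
    by (rule bounded_linear_imp_has_derivative[OF bounded_linear_vec_nth])
  consider "(p, q) = (0, 0)" | "(p, q) = (1, 0)" | "(p, q) = (0, 1)" | "(p, q) = (2, 0)" | "(p, q) = (1, 1)"
    | "(p, q) = (0, 2)" | "p + q \<ge> 3"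
    by (cases p; cases q) force+
  then show ?thesis
  proof cases
    case 7
    then have "quad_jet K c a b p q = (\<lambda>z. 0)" by (auto simp: quad_jet_cubic)
    then show ?thesis using 7 by (simp add: quad_jet_cubic)
  qed (simp_all only: prod.inject num quad_jet_simps[abs_def] quad_jet_cubic;
      (rule has_derivative_eq_rhs, (rule derivative_intros D Y)+, simp add: algebra_simps quad_jet_cubic))+
qed

lemma walker_jets_quad_jet:
  assumes V: "open V" and K: "\<And>c m n. smooth_on (K c m n) V"
    and g: "\<And>z. base_part z \<in> V \<Longrightarrow> g z = (\<chi> i j.
      if i = X1 \<and> j = X1 then quad_jet K 0 0 0 0 0 z
      else if i = X2 \<and> j = X2 then quad_jet K 1 0 0 0 0 z
      else if i \<in> {X1, X2} \<and> j \<in> {X1, X2} then quad_jet K 2 0 0 0 0 z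
      else if (i, j) \<in> {(X1, Y1), (Y1, X1), (X2, Y2), (Y2, X2)} then 1 else 0)"
  shows "walker_jets {z. base_part z \<in> V} (quad_jet K) g"
proof
  have "continuous_on UNIV base_part"
    unfolding base_part_def by (intro continuous_on_vec_lambda continuous_on_component continuous_on_id)
  then have "open (base_part -` V)" using V by (auto simp: continuous_on_open_vimage)
  then show "open {z. base_part z \<in> V}" by (simp add: vimage_def)
qed (use g quad_jet_has_derivative[OF V K] quad_jet_cubic in simp_all)

section \<open>Tangent vectors and charts\<close>

locale surface_atlas =
  fixes A :: "'m::{t2_space, second_countable_topology} chart set"
  assumes surface: "smooth_surface A"
begin

abbreviation "cdom c \<equiv> fst c"
abbreviation "par c \<equiv> inv_into (fst c) (snd c)"

lemma chart:
  assumes "c \<in> A"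
  shows "open (cdom c)" "open (snd c ` cdom c)" "inj_on (snd c) (cdom c)"
    "continuous_on (cdom c) (snd c)" "continuous_on (snd c ` cdom c) (par c)"
proof -
  have "is_chart c" using surface assms by (auto simp: smooth_surface_def)
  then have h: "open (cdom c)" "open (snd c ` cdom c)" "homeomorphism (cdom c) (snd c ` cdom c) (snd c)
      (par c)"
    by (auto simp: is_chart_def)
  then show "open (cdom c)" "open (snd c ` cdom c)" "inj_on (snd c) (cdom c)"
    "continuous_on (cdom c) (snd c)" "continuous_on (snd c ` cdom c) (par c)"
    by (auto simp: homeomorphism_def intro: inj_on_inverseI)
qed

lemma par_coord: "c \<in> A \<Longrightarrow> p \<in> cdom c \<Longrightarrow> par c (snd c p) = p"
  using chart(3) by (simp add: inv_into_f_f)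

lemma coord_par: "x \<in> snd c ` cdom c \<Longrightarrow> snd c (par c x) = x"
  by (rule f_inv_into_f)

lemma par_in: "x \<in> snd c ` cdom c \<Longrightarrow> par c x \<in> cdom c"
  by (rule inv_into_into)

lemma open_coord_image:
  assumes "c \<in> A" "open W" shows "open (snd c ` (cdom c \<inter> W))"
proof -
  have "snd c ` (cdom c \<inter> W) = snd c ` cdom c \<inter> par c -` W"
    using par_coord[OF assms(1)] coord_par par_in by (auto simp: image_iff)
  then show ?thesis using chart[OF assms(1)] assms(2)
    by (metis continuous_on_open_vimage Int_commute)
qed

lemma transition_smooth:
  assumes "c \<in> A" "c' \<in> A"
  shows "smooth_on (snd c' \<circ> par c) (snd c ` (cdom c \<inter> cdom c'))"
  using surface assms unfolding smooth_surface_def chart_compatible_def by blast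

text \<open>Smoothness in a single chart carries over to every other chart through the smooth
  transition maps.\<close>

lemma smooth_funI_chart:
  assumes c: "c \<in> A" and W: "open W" "W \<subseteq> cdom c" and f: "smooth_on (f \<circ> par c) (snd c ` W)"
  shows "smooth_fun A W f"
  unfolding smooth_fun_def
proof (intro conjI ballI W)
  fix c' assume c': "c' \<in> A"
  let ?S = "snd c' ` (cdom c' \<inter> W)" and ?T = "snd c ` W"
  have T: "open ?T" using open_coord_image[OF c W(1)] W(2) by (simp add: Int_absorb1)
  have S: "open ?S" by (rule open_coord_image[OF c' W(1)])
  have t: "smooth_on (snd c \<circ> par c') ?S"
    by (rule smooth_on_subset[OF transition_smooth[OF c' c]]) (use W in auto)
  have "smooth_on (\<lambda>x. (f \<circ> par c) ((snd c \<circ> par c') x)) ?S"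
    by (rule smooth_on_compose[OF S T _ t f]) (use par_coord[OF c'] in auto)
  then show "smooth_on (f \<circ> par c') ?S"
    by (rule smooth_on_cong[OF S, THEN iffD1, rotated]) (use W(2) par_coord[OF c] par_coord[OF c'] in auto)
qed

lemma smooth_funD_chart:
  "smooth_fun A W f \<Longrightarrow> c \<in> A \<Longrightarrow> smooth_on (f \<circ> par c) (snd c ` (cdom c \<inter> W))"
  by (simp add: smooth_fun_def)

lemma smooth_fun_subset:
  assumes "smooth_fun A W f" "open W'" "W' \<subseteq> W" shows "smooth_fun A W' f"
  unfolding smooth_fun_def
proof (intro conjI ballI assms(2))
  fix c assume "c \<in> A"
  from smooth_funD_chart[OF assms(1) this] show "smooth_on (f \<circ> par c) (snd c ` (cdom c \<inter> W'))"
    by (rule smooth_on_subset) (use assms(3) in auto)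
qed

lemma smooth_fun_cong:
  assumes "smooth_fun A W f" "\<And>q. q \<in> W \<Longrightarrow> f q = g q" shows "smooth_fun A W g"
  unfolding smooth_fun_def
proof (intro conjI ballI)
  show W: "open W" using assms(1) by (simp add: smooth_fun_def)
  fix c assume c: "c \<in> A"
  show "smooth_on (g \<circ> par c) (snd c ` (cdom c \<inter> W))"
    by (rule smooth_on_cong[OF open_coord_image[OF c W], THEN iffD1, OF _ smooth_funD_chart[OF assms(1) c]])
       (use assms(2) par_coord[OF c] in auto)
qed

lemma smooth_fun_combination:
  assumes "smooth_fun A W f" "smooth_fun A W g"
  shows "smooth_fun A W (\<lambda>q. a * f q + b * g q)" "smooth_fun A W (\<lambda>q. f q * g q)"
proof -
  have W: "open W" using assms(1) by (simp add: smooth_fun_def)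
  show "smooth_fun A W (\<lambda>q. a * f q + b * g q)" "smooth_fun A W (\<lambda>q. f q * g q)"
    unfolding smooth_fun_def using assms open_coord_image[OF _ W] W
    by (auto simp: smooth_fun_def o_def intro!: smooth_on_add smooth_on_mult)
qed

lemma smooth_fun_const: "open W \<Longrightarrow> smooth_fun A W (\<lambda>q. k)"
  by (simp add: smooth_fun_def o_def)

lemma smooth_fun_coord: "c \<in> A \<Longrightarrow> smooth_fun A (cdom c) (coord_fun c k)"
proof (rule smooth_funI_chart)
  assume c: "c \<in> A"
  have "smooth_on (\<lambda>x::real^2. x $ k) (snd c ` cdom c)"
    by (rule smooth_on_bounded_linear[OF bounded_linear_vec_nth])
  then show "smooth_on (coord_fun c k \<circ> par c) (snd c ` cdom c)"
    by (rule smooth_on_cong[OF chart(2)[OF c], THEN iffD1, rotated]) (simp add: coord_fun_def coord_par)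
qed (use chart in auto)

lemma smooth_near_fun: "smooth_fun A W f \<Longrightarrow> p \<in> W \<Longrightarrow> smooth_near A p f"
  by (auto simp: smooth_near_def)

lemma smooth_near_coord: "c \<in> A \<Longrightarrow> p \<in> cdom c \<Longrightarrow> smooth_near A p (coord_fun c k)"
  by (rule smooth_near_fun[OF smooth_fun_coord])

lemma smooth_near_cong:
  assumes "smooth_near A p f" "open W" "p \<in> W" "\<And>q. q \<in> W \<Longrightarrow> f q = g q" shows "smooth_near A p g"
proof -
  from assms(1) obtain V where V: "p \<in> V" "smooth_fun A V f" by (auto simp: smooth_near_def)
  then have "open V" by (simp add: smooth_fun_def)
  then have "smooth_fun A (V \<inter> W) g"
    by (intro smooth_fun_cong[OF smooth_fun_subset[OF V(2)]]) (use assms in auto)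
  then show ?thesis by (rule smooth_near_fun) (use V assms in auto)
qed

lemma smooth_near_common:
  assumes "smooth_near A p f" "smooth_near A p g"
  obtains V where "open V" "p \<in> V" "smooth_fun A V f" "smooth_fun A V g"
proof -
  from assms obtain V W where VW: "p \<in> V" "smooth_fun A V f" "p \<in> W" "smooth_fun A W g" by (auto simp:
      smooth_near_def)
  then have o: "open V" "open W" by (simp_all add: smooth_fun_def)
  show ?thesis
    by (rule that[of "V \<inter> W"]) (use VW o in \<open>auto intro: smooth_fun_subset\<close>)
qed

lemma smooth_near_combination:
  assumes "smooth_near A p f" "smooth_near A p g"
  shows "smooth_near A p (\<lambda>q. a * f q + b * g q)" "smooth_near A p (\<lambda>q. f q * g q)"
proof -
  obtain V where V: "p \<in> V" "smooth_fun A V f" "smooth_fun A V g"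
    using smooth_near_common[OF assms] by blast
  show "smooth_near A p (\<lambda>q. a * f q + b * g q)" "smooth_near A p (\<lambda>q. f q * g q)"
    using smooth_near_fun[OF smooth_fun_combination(1)[OF V(2,3)] V(1)]
      smooth_near_fun[OF smooth_fun_combination(2)[OF V(2,3)] V(1)] by auto
qed

lemma smooth_near_const: "smooth_near A p (\<lambda>q. k)"
  by (rule smooth_near_fun[OF smooth_fun_const[of UNIV]]) auto

lemma smooth_near_has_derivative:
  assumes c: "c \<in> A" and p: "p \<in> cdom c" and f: "smooth_near A p f"
  shows "((f \<circ> par c) has_derivative (\<lambda>v. \<Sum>i\<in>UNIV. v $ i * coord_vec A c i p f)) (at (snd c p))"
proof -
  from f obtain V where V: "p \<in> V" "smooth_fun A V f" by (auto simp: smooth_near_def)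
  then have "open V" by (simp add: smooth_fun_def)
  from smooth_on_has_derivative_pd[OF open_coord_image[OF c this] smooth_funD_chart[OF V(2) c], of "snd
      c p"]
  show ?thesis using V(1) p f by (simp add: coord_vec_def)
qed

section \<open>Coordinate vector fields\<close>

lemma coord_vec_eqI:
  assumes c: "c \<in> A" and p: "p \<in> cdom c" and f: "smooth_near A p f"
    and D: "((f \<circ> par c) has_derivative D) (at (snd c p))"
  shows "coord_vec A c i p f = D (axis i 1)"
  using f pd_has_derivative[OF D] by (simp add: coord_vec_def)

lemma coord_vec_cong:
  assumes c: "c \<in> A" and p: "p \<in> cdom c" and f: "smooth_near A p f"
    and W: "open W" "p \<in> W" "\<And>q. q \<in> W \<Longrightarrow> f q = g q"
  shows "coord_vec A c i p f = coord_vec A c i p g"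
proof -
  have "pd i (f \<circ> par c) (snd c p) = pd i (g \<circ> par c) (snd c p)"
    by (rule pd_cong[OF open_coord_image[OF c W(1)]]) (use W p par_coord[OF c] in auto)
  then show ?thesis
    using f smooth_near_cong[OF f W] by (simp add: coord_vec_def)
qed

lemma coord_vec_tangent:
  assumes c: "c \<in> A" and p: "p \<in> cdom c"
  shows "coord_vec A c i p \<in> tangent_space A p"
  unfolding tangent_space_def
proof (intro CollectI conjI allI impI; (elim conjE)?)
  fix f assume "\<not> smooth_near A p f" then show "coord_vec A c i p f = 0" by (simp add: coord_vec_def)
next
  fix f g W assume "smooth_near A p f" "open W" "p \<in> W" "\<forall>q\<in>W. f q = g q"
  then show "coord_vec A c i p f = coord_vec A c i p g" using coord_vec_cong[OF c p] by blast
next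
  fix f g a b assume fg: "smooth_near A p f" "smooth_near A p g"
  note D = smooth_near_has_derivative[OF c p fg(1)] smooth_near_has_derivative[OF c p fg(2)]
  have "(((\<lambda>q. a * f q + b * g q) \<circ> par c) has_derivative (\<lambda>v. a * (\<Sum>i\<in>UNIV. v $ i * coord_vec A c i p f) +
      b * (\<Sum>i\<in>UNIV. v $ i * coord_vec A c i p g))) (at (snd c p))"
    using D by (auto simp: o_def intro!: derivative_eq_intros)
  from coord_vec_eqI[OF c p smooth_near_combination(1)[OF fg] this]
  show "coord_vec A c i p (\<lambda>q. a * f q + b * g q) = a * coord_vec A c i p f + b * coord_vec A c i p g"
    using exhaust_2[of i] by (auto simp: sum_2 axis_def)
next
  fix f g assume fg: "smooth_near A p f" "smooth_near A p g"
  note D = smooth_near_has_derivative[OF c p fg(1)] smooth_near_has_derivative[OF c p fg(2)]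
  have "(((\<lambda>q. f q * g q) \<circ> par c) has_derivative (\<lambda>v. f p * (\<Sum>i\<in>UNIV. v $ i * coord_vec A c i p g) +
      (\<Sum>i\<in>UNIV. v $ i * coord_vec A c i p f) * g p)) (at (snd c p))"
    using has_derivative_mult[OF D] par_coord[OF c p] by (simp add: o_def)
  from coord_vec_eqI[OF c p smooth_near_combination(2)[OF fg] this]
  show "coord_vec A c i p (\<lambda>q. f q * g q) = f p * coord_vec A c i p g + g p * coord_vec A c i p f"
    using exhaust_2[of i] by (auto simp: sum_2 axis_def)
qed

lemma coord_vec_coord:
  assumes c: "c \<in> A" and p: "p \<in> cdom c"
  shows "coord_vec A c i p (coord_fun c k) = (if i = k then 1 else 0)"
proof -
  have "((\<lambda>x. x $ k) has_derivative (\<lambda>v. v $ k)) (at (snd c p))"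
    by (rule bounded_linear_imp_has_derivative[OF bounded_linear_vec_nth])
  then have "((coord_fun c k \<circ> par c) has_derivative (\<lambda>v. v $ k)) (at (snd c p))"
    by (rule has_derivative_transform_within_open[OF _ chart(2)[OF c]])
       (use p in \<open>auto simp: coord_fun_def par_coord[OF c]\<close>)
  from coord_vec_eqI[OF c p smooth_near_coord[OF c p] this] show ?thesis
    by (auto simp: axis_def)
qed

lemma vector_field_coord_vec:
  assumes c: "c \<in> A"
  shows "vector_field A (cdom c) (coord_vec A c i)"
  unfolding vector_field_def
proof (intro conjI ballI allI impI; (elim conjE)?)
  fix p assume "p \<in> cdom c" then show "coord_vec A c i p \<in> tangent_space A p" by (rule
      coord_vec_tangent[OF c])
next
  fix V f assume V: "V \<subseteq> cdom c" and f: "smooth_fun A V f"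
  then have oV: "open V" by (simp add: smooth_fun_def)
  have *: "smooth_on (f \<circ> par c) (snd c ` V)" "open (snd c ` V)"
    using smooth_funD_chart[OF f c] open_coord_image[OF c oV] V by (simp_all add: Int_absorb1)
  show "smooth_fun A V (\<lambda>q. coord_vec A c i q f)"
  proof (rule smooth_funI_chart[OF c oV V])
    show "smooth_on ((\<lambda>q. coord_vec A c i q f) \<circ> par c) (snd c ` V)"
      by (rule smooth_on_cong[OF *(2), THEN iffD1, OF _ smooth_on_pd[OF *(1), of i]])
         (use V par_coord[OF c] smooth_near_fun[OF f] in \<open>auto simp: coord_vec_def\<close>)
  qed
qed

section \<open>Tangent and cotangent spaces in terms of a chart\<close>

lemma tangentD:
  assumes "v \<in> tangent_space A p"
  shows "\<not> smooth_near A p f \<Longrightarrow> v f = 0"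
    "smooth_near A p f \<Longrightarrow> open W \<Longrightarrow> p \<in> W \<Longrightarrow> (\<And>q. q \<in> W \<Longrightarrow> f q = g q) \<Longrightarrow> v f = v g"
    "smooth_near A p f \<Longrightarrow> smooth_near A p g \<Longrightarrow> v (\<lambda>q. a * f q + b * g q) = a * v f + b * v g"
    "smooth_near A p f \<Longrightarrow> smooth_near A p g \<Longrightarrow> v (\<lambda>q. f q * g q) = f p * v g + g p * v f"
proof -
  note * = assms[unfolded tangent_space_def mem_Collect_eq]
  show "\<not> smooth_near A p f \<Longrightarrow> v f = 0"
    by (rule *[THEN conjunct1, rule_format])
  show "smooth_near A p f \<Longrightarrow> open W \<Longrightarrow> p \<in> W \<Longrightarrow> (\<And>q. q \<in> W \<Longrightarrow> f q = g q) \<Longrightarrow> v f = v g"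
    by (rule *[THEN conjunct2, THEN conjunct1, rule_format, of f W g]) simp
  show "smooth_near A p f \<Longrightarrow> smooth_near A p g \<Longrightarrow> v (\<lambda>q. a * f q + b * g q) = a * v f + b * v g"
    by (rule *[THEN conjunct2, THEN conjunct2, THEN conjunct1, rule_format]) simp
  show "smooth_near A p f \<Longrightarrow> smooth_near A p g \<Longrightarrow> v (\<lambda>q. f q * g q) = f p * v g + g p * v f"
    by (rule *[THEN conjunct2, THEN conjunct2, THEN conjunct2, rule_format]) simp
qed

lemma tangent_combination:
  assumes "v \<in> tangent_space A p" "w \<in> tangent_space A p"
  shows "(\<lambda>f. a * v f + b * w f) \<in> tangent_space A p"
proof -
  note v = tangentD
  show ?thesis
    unfolding tangent_space_def
  proof (intro CollectI conjI allI impI; (elim conjE)?)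
    fix f g W assume *: "smooth_near A p f" "open W" "p \<in> W" "\<forall>q\<in>W. f q = g q"
    show "a * v f + b * w f = a * v g + b * w g"
      using v(2)[OF assms(1) *(1-3)] v(2)[OF assms(2) *(1-3)] *(4) by metis
  next
    fix f g k l assume *: "smooth_near A p f" "smooth_near A p g"
    show "a * v (\<lambda>q. k * f q + l * g q) + b * w (\<lambda>q. k * f q + l * g q) =
       k * (a * v f + b * w f) + l * (a * v g + b * w g)"
      by (simp add: v(3)[OF assms(1) *] v(3)[OF assms(2) *] algebra_simps)
  next
    fix f g assume *: "smooth_near A p f" "smooth_near A p g"
    show "a * v (\<lambda>q. f q * g q) + b * w (\<lambda>q. f q * g q) = f p * (a * v g + b * w g) + g p * (a * v f + b
        * w f)"
      by (simp add: v(4)[OF assms(1) *] v(4)[OF assms(2) *] algebra_simps)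
  qed (simp add: v(1)[OF assms(1)] v(1)[OF assms(2)])
qed

text \<open>Hadamard's lemma \<open>F(x) = F(x\<^sub>0) + \<Sum>\<^sub>i (x\<^sub>i - x\<^sub>0\<^sub>i) G\<^sub>i(x)\<close> with smooth \<open>G\<^sub>i\<close> shows that a
  derivation is determined by its values on the coordinates.\<close>

lemma hadamard:
  fixes F :: "real^2 \<Rightarrow> real"
  assumes F: "smooth_on F (ball x0 r)" and r: "r > 0"
  obtains G where "\<And>i. smooth_on (G i) (ball x0 (r / 2))" "\<And>i. G i x0 = pd i F x0"
    "\<And>x. x \<in> ball x0 (r / 2) \<Longrightarrow> F x = F x0 + (\<Sum>i\<in>UNIV. (x $ i - x0 $ i) * G i x)"
proof -
  define G where "G = (\<lambda>i x. integral {0..1} (\<lambda>t. pd i F (x0 + t *\<^sub>R (x - x0))))"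
  \<comment> \<open>The segment parameter ranges over an open interval containing 0 and 1, as the
    parametric integral requires; factors up to 2 are absorbed by halving the radius.\<close>
  have seg: "x0 + t *\<^sub>R (x - x0) \<in> ball x0 r" if "x \<in> ball x0 (r / 2)" "t \<in> {-1<..<2}" for x t
  proof -
    have "dist x0 (x0 + t *\<^sub>R (x - x0)) = \<bar>t\<bar> * norm (x - x0)" by (simp add: dist_norm)
    also have "\<dots> \<le> 2 * norm (x - x0)" using that(2) by (intro mult_right_mono) auto
    also have "\<dots> < r" using that(1) by (simp add: dist_norm norm_minus_commute)
    finally show ?thesis by simp
  qed
  have "smooth_on (G i) (ball x0 (r / 2))" for i
  proof -
    have o: "open (ball x0 (r / 2) \<times> {-1<..<2::real})" by (intro open_Times) auto
    have "smooth_on (\<lambda>(p :: (real^2) \<times> real). pd i F (x0 + snd p *\<^sub>R (fst p - x0))) (ball x0 (r / 2) \<times>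
        {-1<..<2})"
    proof (rule smooth_on_compose[OF o open_ball _ _ smooth_on_pd[OF F]])
      show "(\<lambda>p. x0 + snd p *\<^sub>R (fst p - x0)) ` (ball x0 (r / 2) \<times> {-1<..<2}) \<subseteq> ball x0 r"
        using seg by auto
      have "smooth_on (\<lambda>(p :: (real^2) \<times> real). snd p * (fst p $ k - x0 $ k)) (ball x0 (r / 2) \<times>
          {-1<..<2})" for k
        by (intro smooth_on_mult[OF o] smooth_on_diff[OF o] smooth_on_const smooth_on_bounded_linear
            bounded_linear_snd bounded_linear_compose[OF bounded_linear_vec_nth bounded_linear_fst])
      then show "smooth_on (\<lambda>p. x0 + snd p *\<^sub>R (fst p - x0)) (ball x0 (r / 2) \<times> {-1<..<2})"
        by (auto simp: smooth_on_vec_iff[OF o] intro!: smooth_on_add[OF o])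
    qed
    from smooth_on_parametric_integral[OF open_ball _ _ this] show ?thesis
      by (simp add: G_def subset_iff)
  qed
  moreover have "G i x0 = pd i F x0" for i by (simp add: G_def)
  moreover have "F x = F x0 + (\<Sum>i\<in>UNIV. (x $ i - x0 $ i) * G i x)" if x: "x \<in> ball x0 (r / 2)" for x
  proof -
    let ?l = "\<lambda>t. x0 + t *\<^sub>R (x - x0)"
    have d: "((\<lambda>t. F (?l t)) has_vector_derivative (\<Sum>i\<in>UNIV. (x $ i - x0 $ i) * pd i F (?l t))) (at t
        within {0..1})"
      if "t \<in> {0..1}" for t
    proof -
      have "?l t \<in> ball x0 r" using seg[OF x] that by auto
      from smooth_on_has_derivative_pd[OF open_ball F this]
      have "(F has_derivative (\<lambda>v. \<Sum>i\<in>UNIV. v $ i * pd i F (?l t))) (at (?l t))" .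
      moreover have "(?l has_derivative (\<lambda>h. h *\<^sub>R (x - x0))) (at t within {0..1})"
        by (auto intro!: derivative_eq_intros)
      ultimately have "((\<lambda>t. F (?l t)) has_derivative (\<lambda>h. \<Sum>i\<in>UNIV. (h *\<^sub>R (x - x0)) $ i * pd i F (?l
          t))) (at t within {0..1})"
        by (rule has_derivative_compose[rotated])
      then show ?thesis
        by (simp add: has_vector_derivative_def sum_distrib_left mult.assoc)
    qed
    have "((\<lambda>t. \<Sum>i\<in>UNIV. (x $ i - x0 $ i) * pd i F (?l t)) has_integral F (?l 1) - F (?l 0)) {0..1}"
      by (rule fundamental_theorem_of_calculus) (use d in auto)
    moreover have "((\<lambda>t. \<Sum>i\<in>UNIV. (x $ i - x0 $ i) * pd i F (?l t)) has_integral (\<Sum>i\<in>UNIV. (x $ i - x0 $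
        i) * G i x)) {0..1}"
    proof (intro has_integral_sum has_integral_mult_right finite)
      fix i
      have "continuous_on {0..1} (\<lambda>t. pd i F (?l t))"
        by (rule continuous_on_compose2[OF smooth_on_continuous[OF smooth_on_pd[OF F]]])
           (use seg[OF x] in \<open>auto intro!: continuous_intros\<close>)
      then show "((\<lambda>t. pd i F (?l t)) has_integral G i x) {0..1}"
        unfolding G_def by (intro integrable_integral integrable_continuous_real)
    qed
    ultimately have "F (?l 1) - F (?l 0) = (\<Sum>i\<in>UNIV. (x $ i - x0 $ i) * G i x)"
      by (rule has_integral_unique)
    then show ?thesis by simp
  qed
  ultimately show ?thesis by (rule that)
qed

lemma tangent_basis:
  assumes c: "c \<in> A" and p: "p \<in> cdom c" and v: "v \<in> tangent_space A p"
  shows "v f = (\<Sum>i\<in>UNIV. v (coord_fun c i) * coord_vec A c i p f)"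
proof (cases "smooth_near A p f")
  case False
  then show ?thesis using v by (simp add: tangent_space_def coord_vec_def)
next
  case True
  note loc = tangentD(2)[OF v] and lin = tangentD(3)[OF v] and prod = tangentD(4)[OF v]
  \<comment> \<open>The product rule for 1 * 1 gives v(1) = 2 * v(1), so v kills 1 and by linearity
    all constants.\<close>
  have const: "v (\<lambda>q. k) = 0" for k
    using prod[OF smooth_near_const[of p 1] smooth_near_const[of p 1]]
      lin[OF smooth_near_const[of p 1] smooth_near_const[of p 1], of k 0] by simp
  from True obtain V where V: "p \<in> V" "smooth_fun A V f" by (auto simp: smooth_near_def)
  then have oV: "open V" by (simp add: smooth_fun_def)
  let ?x0 = "snd c p" and ?F = "f \<circ> par c"
  from open_coord_image[OF c oV] p V(1) obtain r where r: "r > 0" "ball ?x0 r \<subseteq> snd c ` (cdom c \<inter> V)"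
    by (metis IntI image_eqI open_contains_ball)
  have "smooth_on ?F (ball ?x0 r)"
    by (rule smooth_on_subset[OF smooth_funD_chart[OF V(2) c] r(2)])
  from hadamard[OF this r(1)] obtain G where G: "\<And>i. smooth_on (G i) (ball ?x0 (r / 2))" "\<And>i. G i ?x0 =
      pd i ?F ?x0"
    "\<And>x. x \<in> ball ?x0 (r / 2) \<Longrightarrow> ?F x = ?F ?x0 + (\<Sum>i\<in>UNIV. (x $ i - ?x0 $ i) * G i x)"
    by blast
  define W where "W = cdom c \<inter> snd c -` ball ?x0 (r / 2)"
  have W: "open W" "p \<in> W" "W \<subseteq> cdom c"
    using chart[OF c] p r(1) unfolding W_def
    by (auto simp: continuous_on_open_vimage Int_commute)
  have imW: "snd c ` W \<subseteq> ball ?x0 (r / 2)" by (auto simp: W_def)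
  have oimW: "open (snd c ` W)" using open_coord_image[OF c W(1)] W(3) by (simp add: Int_absorb1)
  define g where "g = (\<lambda>i q. G i (snd c q))"
  have g: "smooth_near A p (g i)" for i
  proof (rule smooth_near_fun[OF smooth_funI_chart[OF c W(1,3)] W(2)])
    show "smooth_on (g i \<circ> par c) (snd c ` W)"
      by (rule smooth_on_cong[OF oimW, THEN iffD1, OF _ smooth_on_subset[OF G(1) imW]])
         (use W(3) par_coord[OF c] in \<open>auto simp: g_def\<close>)
  qed
  let ?e = "\<lambda>i q. coord_fun c i q - ?x0 $ i"
  have e: "smooth_near A p (?e i)" for i
    using smooth_near_combination(1)[OF smooth_near_coord[OF c p, of i] smooth_near_const[of p "?x0 $
        i"], of 1 "-1"]
    by simp
  have ve: "v (?e i) = v (coord_fun c i)" for i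
    using lin[OF smooth_near_coord[OF c p, of i] smooth_near_const[of p "?x0 $ i"], of 1 "-1"] by (simp
        add: const)
  \<comment> \<open>The factor \<open>?e i\<close> vanishes at p, so the product rule leaves only
    its derivative times the value of \<open>g i\<close> at p.\<close>
  have vg: "v (\<lambda>q. ?e i q * g i q) = v (coord_fun c i) * coord_vec A c i p f" for i
  proof -
    have "?e i p = 0" "g i p = coord_vec A c i p f"
      using True by (simp_all add: coord_fun_def g_def G(2) coord_vec_def)
    then show ?thesis using prod[OF e g, of i i] by (simp add: ve)
  qed
  have eg: "smooth_near A p (\<lambda>q. ?e i q * g i q)" for i by (rule smooth_near_combination(2)[OF e g])
  have eq: "f q = f p + (\<Sum>i\<in>UNIV. ?e i q * g i q)" if "q \<in> W" for q
    using G(3)[of "snd c q"] that par_coord[OF c] p by (auto simp: W_def coord_fun_def g_def)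
  have "v f = v (\<lambda>q. f p + (?e 1 q * g 1 q + ?e 2 q * g 2 q))"
    by (rule loc[OF True W(1,2)]) (use eq in \<open>simp add: sum_2\<close>)
  also have "\<dots> = v (\<lambda>q. ?e 1 q * g 1 q + ?e 2 q * g 2 q)"
    using lin[OF smooth_near_const[of p "f p"] smooth_near_combination(1)[OF eg eg, of 1 1 1 2], of 1 1]
    by (simp add: const)
  also have "\<dots> = v (\<lambda>q. ?e 1 q * g 1 q) + v (\<lambda>q. ?e 2 q * g 2 q)"
    using lin[OF eg eg, of 1 1 1 2] by simp
  finally show ?thesis by (simp add: vg sum_2)
qed

lemma tangent_basis':
  assumes "c \<in> A" "p \<in> cdom c" "v \<in> tangent_space A p"
  shows "v = (\<lambda>f. v (coord_fun c 1) * coord_vec A c 1 p f + v (coord_fun c 2) * coord_vec A c 2 p f)"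
  by (rule ext) (rule trans[OF tangent_basis[OF assms] sum_2])

text \<open>Every pair of fibre coordinates is attained. The value 0 off the tangent space is the
  normalisation demanded by \<open>cotangent_space\<close>.\<close>

lemma exists_covector:
  assumes c: "c \<in> A" and p: "p \<in> cdom c"
  obtains \<omega> where "\<omega> \<in> cotangent_space A p" "\<And>i. \<omega> (coord_vec A c i p) = y $ i"
proof -
  define \<omega> where "\<omega> = (\<lambda>v. if v \<in> tangent_space A p then \<Sum>i\<in>UNIV. y $ i * v (coord_fun c i) else 0)"
  have "\<omega> \<in> cotangent_space A p"
    unfolding cotangent_space_def
    by (simp add: \<omega>_def tangent_combination sum_2 distrib_left mult.left_commute)
  moreover have "\<omega> (coord_vec A c i p) = y $ i" for i
    using coord_vec_tangent[OF c p] exhaust_2[of i] by (auto simp: \<omega>_def coord_vec_coord[OF c p] sum_2)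
  ultimately show ?thesis by (rule that)
qed

end

section \<open>Modified Riemannian extensions\<close>

text \<open>The entries e = 0, 1, 2 of the metric are those with indices 11, 22, 12, matching the
  jets of \<open>walker_jets\<close>. The factor 1/2 in the metric disappears because the products
  of components of T are symmetrised over both r, s and i, j.\<close>

definition mre_coeff ::
    "'m::topological_space chart set \<Rightarrow> ('m \<Rightarrow> 'm tvec \<Rightarrow> 'm tvec) \<Rightarrow>
     (('m \<Rightarrow> 'm tvec) \<Rightarrow> ('m \<Rightarrow> 'm tvec) \<Rightarrow> 'm \<Rightarrow> 'm tvec) \<Rightarrow>
     ('m \<Rightarrow> 'm tvec \<Rightarrow> 'm tvec \<Rightarrow> real) \<Rightarrow> 'm chart \<Rightarrow> nat \<Rightarrow> nat \<Rightarrow> nat \<Rightarrow> real^2 \<Rightarrow> real" where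
  "mre_coeff A T nabla Phi c e m n = (let i = (if e = 1 then 2 else 1); j = (if e = 0 then 1 else 2) in
     if (m, n) = (2, 0) then (\<lambda>x. endo_comp A T c 1 i x * endo_comp A T c 1 j x)
     else if (m, n) = (1, 1) then (\<lambda>x. endo_comp A T c 1 i x * endo_comp A T c 2 j x + endo_comp A T c 1
         j x * endo_comp A T c 2 i x)
     else if (m, n) = (0, 2) then (\<lambda>x. endo_comp A T c 2 i x * endo_comp A T c 2 j x)
     else if (m, n) = (1, 0) then (\<lambda>x. - 2 * conn_comp A nabla c i j 1 x)
     else if (m, n) = (0, 1) then (\<lambda>x. - 2 * conn_comp A nabla c i j 2 x)
     else if (m, n) = (0, 0) then sym_comp A Phi c i j
     else (\<lambda>x. 0))"

locale mre_data = surface_atlas A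
  for A :: "'m::{t2_space, second_countable_topology} chart set" +
  fixes nabla :: "('m \<Rightarrow> 'm tvec) \<Rightarrow> ('m \<Rightarrow> 'm tvec) \<Rightarrow> 'm \<Rightarrow> 'm tvec"
    and T :: "'m \<Rightarrow> 'm tvec \<Rightarrow> 'm tvec"
    and Phi :: "'m \<Rightarrow> 'm tvec \<Rightarrow> 'm tvec \<Rightarrow> real"
  assumes conn: "affine_surface A nabla"
    and endo: "smooth_endomorphism_field A T"
    and sym: "smooth_symmetric_2tensor A Phi"
begin

abbreviation "\<Gamma> c \<equiv> conn_comp A nabla c"
abbreviation "\<tau> c \<equiv> endo_comp A T c"
abbreviation "\<phi> c \<equiv> sym_comp A Phi c"
abbreviation "K c \<equiv> mre_coeff A T nabla Phi c"
abbreviation "g c \<equiv> mre_metric A T nabla Phi c"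

lemma smooth_on_component:
  assumes c: "c \<in> A" and X: "vector_field A (cdom c) X"
  shows "smooth_on (\<lambda>x. X (par c x) (coord_fun c k)) (snd c ` cdom c)"
proof -
  have "smooth_fun A (cdom c) (\<lambda>q. X q (coord_fun c k))"
    using X smooth_fun_coord[OF c] unfolding vector_field_def by blast
  from smooth_funD_chart[OF this c] show ?thesis by (simp add: o_def)
qed

lemma smooth_on_conn_comp:
  assumes c: "c \<in> A" shows "smooth_on (\<Gamma> c i j k) (snd c ` cdom c)"
proof -
  have "affine_connection A nabla" using conn by (simp add: affine_surface_def)
  then have "vector_field A (cdom c) (nabla (coord_vec A c i) (coord_vec A c j))"
    by (rule affine_connection_def[THEN iffD1, rule_format, THEN conjunct1, rule_format])
       (use chart(1)[OF c] vector_field_coord_vec[OF c] in simp_all)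
  from smooth_on_component[OF c this, of k] show ?thesis by (simp add: conn_comp_def[abs_def])
qed

lemma smooth_on_endo_comp:
  assumes c: "c \<in> A" shows "smooth_on (\<tau> c r i) (snd c ` cdom c)"
proof -
  have "vector_field A (cdom c) (\<lambda>p. T p (coord_vec A c i p))"
    by (rule endo[unfolded smooth_endomorphism_field_def, THEN conjunct2, THEN conjunct2, rule_format])
       (use chart(1)[OF c] vector_field_coord_vec[OF c] in simp)
  from smooth_on_component[OF c this, of r] show ?thesis by (simp add: endo_comp_def[abs_def] Let_def)
qed

lemma smooth_on_sym_comp:
  assumes c: "c \<in> A" shows "smooth_on (\<phi> c i j) (snd c ` cdom c)"
proof -
  have "smooth_fun A (cdom c) (\<lambda>p. Phi p (coord_vec A c i p) (coord_vec A c j p))"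
    by (rule sym[unfolded smooth_symmetric_2tensor_def, THEN conjunct2, THEN conjunct2, rule_format])
       (use chart(1)[OF c] vector_field_coord_vec[OF c] in simp)
  from smooth_funD_chart[OF this c] show ?thesis by (simp add: sym_comp_def[abs_def] Let_def o_def)
qed

lemma sym_comp_commute:
  assumes c: "c \<in> A" and x: "x \<in> snd c ` cdom c" shows "\<phi> c i j x = \<phi> c j i x"
proof -
  have "par c x \<in> cdom c" using x by (rule par_in)
  then show ?thesis
    unfolding sym_comp_def Let_def
    by (intro sym[unfolded smooth_symmetric_2tensor_def, THEN conjunct1, rule_format]
        coord_vec_tangent[OF c])
qed

text \<open>Torsion-freeness reduces this to the bracket of two coordinate fields applied to a
  coordinate function. The inner derivative is locally constant, so both terms of the bracket
  vanish.\<close>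

lemma conn_comp_commute:
  assumes c: "c \<in> A" and x: "x \<in> snd c ` cdom c" shows "\<Gamma> c i j k x = \<Gamma> c j i k x"
proof -
  let ?p = "par c x"
  have p: "?p \<in> cdom c" using x by (rule par_in)
  have const: "coord_vec A c i ?p (\<lambda>q. coord_vec A c j q (coord_fun c k)) = 0" for i j
  proof -
    have "coord_vec A c i ?p (\<lambda>q. if j = k then 1 else 0 :: real) = coord_vec A c i ?p (\<lambda>q. coord_vec A
        c j q (coord_fun c k))"
      by (rule coord_vec_cong[OF c p smooth_near_const chart(1)[OF c] p]) (simp add: coord_vec_coord[OF c])
    moreover have "coord_vec A c i ?p (\<lambda>q. a) = 0" for a :: real
      using coord_vec_eqI[OF c p smooth_near_const, of a "\<lambda>v. 0"] by (simp add: o_def)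
    ultimately show ?thesis by simp
  qed
  have "nabla (coord_vec A c i) (coord_vec A c j) ?p (coord_fun c k) - nabla (coord_vec A c j)
      (coord_vec A c i) ?p (coord_fun c k)
      = coord_vec A c i ?p (\<lambda>q. coord_vec A c j q (coord_fun c k)) - coord_vec A c j ?p (\<lambda>q. coord_vec A
          c i q (coord_fun c k))"
    by (rule conn[unfolded affine_surface_def torsion_free_def, THEN conjunct2, THEN conjunct2,
        rule_format, of "cdom c"])
       (use smooth_fun_coord[OF c] vector_field_coord_vec[OF c] p in simp_all)
  then show ?thesis by (simp add: conn_comp_def const)
qed

section \<open>The endomorphism field in coordinates\<close>

lemma T_tangent: "v \<in> tangent_space A p \<Longrightarrow> T p v \<in> tangent_space A p"
  by (rule endo[unfolded smooth_endomorphism_field_def, THEN conjunct1, rule_format])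

lemma T_linear: "v \<in> tangent_space A p \<Longrightarrow> w \<in> tangent_space A p \<Longrightarrow>
    T p (\<lambda>f. a * v f + b * w f) = (\<lambda>f. a * T p v f + b * T p w f)"
  by (rule endo[unfolded smooth_endomorphism_field_def, THEN conjunct2, THEN conjunct1, rule_format])

lemma T_coord_vec:
  assumes c: "c \<in> A" and p: "p \<in> cdom c"
  shows "T p (coord_vec A c i p) = (\<lambda>f. \<tau> c 1 i (snd c p) * coord_vec A c 1 p f + \<tau> c 2 i (snd c p) *
      coord_vec A c 2 p f)"
  using tangent_basis'[OF c p T_tangent[OF coord_vec_tangent[OF c p]], of i]
  by (simp add: endo_comp_def Let_def par_coord[OF c p])

lemma T_apply:
  assumes c: "c \<in> A" and p: "p \<in> cdom c" and v: "v \<in> tangent_space A p"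
  shows "T p v = (\<lambda>f. v (coord_fun c 1) * T p (coord_vec A c 1 p) f + v (coord_fun c 2) * T p (coord_vec
      A c 2 p) f)"
proof -
  have "T p v = T p (\<lambda>f. v (coord_fun c 1) * coord_vec A c 1 p f + v (coord_fun c 2) * coord_vec A c 2 p f)"
    using tangent_basis'[OF c p v] by simp
  then show ?thesis by (simp only: T_linear[OF coord_vec_tangent[OF c p] coord_vec_tangent[OF c p]])
qed

lemma square_zero_iff:
  assumes c: "c \<in> A" and p: "p \<in> cdom c"
  shows "square_zero_at A T p \<longleftrightarrow> (\<forall>r i. (\<Sum>k\<in>UNIV. \<tau> c r k (snd c p) * \<tau> c k i (snd c p)) = 0)"
proof -
  let ?x = "snd c p" and ?d = "\<lambda>i. coord_vec A c i p"
  have TT: "T p (T p (?d i)) = (\<lambda>f. (\<Sum>k\<in>UNIV. \<tau> c 1 k ?x * \<tau> c k i ?x) * ?d 1 f + (\<Sum>k\<in>UNIV. \<tau> c 2 k ?x *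
      \<tau> c k i ?x) * ?d 2 f)" for i
    unfolding T_coord_vec[OF c p, of i] T_linear[OF coord_vec_tangent[OF c p] coord_vec_tangent[OF c p]]
    unfolding T_coord_vec[OF c p] sum_2 by (rule ext) (simp add: algebra_simps)
  show ?thesis
  proof
    assume "square_zero_at A T p"
    then have 0: "T p (T p (?d i)) = (\<lambda>f. 0)" for i using coord_vec_tangent[OF c p] by (simp add:
        square_zero_at_def)
    have "(\<Sum>k\<in>UNIV. \<tau> c r k ?x * \<tau> c k i ?x) = 0" for r i
      using fun_cong[OF TT[of i], of "coord_fun c r"] exhaust_2[of r]
      by (auto simp: 0 coord_vec_coord[OF c p])
    then show "\<forall>r i. (\<Sum>k\<in>UNIV. \<tau> c r k ?x * \<tau> c k i ?x) = 0" by blast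
  next
    assume *: "\<forall>r i. (\<Sum>k\<in>UNIV. \<tau> c r k ?x * \<tau> c k i ?x) = 0"
    have 0: "T p (T p (?d i)) = (\<lambda>f. 0)" for i unfolding TT using * by simp
    show "square_zero_at A T p"
      unfolding square_zero_at_def
    proof
      fix v assume v: "v \<in> tangent_space A p"
      have "T p (T p v) = (\<lambda>f. v (coord_fun c 1) * T p (T p (?d 1)) f + v (coord_fun c 2) * T p (T p (?d
          2)) f)"
        unfolding T_apply[OF c p v]
        by (rule T_linear) (intro T_tangent coord_vec_tangent[OF c p])+
      then show "T p (T p v) = (\<lambda>f. 0)" by (simp add: 0)
    qed
  qed
qed

lemma zero_iff:
  assumes c: "c \<in> A" and p: "p \<in> cdom c"
  shows "zero_at A T p \<longleftrightarrow> (\<forall>r i. \<tau> c r i (snd c p) = 0)"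
proof
  assume "zero_at A T p"
  then show "\<forall>r i. \<tau> c r i (snd c p) = 0"
    using coord_vec_tangent[OF c p] by (simp add: zero_at_def endo_comp_def Let_def par_coord[OF c p])
next
  assume *: "\<forall>r i. \<tau> c r i (snd c p) = 0"
  then have "T p (coord_vec A c i p) = (\<lambda>f. 0)" for i unfolding T_coord_vec[OF c p] by simp
  then show "zero_at A T p" unfolding zero_at_def using T_apply[OF c p] by simp
qed

lemma scalar_iff:
  assumes c: "c \<in> A" and p: "p \<in> cdom c"
  shows "p \<in> scalar_locus A T \<longleftrightarrow>
    \<tau> c 1 2 (snd c p) = 0 \<and> \<tau> c 2 1 (snd c p) = 0 \<and> \<tau> c 1 1 (snd c p) = \<tau> c 2 2 (snd c p)"
proof
  assume "p \<in> scalar_locus A T"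
  then obtain l where "\<forall>v\<in>tangent_space A p. T p v = (\<lambda>f. l * v f)" by (auto simp: scalar_locus_def)
  then have "T p (coord_vec A c i p) = (\<lambda>f. l * coord_vec A c i p f)" for i using coord_vec_tangent[OF c
      p] by blast
  then have "\<tau> c r i (snd c p) = (if i = r then l else 0)" for r i
    by (simp add: endo_comp_def Let_def par_coord[OF c p] coord_vec_coord[OF c p])
  then show "\<tau> c 1 2 (snd c p) = 0 \<and> \<tau> c 2 1 (snd c p) = 0 \<and> \<tau> c 1 1 (snd c p) = \<tau> c 2 2 (snd c p)" by simp
next
  assume *: "\<tau> c 1 2 (snd c p) = 0 \<and> \<tau> c 2 1 (snd c p) = 0 \<and> \<tau> c 1 1 (snd c p) = \<tau> c 2 2 (snd c p)"
  have Tc: "T p (coord_vec A c i p) = (\<lambda>f. \<tau> c 1 1 (snd c p) * coord_vec A c i p f)" for i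
    unfolding T_coord_vec[OF c p] using * exhaust_2[of i] by auto
  have "T p v = (\<lambda>f. \<tau> c 1 1 (snd c p) * v f)" if "v \<in> tangent_space A p" for v
  proof
    fix f
    have "T p v f = \<tau> c 1 1 (snd c p) * (v (coord_fun c 1) * coord_vec A c 1 p f + v (coord_fun c 2) *
        coord_vec A c 2 p f)"
      unfolding T_apply[OF c p that] Tc by (simp add: algebra_simps)
    also have "v (coord_fun c 1) * coord_vec A c 1 p f + v (coord_fun c 2) * coord_vec A c 2 p f = v f"
      by (rule fun_cong[OF tangent_basis'[OF c p that], symmetric])
    finally show "T p v f = \<tau> c 1 1 (snd c p) * v f" .
  qed
  then show "p \<in> scalar_locus A T" by (auto simp: scalar_locus_def)
qed

lemma cover: obtains c where "c \<in> A" "p \<in> cdom c"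
proof -
  have "p \<in> (\<Union>c\<in>A. cdom c)" using surface by (simp add: smooth_surface_def)
  then show ?thesis using that by blast
qed

lemma open_nonscalar: "open (- scalar_locus A T)"
proof (subst open_subopen, intro ballI)
  fix p assume p: "p \<in> - scalar_locus A T"
  obtain c where c: "c \<in> A" "p \<in> cdom c" by (rule cover)
  \<comment> \<open>The trace-free part of T measured in the chart; it is continuous and positive
    exactly where T is not scalar.\<close>
  let ?F = "\<lambda>q. \<bar>\<tau> c 1 2 (snd c q)\<bar> + \<bar>\<tau> c 2 1 (snd c q)\<bar> + \<bar>\<tau> c 1 1 (snd c q) - \<tau> c 2 2 (snd c q)\<bar>"
  have "continuous_on (cdom c) (\<lambda>q. \<tau> c r i (snd c q))" for r i
    by (rule continuous_on_compose2[OF smooth_on_continuous[OF smooth_on_endo_comp[OF c(1)]] chart(4)[OF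
        c(1)]]) simp
  then have "continuous_on (cdom c) ?F" by (intro continuous_intros)
  then have o: "open (?F -` {0<..} \<inter> cdom c)"
    using continuous_on_open_vimage[OF chart(1)[OF c(1)]] open_greaterThan by blast
  have iff: "?F q > 0 \<longleftrightarrow> q \<notin> scalar_locus A T" if "q \<in> cdom c" for q
    unfolding scalar_iff[OF c(1) that] by linarith
  have "p \<in> ?F -` {0<..} \<inter> cdom c" using iff[OF c(2)] p c(2) by auto
  moreover have "?F -` {0<..} \<inter> cdom c \<subseteq> - scalar_locus A T" using iff by auto
  ultimately show "\<exists>U. open U \<and> p \<in> U \<and> U \<subseteq> - scalar_locus A T" using o by blast
qed

lemma smooth_on_mre_coeff:
  assumes c: "c \<in> A" shows "smooth_on (K c e m n) (snd c ` cdom c)"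
proof -
  have "smooth_on (\<lambda>x. - (2 * \<Gamma> c i j k x)) (snd c ` cdom c)" for i j k
    using smooth_on_mult[OF chart(2)[OF c] smooth_on_const[of "-2"] smooth_on_conn_comp[OF c]] by simp
  then show ?thesis
    unfolding mre_coeff_def Let_def
    by (simp add: c smooth_on_mult smooth_on_add smooth_on_endo_comp smooth_on_sym_comp chart(2))
qed

lemma walker_jets_mre:
  assumes c: "c \<in> A"
  shows "walker_jets {z. base_part z \<in> snd c ` cdom c} (quad_jet (K c)) (g c)"
proof (rule walker_jets_quad_jet[OF chart(2)[OF c] smooth_on_mre_coeff[OF c]])
  fix z :: "real^(2 + 2)" assume z: "base_part z \<in> snd c ` cdom c"
  have "g c z $ i $ j = (if i = X1 \<and> j = X1 then quad_jet (K c) 0 0 0 0 0 z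
      else if i = X2 \<and> j = X2 then quad_jet (K c) 1 0 0 0 0 z
      else if i \<in> {X1, X2} \<and> j \<in> {X1, X2} then quad_jet (K c) 2 0 0 0 0 z
      else if (i, j) \<in> {(X1, Y1), (Y1, X1), (X2, Y2), (Y2, X2)} then 1 else 0)" for i j
  proof -
    have "\<forall>i j. g c z $ i $ j = (if i = X1 \<and> j = X1 then quad_jet (K c) 0 0 0 0 0 z
      else if i = X2 \<and> j = X2 then quad_jet (K c) 1 0 0 0 0 z
      else if i \<in> {X1, X2} \<and> j \<in> {X1, X2} then quad_jet (K c) 2 0 0 0 0 z
      else if (i, j) \<in> {(X1, Y1), (Y1, X1), (X2, Y2), (Y2, X2)} then 1 else 0)"
      \<comment> \<open>The entry with indices X2, X1 is represented by the coefficients for X1, X2,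
        which requires the symmetry of the connection components and of \<open>Phi\<close>.\<close>
      unfolding forall_idx
      by (simp add: quad_jet_simps pdx_def mre_coeff_def Let_def)
         (simp add: mre_metric_def idx_defs sum_2 Let_def conn_comp_commute[OF c z, of 2 1]
             sym_comp_commute[OF c z, of 2 1] algebra_simps)
    then show ?thesis by blast
  qed
  then show "g c z = (\<chi> i j. if i = X1 \<and> j = X1 then quad_jet (K c) 0 0 0 0 0 z
      else if i = X2 \<and> j = X2 then quad_jet (K c) 1 0 0 0 0 z
      else if i \<in> {X1, X2} \<and> j \<in> {X1, X2} then quad_jet (K c) 2 0 0 0 0 z
      else if (i, j) \<in> {(X1, Y1), (Y1, X1), (X2, Y2), (Y2, X2)} then 1 else 0)"
    by (simp add: vec_eq_iff)
qed

lemma base_part_cotangent: "base_part (cotangent_coords A c \<xi>) = snd c (fst \<xi>)"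
  by (simp add: base_part_def cotangent_coords_def vec_eq_iff)

text \<open>Allows the Bach tensor to be evaluated at freely chosen fibre coordinates over
  p.\<close>

lemma cotangent_point:
  assumes c: "c \<in> A" and p: "p \<in> cdom c"
  obtains \<xi> where "\<xi> \<in> cotangent_bundle A {p}" "base_part (cotangent_coords A c \<xi>) = snd c p"
    "cotangent_coords A c \<xi> $ Y1 = y1" "cotangent_coords A c \<xi> $ Y2 = y2"
proof -
  obtain \<omega> where w: "\<omega> \<in> cotangent_space A p" "\<And>i. \<omega> (coord_vec A c i p) = vec2 y1 y2 $ i"
    using exists_covector[OF c p] by blast
  show ?thesis
  proof (rule that[of "(p, \<omega>)"])
    show "(p, \<omega>) \<in> cotangent_bundle A {p}" using w(1) by (simp add: cotangent_bundle_def)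
    show "base_part (cotangent_coords A c (p, \<omega>)) = snd c p" by (simp add: base_part_cotangent)
    show "cotangent_coords A c (p, \<omega>) $ Y1 = y1" "cotangent_coords A c (p, \<omega>) $ Y2 = y2"
      by (simp_all add: cotangent_coords_def idx_defs w(2))
  qed
qed

text \<open>Maximality of the atlas admits every chart compatible with its members; the new chart is
  c followed by \<Psi>, restricted to the part over V.\<close>

lemma chart_by_diffeo:
  assumes c: "c \<in> A" and V: "open V" "V \<subseteq> snd c ` cdom c" and \<Psi>: "smooth_on \<Psi> V" "inj_on \<Psi> V" "open (\<Psi> ` V)"
    and inv: "smooth_on (inv_into V \<Psi>) (\<Psi> ` V)"
  defines "c' \<equiv> (par c ` V, \<lambda>q. \<Psi> (snd c q))"
  shows "c' \<in> A" "\<And>x. x \<in> V \<Longrightarrow> par c' (\<Psi> x) = par c x"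
proof -
  let ?U = "par c ` V"
  have cp: "snd c (par c x) = x" if "x \<in> V" for x using V(2) that by (intro coord_par) auto
  have im: "snd c' ` ?U = \<Psi> ` V" by (auto simp: c'_def image_image cp)
  have U: "?U = cdom c \<inter> snd c -` V"
    using V(2) cp par_in par_coord[OF c] by (force simp: image_iff)
  have oU: "open ?U"
    unfolding U using chart(1,4)[OF c] V(1) continuous_on_open_vimage by (metis Int_commute)
  have UD: "?U \<subseteq> cdom c" by (simp add: U)
  have inj: "inj_on (snd c') ?U" using \<Psi>(2) by (auto simp: inj_on_def c'_def cp)
  have par': "par c' (\<Psi> x) = par c x" if "x \<in> V" for x
  proof -
    have "inv_into ?U (snd c') (snd c' (par c x)) = par c x"
      by (rule inv_into_f_f[OF inj]) (use that in simp)
    then show ?thesis using cp[OF that] by (simp add: c'_def)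
  qed
  then show "\<And>x. x \<in> V \<Longrightarrow> par c' (\<Psi> x) = par c x" .
  have iV: "inv_into V \<Psi> w \<in> V" "\<Psi> (inv_into V \<Psi> w) = w" if "w \<in> \<Psi> ` V" for w
    using that by (auto simp: inv_into_into f_inv_into_f)
  have snd': "snd c' q = \<Psi> (snd c q)" for q by (simp add: c'_def)
  have par_eq: "par c' w = par c (inv_into V \<Psi> w)" if "w \<in> \<Psi> ` V" for w
    using par'[OF iV(1)[OF that]] iV(2)[OF that] by simp
  have cont: "continuous_on (\<Psi> ` V) (\<lambda>w. par c (inv_into V \<Psi> w))"
    by (rule continuous_on_compose2[OF chart(5)[OF c] smooth_on_continuous[OF inv]]) (use iV V(2) in auto)
  have "homeomorphism ?U (\<Psi> ` V) (snd c') (par c')"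
    unfolding homeomorphism_def
  proof (intro conjI ballI)
    show "par c' (snd c' q) = q" if "q \<in> ?U" for q using that by (auto simp: par' snd' cp)
    show "snd c' ` ?U = \<Psi> ` V" by (rule im)
    show "continuous_on ?U (snd c')"
      unfolding c'_def snd_conv
      by (rule continuous_on_compose2[OF smooth_on_continuous[OF \<Psi>(1)] continuous_on_subset[OF
          chart(4)[OF c] UD]]) (auto simp: cp)
    show "snd c' (par c' w) = w" if "w \<in> \<Psi> ` V" for w
      using iV[OF that] by (simp add: par_eq[OF that] cp snd')
    show "par c' ` \<Psi> ` V = ?U" by (auto simp: image_image par')
    show "continuous_on (\<Psi> ` V) (par c')"
      by (rule continuous_on_eq[OF cont]) (simp add: par_eq)
  qed
  then have "is_chart c'" unfolding is_chart_def using oU \<Psi>(3) im by (simp add: c'_def)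
  moreover have "chart_compatible c' d" if d: "d \<in> A" for d
    unfolding chart_compatible_def
  proof
    let ?W = "snd c ` (cdom c \<inter> (?U \<inter> cdom d))"
    have fst': "fst c' = ?U" by (simp add: c'_def)
    have W: "?W \<subseteq> V" using U by auto
    have oW: "open ?W" by (rule open_coord_image[OF c]) (intro open_Int oU chart(1)[OF d])
    have S: "snd c' ` (?U \<inter> cdom d) = \<Psi> ` ?W" using UD by (auto simp: c'_def image_image)
    have oS: "open (\<Psi> ` ?W)"
    proof -
      have eq: "\<Psi> ` ?W = inv_into V \<Psi> -` ?W \<inter> \<Psi> ` V"
      proof (intro equalityI subsetI)
        fix w assume "w \<in> \<Psi> ` ?W"
        then obtain x where x: "x \<in> ?W" "w = \<Psi> x" by blast
        then have "inv_into V \<Psi> w = x" using W \<Psi>(2) by (simp add: inv_into_f_f subset_iff)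
        then show "w \<in> inv_into V \<Psi> -` ?W \<inter> \<Psi> ` V" using x W by auto
      next
        fix w assume w: "w \<in> inv_into V \<Psi> -` ?W \<inter> \<Psi> ` V"
        then show "w \<in> \<Psi> ` ?W" using iV(2)[of w] by (intro image_eqI[of _ _ "inv_into V \<Psi> w"]) auto
      qed
      show ?thesis
        unfolding eq using continuous_on_open_vimage[OF \<Psi>(3)] smooth_on_continuous[OF inv] oW by blast
    qed
    have s1: "smooth_on (inv_into V \<Psi>) (\<Psi> ` ?W)" by (rule smooth_on_subset[OF inv]) (use W in auto)
    have "smooth_on (\<lambda>w. (snd d \<circ> par c) (inv_into V \<Psi> w)) (\<Psi> ` ?W)"
    proof (rule smooth_on_compose[OF oS oW _ s1])
      show "inv_into V \<Psi> ` \<Psi> ` ?W \<subseteq> ?W" using W \<Psi>(2) by (force simp: inv_into_f_f subset_iff)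
      show "smooth_on (snd d \<circ> par c) ?W"
        by (rule smooth_on_subset[OF transition_smooth[OF c d]]) auto
    qed
    moreover have "smooth_on (snd d \<circ> par c') (\<Psi> ` ?W) \<longleftrightarrow> smooth_on (\<lambda>w. (snd d \<circ> par c) (inv_into V \<Psi>
        w)) (\<Psi> ` ?W)"
      by (rule smooth_on_cong[OF oS]) (simp only: o_apply par_eq[OF subsetD[OF image_mono[OF W]]])
    ultimately show "smooth_on (snd d \<circ> inv_into (fst c') (snd c')) (snd c' ` (fst c' \<inter> fst d))"
      unfolding fst' S using fst' by simp
    have S': "snd d ` (fst c' \<inter> fst d) = snd d ` (cdom d \<inter> ?U)" unfolding fst' by (simp add: Int_commute)
    have oS': "open (snd d ` (cdom d \<inter> ?U))" by (rule open_coord_image[OF d oU])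
    have s2: "smooth_on (snd c \<circ> par d) (snd d ` (cdom d \<inter> ?U))"
      by (rule smooth_on_subset[OF transition_smooth[OF d c]]) (use UD in auto)
    have "smooth_on (\<lambda>x. \<Psi> ((snd c \<circ> par d) x)) (snd d ` (cdom d \<inter> ?U))"
      by (rule smooth_on_compose[OF oS' V(1) _ s2 \<Psi>(1)]) (use U par_coord[OF d] in auto)
    then show "smooth_on (snd c' \<circ> inv_into (fst d) (snd d)) (snd d ` (fst c' \<inter> fst d))"
      unfolding S' by (simp add: c'_def o_def)
  qed
  ultimately show "c' \<in> A"
    using surface[unfolded smooth_surface_def, THEN conjunct2, THEN conjunct2, THEN conjunct2,
        rule_format, of c'] by blast
qed

text \<open>The equations are the entries of T^2 = 0. They make trace(T) annihilate q, r and p - s;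
  were the trace nonzero, T would be scalar with square zero, hence zero.\<close>

lemma nilpotent_components:
  fixes p q r s :: real
  assumes "p * p + q * r = 0" "p * q + q * s = 0" "r * p + s * r = 0" "r * q + s * s = 0"
  shows "s = - p" "q * r = - (p * p)"
proof -
  have "(p + s) * q = 0" "(p + s) * r = 0" "(p + s) * (p - s) = 0" using assms by algebra+
  then have "p + s = 0 \<or> q = 0 \<and> r = 0 \<and> p - s = 0" by auto
  then show "s = - p" using assms(1) by auto
  show "q * r = - (p * p)" using assms(1) by simp
qed

lemma exists_normal_form:
  assumes sq: "\<And>p. square_zero_at A T p" and nz: "\<not> zero_at A T P"
  shows "\<exists>c\<in>A. P \<in> cdom c \<and> nilpotent_normal_form A T c"
proof -
  obtain c where c: "c \<in> A" and P: "P \<in> cdom c" by (rule cover)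
  let ?V = "snd c ` cdom c"
  have V: "open ?V" "snd c P \<in> ?V" using chart(2)[OF c] P by auto
  have nil: "\<tau> c 2 2 x = - \<tau> c 1 1 x" "\<tau> c 1 2 x * \<tau> c 2 1 x = - (\<tau> c 1 1 x * \<tau> c 1 1 x)" if x: "x \<in> ?V"
      for x
  proof -
    from x obtain p where p: "p \<in> cdom c" "x = snd c p" by blast
    have *: "(\<Sum>k\<in>UNIV. \<tau> c r k x * \<tau> c k i x) = 0" for r i using sq[of p] unfolding square_zero_iff[OF c
        p(1)] p(2) by blast
    show "\<tau> c 2 2 x = - \<tau> c 1 1 x" "\<tau> c 1 2 x * \<tau> c 2 1 x = - (\<tau> c 1 1 x * \<tau> c 1 1 x)"
      using nilpotent_components[of "\<tau> c 1 1 x" "\<tau> c 1 2 x" "\<tau> c 2 1 x" "\<tau> c 2 2 x"] *[of 1 1] *[of 1 2]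
          *[of 2 1] *[of 2 2]
      by (simp_all add: sum_2)
  qed
  \<comment> \<open>If both off-diagonal entries vanished, the determinant relation would give a
    zero first diagonal entry and the trace relation a zero second one, so T would vanish at
    P.\<close>
  have nz': "\<tau> c 1 2 (snd c P) \<noteq> 0 \<or> \<tau> c 2 1 (snd c P) \<noteq> 0"
    using nz nil[OF V(2)] unfolding zero_iff[OF c P] forall_2 by auto
  obtain V' and \<Psi> :: "real^2 \<Rightarrow> real^2" where V': "open V'" "snd c P \<in> V'" "V' \<subseteq> ?V" and \<Psi>: "smooth_on \<Psi>
      V'" "inj_on \<Psi> V'"
     "open (\<Psi> ` V')" and inv: "smooth_on (inv_into V' \<Psi>) (\<Psi> ` V')"
    and ex: "\<And>x. x \<in> V' \<Longrightarrow> \<exists>a :: real^2. (\<forall>r i. \<tau> c r i x = a $ r * pd i (\<lambda>x. \<Psi> x $ 2) x) \<and>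
       a $ 1 * pd 1 (\<lambda>x. \<Psi> x $ 1) x + a $ 2 * pd 2 (\<lambda>x. \<Psi> x $ 1) x = 1 \<and>
       a $ 1 * pd 1 (\<lambda>x. \<Psi> x $ 2) x + a $ 2 * pd 2 (\<lambda>x. \<Psi> x $ 2) x = 0"
    by (rule nilpotent_coordinates[OF V smooth_on_endo_comp[OF c] nil nz']) (assumption | rule that;
        assumption)+
  define c' where "c' = (par c ` V', \<lambda>q. \<Psi> (snd c q))"
  have c': "c' \<in> A" and par': "\<And>x. x \<in> V' \<Longrightarrow> par c' (\<Psi> x) = par c x"
    unfolding c'_def by (rule chart_by_diffeo[OF c V'(1,3) \<Psi> inv]; assumption)+
  have dom': "cdom c' = par c ` V'" and snd': "snd c' = (\<lambda>q. \<Psi> (snd c q))" by (simp_all add: c'_def)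
  have "P \<in> cdom c'" using V'(2) par_coord[OF c P] unfolding dom' by force
  moreover have "nilpotent_normal_form A T c'"
    unfolding nilpotent_normal_form_def
  proof (intro ballI ext)
    fix p v f assume p': "p \<in> cdom c'" and v: "v \<in> tangent_space A p"
    then obtain x where x: "x \<in> V'" "p = par c x" unfolding dom' by blast
    have xV: "x \<in> ?V" using x V'(3) by blast
    have p: "p \<in> cdom c" "snd c p = x" "snd c' p = \<Psi> x" using par_in[OF xV] coord_par[OF xV] by (auto
        simp: x snd')
    obtain a where a: "\<And>r i. \<tau> c r i x = a $ r * pd i (\<lambda>x. \<Psi> x $ 2) x"
       "a $ 1 * pd 1 (\<lambda>x. \<Psi> x $ 1) x + a $ 2 * pd 2 (\<lambda>x. \<Psi> x $ 1) x = 1"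
       "a $ 1 * pd 1 (\<lambda>x. \<Psi> x $ 2) x + a $ 2 * pd 2 (\<lambda>x. \<Psi> x $ 2) x = 0" using ex[OF x(1)] by blast
    \<comment> \<open>Change of coordinate vectors between c and c', that is, the chain rule for f
      read through \<Psi>.\<close>
    have chain: "coord_vec A c r p f = coord_vec A c' 1 p f * pd r (\<lambda>x. \<Psi> x $ 1) x + coord_vec A c' 2 p
        f * pd r (\<lambda>x. \<Psi> x $ 2) x"
      if f: "smooth_near A p f" for r f
    proof -
      from f obtain W where W: "p \<in> W" "smooth_fun A W f" by (auto simp: smooth_near_def)
      then have oW: "open W" by (simp add: smooth_fun_def)
      have "pd r (f \<circ> par c) x = pd r (\<lambda>y. (f \<circ> par c') (\<Psi> y)) x"
        by (rule pd_cong[OF V'(1) x(1)]) (simp add: par')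
      also have "\<dots> = pd 1 (f \<circ> par c') (\<Psi> x) * pd r (\<lambda>x. \<Psi> x $ 1) x + pd 2 (f \<circ> par c') (\<Psi> x) * pd r
          (\<lambda>x. \<Psi> x $ 2) x"
        by (rule pd_chain_2d[OF V'(1) \<Psi>(1) x(1) open_coord_image[OF c' oW] smooth_funD_chart[OF W(2) c']])
           (use W(1) p p' in force)
      finally show ?thesis using f by (simp add: coord_vec_def p)
    qed
    \<comment> \<open>The vector a has derivative 1 along the first and 0 along the second new
      coordinate, so it is the first coordinate vector of c'.\<close>
    have D: "a $ 1 * coord_vec A c 1 p f + a $ 2 * coord_vec A c 2 p f = coord_vec A c' 1 p f"
    proof (cases "smooth_near A p f")
      case True
      have "a $ 1 * coord_vec A c 1 p f + a $ 2 * coord_vec A c 2 p f =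
        coord_vec A c' 1 p f * (a $ 1 * pd 1 (\<lambda>x. \<Psi> x $ 1) x + a $ 2 * pd 2 (\<lambda>x. \<Psi> x $ 1) x) +
        coord_vec A c' 2 p f * (a $ 1 * pd 1 (\<lambda>x. \<Psi> x $ 2) x + a $ 2 * pd 2 (\<lambda>x. \<Psi> x $ 2) x)"
        unfolding chain[OF True] by (simp add: algebra_simps)
      then show ?thesis by (simp add: a)
    qed (simp add: coord_vec_def)
    have w: "coord_vec A c r p (coord_fun c' 2) = pd r (\<lambda>x. \<Psi> x $ 2) x" for r
      using chain[OF smooth_near_coord[OF c' p', of 2], of r] by (simp add: coord_vec_coord[OF c' p'])
    have vw: "v (coord_fun c' 2) = v (coord_fun c 1) * pd 1 (\<lambda>x. \<Psi> x $ 2) x + v (coord_fun c 2) * pd 2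
        (\<lambda>x. \<Psi> x $ 2) x"
      using tangent_basis[OF c p(1) v, of "coord_fun c' 2"] by (simp add: sum_2 w)
    have "T p v f = v (coord_fun c 1) * (\<tau> c 1 1 x * coord_vec A c 1 p f + \<tau> c 2 1 x * coord_vec A c 2 p
        f) +
        v (coord_fun c 2) * (\<tau> c 1 2 x * coord_vec A c 1 p f + \<tau> c 2 2 x * coord_vec A c 2 p f)"
      unfolding T_apply[OF c p(1) v] T_coord_vec[OF c p(1)] p(2) ..
    also have "\<dots> = (v (coord_fun c 1) * pd 1 (\<lambda>x. \<Psi> x $ 2) x + v (coord_fun c 2) * pd 2 (\<lambda>x. \<Psi> x $ 2) x) *
        (a $ 1 * coord_vec A c 1 p f + a $ 2 * coord_vec A c 2 p f)"
      unfolding a(1) by (simp add: algebra_simps)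
    finally show "T p v f = v (coord_fun c' 2) * coord_vec A c' 1 p f" by (simp add: D vw)
  qed
  ultimately show ?thesis using c' by blast
qed

end

section \<open>Partial derivatives of locally equal functions, constants, multiples and
  differences\<close>

lemma pdx_cong:
  assumes "open V" "x \<in> V" "\<And>y. y \<in> V \<Longrightarrow> f y = f' y"
  shows "pdx a b f x = pdx a b f' x"
proof -
  have pw: "(pd i ^^ n) f x = (pd i ^^ n) f' x"
    if "\<And>y. y \<in> V \<Longrightarrow> f y = f' y" "x \<in> V" for f f' i n x
    using that(2)
  proof (induction n arbitrary: x)
    case 0
    then show ?case using that(1) by simp
  next
    case (Suc n)
    show ?case unfolding funpow.simps o_apply by (rule pd_cong[OF assms(1) Suc.prems Suc.IH])
  qed
  show ?thesis unfolding pdx_def by (rule pw[OF pw[OF assms(3)] assms(2)])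
qed

lemma pdx_const: "pdx a b (\<lambda>x. k) x = (if a = 0 \<and> b = 0 then k else 0)"
proof -
  have p: "pd i (\<lambda>x. k) = (\<lambda>x. 0)" for i :: 2 and k by (rule ext) (simp add: pd_def)
  have pw: "(pd i ^^ n) (\<lambda>x. k) = (\<lambda>x. if n = 0 then k else 0)" for i :: 2 and n k
    by (induction n) (auto simp: p)
  show ?thesis unfolding pdx_def pw by (cases b) (simp_all add: pw)
qed

lemma pdx_0: "pdx 0 0 f = f" and pdx_1: "pdx 1 0 f = pd 1 f" and pdx_2: "pdx 0 1 f = pd 2 f"
  by (simp_all add: pdx_def)

lemma pd_cmult:
  assumes "open V" "smooth_on f V" "x \<in> V"
  shows "pd i (\<lambda>x. k * f x) x = k * pd i f x"
proof -
  have "((\<lambda>x. k * f x) has_derivative (\<lambda>v. k * frechet_derivative f (at x) v)) (at x)"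
    by (rule has_derivative_mult_right[OF smooth_on_has_derivative[OF assms]])
  from pd_has_derivative[OF this] show ?thesis by (simp add: pd_def)
qed

lemma pd_diff:
  assumes "open V" "smooth_on f V" "smooth_on f' V" "x \<in> V"
  shows "pd i (\<lambda>x. f x - f' x) x = pd i f x - pd i f' x"
  using pd_has_derivative[OF has_derivative_diff[OF smooth_on_has_derivative[OF assms(1,2,4)]
      smooth_on_has_derivative[OF assms(1,3,4)]]]
  by (simp add: pd_def)

text \<open>The coefficients of \<open>y\<^sub>1\<^sup>2\<close>, \<open>y\<^sub>2\<^sup>2\<close> in \<open>\<BB>\<^sub>1\<^sub>1\<close> and of \<open>y\<^sub>1\<^sup>2\<close> in \<open>\<BB>\<^sub>2\<^sub>2\<close> for
  \<open>T = ((p, q), (r, s))\<close>, with \<open>m = q r\<close>; the last two are \<open>r\<^sup>2\<close> and \<open>q\<^sup>2\<close> times \<open>top2\<close>.\<close>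

definition top1 :: "real \<Rightarrow> real \<Rightarrow> real \<Rightarrow> real" where
  "top1 p s m = 1/6 * p^6 - 1/6 * p^5 * s + 5/6 * p^4 * m - p^4 * s^2 + 5/3 * p^3 * m * s + 11/6 * p^3 * s^3
     + 1/3 * p^2 * m^2 - 17/6 * p^2 * m * s^2 - 5/6 * p^2 * s^4 + 4/3 * p * m * s^3 + 5/3 * m^3 - 1/3 *
         m^2 * s^2"

definition top2 :: "real \<Rightarrow> real \<Rightarrow> real \<Rightarrow> real" where
  "top2 p s m = 1/6 * p^4 + 1/2 * p^3 * s - 13/3 * p^2 * s^2 + 1/2 * p * s^3 + 1/6 * s^4 + 1/6 * p^2 * m
     + 31/3 * p * m * s + 1/6 * m * s^2 - 5 * m^2"

text \<open>With m = q * r and s = - p the quantity p * p + m is minus the determinant of T.\<close>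

lemma trace_zero_tops:
  "top1 p (- p) m = 5/3 * (p * p + m)^2 * (p * p + m - 3 * (p * p))" "top2 p (- p) m = - 5 * (p * p + m)^2"
  unfolding top1_def top2_def by algebra+

text \<open>Here l is the double eigenvalue: p = l + a, s = l - a, and the vanishing discriminant
  gives m = - (a * a).\<close>

lemma double_eigenvalue_tops:
  "top1 (l + a) (l - a) (- (a * a)) = - 3 * l^4 * (a * a)" "top2 (l + a) (l - a) (- (a * a)) = - 3 * l^4"
  unfolding top1_def top2_def by algebra+

text \<open>The first three hypotheses are trace times discriminant times p - s, r and q. These
  three factors are not all zero when T is not scalar, so trace or discriminant vanishes;
  \<open>trace_zero_tops\<close> and \<open>double_eigenvalue_tops\<close> treat the two
  cases.\<close>

lemma nilpotent_if_tops_vanish: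
  fixes p q r s :: real
  assumes mixed: "(p * p - s * s) * ((p - s) * (p - s) + 4 * (q * r)) = 0" "r * (p + s) * ((p - s) * (p
      - s) + 4 * (q * r)) = 0"
      "q * (p + s) * ((p - s) * (p - s) + 4 * (q * r)) = 0"
    and tops: "top1 p s (q * r) = 0" "r * r * top2 p s (q * r) = 0" "q * q * top2 p s (q * r) = 0"
    and nonscalar: "\<not> (q = 0 \<and> r = 0 \<and> p = s)"
  shows "s = - p \<and> q * r = - (p * p)"
proof -
  let ?D = "(p - s) * (p - s) + 4 * (q * r)"
  consider "s = - p" | "?D = 0" "p + s \<noteq> 0"
  proof -
    have "(p - s) * ((p + s) * ?D) = 0" "r * ((p + s) * ?D) = 0" "q * ((p + s) * ?D) = 0"
      using mixed by algebra+
    then have "(p + s) * ?D = 0" using nonscalar by auto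
    then show thesis using that by fastforce
  qed
  then show ?thesis
  proof cases
    case 1
    let ?d = "p * p + q * r"
    have "?d = 0"
    proof (rule ccontr)
      assume d: "?d \<noteq> 0"
      \<comment> \<open>A nonzero determinant makes \<open>top2\<close> nonzero. With q = r = 0 the
        polynomial \<open>top1\<close> becomes a nonzero multiple of p^6, while p is
        nonzero.\<close>
      have "r = 0" "q = 0" using tops(2,3) d by (auto simp: 1 trace_zero_tops)
      then show False using tops(1) d by (simp add: 1 trace_zero_tops)
    qed
    then show ?thesis using 1 by simp
  next
    case 2
    define l a where "l = (p + s) / 2" and "a = (p - s) / 2"
    have ps: "p = l + a" "s = l - a" and l: "l \<noteq> 0" using 2(2) by (auto simp: l_def a_def field_simps)
    have "4 * (q * r) = 4 * (- (a * a))" using 2(1) by (simp add: a_def field_simps)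
    then have m: "q * r = - (a * a)" by simp
    \<comment> \<open>All three hypotheses on the coefficients are squares times - 3 * l^4 with l
      nonzero, so T would be scalar.\<close>
    have "a = 0" "r = 0" "q = 0"
      using tops l unfolding m unfolding ps double_eigenvalue_tops by auto
    then show ?thesis using nonscalar ps by simp
  qed
qed

section \<open>The Bach tensor of a modified Riemannian extension\<close>

context mre_data
begin

lemma bach_flat_if_scalar:
  assumes "scalar_locus A T = UNIV"
  shows "mre_half_conformally_flat A T nabla Phi A" "mre_bach_flat A T nabla Phi A"
proof -
  have key: "weyl_half (- 1) (g c) i j k l z = 0 \<and> bach (g c) i j z = 0" if c: "c \<in> A" and z: "base_part
      z \<in> snd c ` cdom c" for c i j k l z
  proof -
    let ?V = "snd c ` cdom c"
    interpret w: walker_jets "{z. base_part z \<in> ?V}" "quad_jet (K c)" "g c" by (rule walker_jets_mre[OF c])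
    have sc: "\<tau> c 1 2 x = 0 \<and> \<tau> c 2 1 x = 0 \<and> \<tau> c 1 1 x = \<tau> c 2 2 x" if "x \<in> ?V" for x
      using that scalar_iff[OF c] assms by blast
    have K0: "pdx a b (K c e m n) x = 0"
      if x: "x \<in> ?V" and emn: "(e, m, n) \<in> {(0, 1, 1), (0, 0, 2), (1, 1, 1), (1, 2, 0), (2, 2, 0), (2,
          0, 2)}" for e m n a b x
    proof -
      have "K c e m n y = 0" if "y \<in> ?V" for y
        using emn sc[OF that] by (elim insertE emptyE) (simp_all add: mre_coeff_def Let_def)
      from pdx_cong[OF chart(2)[OF c] x this] show ?thesis by (simp add: pdx_const)
    qed
    \<comment> \<open>For T = \<lambda> Id the quadratic part is the square of \<lambda> times y_i
      y_j; the three coefficients all equal that square.\<close>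
    have K1: "pdx a b (K c 0 2 0) x = pdx a b (K c 2 1 1) x" "pdx a b (K c 1 0 2) x = pdx a b (K c 2 1 1) x"
      if x: "x \<in> ?V" for a b x
    proof -
      have "K c 0 2 0 y = K c 2 1 1 y" "K c 1 0 2 y = K c 2 1 1 y" if "y \<in> ?V" for y
        using sc[OF that] by (simp_all add: mre_coeff_def Let_def)
      from pdx_cong[OF chart(2)[OF c] x this(1)] pdx_cong[OF chart(2)[OF c] x this(2)]
      show "pdx a b (K c 0 2 0) x = pdx a b (K c 2 1 1) x" "pdx a b (K c 1 0 2) x = pdx a b (K c 2 1 1)
          x" by auto
    qed
    show ?thesis
    proof
      show "weyl_half (- 1) (g c) i j k l z = 0"
        by (rule w.weyl_half_scalar) (simp_all add: quad_jet_simps K0 K1 z)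
      show "bach (g c) i j z = 0"
        by (rule w.bach_scalar) (simp_all add: quad_jet_simps K0 K1 z)
    qed
  qed
  have base: "base_part (cotangent_coords A c \<xi>) \<in> snd c ` cdom c" if "\<xi> \<in> cotangent_bundle A (cdom c)"
      for c \<xi>
    using that by (auto simp: cotangent_bundle_def base_part_cotangent)
  show "mre_half_conformally_flat A T nabla Phi A"
    unfolding mre_half_conformally_flat_def using key base by (intro bexI[of _ "- 1"]) auto
  show "mre_bach_flat A T nabla Phi A"
    unfolding mre_bach_flat_def bach_zero_on_def using key base by auto
qed

lemma square_zero_if_bach_zero:
  assumes P: "P \<notin> scalar_locus A T" and c: "c \<in> A" and Pc: "P \<in> cdom c"
    and B: "bach_zero_on A T nabla Phi c (cotangent_bundle A {P})"
  shows "square_zero_at A T P"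
proof -
  let ?V = "snd c ` cdom c" and ?x = "snd c P"
  interpret w: walker_jets "{z. base_part z \<in> ?V}" "quad_jet (K c)" "g c" by (rule walker_jets_mre[OF c])
  define p q r s where pqrs: "p = \<tau> c 1 1 ?x" "q = \<tau> c 1 2 ?x" "r = \<tau> c 2 1 ?x" "s = \<tau> c 2 2 ?x"
  have Kx: "K c 0 2 0 ?x = p * p" "K c 0 1 1 ?x = 2 * (p * r)" "K c 0 0 2 ?x = r * r"
    "K c 1 2 0 ?x = q * q" "K c 1 1 1 ?x = 2 * (q * s)" "K c 1 0 2 ?x = s * s"
    "K c 2 2 0 ?x = p * q" "K c 2 1 1 ?x = p * s + q * r" "K c 2 0 2 ?x = r * s"
    by (simp_all add: mre_coeff_def Let_def pqrs)
  \<comment> \<open>The hypothesis on the fibre is used only at the covectors with coordinates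
    (0,0), (1,0), (-1,0), (0,1) and (0,-1).\<close>
  have ex: "\<exists>z. base_part z = ?x \<and> z $ Y1 = y1 \<and> z $ Y2 = y2 \<and> (\<forall>i j. bach (g c) i j z = 0)" for y1 y2
    by (rule cotangent_point[OF c Pc, of y1 y2]) (use B in \<open>auto simp: bach_zero_on_def\<close>)
  obtain Zp where Zp: "\<And>y1 y2. base_part (Zp y1 y2) = ?x" "\<And>y1 y2. Zp y1 y2 $ Y1 = y1" "\<And>y1 y2. Zp y1 y2
      $ Y2 = y2"
    "\<And>y1 y2 i j. bach (g c) i j (Zp y1 y2) = 0"
    using ex by metis
  have Z: "Zp y1 y2 \<in> {z. base_part z \<in> ?V}" for y1 y2 using Zp(1) Pc by simp
  note B' = w.bach_components[THEN bspec, OF Z]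
  note rules = quad_jet_simps Zp pdx_0 Kx
  have mixed: "(p * p - s * s) * ((p - s) * (p - s) + 4 * (q * r)) = 0" "r * (p + s) * ((p - s) * (p -
      s) + 4 * (q * r)) = 0"
      "q * (p + s) * ((p - s) * (p - s) + 4 * (q * r)) = 0"
  proof -
    \<comment> \<open>The mixed components contain only second derivatives in y and are constant on
      the fibre, so the zero covector suffices.\<close>
    have "(p * p - s * s) * ((p - s) * (p - s) + 4 * (q * r)) = 6 * bach (g c) X1 Y1 (Zp 0 0)"
      by (subst B') (simp only: rules; algebra)
    then show "(p * p - s * s) * ((p - s) * (p - s) + 4 * (q * r)) = 0" by (simp add: Zp)
    have "r * (p + s) * ((p - s) * (p - s) + 4 * (q * r)) = 3 * bach (g c) X1 Y2 (Zp 0 0)"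
      by (subst B') (simp only: rules; algebra)
    then show "r * (p + s) * ((p - s) * (p - s) + 4 * (q * r)) = 0" by (simp add: Zp)
    have "q * (p + s) * ((p - s) * (p - s) + 4 * (q * r)) = 3 * bach (g c) X2 Y1 (Zp 0 0)"
      by (subst B') (simp only: rules; algebra)
    then show "q * (p + s) * ((p - s) * (p - s) + 4 * (q * r)) = 0" by (simp add: Zp)
  qed
  have tops: "top1 p s (q * r) = 0" "r * r * top2 p s (q * r) = 0" "q * q * top2 p s (q * r) = 0"
  proof -
    \<comment> \<open>A symmetric second difference of a polynomial of degree at most two in y is
      twice its leading coefficient; the unknown terms of degree zero and one, with derivatives of T
      and the connection, cancel.\<close>
    have "2 * top1 p s (q * r) = bach (g c) X1 X1 (Zp 1 0) + bach (g c) X1 X1 (Zp (- 1) 0) - 2 * bach (g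
        c) X1 X1 (Zp 0 0)"
      unfolding B' top1_def by (simp only: rules; algebra)
    then show "top1 p s (q * r) = 0" by (simp add: Zp)
    have "2 * (r * r * top2 p s (q * r)) = bach (g c) X1 X1 (Zp 0 1) + bach (g c) X1 X1 (Zp 0 (- 1)) - 2
        * bach (g c) X1 X1 (Zp 0 0)"
      unfolding B' top2_def by (simp only: rules; algebra)
    then show "r * r * top2 p s (q * r) = 0" by (simp add: Zp)
    have "2 * (q * q * top2 p s (q * r)) = bach (g c) X2 X2 (Zp 1 0) + bach (g c) X2 X2 (Zp (- 1) 0) - 2
        * bach (g c) X2 X2 (Zp 0 0)"
      unfolding B' top2_def by (simp only: rules; algebra)
    then show "q * q * top2 p s (q * r) = 0" by (simp add: Zp)
  qed
  have "\<not> (q = 0 \<and> r = 0 \<and> p = s)" using P scalar_iff[OF c Pc] by (simp add: pqrs)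
  from nilpotent_if_tops_vanish[OF mixed tops this] have s: "s = - p" and m: "q * r = - (p * p)" by auto
  show ?thesis
    unfolding square_zero_iff[OF c Pc] forall_2 sum_2 pqrs[symmetric] using m by (simp add: s mult.commute)
qed

lemma bach_flat_iff_in_normal_form:
  assumes c: "c \<in> A" and nf: "nilpotent_normal_form A T c"
  shows "mre_bach_flat A T nabla Phi {c} \<longleftrightarrow>
    (\<forall>x \<in> snd c ` fst c. \<Gamma> c 1 1 2 x = 0 \<and>
      (\<Gamma> c 1 1 1 x)\<^sup>2 - \<Gamma> c 1 1 1 x * \<Gamma> c 1 2 2 x + pd 1 (\<lambda>u. \<Gamma> c 1 1 1 u - \<Gamma> c 1 2 2 u) x = 0)"
proof -
  let ?V = "snd c ` cdom c"
  interpret w: walker_jets "{z. base_part z \<in> ?V}" "quad_jet (K c)" "g c" by (rule walker_jets_mre[OF c])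
  note V = chart(2)[OF c] and sm = smooth_on_conn_comp[OF c]
  have \<tau>: "\<tau> c r i x = (if r = 1 \<and> i = 2 then 1 else 0)" if x: "x \<in> ?V" for r i x
  proof -
    have p: "par c x \<in> cdom c" by (rule par_in[OF x])
    have "T (par c x) (coord_vec A c i (par c x)) = (\<lambda>f. coord_vec A c i (par c x) (coord_fun c 2) *
        coord_vec A c 1 (par c x) f)"
      using nf p coord_vec_tangent[OF c p] unfolding nilpotent_normal_form_def by blast
    then show ?thesis by (simp add: endo_comp_def Let_def coord_vec_coord[OF c p])
  qed
  \<comment> \<open>In the normal form the only quadratic term of the metric is y1^2 dx2 dx2, with
    constant coefficient.\<close>
  have Kc: "pdx a b (K c e m n) x = (if (e, m, n) = (1, 2, 0) \<and> a = 0 \<and> b = 0 then 1 else 0)"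
    if "x \<in> ?V" "m + n = 2" for e m n a b x
  proof -
    have mn: "(m, n) \<in> {(2, 0), (1, 1), (0, 2)}" using that(2) by (cases m; cases n) (auto simp:
        numeral_2_eq_2)
    have "pdx a b (K c e m n) x = pdx a b (\<lambda>x. if (e, m, n) = (1, 2, 0) then 1 else 0) x"
    proof (rule pdx_cong[OF V that(1)])
      fix y assume "y \<in> ?V"
      then show "K c e m n y = (if (e, m, n) = (1, 2, 0) then 1 else 0)"
        using mn by (elim insertE emptyE) (simp_all add: mre_coeff_def Let_def \<tau>)
    qed
    then show ?thesis by (simp add: pdx_const)
  qed
  have lin: "K c 0 1 0 = (\<lambda>x. - 2 * \<Gamma> c 1 1 1 x)" "K c 0 0 1 = (\<lambda>x. - 2 * \<Gamma> c 1 1 2 x)"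
    "K c 2 1 0 = (\<lambda>x. - 2 * \<Gamma> c 1 2 1 x)" "K c 2 0 1 = (\<lambda>x. - 2 * \<Gamma> c 1 2 2 x)"
    by (simp_all add: mre_coeff_def Let_def)
  \<comment> \<open>None of these values involves the fibre coordinates or \<open>Phi\<close>. They
    follow from \<open>bach_nilpotent\<close>, since the first y-derivatives of h in question are -2
    times connection components.\<close>
  have B: "bach (g c) X1 X1 z = - (4 * (\<Gamma> c 1 1 2 x * \<Gamma> c 1 1 2 x))"
    "bach (g c) X1 X2 z = 4 * (\<Gamma> c 1 1 2 x * \<Gamma> c 1 1 1 x) + 2 * pd 1 (\<Gamma> c 1 1 2) x"
    "bach (g c) X2 X1 z = 4 * (\<Gamma> c 1 1 2 x * \<Gamma> c 1 1 1 x) + 2 * pd 1 (\<Gamma> c 1 1 2) x"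
    "bach (g c) X2 X2 z = - 4 * (\<Gamma> c 1 1 2 x * \<Gamma> c 1 2 1 x) - 4 * pd 2 (\<Gamma> c 1 1 2) x
       - 4 * ((\<Gamma> c 1 1 1 x)\<^sup>2 - \<Gamma> c 1 1 1 x * \<Gamma> c 1 2 2 x + pd 1 (\<lambda>u. \<Gamma> c 1 1 1 u - \<Gamma> c 1 2 2 u) x)"
    "bach (g c) X1 Y1 z = 0" "bach (g c) X1 Y2 z = 0" "bach (g c) X2 Y1 z = 0" "bach (g c) X2 Y2 z = 0"
    "bach (g c) Y1 i z = 0" "bach (g c) Y2 i z = 0"
    if z: "base_part z = x" and x: "x \<in> ?V" for z x i
  proof -
    have n: "quad_jet (K c) e a b 1 1 z = 0" "quad_jet (K c) e a b 0 2 z = 0" "quad_jet (K c) 0 a b 2 0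
        z = 0"
      "quad_jet (K c) 2 a b 2 0 z = 0" "quad_jet (K c) 1 0 0 2 0 z = 2" "quad_jet (K c) 1 (a + 1) b 2 0
          z = 0"
      "quad_jet (K c) 1 a (b + 1) 2 0 z = 0" for e a b
      using x by (simp_all add: quad_jet_simps z Kc)
    have zZ: "z \<in> {z. base_part z \<in> ?V}" using z x by simp
    have J: "quad_jet (K c) 0 0 0 0 1 z = - 2 * \<Gamma> c 1 1 2 x" "quad_jet (K c) 0 0 0 1 0 z = - 2 * \<Gamma> c 1 1
        1 x"
      "quad_jet (K c) 2 0 0 1 0 z = - 2 * \<Gamma> c 1 2 1 x" "quad_jet (K c) 2 0 0 0 1 z = - 2 * \<Gamma> c 1 2 2 x"
      "quad_jet (K c) 0 1 0 0 1 z = - 2 * pd 1 (\<Gamma> c 1 1 2) x" "quad_jet (K c) 0 0 1 0 1 z = - 2 * pd 2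
          (\<Gamma> c 1 1 2) x"
      "quad_jet (K c) 0 1 0 1 0 z = - 2 * pd 1 (\<Gamma> c 1 1 1) x" "quad_jet (K c) 2 1 0 0 1 z = - 2 * pd 1
          (\<Gamma> c 1 2 2) x"
      using pd_cmult[OF V sm x, of _ "- 2"]
      by (simp_all only: quad_jet_simps z) (simp_all add: Kc[OF x], simp_all add: lin pdx_0 pdx_1 pdx_2)
    note bn = w.bach_nilpotent[OF zZ n]
    show "bach (g c) X1 X1 z = - (4 * (\<Gamma> c 1 1 2 x * \<Gamma> c 1 1 2 x))"
      "bach (g c) X1 X2 z = 4 * (\<Gamma> c 1 1 2 x * \<Gamma> c 1 1 1 x) + 2 * pd 1 (\<Gamma> c 1 1 2) x"
      "bach (g c) X2 X1 z = 4 * (\<Gamma> c 1 1 2 x * \<Gamma> c 1 1 1 x) + 2 * pd 1 (\<Gamma> c 1 1 2) x"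
      "bach (g c) X2 X2 z = - 4 * (\<Gamma> c 1 1 2 x * \<Gamma> c 1 2 1 x) - 4 * pd 2 (\<Gamma> c 1 1 2) x
       - 4 * ((\<Gamma> c 1 1 1 x)\<^sup>2 - \<Gamma> c 1 1 1 x * \<Gamma> c 1 2 2 x + pd 1 (\<lambda>u. \<Gamma> c 1 1 1 u - \<Gamma> c 1 2 2 u) x)"
      unfolding bn(1-4) J pd_diff[OF V sm sm x] by algebra+
    show "bach (g c) X1 Y1 z = 0" "bach (g c) X1 Y2 z = 0" "bach (g c) X2 Y1 z = 0" "bach (g c) X2 Y2 z = 0"
      "bach (g c) Y1 i z = 0" "bach (g c) Y2 i z = 0"
      by (rule bn)+
  qed
  show ?thesis
  proof
    assume flat: "mre_bach_flat A T nabla Phi {c}"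
    show "\<forall>x \<in> ?V. \<Gamma> c 1 1 2 x = 0 \<and>
      (\<Gamma> c 1 1 1 x)\<^sup>2 - \<Gamma> c 1 1 1 x * \<Gamma> c 1 2 2 x + pd 1 (\<lambda>u. \<Gamma> c 1 1 1 u - \<Gamma> c 1 2 2 u) x = 0"
    proof -
      \<comment> \<open>One point in each fibre is enough, because the components in
        \<open>B\<close> depend on x alone; the zero covector is taken.\<close>
      have ex: "\<exists>z. base_part z = x \<and> (\<forall>i j. bach (g c) i j z = 0)" if x: "x \<in> ?V" for x
      proof -
        obtain \<xi> where \<xi>: "\<xi> \<in> cotangent_bundle A {par c x}" "base_part (cotangent_coords A c \<xi>) = snd c
            (par c x)"
          by (rule cotangent_point[OF c par_in[OF x], of 0 0])
        have "\<xi> \<in> cotangent_bundle A (cdom c)" using \<xi>(1) par_in[OF x] by (auto simp: cotangent_bundle_def)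
        then show ?thesis
          using flat \<xi>(2) coord_par[OF x] unfolding mre_bach_flat_def bach_zero_on_def
          by (intro exI[of _ "cotangent_coords A c \<xi>"]) auto
      qed
      \<comment> \<open>The component with indices X1, X1 is -4 times the square of this connection
        component. Once it vanishes on the whole chart, so do its derivatives, and the component X2,
        X2 reduces to the differential condition.\<close>
      have G: "\<Gamma> c 1 1 2 x = 0" if x: "x \<in> ?V" for x
        using ex[OF x] B(1)[OF _ x] by force
      have "pd 2 (\<Gamma> c 1 1 2) x = pd 2 (\<lambda>x. 0) x" if "x \<in> ?V" for x
        by (rule pd_cong[OF V that]) (rule G)
      then have "pd 2 (\<Gamma> c 1 1 2) x = 0" if "x \<in> ?V" for x using that by (simp add: pd_def)
      then show ?thesis using ex B(4) G by fastforce
    qed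
  next
    assume *: "\<forall>x \<in> ?V. \<Gamma> c 1 1 2 x = 0 \<and>
      (\<Gamma> c 1 1 1 x)\<^sup>2 - \<Gamma> c 1 1 1 x * \<Gamma> c 1 2 2 x + pd 1 (\<lambda>u. \<Gamma> c 1 1 1 u - \<Gamma> c 1 2 2 u) x = 0"
    have "pd i (\<Gamma> c 1 1 2) x = pd i (\<lambda>x. 0) x" if "x \<in> ?V" for x i
      by (rule pd_cong[OF V that]) (use * in blast)
    then have pd0: "pd i (\<Gamma> c 1 1 2) x = 0" if "x \<in> ?V" for x i using that by (simp add: pd_def)
    have "\<forall>i j. bach (g c) i j z = 0" if "base_part z \<in> ?V" for z
      unfolding forall_idx using B[OF refl that] * pd0[OF that] that by simp
    then show "mre_bach_flat A T nabla Phi {c}"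
      unfolding mre_bach_flat_def bach_zero_on_def
      by (auto simp: cotangent_bundle_def base_part_cotangent)
  qed
qed

end

theorem theorem1p1:
  fixes A :: "'m::{t2_space, second_countable_topology} chart set"
    and nabla :: "('m \<Rightarrow> 'm tvec) \<Rightarrow> ('m \<Rightarrow> 'm tvec) \<Rightarrow> 'm \<Rightarrow> 'm tvec"
    and T :: "'m \<Rightarrow> 'm tvec \<Rightarrow> 'm tvec"
    and Phi :: "'m \<Rightarrow> 'm tvec \<Rightarrow> 'm tvec \<Rightarrow> real"
  assumes "affine_surface A nabla"
    and "smooth_endomorphism_field A T"
    and "smooth_symmetric_2tensor A Phi"
  shows
    "(scalar_locus A T = UNIV \<longrightarrow>
        mre_half_conformally_flat A T nabla Phi A \<and> mre_bach_flat A T nabla Phi A) \<and>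
     open (- scalar_locus A T) \<and>
     (\<forall>P \<in> - scalar_locus A T. \<forall>c\<in>A. P \<in> fst c \<and>
        bach_zero_on A T nabla Phi c (cotangent_bundle A {P}) \<longrightarrow> square_zero_at A T P) \<and>
     ((\<forall>p. square_zero_at A T p) \<longrightarrow> (\<forall>P. \<not> zero_at A T P \<longrightarrow>
        (\<exists>c\<in>A. P \<in> fst c \<and> nilpotent_normal_form A T c) \<and>
        (\<forall>c\<in>A. P \<in> fst c \<and> nilpotent_normal_form A T c \<longrightarrow>
           (mre_bach_flat A T nabla Phi {c} \<longleftrightarrow>
            (\<forall>x \<in> snd c ` fst c.
               conn_comp A nabla c 1 1 2 x = 0 \<and>
               (conn_comp A nabla c 1 1 1 x)\<^sup>2
                 - conn_comp A nabla c 1 1 1 x * conn_comp A nabla c 1 2 2 x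
                 + pd 1 (\<lambda>u. conn_comp A nabla c 1 1 1 u - conn_comp A nabla c 1 2 2 u) x = 0)))))"
proof -
  interpret mre_data A nabla T Phi
    using assms by unfold_locales (simp_all add: affine_surface_def)
  show ?thesis
  proof (intro conjI impI ballI allI)
    assume "scalar_locus A T = UNIV"
    then show "mre_half_conformally_flat A T nabla Phi A" "mre_bach_flat A T nabla Phi A" by (rule bach_flat_if_scalar)+
  next
    show "open (- scalar_locus A T)" by (rule open_nonscalar)
  next
    fix P c assume "P \<in> - scalar_locus A T" "c \<in> A"
      "P \<in> fst c \<and> bach_zero_on A T nabla Phi c (cotangent_bundle A {P})"
    then show "square_zero_at A T P" using square_zero_if_bach_zero[of P c] by simp
  next
    fix P assume "\<forall>p. square_zero_at A T p" "\<not> zero_at A T P"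
    then show "\<exists>c\<in>A. P \<in> fst c \<and> nilpotent_normal_form A T c" using exists_normal_form[of P] by simp
  next
    fix P c assume "c \<in> A" "P \<in> fst c \<and> nilpotent_normal_form A T c"
    then show "mre_bach_flat A T nabla Phi {c} \<longleftrightarrow>
      (\<forall>x \<in> snd c ` fst c. conn_comp A nabla c 1 1 2 x = 0 \<and>
         (conn_comp A nabla c 1 1 1 x)\<^sup>2 - conn_comp A nabla c 1 1 1 x * conn_comp A nabla c 1 2 2 x
           + pd 1 (\<lambda>u. conn_comp A nabla c 1 1 1 u - conn_comp A nabla c 1 2 2 u) x = 0)"
      using bach_flat_iff_in_normal_form[of c] by blast
  qed
qed

end
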